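(* Let $n\geq 3$ and let $\Sigma^n\subset\mathbb{R}^{n+1}$ be a complete immersed two-sided hypersurface which is a self-expander of the mean curvature flow, i.e. $H=\langle x,\nu\rangle$ on $\Sigma$, where $x$ is the position vector. Suppose $\Sigma$ is 2-convex, i.e. $\kappa_1+\kappa_2>0$ at every point of $\Sigma$, and that $\Sigma$ is asymptotically conical with a mean convex asymptotic cone. Then $\Sigma$ is convex, i.e. $\kappa_1\geq 0$ at every point of $\Sigma$.
   Context: All hypersurfaces are smooth. Two-sided means that there is a global unit normal vector field $\nu$ along the immersion $x:\Sigma^n\to\mathbb{R}^{n+1}$; complete means complete in the induced metric. The second fundamental form is $A=(h_{ij})$ with $h_{ij}=\langle \partial^2_{ij}F,\nu\rangle$ for a local parametrization $F$ of $\Sigma$; $\kappa_1\leq\kappa_2\leq\cdots\leq\kappa_n$ are the principal curvatures (eigenvalues of $A$), and $H=\kappa_1+\cdots+\kappa_n$ is the mean curvature. A regular cone (with vertex at the origin) is a set $\mathcal{C}=\{\rho\,\Gamma^{n-1}: 0\leq\rho<\infty\}\subset\mathbb{R}^{n+1}$, where $\Gamma^{n-1}$ is a smooth connected closed embedded submanifold of the unit sphere $\mathbb{S}^n$. The cone is mean convex if its mean curvature is strictly positive ($H>0$) away from the origin. A self-expander $\Sigma$ is asymptotically conical with asymptotic cone $\mathcal{C}$ (or asymptotic to $\mathcal{C}$) if $\mathcal{C}$ is a regular cone and $\mathcal{C}=\lim_{t\to 0^+}\sqrt{t}\,\Sigma$ in the sense that for every $R>0$ and $k\in\mathbb{N}$,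 $\sqrt{t}\,\Sigma\cap(\bar B_R\setminus B_{1/R})$ converges to $\mathcal{C}\cap(\bar B_R\setminus B_{1/R})$ in the $C^k$ topology as $t\to 0^+$, where $B_R$ is the ball of radius $R$ centered at the origin of $\mathbb{R}^{n+1}$. *)

theory Defs
  imports "HOL-Analysis.Analysis"
begin

section \<open>Smooth maps between Euclidean spaces\<close>

text \<open>Iterated directional derivatives: \<open>dderivs [v\<^sub>1, \<dots>, v\<^sub>k] f x\<close> is
  \<open>D\<^bsub>v\<^sub>1\<^esub> \<dots> D\<^bsub>v\<^sub>k\<^esub> f (x)\<close>.\<close>

primrec dderivs :: "'a::euclidean_space list \<Rightarrow> ('a \<Rightarrow> 'b::euclidean_space) \<Rightarrow> 'a \<Rightarrow> 'b" where
  "dderivs [] f = f"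
| "dderivs (v # vs) f = (\<lambda>x. frechet_derivative (dderivs vs f) (at x) v)"

text \<open>\<open>C\<^sup>\<infinity>\<close> on an open set: all iterated directional derivatives exist and are (totally)
  differentiable. In particular they are all continuous.\<close>

definition smooth_on :: "'a::euclidean_space set \<Rightarrow> ('a \<Rightarrow> 'b::euclidean_space) \<Rightarrow> bool" where
  "smooth_on U f \<longleftrightarrow> open U \<and> (\<forall>vs. dderivs vs f differentiable_on U)"

text \<open>\<open>k\<close>-dimensional smooth embedded submanifolds (without boundary) of a Euclidean space,
  by means of slice charts.\<close>

definition embedded_submanifold :: "nat \<Rightarrow> 'v::euclidean_space set \<Rightarrow> bool" where
  "embedded_submanifold k M \<longleftrightarrow>
     (\<forall>p\<in>M. \<exists>(U::'v set) (V::'v set) \<Phi> \<Psi> (L::'v set).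
        p \<in> U \<and> homeomorphism U V \<Phi> \<Psi> \<and> smooth_on U \<Phi> \<and> smooth_on V \<Psi> \<and>
        subspace L \<and> dim L = k \<and> \<Phi> ` (U \<inter> M) = V \<inter> L)"

section \<open>Manifolds and immersed hypersurfaces\<close>

text \<open>An atlas is a set of pairs \<open>(U, \<phi>)\<close> consisting of an open set \<open>U \<subseteq> \<real>\<^sup>n\<close> and a local
  parametrization \<open>\<phi>\<close> (the inverse of a chart), which is a homeomorphism of \<open>U\<close> onto an open
  subset of the manifold.\<close>

type_synonym ('n, 'a) param = "(real ^ 'n) set \<times> (real ^ 'n \<Rightarrow> 'a)"

definition local_param :: "'a topology \<Rightarrow> ('n::finite, 'a) param \<Rightarrow> bool" where
  "local_param X c \<longleftrightarrow> (case c of (U, \<phi>) \<Rightarrow>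
     open U \<and> openin X (\<phi> ` U) \<and>
     homeomorphic_map (top_of_set U) (subtopology X (\<phi> ` U)) \<phi>)"

definition smooth_manifold :: "'a topology \<Rightarrow> ('n::finite, 'a) param set \<Rightarrow> bool" where
  "smooth_manifold X \<A> \<longleftrightarrow>
     Hausdorff_space X \<and> second_countable X \<and>
     (\<forall>c\<in>\<A>. local_param X c) \<and>
     (\<Union>(U, \<phi>)\<in>\<A>. \<phi> ` U) = topspace X \<and>
     (\<forall>(U, \<phi>)\<in>\<A>. \<forall>(V, \<psi>)\<in>\<A>. smooth_on {u \<in> U. \<phi> u \<in> \<psi> ` V} (inv_into V \<psi> \<circ> \<phi>))"

definition smooth_immersion ::
  "('n::finite, 'a) param set \<Rightarrow> ('a \<Rightarrow> 'v::euclidean_space) \<Rightarrow> bool" where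
  "smooth_immersion \<A> x \<longleftrightarrow>
     (\<forall>(U, \<phi>)\<in>\<A>. smooth_on U (x \<circ> \<phi>) \<and>
        (\<forall>u\<in>U. inj (frechet_derivative (x \<circ> \<phi>) (at u))))"

text \<open>Only continuity of the unit normal is required; it is then automatically smooth.\<close>

definition unit_normal_field ::
  "'a topology \<Rightarrow> ('n::finite, 'a) param set \<Rightarrow> ('a \<Rightarrow> 'v::euclidean_space) \<Rightarrow> ('a \<Rightarrow> 'v) \<Rightarrow> bool"
where
  "unit_normal_field X \<A> x \<nu> \<longleftrightarrow>
     continuous_map X euclidean \<nu> \<and> (\<forall>p\<in>topspace X. norm (\<nu> p) = 1) \<and>
     (\<forall>(U, \<phi>)\<in>\<A>. \<forall>u\<in>U. \<forall>v. frechet_derivative (x \<circ> \<phi>) (at u) v \<bullet> \<nu> (\<phi> u) = 0)"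

text \<open>The ambient space \<open>\<real>\<^sup>n\<^sup>+\<^sup>1\<close> is rendered as \<open>\<real>\<^sup>n \<times> \<real>\<close>, whose inner product and norm are
  the Euclidean ones.\<close>

type_synonym 'n ambient = "(real ^ 'n) \<times> real"

definition two_sided_immersed_hypersurface ::
  "'a topology \<Rightarrow> ('n::finite, 'a) param set \<Rightarrow> ('a \<Rightarrow> 'n ambient) \<Rightarrow> ('a \<Rightarrow> 'n ambient) \<Rightarrow> bool"
where
  "two_sided_immersed_hypersurface X \<A> x \<nu> \<longleftrightarrow>
     smooth_manifold X \<A> \<and> smooth_immersion \<A> x \<and> unit_normal_field X \<A> x \<nu>"

section \<open>Curvature\<close>

text \<open>\<open>g\<^sub>i\<^sub>j = \<langle>\<partial>\<^sub>iF, \<partial>\<^sub>jF\<rangle>\<close> and \<open>h\<^sub>i\<^sub>j = \<langle>\<partial>\<^sup>2\<^sub>i\<^sub>jF, N\<rangle>\<close> at a point \<open>u\<close> of the parameter domain.\<close>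

definition first_fundamental_form ::
  "(real ^ 'n::finite \<Rightarrow> 'v::euclidean_space) \<Rightarrow> real ^ 'n \<Rightarrow> real ^ 'n ^ 'n" where
  "first_fundamental_form F u =
     (\<chi> i j. dderivs [axis i 1] F u \<bullet> dderivs [axis j 1] F u)"

definition second_fundamental_form ::
  "(real ^ 'n::finite \<Rightarrow> 'v::euclidean_space) \<Rightarrow> 'v \<Rightarrow> real ^ 'n \<Rightarrow> real ^ 'n ^ 'n" where
  "second_fundamental_form F N u = (\<chi> i j. dderivs [axis i 1, axis j 1] F u \<bullet> N)"

definition shape_operator ::
  "(real ^ 'n::finite \<Rightarrow> 'v::euclidean_space) \<Rightarrow> 'v \<Rightarrow> real ^ 'n \<Rightarrow> real ^ 'n ^ 'n" where
  "shape_operator F N u =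
     matrix_inv (first_fundamental_form F u) ** second_fundamental_form F N u"

text \<open>The increasing list of the eigenvalues of the second fundamental form with respect to the
  induced metric, repeated according to multiplicity, i.e. of the roots of the characteristic
  polynomial of \<open>g\<^sup>-\<^sup>1h\<close>. The latter does not depend on the parametrization.\<close>

definition principal_curvatures ::
  "('n::finite, 'a) param set \<Rightarrow> ('a \<Rightarrow> 'v::euclidean_space) \<Rightarrow> ('a \<Rightarrow> 'v) \<Rightarrow> 'a \<Rightarrow> real list"
where
  "principal_curvatures \<A> x \<nu> p =
     (THE ks. sorted ks \<and> length ks = CARD('n) \<and>
        (\<forall>(U, \<phi>)\<in>\<A>. \<forall>u\<in>U. \<phi> u = p \<longrightarrow>
           (\<forall>t. det (t *\<^sub>R mat 1 - shape_operator (x \<circ> \<phi>) (\<nu> p) u) = (\<Prod>k\<leftarrow>ks. t - k))))"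

text \<open>The numbering \<open>\<kappa>\<^sub>1 \<le> \<dots> \<le> \<kappa>\<^sub>n\<close> starts at 1.\<close>

definition kappa ::
  "('n::finite, 'a) param set \<Rightarrow> ('a \<Rightarrow> 'v::euclidean_space) \<Rightarrow> ('a \<Rightarrow> 'v) \<Rightarrow> nat \<Rightarrow> 'a \<Rightarrow> real"
where
  "kappa \<A> x \<nu> i p = principal_curvatures \<A> x \<nu> p ! (i - 1)"

definition mean_curvature ::
  "('n::finite, 'a) param set \<Rightarrow> ('a \<Rightarrow> 'v::euclidean_space) \<Rightarrow> ('a \<Rightarrow> 'v) \<Rightarrow> 'a \<Rightarrow> real"
where
  "mean_curvature \<A> x \<nu> p = (\<Sum>i = 1..CARD('n). kappa \<A> x \<nu> i p)"

section \<open>Completeness in the induced metric\<close>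

text \<open>A curve \<open>\<gamma>\<close> in \<open>X\<close> is admissible if it is continuous and \<open>x \<circ> \<gamma>\<close> is piecewise \<open>C\<^sup>1\<close>; as \<open>x\<close> is an
  immersion, this means that \<open>\<gamma>\<close> itself is piecewise \<open>C\<^sup>1\<close>. Its length in the metric induced by \<open>x\<close>
  is the length of \<open>x \<circ> \<gamma>\<close>. The library's piecewise \<open>C\<^sup>1\<close> paths may have a non-integrable derivative
  near the exceptional points; the nonnegative integral then gives length \<open>\<infinity>\<close>. Points in
  different components have distance \<open>\<infinity>\<close>.\<close>

definition admissible_curve ::
  "'a topology \<Rightarrow> ('a \<Rightarrow> 'v::euclidean_space) \<Rightarrow> 'a \<Rightarrow> 'a \<Rightarrow> (real \<Rightarrow> 'a) \<Rightarrow> bool" where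
  "admissible_curve X x p q \<gamma> \<longleftrightarrow>
     pathin X \<gamma> \<and> (x \<circ> \<gamma>) piecewise_C1_differentiable_on {0..1} \<and> \<gamma> 0 = p \<and> \<gamma> 1 = q"

definition curve_length :: "(real \<Rightarrow> 'v::euclidean_space) \<Rightarrow> ennreal" where
  "curve_length c = (\<integral>\<^sup>+ s\<in>{0..1}. ennreal (norm (vector_derivative c (at s))) \<partial>lborel)"

definition induced_dist ::
  "'a topology \<Rightarrow> ('a \<Rightarrow> 'v::euclidean_space) \<Rightarrow> 'a \<Rightarrow> 'a \<Rightarrow> ennreal" where
  "induced_dist X x p q =
     (INF \<gamma>\<in>{\<gamma>. admissible_curve X x p q \<gamma>}. curve_length (x \<circ> \<gamma>))"

definition complete_hypersurface :: "'a topology \<Rightarrow> ('a \<Rightarrow> 'v::euclidean_space) \<Rightarrow> bool" where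
  "complete_hypersurface X x \<longleftrightarrow>
     (\<forall>\<sigma>. (\<forall>i::nat. \<sigma> i \<in> topspace X) \<and>
          (\<forall>e>0. \<exists>N. \<forall>i\<ge>N. \<forall>j\<ge>N. induced_dist X x (\<sigma> i) (\<sigma> j) < e) \<longrightarrow>
          (\<exists>p\<in>topspace X. (\<lambda>i. induced_dist X x (\<sigma> i) p) \<longlonglongrightarrow> 0))"

section \<open>Cones and asymptotics\<close>

definition regular_cone :: "('n::finite) ambient set \<Rightarrow> bool" where
  "regular_cone C \<longleftrightarrow>
     (\<exists>\<Gamma>. \<Gamma> \<subseteq> sphere 0 1 \<and> \<Gamma> \<noteq> {} \<and> compact \<Gamma> \<and> connected \<Gamma> \<and>
        embedded_submanifold (CARD('n) - 1) \<Gamma> \<and> C = {\<rho> *\<^sub>R y | \<rho> y. 0 \<le> \<rho> \<and> y \<in> \<Gamma>})"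

text \<open>For an embedded hypersurface \<open>M\<close>, regarded as an immersed one via the inclusion, take the
  atlas of all its smooth local parametrizations.\<close>

definition maximal_atlas :: "('n::finite) ambient set \<Rightarrow> ('n, 'n ambient) param set" where
  "maximal_atlas M = {c. local_param (top_of_set M) c \<and> smooth_immersion {c} (\<lambda>y. y)}"

definition mean_convex_cone :: "('n::finite) ambient set \<Rightarrow> bool" where
  "mean_convex_cone C \<longleftrightarrow>
     (let M = C - {0} in
      \<exists>N. two_sided_immersed_hypersurface (top_of_set M) (maximal_atlas M) (\<lambda>y. y) N \<and>
          (\<forall>y\<in>M. mean_curvature (maximal_atlas M) (\<lambda>y. y) N y > 0))"

definition annulus :: "real \<Rightarrow> 'v::euclidean_space set" where
  "annulus R = cball 0 R - ball 0 (1 / R)"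

text \<open>\<open>C\<^sup>k\<close> convergence of \<open>S\<^sub>t\<close> to \<open>C\<close> in \<open>annulus R\<close> as \<open>t \<rightarrow> 0\<^sup>+\<close>: inside the annulus, \<open>S\<^sub>t\<close> is the
  image of (a neighbourhood in \<open>C\<close> of the relevant part of) \<open>C\<close> under a perturbation
  \<open>y \<mapsto> y + w(y)\<close> of the inclusion, where \<open>w\<close> tends to 0 in the \<open>C\<^sup>k\<close> norm. The perturbation is
  defined on an open set \<open>W\<close> of the ambient space, so that the \<open>C\<^sup>k\<close> norm can be taken with respect
  to ambient partial derivatives. Fields along the compact piece of \<open>C\<close>, e.g. multiples \<open>u \<nu>\<close> of
  the unit normal in the description as a normal graph, extend to \<open>W\<close> with comparable norms.\<close>

definition Ck_convergent_in_annulus ::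
  "nat \<Rightarrow> real \<Rightarrow> (real \<Rightarrow> 'v::euclidean_space set) \<Rightarrow> 'v set \<Rightarrow> bool" where
  "Ck_convergent_in_annulus k R S C \<longleftrightarrow>
     (\<forall>\<epsilon>>0. \<forall>\<^sub>F t in at_right 0.
        \<exists>W w. C \<inter> annulus R \<subseteq> W \<and> smooth_on W w \<and>
          (\<forall>y\<in>C \<inter> W. \<forall>vs. length vs \<le> k \<and> set vs \<subseteq> Basis \<longrightarrow> norm (dderivs vs w y) < \<epsilon>) \<and>
          S t \<inter> annulus R = (\<lambda>y. y + w y) ` (C \<inter> W) \<inter> annulus R)"

definition asymptotically_conical ::
  "('n::finite) ambient set \<Rightarrow> 'n ambient set \<Rightarrow> bool" where
  "asymptotically_conical S C \<longleftrightarrow>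
     regular_cone C \<and>
     (\<forall>R>0. \<forall>k. Ck_convergent_in_annulus k R (\<lambda>t. (\<lambda>y. sqrt t *\<^sub>R y) ` S) C)"

end

(* Two-convexity and n >= 3 give |A| <= H, and H = <x,nu> <= |x|, so the curvature is bounded on bounded
   sets. Suppose that u = kappa_1 / H is negative somewhere.

   At infinity u has nonnegative lower limit: on the cone the radial direction is in the kernel of the
   second fundamental form, which is a limit of rescaled second fundamental forms of the expander, so
   kappa_1 + kappa_2 >= 0 in the limit makes it nonnegative, while its trace is positive.

   Hence u - epsilon exp(|x|^2) has a negative infimum over a bounded part of the hypersurface. The
   infimum need not be attained, since the immersion need not be proper; but by completeness and the
   curvature bound every point is the centre of a graph over a ball of uniform size. Near an almost
   minimal point p, adding theta |x - x(p)|^2 produces an interior minimum. There, the elliptic equation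
   satisfied by the second fundamental form of a self-expander, tested on the eigenvector of kappa_1,
   gives 2 n epsilon <= theta (2 n + 8 R), which is false for small theta. *)

theory Submission
  imports Defs "HOL-Computational_Algebra.Polynomial" "HOL-Real_Asymp.Real_Asymp"
begin

section \<open>Symmetric bilinear forms and their eigenvalues\<close>

text \<open>The function kappa_1 need not be differentiable, so the minimum is examined on the graph
  over the tangent plane at the minimum point, with the eigenvector \<open>e\<close> held fixed: the
  normalised second derivative of the graph in the direction \<open>e\<close> dominates kappa_1 and
  agrees with it at the point. Differentiating the graph equation twice makes the cubic and the
  zeroth-order terms cancel, since kappa_1 and H obey the same linear equation. Only a drift term (2
  / H) <grad H, grad u> remains. As grad H = - A(x^T), with x^T the tangential part of x, and |A| <=
  H, its coefficient is at most 2 |x^T|. The barrier |x|^2 alone may lose against this drift far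
  from the origin. The exponential adds 4 |x^T|^2, the contribution of its squared gradient, which
  absorbs the drift.

  At infinity the unit normals may converge to either normal of the cone. The orientation is never
  determined: mean convexity gives a limit trace different from zero, and positivity of H on the
  expander gives its sign.\<close>

lemma selfadjoint_eigenvector:
  fixes T :: "'v::euclidean_space \<Rightarrow> 'v"
  assumes lin: "linear T" and sa: "\<And>v w. T v \<bullet> w = v \<bullet> T w"
    and V: "subspace V" "T ` V \<subseteq> V" "V \<noteq> {0}"
  obtains v l where "v \<in> V" "norm v = 1" "T v = l *\<^sub>R v"
proof -
  interpret linear T by fact
  have cont: "continuous_on A (\<lambda>v. v \<bullet> T v)" for A
    by (intro continuous_intros linear_continuous_on linear_conv_bounded_linear[THEN iffD1] lin)
  obtain z where z: "z \<in> V" "z \<noteq> 0" using V subspace_0 by auto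
  have "compact (V \<inter> sphere 0 1)"
    using closed_subspace[OF V(1)] by (simp add: closed_Int_compact)
  moreover have "z /\<^sub>R norm z \<in> V \<inter> sphere 0 1"
    using z V(1) by (auto simp: subspace_scale)
  ultimately obtain v where v: "v \<in> V" "norm v = 1"
    and max: "\<And>u. u \<in> V \<Longrightarrow> norm u = 1 \<Longrightarrow> u \<bullet> T u \<le> v \<bullet> T v"
    using continuous_attains_sup[OF _ _ cont, of "V \<inter> sphere 0 1"] by fastforce
  define l where "l = v \<bullet> T v"
  have le: "u \<bullet> T u \<le> l * (u \<bullet> u)" if "u \<in> V" for u
  proof (cases "u = 0")
    case False
    then have "(u /\<^sub>R norm u) \<bullet> T (u /\<^sub>R norm u) \<le> l"
      using max[of "u /\<^sub>R norm u"] that V(1) by (simp add: subspace_scale l_def)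
    then have "(u \<bullet> T u) / (norm u)\<^sup>2 \<le> l"
      by (simp add: scale field_simps power2_eq_square)
    then show ?thesis using False by (simp add: field_simps power2_norm_eq_inner)
  qed (simp add: zero)
  define R where "R = T v - l *\<^sub>R v"
  have R: "R \<in> V" using v V by (auto simp: R_def subspace_diff subspace_scale)
  \<comment> \<open>First variation at a maximiser of the Rayleigh quotient. Varying in the
    direction of the residual \<open>R\<close> itself makes the linear coefficient
    \<open>2 * (R \<bullet> R)\<close>, and a quadratic without constant term that is nowhere
    positive has no linear term.\<close>
  have key: "2 * t * (R \<bullet> R) + t\<^sup>2 * (R \<bullet> T R - l * (R \<bullet> R)) \<le> 0" for t
  proof -
    have "v + t *\<^sub>R R \<in> V" using v R V by (simp add: subspace_add subspace_scale)
    from le[OF this] have "l + 2 * t * (R \<bullet> T v) + t\<^sup>2 * (R \<bullet> T R) \<le> l * (1 + 2 * t * (v \<bullet> R) + t\<^sup>2 * (R \<bullet> R))"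
      using sa[of v R] v(2)
      by (simp add: add scale inner_add_left inner_add_right l_def[symmetric] power2_eq_square
          norm_eq_1 inner_commute algebra_simps)
    moreover have "R \<bullet> T v = R \<bullet> R + l * (v \<bullet> R)"
      by (simp add: R_def inner_diff_left inner_diff_right inner_commute algebra_simps)
    ultimately show ?thesis by (simp add: algebra_simps)
  qed
  have "R \<bullet> R = 0"
  proof (rule ccontr)
    assume "R \<bullet> R \<noteq> 0"
    then have p: "R \<bullet> R > 0" by simp
    define c where "c = \<bar>R \<bullet> T R - l * (R \<bullet> R)\<bar> + 1"
    have c: "c > 0" by (simp add: c_def)
    define t where "t = (R \<bullet> R) / c"
    have t: "t > 0" using p c by (simp add: t_def)
    have "t\<^sup>2 * (R \<bullet> T R - l * (R \<bullet> R)) \<ge> t\<^sup>2 * (- c)"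
      by (intro mult_left_mono) (auto simp: c_def)
    with key[of t] have "2 * t * (R \<bullet> R) - t\<^sup>2 * c \<le> 0" by simp
    moreover have "t\<^sup>2 * c = t * (R \<bullet> R)" using c by (simp add: t_def power2_eq_square)
    ultimately have "t * (R \<bullet> R) \<le> 0" by simp
    then show False using t p by (simp add: mult_le_0_iff)
  qed
  then have "T v = l *\<^sub>R v" by (simp add: R_def)
  with v that show ?thesis by blast
qed

text \<open>Formulated for invariant subspaces, so that the induction can pass to the orthogonal
  complement of an eigenvector, which self-adjointness keeps invariant.\<close>

lemma selfadjoint_orthonormal_eigenbasis:
  fixes T :: "'v::euclidean_space \<Rightarrow> 'v"
  assumes lin: "linear T" and sa: "\<And>v w. T v \<bullet> w = v \<bullet> T w"
  shows "subspace V \<Longrightarrow> T ` V \<subseteq> V \<Longrightarrow>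
    \<exists>B. B \<subseteq> V \<and> finite B \<and> card B = dim V \<and> pairwise orthogonal B \<and>
      (\<forall>v\<in>B. norm v = 1 \<and> (\<exists>l. T v = l *\<^sub>R v))"
proof (induction "dim V" arbitrary: V)
  case 0
  then have "V = {0}" by (metis dim_eq_0 subspace_0 subset_singleton_iff empty_iff)
  then show ?case by (intro exI[of _ "{}"]) auto
next
  case (Suc d)
  then have "V \<noteq> {0}" by auto
  from selfadjoint_eigenvector[OF lin sa Suc.prems this]
  obtain v l where v: "v \<in> V" "norm v = 1" "T v = l *\<^sub>R v" by blast
  define W where "W = {y \<in> V. \<forall>x\<in>span {v}. orthogonal x y}"
  have W: "W = {y \<in> V. v \<bullet> y = 0}"
    unfolding W_def by (auto simp: span_singleton orthogonal_def)
  have sW: "subspace W" using Suc.prems(1)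
    unfolding W by (auto simp: subspace_def inner_add_right)
  have "T ` W \<subseteq> W"
    using Suc.prems(2) v(3) by (auto simp: W sa[symmetric] image_subset_iff)
  moreover have "dim {y \<in> V. \<forall>x\<in>span {v}. orthogonal x y} + dim (span {v}) = dim V"
    using Suc.prems v(1) by (intro dim_subspace_orthogonal_to_vectors) (auto simp: span_minimal)
  then have "dim W + 1 = dim V"
    using v(2) by (metis W_def dim_span dim_singleton norm_zero zero_neq_one)
  ultimately obtain B where B: "B \<subseteq> W" "finite B" "card B = dim W" "pairwise orthogonal B"
      "\<forall>v\<in>B. norm v = 1 \<and> (\<exists>l. T v = l *\<^sub>R v)"
    using Suc.hyps(1)[of W] Suc.hyps(2) sW by auto
  have "v \<notin> B" using B(1) v(2) by (auto simp: W norm_eq_1)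
  then show ?case
    using B v \<open>dim W + 1 = dim V\<close>
    by (intro exI[of _ "insert v B"])
      (auto simp: W pairwise_insert orthogonal_def inner_commute)
qed

text \<open>A family indexed by the coordinate type has the right cardinality for a basis: the
  matrix with rows \<open>q i\<close> is square, so orthonormality of its rows makes its columns
  orthonormal as well.\<close>

lemma orthonormal_basis_expansion:
  fixes q :: "'n::finite \<Rightarrow> real ^ 'n"
  assumes q: "\<And>i j. q i \<bullet> q j = (if i = j then 1 else 0)"
  shows "(\<Sum>i\<in>UNIV. (q i \<bullet> v) *\<^sub>R q i) = v" "(\<Sum>i\<in>UNIV. (q i \<bullet> v) * (q i \<bullet> w)) = v \<bullet> w"
proof -
  define Q where "Q = (\<chi> i. q i)"
  have "orthogonal_matrix (transpose Q)"
    unfolding orthogonal_matrix_orthonormal_columns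
    using q by (auto simp: Q_def norm_eq_1 orthogonal_def row_def column_transpose)
  then have Q: "transpose Q ** Q = mat 1" by (simp add: orthogonal_matrix_def)
  have Qv: "(Q *v v) $ i = q i \<bullet> v" for v i
    by (simp add: Q_def matrix_vector_mult_def inner_vec_def)
  have "transpose Q *v (Q *v v) = v" for v by (simp add: matrix_vector_mul_assoc Q)
  moreover have "transpose Q *v u = (\<Sum>i\<in>UNIV. (u $ i) *\<^sub>R q i)" for u
    by (simp add: vec_eq_iff matrix_vector_mult_def transpose_def Q_def mult.commute)
  ultimately have "(\<Sum>i\<in>UNIV. (q i \<bullet> v) *\<^sub>R q i) = v" for v by (metis (no_types, lifting) Qv sum.cong)
  then show *: "(\<Sum>i\<in>UNIV. (q i \<bullet> v) *\<^sub>R q i) = v" for v .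
  have "v \<bullet> w = (\<Sum>i\<in>UNIV. (q i \<bullet> v) *\<^sub>R q i) \<bullet> w" by (simp add: *)
  also have "\<dots> = (\<Sum>i\<in>UNIV. (q i \<bullet> v) * (q i \<bullet> w))" by (simp add: inner_sum_left)
  finally show "(\<Sum>i\<in>UNIV. (q i \<bullet> v) * (q i \<bullet> w)) = v \<bullet> w" ..
qed

lemma symmetric_matrix_diagonalization:
  fixes S :: "real ^ 'n::finite ^ 'n"
  assumes "transpose S = S"
  obtains q l where "\<And>i j. q i \<bullet> q j = (if i = j then 1 else 0)"
    and "\<And>i. S *v q i = l i *\<^sub>R q (i::'n)"
proof -
  have sa: "(S *v v) \<bullet> w = v \<bullet> (S *v w)" for v w
    using dot_lmul_matrix[of v S w] assms by (metis transpose_matrix_vector)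
  obtain B where B: "finite B" "card B = CARD('n)" "pairwise orthogonal B"
     "\<forall>v\<in>B. norm v = 1 \<and> (\<exists>l. S *v v = l *\<^sub>R v)"
    using selfadjoint_orthonormal_eigenbasis[of "(*v) S" UNIV] sa
    by auto
  obtain q where q: "bij_betw q (UNIV::'n set) B"
    using B(1,2) by (metis finite_class.finite_UNIV finite_same_card_bij)
  have qB: "q i \<in> B" for i using q by (auto simp: bij_betw_def)
  have "\<forall>i. \<exists>l. S *v q i = l *\<^sub>R q i" using B(4) qB by blast
  then obtain l where "\<And>i. S *v q i = l i *\<^sub>R q i" by metis
  moreover have "q i \<bullet> q j = (if i = j then 1 else 0)" for i j
  proof (cases "i = j")
    case True
    then show ?thesis using B(4) qB[of j] by (simp add: norm_eq_1)
  next
    case False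
    then have "q i \<noteq> q j" using q by (auto simp: bij_betw_def inj_on_def)
    then show ?thesis using False B(3) qB[of i] qB[of j] by (auto simp: pairwise_def orthogonal_def)
  qed
  ultimately show ?thesis using that by blast
qed

text \<open>This makes the \<open>THE\<close> in \<open>principal_curvatures\<close> unambiguous: a
  polynomial function on the reals determines its multiset of roots, and sorting fixes the
  order.\<close>

lemma sorted_roots_unique:
  fixes ks ks' :: "real list"
  assumes "sorted ks" "sorted ks'" "\<And>t. (\<Prod>k\<leftarrow>ks. t - k) = (\<Prod>k\<leftarrow>ks'. t - k)"
  shows "ks = ks'"
proof -
  define p where "p ks = (\<Prod>k\<leftarrow>ks. [:- k, 1:])" for ks :: "real list"
  have p: "poly (p ks) t = (\<Prod>k\<leftarrow>ks. t - k)" for ks t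
    by (induction ks) (auto simp: p_def algebra_simps)
  have pr: "proots (p ks) = mset ks" for ks :: "real list"
  proof (induction ks)
    case (Cons k ks)
    have "p ks \<noteq> 0" unfolding p_def by (auto simp: prod_list_zero_iff)
    moreover have "p (k # ks) = [:- k, 1:] * p ks" by (simp add: p_def)
    ultimately show ?case using Cons proots_mult[of "[:- k, 1:]" "p ks"] by simp
  qed (simp add: p_def)
  have "poly (p ks) = poly (p ks')" using p assms(3) by auto
  then have "p ks = p ks'" by (simp only: poly_eq_poly_eq_iff)
  then have "mset ks = mset ks'" using pr by metis
  then show ?thesis using assms(1,2) properties_for_sort by metis
qed

section \<open>The characteristic polynomial of the shape operator in a principal frame\<close>

lemma matrix_inv_mult_left:
  assumes "invertible (A :: real ^ 'n::finite ^ 'n)"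
  shows "matrix_inv A ** A = mat 1"
  using someI_ex[OF assms[unfolded invertible_def]] by (simp add: matrix_inv_def)

text \<open>The columns of \<open>E\<close> are principal directions, orthonormal for
  \<open>g\<close>. Cancelling the transpose of \<open>E\<close> in both hypotheses shows that
  \<open>E\<close> conjugates the shape operator to the diagonal matrix of the
  \<open>l i\<close>.\<close>

lemma det_shape_frame:
  fixes g h E :: "real ^ 'n::finite ^ 'n"
  assumes g: "transpose E ** g ** E = mat 1"
    and h: "transpose E ** h ** E = (\<chi> i j. if i = j then l i else 0)"
  shows "det (t *\<^sub>R mat 1 - matrix_inv g ** h) = (\<Prod>i\<in>UNIV. t - l i)"
proof -
  let ?D = "\<chi> i j. if i = j then l i else 0"
  have dE: "det E \<noteq> 0" "det g \<noteq> 0"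
    using arg_cong[OF g, of det] by (auto simp: det_mul)
  have invE: "invertible E" "invertible (transpose E)" and invg: "invertible g"
    using dE by (auto simp: invertible_det_nz)
  have cancel: "A ** B = matrix_inv (transpose E) ** C" if "transpose E ** A ** B = C"
    for A B C :: "real ^ 'n ^ 'n"
  proof -
    have "matrix_inv (transpose E) ** C = matrix_inv (transpose E) ** transpose E ** (A ** B)"
      unfolding that[symmetric] by (simp add: matrix_mul_assoc)
    then show ?thesis by (simp add: matrix_inv_mult_left[OF invE(2)])
  qed
  have "matrix_inv g ** h ** E = matrix_inv g ** (h ** E)" by (simp add: matrix_mul_assoc)
  also have "\<dots> = matrix_inv g ** (matrix_inv (transpose E) ** ?D)" by (simp only: cancel[OF h])
  also have "\<dots> = matrix_inv g ** (matrix_inv (transpose E) ** mat 1) ** ?D"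
    by (simp add: matrix_mul_assoc)
  also have "\<dots> = matrix_inv g ** (g ** E) ** ?D" by (simp only: cancel[OF g])
  also have "\<dots> = matrix_inv g ** g ** E ** ?D" by (simp only: matrix_mul_assoc)
  finally have sE: "matrix_inv g ** h ** E = E ** ?D" by (simp add: matrix_inv_mult_left[OF invg])
  have sub: "(A - B) ** E = A ** E - B ** E" "E ** (A - B) = E ** A - E ** B" for A B :: "real ^ 'n ^ 'n"
    by (simp_all add: vec_eq_iff matrix_matrix_mult_def left_diff_distrib right_diff_distrib sum_subtractf)
  have tE: "(t *\<^sub>R mat 1) ** E = E ** (t *\<^sub>R mat 1)"
    by (simp add: matrix_scalar_ac flip: scalar_matrix_assoc)
  have "(t *\<^sub>R mat 1 - matrix_inv g ** h) ** E = E ** (t *\<^sub>R mat 1 - ?D)"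
    by (simp only: sub tE sE)
  from arg_cong[OF this, of det]
  have "det (t *\<^sub>R mat 1 - matrix_inv g ** h) * det E = det E * det (t *\<^sub>R mat 1 - ?D)"
    by (simp only: det_mul)
  then have "det (t *\<^sub>R mat 1 - matrix_inv g ** h) = det (t *\<^sub>R mat 1 - ?D)"
    using dE(1) by simp
  also have "\<dots> = (\<Prod>i\<in>UNIV. (t *\<^sub>R mat 1 - ?D) $ i $ i)"
    by (rule det_diagonal) (auto simp: mat_def)
  also have "\<dots> = (\<Prod>i\<in>UNIV. t - l i)" by (simp add: mat_def)
  finally show ?thesis .
qed

section \<open>Iterated derivatives of smooth maps\<close>

declare dderivs.simps(2) [simp del]

lemma smooth_on_open: "smooth_on U f \<Longrightarrow> open U"
  by (simp add: smooth_on_def)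

lemma dderivs_append: "dderivs vs (dderivs ws f) = dderivs (vs @ ws) f"
  by (induction vs) (auto simp: dderivs.simps(2))

lemma smooth_on_dderivs: "smooth_on U f \<Longrightarrow> smooth_on U (dderivs vs f)"
  by (auto simp: smooth_on_def dderivs_append)

lemma smooth_on_subset: "smooth_on U f \<Longrightarrow> open V \<Longrightarrow> V \<subseteq> U \<Longrightarrow> smooth_on V f"
  by (auto simp: smooth_on_def intro: differentiable_on_subset)

lemma dderivs_differentiable: "smooth_on U f \<Longrightarrow> x \<in> U \<Longrightarrow> dderivs vs f differentiable at x"
  by (metis smooth_on_def differentiable_on_def at_within_open)

lemma dderivs_has_derivative:
  "smooth_on U f \<Longrightarrow> x \<in> U \<Longrightarrow> (dderivs vs f has_derivative (\<lambda>v. dderivs (v # vs) f x)) (at x)"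
  using dderivs_differentiable frechet_derivative_works by (fastforce simp: dderivs.simps(2))

lemma smooth_on_has_derivative:
  "smooth_on U f \<Longrightarrow> x \<in> U \<Longrightarrow> (f has_derivative (\<lambda>v. dderivs [v] f x)) (at x)"
  using dderivs_has_derivative[of U f x "[]"] by simp

lemma dderivs_Cons_eqI:
  "(dderivs vs f has_derivative L) (at x) \<Longrightarrow> dderivs (v # vs) f x = L v"
  using frechet_derivative_at by (fastforce simp: dderivs.simps(2))

lemma frechet_derivative_eqI:
  "(f has_derivative L) (at x) \<Longrightarrow> L v = y \<Longrightarrow> f differentiable at x \<and> frechet_derivative f (at x) v = y"
  using frechet_derivative_at by (fastforce simp: differentiable_def)

section \<open>Smooth maps: dependence on germs and closure properties\<close>

lemma dderivs_cong:
  assumes "open U" "\<And>x. x \<in> U \<Longrightarrow> f x = g x" "x \<in> U"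
  shows "dderivs vs f x = dderivs vs g x"
  using assms(3)
proof (induction vs arbitrary: x)
  case (Cons v vs)
  have "(dderivs vs f has_derivative L) (at x) \<longleftrightarrow> (dderivs vs g has_derivative L) (at x)" for L
    using has_derivative_transform_within_open[OF _ assms(1) Cons.prems] Cons.IH by metis
  then show ?case by (simp add: frechet_derivative_def dderivs.simps(2))
qed (use assms in auto)

lemma smooth_on_iff:
  "smooth_on U f \<longleftrightarrow> open U \<and> (\<forall>vs. \<forall>x\<in>U. dderivs vs f differentiable at x)"
  unfolding smooth_on_def by (metis differentiable_on_eq_differentiable_at)

lemma differentiable_cong_open:
  assumes "open U" "\<And>x. x \<in> U \<Longrightarrow> f x = g x" "x \<in> U" "f differentiable at x"
  shows "g differentiable at x"
proof -
  from assms(4) obtain L where "(f has_derivative L) (at x)" unfolding differentiable_def by blast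
  then have "(g has_derivative L) (at x)"
    by (rule has_derivative_transform_within_open[OF _ assms(1,3)]) (rule assms(2))
  then show ?thesis unfolding differentiable_def by blast
qed

lemma smooth_on_cong:
  assumes "smooth_on U f" "\<And>x. x \<in> U \<Longrightarrow> f x = g x"
  shows "smooth_on U g"
proof -
  have U: "open U" using assms(1) smooth_on_open by blast
  have "dderivs vs g differentiable at x" if "x \<in> U" for vs x
    by (rule differentiable_cong_open[where f="dderivs vs f", OF U dderivs_cong[where f=f] that])
      (use U assms that in \<open>auto simp: dderivs_differentiable\<close>)
  then show ?thesis using U by (simp add: smooth_on_iff)
qed

text \<open>Higher derivatives are handled by an invariant family instead of formulas of Leibniz or
  Faa di Bruno type: if \<open>F\<close> is closed under directional derivatives up to equality on
  \<open>U\<close>, every iterated derivative of a member agrees on \<open>U\<close> with a member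
  and is therefore differentiable.\<close>

lemma smooth_on_coinduct:
  assumes "open U" "f \<in> F"
    and step: "\<And>f v. f \<in> F \<Longrightarrow> \<exists>g\<in>F. \<forall>x\<in>U. f differentiable at x \<and> frechet_derivative f (at x) v = g x"
  shows "smooth_on U f"
proof -
  have "\<exists>g\<in>F. \<forall>x\<in>U. dderivs vs f x = g x" for vs
  proof (induction vs)
    case (Cons v vs)
    then obtain g where g: "g \<in> F" "\<And>x. x \<in> U \<Longrightarrow> dderivs vs f x = g x" by auto
    from step[OF g(1), of v] obtain g' where "g' \<in> F" "\<forall>x\<in>U. frechet_derivative g (at x) v = g' x" by blast
    moreover have "dderivs (v # vs) f x = frechet_derivative g (at x) v" if "x \<in> U" for x
      using dderivs_cong[where f="dderivs vs f" and vs="[v]", OF assms(1) g(2) that] by (simp add: dderivs.simps(2))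
    ultimately show ?case by auto
  qed (use assms in auto)
  then have "\<exists>g\<in>F. (\<forall>x\<in>U. g x = dderivs vs f x) \<and> (\<forall>x\<in>U. g differentiable at x)" for vs
    using step by metis
  then have "dderivs vs f differentiable at x" if "x \<in> U" for x vs
    using differentiable_cong_open[OF assms(1) _ that] that by meson
  then show ?thesis using assms by (simp add: smooth_on_iff)
qed

lemma smooth_on_const: "open U \<Longrightarrow> smooth_on U (\<lambda>x. c)"
  by (rule smooth_on_coinduct[of _ _ "range (\<lambda>c x. c)"]) auto

lemma dderivs_linear_comp:
  assumes "smooth_on U f" "linear l" "x \<in> U"
  shows "dderivs vs (\<lambda>x. l (f x)) x = l (dderivs vs f x)"
  using assms(3)
proof (induction vs arbitrary: x)
  case (Cons v vs)
  have "((\<lambda>x. l (dderivs vs f x)) has_derivative (\<lambda>v. l (dderivs (v # vs) f x))) (at x)"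
    using dderivs_has_derivative[OF assms(1) Cons.prems]
    by (rule bounded_linear.has_derivative[OF linear_conv_bounded_linear[THEN iffD1, OF assms(2)]])
  then have "(dderivs vs (\<lambda>x. l (f x)) has_derivative (\<lambda>v. l (dderivs (v # vs) f x))) (at x)"
    by (rule has_derivative_transform_within_open[OF _ smooth_on_open[OF assms(1)] Cons.prems])
      (simp add: Cons.IH)
  then show ?case by (rule dderivs_Cons_eqI)
qed auto

lemma smooth_on_linear_comp:
  assumes "smooth_on U f" "linear l"
  shows "smooth_on U (\<lambda>x. l (f x))"
proof (rule smooth_on_coinduct[of _ _ "range (\<lambda>vs x. l (dderivs vs f x))"])
  show "(\<lambda>x. l (f x)) \<in> range (\<lambda>vs x. l (dderivs vs f x))"
    by (rule range_eqI[of _ _ "[]"]) simp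
  fix g v assume "g \<in> range (\<lambda>vs x. l (dderivs vs f x))"
  then obtain vs where g: "g = (\<lambda>x. l (dderivs vs f x))" by auto
  have "(g has_derivative (\<lambda>v. l (dderivs (v # vs) f x))) (at x)" if "x \<in> U" for x
    using dderivs_has_derivative[OF assms(1) that] unfolding g
    by (rule bounded_linear.has_derivative[OF linear_conv_bounded_linear[THEN iffD1, OF assms(2)]])
  then show "\<exists>h\<in>range (\<lambda>vs x. l (dderivs vs f x)). \<forall>x\<in>U. g differentiable at x \<and> frechet_derivative g (at x) v = h x"
    by (intro bexI[of _ "\<lambda>x. l (dderivs (v # vs) f x)"] ballI frechet_derivative_eqI rangeI) auto
qed (use assms smooth_on_open in auto)

lemma smooth_on_inner_left: "smooth_on U f \<Longrightarrow> smooth_on U (\<lambda>x. f x \<bullet> e)"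
  by (rule smooth_on_linear_comp) (simp_all add: bounded_linear_inner_left bounded_linear.linear)

lemma dderivs_inner_left: "smooth_on U f \<Longrightarrow> x \<in> U \<Longrightarrow> dderivs vs (\<lambda>x. f x \<bullet> e) x = dderivs vs f x \<bullet> e"
  using dderivs_linear_comp[where l="\<lambda>y. y \<bullet> e"] by (simp add: bounded_linear_inner_left bounded_linear.linear)

text \<open>An invariant family for \<open>smooth_on_coinduct\<close>: derivatives of sums, products
  and reciprocals are again built from smooth functions by these three operations.\<close>

inductive_set smooth_algebra :: "'a::euclidean_space set \<Rightarrow> ('a \<Rightarrow> real) set" for U where
  base: "smooth_on U f \<Longrightarrow> f \<in> smooth_algebra U"
| add: "f \<in> smooth_algebra U \<Longrightarrow> g \<in> smooth_algebra U \<Longrightarrow> (\<lambda>x. f x + g x) \<in> smooth_algebra U"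
| mult: "f \<in> smooth_algebra U \<Longrightarrow> g \<in> smooth_algebra U \<Longrightarrow> (\<lambda>x. f x * g x) \<in> smooth_algebra U"
| inv: "f \<in> smooth_algebra U \<Longrightarrow> (\<And>x. x \<in> U \<Longrightarrow> f x \<noteq> 0) \<Longrightarrow> (\<lambda>x. inverse (f x)) \<in> smooth_algebra U"

lemma smooth_algebra_derivative:
  assumes "open U" "f \<in> smooth_algebra U"
  shows "\<exists>f'. (\<forall>x\<in>U. (f has_derivative (\<lambda>v. f' v x)) (at x)) \<and> (\<forall>v. f' v \<in> smooth_algebra U)"
  using assms(2)
proof induction
  case (base f)
  then show ?case
    using smooth_on_has_derivative smooth_on_dderivs smooth_algebra.base
    by (intro exI[of _ "\<lambda>v. dderivs [v] f"]) blast
next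
  case (add f g)
  then obtain f' g' where
    "\<forall>x\<in>U. (f has_derivative (\<lambda>v. f' v x)) (at x)" "\<forall>v. f' v \<in> smooth_algebra U"
    "\<forall>x\<in>U. (g has_derivative (\<lambda>v. g' v x)) (at x)" "\<forall>v. g' v \<in> smooth_algebra U" by blast
  then show ?case
    by (intro exI[of _ "\<lambda>v x. f' v x + g' v x"]) (auto intro: smooth_algebra.add has_derivative_add)
next
  case (mult f g)
  then obtain f' g' where
    "\<forall>x\<in>U. (f has_derivative (\<lambda>v. f' v x)) (at x)" "\<forall>v. f' v \<in> smooth_algebra U"
    "\<forall>x\<in>U. (g has_derivative (\<lambda>v. g' v x)) (at x)" "\<forall>v. g' v \<in> smooth_algebra U" by blast
  then show ?case using mult.hyps
    by (intro exI[of _ "\<lambda>v x. f x * g' v x + f' v x * g x"])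
      (auto intro!: has_derivative_mult smooth_algebra.add[OF smooth_algebra.mult smooth_algebra.mult])
next
  case (inv f)
  then obtain f' where f': "\<And>x. x \<in> U \<Longrightarrow> (f has_derivative (\<lambda>v. f' v x)) (at x)"
      "\<And>v. f' v \<in> smooth_algebra U" by blast
  have "(\<lambda>x. - 1) \<in> smooth_algebra U" by (simp add: smooth_algebra.base smooth_on_const assms)
  then have "(\<lambda>x. - 1 * (inverse (f x) * f' v x * inverse (f x))) \<in> smooth_algebra U" for v
    using inv f' by (intro smooth_algebra.mult smooth_algebra.inv) auto
  moreover have "((\<lambda>x. inverse (f x)) has_derivative (\<lambda>v. - 1 * (inverse (f x) * f' v x * inverse (f x)))) (at x)"
    if "x \<in> U" for x
    using Deriv.has_derivative_inverse[OF inv(2)[OF that] f'(1)[OF that]] by simp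
  ultimately show ?case
    by (intro exI[of _ "\<lambda>v x. - 1 * (inverse (f x) * f' v x * inverse (f x))"]) blast
qed

lemma smooth_algebra_smooth:
  assumes "open U" "f \<in> smooth_algebra U"
  shows "smooth_on U f"
proof (rule smooth_on_coinduct[OF assms])
  fix f v assume "f \<in> smooth_algebra U"
  from smooth_algebra_derivative[OF assms(1) this]
  obtain f' where "\<forall>x\<in>U. (f has_derivative (\<lambda>v. f' v x)) (at x)" "f' v \<in> smooth_algebra U" by blast
  then show "\<exists>g\<in>smooth_algebra U. \<forall>x\<in>U. f differentiable at x \<and> frechet_derivative f (at x) v = g x"
    by (intro bexI[of _ "f' v"] ballI frechet_derivative_eqI) auto
qed

lemma smooth_on_add: "smooth_on U f \<Longrightarrow> smooth_on U g \<Longrightarrow> smooth_on U (\<lambda>x. f x + g x :: real)"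
  by (rule smooth_algebra_smooth[OF smooth_on_open smooth_algebra.add[OF smooth_algebra.base smooth_algebra.base]])

lemma smooth_on_mult: "smooth_on U f \<Longrightarrow> smooth_on U g \<Longrightarrow> smooth_on U (\<lambda>x. f x * g x :: real)"
  by (rule smooth_algebra_smooth[OF smooth_on_open smooth_algebra.mult[OF smooth_algebra.base smooth_algebra.base]])

lemma smooth_on_inverse:
  "smooth_on U f \<Longrightarrow> (\<And>x. x \<in> U \<Longrightarrow> f x \<noteq> 0) \<Longrightarrow> smooth_on U (\<lambda>x. inverse (f x :: real))"
  by (rule smooth_algebra_smooth[OF smooth_on_open smooth_algebra.inv[OF smooth_algebra.base]])

lemma smooth_on_sum:
  "open U \<Longrightarrow> (\<And>i. i \<in> I \<Longrightarrow> smooth_on U (f i)) \<Longrightarrow> smooth_on U (\<lambda>x. \<Sum>i\<in>I. f i x :: real)"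
  by (induction I rule: infinite_finite_induct) (auto intro: smooth_on_const smooth_on_add)

lemma smooth_on_prod:
  "open U \<Longrightarrow> (\<And>i. i \<in> I \<Longrightarrow> smooth_on U (f i)) \<Longrightarrow> smooth_on U (\<lambda>x. \<Prod>i\<in>I. f i x :: real)"
  by (induction I rule: infinite_finite_induct) (auto intro: smooth_on_const smooth_on_mult)

lemma smooth_on_det:
  fixes M :: "'a::euclidean_space \<Rightarrow> real ^ 'n::finite ^ 'n"
  assumes "open U" "\<And>i j. smooth_on U (\<lambda>x. M x $ i $ j)"
  shows "smooth_on U (\<lambda>x. det (M x))"
  unfolding det_def
  by (intro smooth_on_sum smooth_on_mult smooth_on_const smooth_on_prod assms)

text \<open>The increment in the direction \<open>w\<close> is a function of one variable along
  \<open>v\<close>; the mean value theorem reduces the second difference to two values of the first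
  derivative in the direction \<open>v\<close>. Total differentiability of that derivative at the
  single point \<open>x\<close> then suffices, in accordance with \<open>smooth_on\<close>.\<close>

lemma mixed_difference_quotient:
  fixes f :: "'a::euclidean_space \<Rightarrow> real"
  assumes U: "open U" "x \<in> U" and f: "\<And>y. y \<in> U \<Longrightarrow> (f has_derivative f' y) (at y)"
    and A: "((\<lambda>y. f' y v) has_derivative A) (at x)" and e: "e > 0"
  shows "\<exists>d>0. \<forall>s. 0 < s \<longrightarrow> s < d \<longrightarrow>
    \<bar>f (x + s *\<^sub>R v + s *\<^sub>R w) - f (x + s *\<^sub>R w) - f (x + s *\<^sub>R v) + f x - s\<^sup>2 * A w\<bar> \<le> e * s\<^sup>2"
proof -
  interpret A: bounded_linear A using A by (rule has_derivative_bounded_linear)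
  define K where "K = norm v + norm w + 1"
  have K: "K > 0" by (simp add: K_def add_nonneg_pos)
  obtain r where r: "r > 0" "ball x r \<subseteq> U" using U open_contains_ball by blast
  \<comment> \<open>Both points at which the first derivative is compared lie within
    \<open>s * K\<close> of \<open>x\<close>; with this tolerance each of the two errors is at most
    \<open>e / 2 * s\<close>.\<close>
  have "e / (2 * K) > 0" using e K by simp
  from A[unfolded has_derivative_at_alt, THEN conjunct2, rule_format, OF this]
  obtain d where d: "d > 0"
    "\<And>y. norm (y - x) < d \<Longrightarrow> \<bar>f' y v - f' x v - A (y - x)\<bar> \<le> e / (2 * K) * norm (y - x)"
    by auto
  show ?thesis
  proof (intro exI[of _ "min r d / K"] conjI allI impI)
    show "min r d / K > 0" using r d K by simp
    fix s :: real assume s: "0 < s" "s < min r d / K"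
    have near: "norm (t *\<^sub>R v + u *\<^sub>R w) \<le> s * K" "norm (t *\<^sub>R v + u *\<^sub>R w) < min r d"
      if "0 \<le> t" "t \<le> s" "0 \<le> u" "u \<le> s" for t u
    proof -
      have "norm (t *\<^sub>R v + u *\<^sub>R w) \<le> t * norm v + u * norm w"
        using norm_triangle_ineq[of "t *\<^sub>R v" "u *\<^sub>R w"] that by simp
      also have "\<dots> \<le> s * norm v + s * norm w" using that by (intro add_mono mult_right_mono) auto
      also have "\<dots> \<le> s * K" using s by (simp add: K_def algebra_simps)
      finally show "norm (t *\<^sub>R v + u *\<^sub>R w) \<le> s * K" .
      also have "\<dots> < min r d" using s K by (simp add: field_simps)
      finally show "norm (t *\<^sub>R v + u *\<^sub>R w) < min r d" .
    qed
    have inU: "x + (t *\<^sub>R v + u *\<^sub>R w) \<in> U" if "0 \<le> t" "t \<le> s" "0 \<le> u" "u \<le> s" for t u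
      using near(2)[OF that] by (intro subsetD[OF r(2)]) (metis dist_add_cancel dist_0_norm add.right_neutral mem_ball min_less_iff_conj)
    define \<phi> where "\<phi> t = f (x + (t *\<^sub>R v + s *\<^sub>R w)) - f (x + (t *\<^sub>R v + 0 *\<^sub>R w))" for t
    have "(\<phi> has_derivative (\<lambda>h. h * (f' (x + (t *\<^sub>R v + s *\<^sub>R w)) v - f' (x + (t *\<^sub>R v + 0 *\<^sub>R w)) v))) (at t)"
      if t: "0 \<le> t" "t \<le> s" for t
    proof -
      have *: "((\<lambda>t. f (x + (t *\<^sub>R v + u *\<^sub>R w))) has_derivative (\<lambda>h. h * f' (x + (t *\<^sub>R v + u *\<^sub>R w)) v)) (at t)"
        if u: "0 \<le> u" "u \<le> s" for u
      proof -
        have fu: "(f has_derivative f' (x + (t *\<^sub>R v + u *\<^sub>R w))) (at (x + (t *\<^sub>R v + u *\<^sub>R w)))"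
          by (rule f[OF inU[OF t u]])
        have "((\<lambda>t. x + (t *\<^sub>R v + u *\<^sub>R w)) has_derivative (\<lambda>h. h *\<^sub>R v)) (at t)"
          by (auto intro!: derivative_eq_intros)
        from has_derivative_compose[OF this fu]
        show ?thesis using linear_scale[OF has_derivative_linear[OF fu]] by simp
      qed
      show ?thesis unfolding \<phi>_def
        by (rule has_derivative_eq_rhs[OF has_derivative_diff[OF *[of s] *[of 0]]])
          (use s in \<open>auto simp: algebra_simps\<close>)
    qed
    then obtain t where t: "0 < t" "t < s"
      and mv: "\<phi> s - \<phi> 0 = s * (f' (x + (t *\<^sub>R v + s *\<^sub>R w)) v - f' (x + (t *\<^sub>R v + 0 *\<^sub>R w)) v)"
      using mvt_simple[of 0 s \<phi> "\<lambda>t h. h * (f' (x + (t *\<^sub>R v + s *\<^sub>R w)) v - f' (x + (t *\<^sub>R v + 0 *\<^sub>R w)) v)"] s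
      by (auto simp: has_derivative_at_withinI)
    define p q where "p = t *\<^sub>R v + s *\<^sub>R w" and "q = t *\<^sub>R v + 0 *\<^sub>R w"
    have b: "\<bar>f' (x + y) v - f' x v - A y\<bar> \<le> e / 2 * s" if "y = p \<or> y = q" for y
    proof -
      have y: "norm y \<le> s * K" "norm y < min r d"
        using near[of t s] near[of t 0] t that by (auto simp: p_def q_def)
      then have "\<bar>f' (x + y) v - f' x v - A y\<bar> \<le> e / (2 * K) * norm y"
        using d(2)[of "x + y"] by simp
      also have "\<dots> \<le> e / (2 * K) * (s * K)" using e K y by (intro mult_left_mono) auto
      also have "\<dots> = e / 2 * s" using K by simp
      finally show ?thesis .
    qed
    have "A p - A q = s * A w" by (simp add: p_def q_def A.add A.scaleR)
    moreover define E where "E = e / 2 * s"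
    moreover have "\<bar>f' (x + p) v - f' x v - A p\<bar> \<le> E" "\<bar>f' (x + q) v - f' x v - A q\<bar> \<le> E"
      using b unfolding E_def by blast+
    ultimately have "\<bar>f' (x + p) v - f' (x + q) v - s * A w\<bar> \<le> 2 * E" by arith
    then have "\<bar>f' (x + p) v - f' (x + q) v - s * A w\<bar> \<le> e * s" by (simp add: E_def)
    then have "s * \<bar>f' (x + p) v - f' (x + q) v - s * A w\<bar> \<le> s * (e * s)"
      using s by (intro mult_left_mono) auto
    moreover have "\<phi> s - \<phi> 0 = s * (f' (x + p) v - f' (x + q) v)" using mv by (simp only: p_def q_def)
    then have "\<bar>\<phi> s - \<phi> 0 - s\<^sup>2 * A w\<bar> = \<bar>s * (f' (x + p) v - f' (x + q) v - s * A w)\<bar>"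
      by (simp only: power2_eq_square right_diff_distrib mult.assoc)
    then have "s * \<bar>f' (x + p) v - f' (x + q) v - s * A w\<bar> = \<bar>\<phi> s - \<phi> 0 - s\<^sup>2 * A w\<bar>"
      using s by (simp add: abs_mult)
    moreover have "\<phi> s - \<phi> 0 =
      f (x + s *\<^sub>R v + s *\<^sub>R w) - f (x + s *\<^sub>R w) - f (x + s *\<^sub>R v) + f x"
      by (simp add: \<phi>_def algebra_simps)
    ultimately show "\<bar>f (x + s *\<^sub>R v + s *\<^sub>R w) - f (x + s *\<^sub>R w) - f (x + s *\<^sub>R v) + f x - s\<^sup>2 * A w\<bar> \<le> e * s\<^sup>2"
      by (simp add: power2_eq_square mult.commute mult.left_commute)
  qed
qed

text \<open>The second difference of \<open>f\<close> in \<open>v\<close> and \<open>w\<close> is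
  symmetric in the two directions, and divided by the square of the step it approaches each of the
  two second derivatives.\<close>

lemma second_derivative_symmetric:
  fixes f :: "'a::euclidean_space \<Rightarrow> real"
  assumes U: "open U" "x \<in> U" and f: "\<And>y. y \<in> U \<Longrightarrow> (f has_derivative f' y) (at y)"
    and A: "((\<lambda>y. f' y v) has_derivative A) (at x)" and B: "((\<lambda>y. f' y w) has_derivative B) (at x)"
  shows "A w = B v"
proof -
  have "\<bar>A w - B v\<bar> \<le> e" if "e > 0" for e
  proof -
    have e2: "e / 2 > 0" using that by simp
    obtain d where d: "d > 0" "\<And>s. 0 < s \<Longrightarrow> s < d \<Longrightarrow>
      \<bar>f (x + s *\<^sub>R v + s *\<^sub>R w) - f (x + s *\<^sub>R w) - f (x + s *\<^sub>R v) + f x - s\<^sup>2 * A w\<bar> \<le> (e/2) * s\<^sup>2"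
      using mixed_difference_quotient[OF U f A e2, of w] by auto
    obtain d' where d': "d' > 0" "\<And>s. 0 < s \<Longrightarrow> s < d' \<Longrightarrow>
      \<bar>f (x + s *\<^sub>R w + s *\<^sub>R v) - f (x + s *\<^sub>R v) - f (x + s *\<^sub>R w) + f x - s\<^sup>2 * B v\<bar> \<le> (e/2) * s\<^sup>2"
      using mixed_difference_quotient[OF U f B e2, of v] by auto
    define s where "s = min d d' / 2"
    have s: "0 < s" "s < d" "s < d'" using d(1) d'(1) by (auto simp: s_def)
    have "\<bar>s\<^sup>2 * A w - s\<^sup>2 * B v\<bar> \<le> e * s\<^sup>2"
    proof -
      define D where "D = f (x + s *\<^sub>R v + s *\<^sub>R w) - f (x + s *\<^sub>R w) - f (x + s *\<^sub>R v) + f x"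
      define E where "E = e / 2 * s\<^sup>2"
      have D: "f (x + s *\<^sub>R w + s *\<^sub>R v) - f (x + s *\<^sub>R v) - f (x + s *\<^sub>R w) + f x = D"
        by (simp add: D_def algebra_simps)
      have "\<bar>D - s\<^sup>2 * A w\<bar> \<le> E"
        using d(2)[OF s(1,2)] by (simp only: D_def E_def)
      moreover have "\<bar>D - s\<^sup>2 * B v\<bar> \<le> E"
        using d'(2)[OF s(1,3)] by (simp only: D E_def)
      ultimately have "\<bar>s\<^sup>2 * A w - s\<^sup>2 * B v\<bar> \<le> 2 * E" by arith
      then show ?thesis by (simp add: E_def)
    qed
    moreover have "s\<^sup>2 * \<bar>A w - B v\<bar> = \<bar>s\<^sup>2 * A w - s\<^sup>2 * B v\<bar>"
      by (simp add: abs_mult flip: right_diff_distrib)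
    ultimately have "s\<^sup>2 * \<bar>A w - B v\<bar> \<le> s\<^sup>2 * e" by (simp only: mult.commute)
    then show ?thesis using s(1) by simp
  qed
  then show ?thesis by (metis abs_le_zero_iff dense_ge eq_iff_diff_eq_0)
qed

lemma dderivs_swap:
  assumes f: "smooth_on U f" and x: "x \<in> U"
  shows "dderivs (v # w # vs) f x = dderivs (w # v # vs) f x"
proof (rule euclidean_eqI)
  fix b :: 'b assume "b \<in> Basis"
  define g where "g = (\<lambda>y. dderivs vs f y \<bullet> b)"
  have g: "smooth_on U g" unfolding g_def by (intro smooth_on_inner_left smooth_on_dderivs f)
  have gD: "dderivs ws g x = dderivs (ws @ vs) f x \<bullet> b" for ws
    using dderivs_inner_left[OF smooth_on_dderivs[OF f] x, of ws vs b] by (simp add: g_def dderivs_append)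
  have "dderivs [w, v] g x = dderivs [v, w] g x"
    by (rule second_derivative_symmetric[where f=g and f'="\<lambda>y v. dderivs [v] g y",
          OF smooth_on_open[OF f] x smooth_on_has_derivative[OF g]])
      (use dderivs_has_derivative[OF g x] in auto)
  then show "dderivs (v # w # vs) f x \<bullet> b = dderivs (w # v # vs) f x \<bullet> b" unfolding gD by simp
qed

section \<open>Linearity of iterated derivatives in their directions, and joint continuity\<close>

lemma linear_dderivs1: "smooth_on U f \<Longrightarrow> x \<in> U \<Longrightarrow> linear (\<lambda>v. dderivs (v # vs) f x)"
  using dderivs_has_derivative has_derivative_linear by blast

lemma linear_dderivs2: "smooth_on U f \<Longrightarrow> x \<in> U \<Longrightarrow> linear (\<lambda>w. dderivs (v # w # vs) f x)"
  using linear_dderivs1[of U f x "v # vs"] by (simp add: dderivs_swap[where v=v])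

lemma continuous_on_dderivs: "smooth_on U f \<Longrightarrow> continuous_on U (dderivs vs f)"
  by (simp add: smooth_on_def differentiable_imp_continuous_on)

lemma linear_Basis_expansion: "linear L \<Longrightarrow> L v = (\<Sum>b\<in>Basis. (v \<bullet> b) *\<^sub>R L b)"
  using linear_sum[of L "\<lambda>b. (v \<bullet> b) *\<^sub>R b" Basis] by (simp add: linear_scale euclidean_representation)

lemma tendsto_dderivs_gen:
  assumes "smooth_on U f" "x \<in> U" "(y \<longlongrightarrow> x) F"
  shows "((\<lambda>j. dderivs vs f (y j)) \<longlongrightarrow> dderivs vs f x) F"
proof -
  have "isCont (dderivs vs f) x"
    using continuous_on_dderivs[OF assms(1), of vs] assms(2) smooth_on_open[OF assms(1)]
    by (simp add: continuous_on_eq_continuous_at)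
  then show ?thesis using assms(3) by (rule isCont_tendsto_compose)
qed

text \<open>Moving directions are expanded in the basis, which leaves finitely many continuous
  functions of the base point.\<close>

lemma tendsto_dderivs1:
  assumes f: "smooth_on U f" "x \<in> U" and "(y \<longlongrightarrow> x) F" "(v \<longlongrightarrow> v0) F"
  shows "((\<lambda>j. dderivs (v j # vs) f (y j)) \<longlongrightarrow> dderivs (v0 # vs) f x) F"
proof -
  have "\<forall>\<^sub>F j in F. y j \<in> U" using assms smooth_on_open topological_tendstoD by blast
  then have ev: "\<forall>\<^sub>F j in F. (\<Sum>b\<in>Basis. (v j \<bullet> b) *\<^sub>R dderivs (b # vs) f (y j)) = dderivs (v j # vs) f (y j)"
    by (rule eventually_mono) (simp only: linear_Basis_expansion[OF linear_dderivs1[OF f(1)], symmetric])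
  have "((\<lambda>j. \<Sum>b\<in>Basis. (v j \<bullet> b) *\<^sub>R dderivs (b # vs) f (y j)) \<longlongrightarrow> (\<Sum>b\<in>Basis. (v0 \<bullet> b) *\<^sub>R dderivs (b # vs) f x)) F"
    by (intro tendsto_intros tendsto_dderivs_gen[OF f] assms)
  then show ?thesis
    using ev linear_Basis_expansion[OF linear_dderivs1[OF f], of v0 vs] by (simp add: tendsto_cong)
qed

lemma tendsto_dderivs2:
  assumes f: "smooth_on U f" "x \<in> U" and "(y \<longlongrightarrow> x) F" "(v \<longlongrightarrow> v0) F" "(w \<longlongrightarrow> w0) F"
  shows "((\<lambda>j. dderivs [v j, w j] f (y j)) \<longlongrightarrow> dderivs [v0, w0] f x) F"
proof -
  have "\<forall>\<^sub>F j in F. y j \<in> U" using assms smooth_on_open topological_tendstoD by blast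
  then have ev: "\<forall>\<^sub>F j in F. (\<Sum>b\<in>Basis. (w j \<bullet> b) *\<^sub>R dderivs [v j, b] f (y j)) = dderivs [v j, w j] f (y j)"
    by (rule eventually_mono) (simp only: linear_Basis_expansion[OF linear_dderivs2[OF f(1)], symmetric])
  have "((\<lambda>j. \<Sum>b\<in>Basis. (w j \<bullet> b) *\<^sub>R dderivs [v j, b] f (y j)) \<longlongrightarrow> (\<Sum>b\<in>Basis. (w0 \<bullet> b) *\<^sub>R dderivs [v0, b] f x)) F"
    by (intro tendsto_intros tendsto_dderivs1[OF f] assms)
  then show ?thesis
    using ev linear_Basis_expansion[OF linear_dderivs2[OF f, of v0 "[]"], of w0] by (simp add: tendsto_cong)
qed

lemma dderivs_line_vector_derivative:
  assumes "smooth_on U f" "a + t *\<^sub>R z \<in> U"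
  shows "((\<lambda>t. dderivs vs f (a + t *\<^sub>R z)) has_vector_derivative dderivs (z # vs) f (a + t *\<^sub>R z)) (at t)"
proof -
  have "((\<lambda>t. a + t *\<^sub>R z) has_derivative (\<lambda>h. h *\<^sub>R z)) (at t)"
    by (auto intro!: derivative_eq_intros)
  from has_derivative_compose[OF this dderivs_has_derivative[OF assms]]
  show ?thesis
    using linear_scale[OF linear_dderivs1[OF assms]] by (simp add: has_vector_derivative_def)
qed

section \<open>Second-order contact\<close>

text \<open>Differentiability gives the estimate for each basis direction. Linearity in
  \<open>z\<close> makes it uniform at the price of a factor \<open>?n\<close>, by which the
  tolerance is divided beforehand.\<close>

lemma smooth_derivative_expansion:
  assumes f: "smooth_on U f" and a: "a \<in> U" and e: "e > 0"
  shows "\<exists>d>0. \<forall>y z. norm y < d \<longrightarrow>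
    norm (dderivs [z] f (a + y) - dderivs [z] f a - dderivs [y, z] f a) \<le> e * norm y * norm z"
proof -
  let ?n = "real (card (Basis :: 'a set))"
  have n: "?n > 0" by (simp add: DIM_positive)
  obtain r where r: "r > 0" "ball a r \<subseteq> U" using smooth_on_open[OF f] a open_contains_ball by blast
  have "\<exists>d>0. \<forall>y. norm (y - a) < d \<longrightarrow>
      norm (dderivs [b] f y - dderivs [b] f a - dderivs [y - a, b] f a) \<le> (e / ?n) * norm (y - a)" for b
  proof -
    have "e / ?n > 0" using e n by simp
    then show ?thesis
      using dderivs_has_derivative[OF f a, of "[b]"] unfolding has_derivative_at_alt by blast
  qed
  then obtain d where d: "\<And>b. d b > 0" "\<And>b y. norm (y - a) < d b \<Longrightarrow>
      norm (dderivs [b] f y - dderivs [b] f a - dderivs [y - a, b] f a) \<le> (e / ?n) * norm (y - a)"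
    by metis
  define d0 where "d0 = min r (Min (d ` Basis))"
  show ?thesis
  proof (intro exI[of _ d0] conjI allI impI)
    show "d0 > 0" using r d(1) by (simp add: d0_def)
    fix y z :: 'a assume y: "norm y < d0"
    have yb: "norm y < d b" if "b \<in> Basis" for b
    proof -
      have "Min (d ` Basis) \<le> d b" using that by simp
      then show ?thesis using y unfolding d0_def by linarith
    qed
    have "a + y \<in> ball a r" using y by (simp add: d0_def dist_norm norm_minus_commute)
    then have U: "a + y \<in> U" using r by blast
    define R where "R z = dderivs [z] f (a + y) - dderivs [z] f a - dderivs [y, z] f a" for z
    have "linear R"
      unfolding R_def
      by (intro linear_compose_sub linear_dderivs1[OF f] linear_dderivs2[OF f] U a)
    then have "norm (R z) = norm (\<Sum>b\<in>Basis. (z \<bullet> b) *\<^sub>R R b)"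
      by (metis linear_Basis_expansion)
    also have "\<dots> \<le> (\<Sum>b\<in>Basis. \<bar>z \<bullet> b\<bar> * norm (R b))"
      by (rule order_trans[OF norm_sum]) simp
    also have "\<dots> \<le> (\<Sum>b\<in>(Basis::'a set). norm z * (e / ?n * norm y))"
    proof (rule sum_mono, rule mult_mono)
      fix b :: 'a assume b: "b \<in> Basis"
      show "\<bar>z \<bullet> b\<bar> \<le> norm z" using b by (simp add: Basis_le_norm)
      show "norm (R b) \<le> e / ?n * norm y" using d(2)[of "a + y" b] yb[OF b] by (simp add: R_def)
    qed auto
    also have "\<dots> = e * norm y * norm z" using n by simp
    finally show "norm (dderivs [z] f (a + y) - dderivs [z] f a - dderivs [y, z] f a) \<le> e * norm y * norm z"
      by (simp add: R_def)
  qed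
qed

text \<open>Mean value inequality on a segment for \<open>f\<close> minus its second-order Taylor
  polynomial; the derivative of this difference is controlled by
  \<open>smooth_derivative_expansion\<close>.\<close>

lemma smooth_second_order_expansion:
  assumes f: "smooth_on U f" and a: "a \<in> U" and e: "e > 0"
  shows "\<exists>d>0. \<forall>z. norm z < d \<longrightarrow>
    norm (f (a + z) - f a - dderivs [z] f a - (1/2) *\<^sub>R dderivs [z, z] f a) \<le> e * (norm z)\<^sup>2"
proof -
  obtain r where r: "r > 0" "ball a r \<subseteq> U" using smooth_on_open[OF f] a open_contains_ball by blast
  obtain d where d: "d > 0" "\<And>y z. norm y < d \<Longrightarrow>
      norm (dderivs [z] f (a + y) - dderivs [z] f a - dderivs [y, z] f a) \<le> e * norm y * norm z"
    using smooth_derivative_expansion[OF assms] by blast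
  show ?thesis
  proof (intro exI[of _ "min r d"] conjI allI impI)
    show "min r d > 0" using r d by simp
    fix z :: 'a assume z: "norm z < min r d"
    define g where "g t = f (a + t *\<^sub>R z) - t *\<^sub>R dderivs [z] f a - (t\<^sup>2 / 2) *\<^sub>R dderivs [z, z] f a" for t
    define g' where "g' t = dderivs [z] f (a + t *\<^sub>R z) - dderivs [z] f a - t *\<^sub>R dderivs [z, z] f a" for t
    have tz: "norm (t *\<^sub>R z) < d" "a + t *\<^sub>R z \<in> U" if "t \<in> {0..1}" for t
    proof -
      have "norm (t *\<^sub>R z) \<le> norm z" using that by (simp add: mult_left_le_one_le)
      then have *: "norm (t *\<^sub>R z) < d" "norm (t *\<^sub>R z) < r" using z by auto
      then show "norm (t *\<^sub>R z) < d" by blast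
      have "a + t *\<^sub>R z \<in> ball a r" using *(2) by (simp add: dist_norm norm_minus_commute)
      then show "a + t *\<^sub>R z \<in> U" using r by blast
    qed
    have "(g has_derivative (\<lambda>h. h *\<^sub>R g' t)) (at t within {0..1})" if "t \<in> {0..1}" for t
    proof -
      have "(g has_vector_derivative g' t) (at t)"
        unfolding g_def g'_def
        by (auto intro!: derivative_eq_intros dderivs_line_vector_derivative[OF f tz(2)[OF that], of "[]", simplified])
      then show ?thesis by (simp add: has_vector_derivative_def has_derivative_at_withinI)
    qed
    moreover have "onorm (\<lambda>h. h *\<^sub>R g' t) \<le> e * (norm z)\<^sup>2" if "t \<in> {0..1}" for t
    proof (rule onorm_bound)
      have "norm (g' t) \<le> e * norm (t *\<^sub>R z) * norm z"
        using d(2)[OF tz(1)[OF that], of z] linear_scale[OF linear_dderivs1[OF f a]]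
        by (simp add: g'_def)
      also have "\<dots> = t * (e * (norm z)\<^sup>2)" using that by (simp add: power2_eq_square)
      also have "\<dots> \<le> e * (norm z)\<^sup>2" using that e by (simp add: mult_left_le_one_le)
      finally show "norm (h *\<^sub>R g' t) \<le> e * (norm z)\<^sup>2 * norm h" for h
        by (simp add: mult.commute mult_left_mono)
    qed (use e in auto)
    ultimately have "norm (g 1 - g 0) \<le> e * (norm z)\<^sup>2 * norm (1 - 0 :: real)"
      by (intro differentiable_bound[of "{0..1}" g "\<lambda>t h. h *\<^sub>R g' t"]) auto
    then show "norm (f (a + z) - f a - dderivs [z] f a - (1/2) *\<^sub>R dderivs [z, z] f a) \<le> e * (norm z)\<^sup>2"
      by (simp add: g_def algebra_simps)
  qed
qed

text \<open>The second-order Taylor expansion, tested along curves: \<open>B\<close> is the quadratic form of the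
  second derivative. In this form the notion is evidently stable under composition.\<close>

definition jet2 :: "('a::euclidean_space \<Rightarrow> 'b::euclidean_space) \<Rightarrow> 'a \<Rightarrow> ('a \<Rightarrow> 'b) \<Rightarrow> ('a \<Rightarrow> 'b) \<Rightarrow> bool" where
  "jet2 G a L B \<longleftrightarrow> linear L \<and>
     (\<forall>\<zeta> \<xi>. ((\<lambda>s::real. \<zeta> s /\<^sub>R s) \<longlongrightarrow> \<xi>) (at 0) \<longrightarrow>
        ((\<lambda>s. (G (a + \<zeta> s) - G a - L (\<zeta> s)) /\<^sub>R s\<^sup>2) \<longlongrightarrow> (1/2) *\<^sub>R B \<xi>) (at 0))"

lemma jet2D:
  "jet2 G a L B \<Longrightarrow> ((\<lambda>s::real. \<zeta> s /\<^sub>R s) \<longlongrightarrow> \<xi>) (at 0) \<Longrightarrow>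
    ((\<lambda>s. (G (a + \<zeta> s) - G a - L (\<zeta> s)) /\<^sub>R s\<^sup>2) \<longlongrightarrow> (1/2) *\<^sub>R B \<xi>) (at 0)"
  by (simp add: jet2_def)

lemma quotient_tendsto_zero:
  fixes \<zeta> :: "real \<Rightarrow> 'a::real_normed_vector"
  assumes "((\<lambda>s. \<zeta> s /\<^sub>R s) \<longlongrightarrow> \<xi>) (at 0)"
  shows "(\<zeta> \<longlongrightarrow> 0) (at 0)"
proof -
  have "((\<lambda>s. s *\<^sub>R (\<zeta> s /\<^sub>R s)) \<longlongrightarrow> 0 *\<^sub>R \<xi>) (at 0)"
    by (intro tendsto_intros assms)
  then have "((\<lambda>s. s *\<^sub>R (\<zeta> s /\<^sub>R s)) \<longlongrightarrow> 0) (at 0)" by simp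
  then show ?thesis
    by (rule Lim_transform_eventually) (auto simp: eventually_at_filter)
qed

lemma smooth_jet2:
  assumes f: "smooth_on U f" and a: "a \<in> U"
  shows "jet2 f a (\<lambda>v. dderivs [v] f a) (\<lambda>v. dderivs [v, v] f a)"
  unfolding jet2_def
proof (intro conjI allI impI linear_dderivs1[OF f a])
  fix \<zeta> :: "real \<Rightarrow> 'a" and \<xi> assume \<zeta>: "((\<lambda>s. \<zeta> s /\<^sub>R s) \<longlongrightarrow> \<xi>) (at 0)"
  define R where "R z = f (a + z) - f a - dderivs [z] f a - (1/2) *\<^sub>R dderivs [z, z] f a" for z
  have "((\<lambda>s. R (\<zeta> s) /\<^sub>R s\<^sup>2) \<longlongrightarrow> 0) (at 0)"
  proof (rule tendstoI)
    fix e :: real assume e: "e > 0"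
    define C where "C = (norm \<xi> + 1)\<^sup>2"
    have "norm \<xi> + 1 > 0" by (simp add: add_nonneg_pos)
    then have C: "C > 0" unfolding C_def by (rule zero_less_power)
    obtain d where d: "d > 0" "\<And>z. norm z < d \<Longrightarrow> norm (R z) \<le> e / (2 * C) * (norm z)\<^sup>2"
      using smooth_second_order_expansion[OF f a, of "e / (2 * C)"] e C by (auto simp: R_def)
    have "\<forall>\<^sub>F s in at 0. norm (\<zeta> s) < d"
      using tendsto_norm[OF quotient_tendsto_zero[OF \<zeta>]] d(1) by (auto dest: order_tendstoD(2))
    moreover have "\<forall>\<^sub>F s in at 0. norm (\<zeta> s /\<^sub>R s) < norm \<xi> + 1"
      using tendsto_norm[OF \<zeta>] by (rule order_tendstoD(2)) simp
    moreover have "\<forall>\<^sub>F s in at (0::real). s \<noteq> 0" by (simp add: eventually_at_filter)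
    ultimately show "\<forall>\<^sub>F s in at 0. dist (R (\<zeta> s) /\<^sub>R s\<^sup>2) 0 < e"
    proof eventually_elim
      case (elim s)
      have "norm (R (\<zeta> s) /\<^sub>R s\<^sup>2) = norm (R (\<zeta> s)) / s\<^sup>2" by (simp add: divide_inverse mult.commute)
      also have "\<dots> \<le> (e / (2 * C) * (norm (\<zeta> s))\<^sup>2) / s\<^sup>2"
        using d(2)[OF elim(1)] by (rule divide_right_mono) simp
      also have "\<dots> = e / (2 * C) * (norm (\<zeta> s /\<^sub>R s))\<^sup>2"
      proof -
        have n: "norm (\<zeta> s /\<^sub>R s) = norm (\<zeta> s) / \<bar>s\<bar>" by (simp add: divide_inverse_commute)
        show ?thesis unfolding n power_divide by simp
      qed
      also have "\<dots> \<le> e / (2 * C) * C"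
        unfolding C_def using elim(2) e C by (intro mult_left_mono power_mono) auto
      also have "\<dots> < e" using e C by simp
      finally show ?case by simp
    qed
  qed
  moreover have "((\<lambda>s. dderivs [\<zeta> s /\<^sub>R s, \<zeta> s /\<^sub>R s] f a) \<longlongrightarrow> dderivs [\<xi>, \<xi>] f a) (at 0)"
    by (rule tendsto_dderivs2[OF f a tendsto_const \<zeta> \<zeta>])
  ultimately have "((\<lambda>s. R (\<zeta> s) /\<^sub>R s\<^sup>2 + (1/2) *\<^sub>R dderivs [\<zeta> s /\<^sub>R s, \<zeta> s /\<^sub>R s] f a) \<longlongrightarrow> 0 + (1/2) *\<^sub>R dderivs [\<xi>, \<xi>] f a) (at 0)"
    by (intro tendsto_intros)
  moreover have "R (\<zeta> s) /\<^sub>R s\<^sup>2 + (1/2) *\<^sub>R dderivs [\<zeta> s /\<^sub>R s, \<zeta> s /\<^sub>R s] f a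
      = (f (a + \<zeta> s) - f a - dderivs [\<zeta> s] f a) /\<^sub>R s\<^sup>2" for s
    using linear_scale[OF linear_dderivs1[OF f a]] linear_scale[OF linear_dderivs2[OF f a]]
    by (simp add: R_def algebra_simps power2_eq_square)
  ultimately show "((\<lambda>s. (f (a + \<zeta> s) - f a - dderivs [\<zeta> s] f a) /\<^sub>R s\<^sup>2) \<longlongrightarrow> (1/2) *\<^sub>R dderivs [\<xi>, \<xi>] f a) (at 0)"
    by simp
qed

lemma jet2_quotient:
  assumes G: "jet2 G a L B" and \<zeta>: "((\<lambda>s::real. \<zeta> s /\<^sub>R s) \<longlongrightarrow> \<xi>) (at 0)"
  shows "((\<lambda>s. (G (a + \<zeta> s) - G a) /\<^sub>R s) \<longlongrightarrow> L \<xi>) (at 0)"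
proof -
  have L: "linear L" using G by (simp add: jet2_def)
  have "((\<lambda>s. s *\<^sub>R ((G (a + \<zeta> s) - G a - L (\<zeta> s)) /\<^sub>R s\<^sup>2) + L (\<zeta> s /\<^sub>R s)) \<longlongrightarrow> 0 *\<^sub>R ((1/2) *\<^sub>R B \<xi>) + L \<xi>) (at 0)"
    by (intro tendsto_intros jet2D[OF G \<zeta>] bounded_linear.tendsto[OF linear_conv_bounded_linear[THEN iffD1, OF L]] \<zeta>)
  moreover have "s *\<^sub>R ((G (a + \<zeta> s) - G a - L (\<zeta> s)) /\<^sub>R s\<^sup>2) + L (\<zeta> s /\<^sub>R s) = (G (a + \<zeta> s) - G a) /\<^sub>R s"
    if "s \<noteq> 0" for s
  proof -
    have "s *\<^sub>R (w /\<^sub>R s\<^sup>2) = w /\<^sub>R s" for w :: 'b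
      using that by (simp add: power2_eq_square)
    then show ?thesis by (simp only: linear_scale[OF L]) (simp add: scaleR_diff_right)
  qed
  ultimately show ?thesis
    by (auto intro: Lim_transform_eventually simp: eventually_at_filter)
qed

lemma jet2_compose:
  assumes G: "jet2 G a L B" and P: "jet2 P (G a) L' B'"
  shows "jet2 (\<lambda>z. P (G z)) a (\<lambda>v. L' (L v)) (\<lambda>v. L' (B v) + B' (L v))"
  unfolding jet2_def
proof (intro conjI allI impI)
  have L: "linear L" and L': "linear L'" using G P by (auto simp: jet2_def)
  show "linear (\<lambda>v. L' (L v))" using linear_compose[OF L L'] by (simp add: o_def)
  fix \<zeta> :: "real \<Rightarrow> 'a" and \<xi> assume \<zeta>: "((\<lambda>s. \<zeta> s /\<^sub>R s) \<longlongrightarrow> \<xi>) (at 0)"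
  define \<delta> where "\<delta> s = G (a + \<zeta> s) - G a" for s
  have \<delta>: "((\<lambda>s. \<delta> s /\<^sub>R s) \<longlongrightarrow> L \<xi>) (at 0)"
    unfolding \<delta>_def by (rule jet2_quotient[OF G \<zeta>])
  have "((\<lambda>s. (P (G a + \<delta> s) - P (G a) - L' (\<delta> s)) /\<^sub>R s\<^sup>2 + L' ((\<delta> s - L (\<zeta> s)) /\<^sub>R s\<^sup>2))
      \<longlongrightarrow> (1/2) *\<^sub>R B' (L \<xi>) + L' ((1/2) *\<^sub>R B \<xi>)) (at 0)"
    unfolding \<delta>_def
    by (intro tendsto_add bounded_linear.tendsto[OF linear_conv_bounded_linear[THEN iffD1, OF L']]
        jet2D[OF G \<zeta>] jet2D[OF P] \<delta>[unfolded \<delta>_def])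
  moreover have "(P (G a + \<delta> s) - P (G a) - L' (\<delta> s)) /\<^sub>R s\<^sup>2 + L' ((\<delta> s - L (\<zeta> s)) /\<^sub>R s\<^sup>2)
     = (P (G (a + \<zeta> s)) - P (G a) - L' (L (\<zeta> s))) /\<^sub>R s\<^sup>2" for s
    by (simp add: \<delta>_def linear_scale[OF L'] linear_diff[OF L'] linear_add[OF L'] scaleR_diff_right)
  ultimately show "((\<lambda>s. (P (G (a + \<zeta> s)) - P (G a) - L' (L (\<zeta> s))) /\<^sub>R s\<^sup>2)
      \<longlongrightarrow> (1/2) *\<^sub>R (L' (B \<xi>) + B' (L \<xi>))) (at 0)"
    by (simp add: linear_scale[OF L'] scaleR_add_right add.commute)
qed

text \<open>The first-order term is tangential, so pairing with the normal \<open>N\<close> removes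
  it. What remains depends on the curve only through its velocity, which is why a second fundamental
  form can be read off from curves of low regularity.\<close>

lemma jet2_normal_part:
  assumes G: "jet2 G a L B" and \<zeta>: "((\<lambda>s::real. \<zeta> s /\<^sub>R s) \<longlongrightarrow> \<xi>) (at 0)"
    and N: "\<And>v. L v \<bullet> N = 0"
  shows "((\<lambda>s. ((G (a + \<zeta> s) - G a) \<bullet> N) / s\<^sup>2) \<longlongrightarrow> (B \<xi> \<bullet> N) / 2) (at 0)"
proof -
  have "((\<lambda>s. ((G (a + \<zeta> s) - G a - L (\<zeta> s)) /\<^sub>R s\<^sup>2) \<bullet> N) \<longlongrightarrow> ((1/2) *\<^sub>R B \<xi>) \<bullet> N) (at 0)"
    by (intro tendsto_intros jet2D[OF G \<zeta>])
  moreover have "((w - L v) /\<^sub>R c) \<bullet> N = (w \<bullet> N) / c" for w v c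
    by (simp add: inner_diff_left N divide_inverse)
  ultimately show ?thesis by simp
qed

text \<open>Injectivity of \<open>L\<close> makes \<open>G\<close> expanding at \<open>a\<close>, so
  \<open>\<zeta>\<close> is of order \<open>s\<close>. The remainder of \<open>G\<close> along it is
  then of smaller order, hence \<open>L\<close> applied to the quotient of \<open>\<zeta> s\<close>
  by \<open>s\<close> converges, and a left inverse \<open>K\<close> of \<open>L\<close> recovers
  the limit of the quotient.\<close>

lemma curve_lift:
  fixes G :: "'a::euclidean_space \<Rightarrow> 'b::euclidean_space"
  assumes G: "(G has_derivative L) (at a)" and inj: "inj L"
    and \<zeta>: "(\<zeta> \<longlongrightarrow> 0) (at 0)"
    and c: "((\<lambda>s::real. (G (a + \<zeta> s) - G a) /\<^sub>R s) \<longlongrightarrow> e) (at 0)"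
  obtains \<xi> where "L \<xi> = e" "((\<lambda>s. \<zeta> s /\<^sub>R s) \<longlongrightarrow> \<xi>) (at 0)"
proof -
  have L: "linear L" using G by (rule has_derivative_linear)
  have bL: "bounded_linear L" using G by (rule has_derivative_bounded_linear)
  obtain K where K: "linear K" "K \<circ> L = id" using linear_injective_left_inverse[OF L inj] by blast
  have bK: "bounded_linear K" by (rule linear_conv_bounded_linear[THEN iffD1, OF K(1)])
  then obtain C where C: "C > 0" "\<And>y. norm (K y) \<le> norm y * C"
    using bounded_linear.pos_bounded by blast
  have lower: "norm z \<le> C * norm (L z)" for z
    using C(2)[of "L z"] K(2) by (metis comp_apply id_apply mult.commute)
  define R where "R z = G (a + z) - G a - L z" for z
  have small: "\<forall>e>0. \<exists>d>0. \<forall>z. norm z < d \<longrightarrow> norm (R z) \<le> e * norm z"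
  proof (intro allI impI)
    fix e :: real assume "e > 0"
    then obtain d where "d > 0" "\<And>y. norm (y - a) < d \<Longrightarrow> norm (G y - G a - L (y - a)) \<le> e * norm (y - a)"
      using G unfolding has_derivative_at_alt by blast
    from this(1) this(2)[of "a + _"] show "\<exists>d>0. \<forall>z. norm z < d \<longrightarrow> norm (R z) \<le> e * norm z"
      by (auto simp: R_def)
  qed
  have nz: "\<forall>\<^sub>F s in at (0::real). s \<noteq> 0" by (simp add: eventually_at_filter)
  have ev: "\<forall>\<^sub>F s in at 0. norm (\<zeta> s) < d" if "d > 0" for d
    using tendsto_norm[OF \<zeta>] that by (auto dest: order_tendstoD(2))
  define M where "M = norm e + 1"
  have cM: "\<forall>\<^sub>F s in at 0. norm ((G (a + \<zeta> s) - G a) /\<^sub>R s) < M"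
    using tendsto_norm[OF c] by (rule order_tendstoD(2)) (simp add: M_def)
  have bound: "\<forall>\<^sub>F s in at 0. norm (\<zeta> s /\<^sub>R s) \<le> 2 * C * M"
  proof -
    obtain d where d: "d > 0" "\<And>z. norm z < d \<Longrightarrow> norm (R z) \<le> 1 / (2 * C) * norm z"
      using small[rule_format, of "1 / (2 * C)"] C by auto
    show ?thesis using ev[OF d(1)] cM nz
    proof eventually_elim
      case (elim s)
      have "norm (\<zeta> s) \<le> C * norm (G (a + \<zeta> s) - G a - R (\<zeta> s))"
        using lower[of "\<zeta> s"] by (simp add: R_def)
      also have "\<dots> \<le> C * (norm (G (a + \<zeta> s) - G a) + 1 / (2 * C) * norm (\<zeta> s))"
        using C(1) d(2)[OF elim(1)] norm_triangle_ineq4[of "G (a + \<zeta> s) - G a" "R (\<zeta> s)"]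
        by (intro mult_left_mono) auto
      finally have "norm (\<zeta> s) \<le> 2 * C * norm (G (a + \<zeta> s) - G a)"
        using C(1) by (simp add: algebra_simps)
      then have "norm (\<zeta> s) / \<bar>s\<bar> \<le> 2 * C * norm (G (a + \<zeta> s) - G a) / \<bar>s\<bar>"
        by (simp add: divide_right_mono)
      also have "\<dots> = 2 * C * norm ((G (a + \<zeta> s) - G a) /\<^sub>R s)" by (simp add: divide_inverse mult_ac)
      also have "\<dots> \<le> 2 * C * M" using elim(2) C(1) by (intro mult_left_mono) auto
      finally show ?case by (simp add: divide_inverse mult.commute)
    qed
  qed
  have M: "M > 0" by (simp add: M_def add_nonneg_pos)
  have "((\<lambda>s. R (\<zeta> s) /\<^sub>R s) \<longlongrightarrow> 0) (at 0)"
  proof (rule tendstoI)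
    fix e :: real assume e: "e > 0"
    obtain d where d: "d > 0" "\<And>z. norm z < d \<Longrightarrow> norm (R z) \<le> e / (4 * C * M) * norm z"
      using small[rule_format, of "e / (4 * C * M)"] C M e by auto
    show "\<forall>\<^sub>F s in at 0. dist (R (\<zeta> s) /\<^sub>R s) 0 < e"
      using ev[OF d(1)] bound nz
    proof eventually_elim
      case (elim s)
      have "norm (R (\<zeta> s) /\<^sub>R s) \<le> e / (4 * C * M) * norm (\<zeta> s /\<^sub>R s)"
        using mult_left_mono[OF d(2)[OF elim(1)], of "inverse \<bar>s\<bar>"] by (simp add: mult_ac)
      also have "\<dots> \<le> e / (4 * C * M) * (2 * C * M)"
        using elim(2) e C(1) M by (intro mult_left_mono) auto
      also have "\<dots> < e" using e C(1) M by (simp add: field_simps)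
      finally show ?case by simp
    qed
  qed
  from tendsto_diff[OF c this] have "((\<lambda>s. L (\<zeta> s /\<^sub>R s)) \<longlongrightarrow> e) (at 0)"
    by (simp add: R_def linear_scale[OF L] flip: scaleR_diff_right)
  from bounded_linear.tendsto[OF bK this] have lim: "((\<lambda>s. \<zeta> s /\<^sub>R s) \<longlongrightarrow> K e) (at 0)"
    using K(2) by (simp add: pointfree_idE)
  have "((\<lambda>s. L (\<zeta> s /\<^sub>R s)) \<longlongrightarrow> L (K e)) (at 0)" by (rule bounded_linear.tendsto[OF bL lim])
  with \<open>((\<lambda>s. L (\<zeta> s /\<^sub>R s)) \<longlongrightarrow> e) (at 0)\<close> have "L (K e) = e"
    by (metis LIM_unique)
  with lim that show ?thesis by blast
qed

section \<open>The second fundamental form\<close>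

lemma bilinear_expand_axis:
  fixes B :: "real ^ 'n::finite \<Rightarrow> real ^ 'n \<Rightarrow> real"
  assumes "bilinear B"
  shows "B v w = (\<Sum>i\<in>UNIV. \<Sum>j\<in>UNIV. v $ i * w $ j * B (axis i 1) (axis j 1))"
proof -
  have "B v w = B (\<Sum>i\<in>UNIV. v $ i *\<^sub>R axis i 1) (\<Sum>j\<in>UNIV. w $ j *\<^sub>R axis j 1)"
    by (simp add: basis_expansion flip: scalar_mult_eq_scaleR)
  also have "\<dots> = (\<Sum>(i, j)\<in>UNIV \<times> UNIV. B (v $ i *\<^sub>R axis i 1) (w $ j *\<^sub>R axis j 1))"
    by (rule bilinear_sum[OF assms]) 
  also have "\<dots> = (\<Sum>i\<in>UNIV. \<Sum>j\<in>UNIV. v $ i * w $ j * B (axis i 1) (axis j 1))"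
    by (simp add: sum.cartesian_product bilinear_lmul[OF assms] bilinear_rmul[OF assms] case_prod_unfold mult_ac)
  finally show ?thesis .
qed

lemma bilinear_matrix_congruence:
  fixes B :: "real ^ 'n::finite \<Rightarrow> real ^ 'n \<Rightarrow> real" and E :: "real ^ 'n ^ 'n"
  assumes "bilinear B"
  shows "(transpose E ** (\<chi> i j. B (axis i 1) (axis j 1)) ** E) $ a $ b = B (column a E) (column b E)"
proof -
  have "(transpose E ** (\<chi> i j. B (axis i 1) (axis j 1)) ** E) $ a $ b
      = (\<Sum>j\<in>UNIV. \<Sum>i\<in>UNIV. E $ i $ a * B (axis i 1) (axis j 1) * E $ j $ b)"
    by (simp add: matrix_matrix_mult_def transpose_def sum_distrib_right)
  also have "\<dots> = (\<Sum>i\<in>UNIV. \<Sum>j\<in>UNIV. column a E $ i * column b E $ j * B (axis i 1) (axis j 1))"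
    by (subst sum.swap) (simp add: column_def mult_ac)
  finally show ?thesis by (simp only: bilinear_expand_axis[OF assms, symmetric])
qed

text \<open>Coordinates on a tangent hyperplane. Forms on varying tangent spaces become forms on one
  fixed space, where they can be compared and passed to the limit.\<close>

definition normal_frame :: "'n::finite ambient \<Rightarrow> (real ^ 'n \<Rightarrow> 'n ambient) \<Rightarrow> bool" where
  "normal_frame N \<iota> \<longleftrightarrow> linear \<iota> \<and> (\<forall>v. norm (\<iota> v) = norm v) \<and> range \<iota> = {e. e \<bullet> N = 0}"

lemma normal_frame_exists:
  fixes N :: "'n::finite ambient"
  assumes "norm N = 1"
  obtains \<iota> where "normal_frame N \<iota>"
proof -
  have "subspace {e. N \<bullet> e = 0}" by (rule subspace_hyperplane)
  moreover have "dim (UNIV :: (real^'n) set) = dim {e. N \<bullet> e = 0}"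
    using assms by (subst dim_hyperplane) auto
  ultimately obtain \<iota> :: "real^'n \<Rightarrow> 'n ambient" where "linear \<iota>" "range \<iota> = {e. N \<bullet> e = 0}" "\<And>v. norm (\<iota> v) = norm v"
    using isometry_subspaces[OF subspace_UNIV, where T="{e. N \<bullet> e = 0}" and ?'a="real^'n"] by auto
  with that show ?thesis unfolding normal_frame_def by (metis (no_types, lifting) Collect_cong inner_commute)
qed

lemma normal_frameD:
  assumes "normal_frame N \<iota>"
  shows "linear \<iota>" "norm (\<iota> v) = norm v" "\<iota> v \<bullet> N = 0" "N \<bullet> \<iota> v = 0" "\<iota> v \<bullet> \<iota> w = v \<bullet> w"
    "e \<bullet> N = 0 \<Longrightarrow> \<exists>v. e = \<iota> v"
proof -
  show lin: "linear \<iota>" and n: "norm (\<iota> v) = norm v" for v using assms by (auto simp: normal_frame_def)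
  show N: "\<iota> v \<bullet> N = 0" for v using assms by (auto simp: normal_frame_def)
  then show "N \<bullet> \<iota> v = 0" by (simp add: inner_commute)
  show "e \<bullet> N = 0 \<Longrightarrow> \<exists>v. e = \<iota> v" using assms by (auto simp: normal_frame_def)
  have "(norm (\<iota> (v + w)))\<^sup>2 = (norm (v + w))\<^sup>2" by (simp add: n)
  then have "(norm (\<iota> v + \<iota> w))\<^sup>2 = (norm (v + w))\<^sup>2" by (simp add: linear_add[OF lin])
  moreover have "\<iota> u \<bullet> \<iota> u = u \<bullet> u" for u by (metis n power2_norm_eq_inner)
  ultimately show "\<iota> v \<bullet> \<iota> w = v \<bullet> w"
    by (simp add: power2_norm_eq_inner inner_add_left inner_add_right inner_commute)
qed

lemma sum_axis_inner: "(\<Sum>k\<in>UNIV. (u \<bullet> axis k 1)\<^sup>2) = u \<bullet> (u :: real ^ 'n::finite)"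
proof -
  have "u \<bullet> axis k 1 = u $ k" for k by (simp add: inner_axis)
  then show ?thesis by (simp add: inner_vec_def power2_eq_square)
qed

text \<open>A negative \<open>k0\<close> is outweighed by any single other eigenvalue, since these
  are at least \<open>k1 > - k0\<close>. Dimension three leaves one eigenvalue for this purpose
  besides the one being estimated; for surfaces the bound fails.\<close>

lemma two_convex_eigenvalue_bound:
  fixes l :: "'n::finite \<Rightarrow> real"
  assumes "CARD('n) \<ge> 3" and l: "l i0 = k0" "\<And>i. i \<noteq> i0 \<Longrightarrow> k1 \<le> l i" and k: "k0 \<le> k1" "k0 + k1 > 0"
  shows "\<bar>l i\<bar> \<le> sum l UNIV" "0 < sum l UNIV"
proof -
  have k1: "k1 > 0" using k by linarith
  have lower: "real (card A) * k1 \<le> sum l A" if "i0 \<notin> A" for A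
  proof (rule sum_bounded_below)
    fix i assume "i \<in> A"
    then have "i \<noteq> i0" using that by blast
    then show "k1 \<le> l i" by (rule l(2))
  qed
  have card: "real (card (UNIV - {i0})) \<ge> 2" using assms(1) by (simp add: card_Diff_singleton)
  have S: "sum l UNIV = k0 + sum l (UNIV - {i0})" using l(1) by (simp add: sum.remove[of UNIV i0])
  have "2 * k1 \<le> real (card (UNIV - {i0})) * k1" using card k1 by (intro mult_right_mono) auto
  then have S2: "2 * k1 \<le> sum l (UNIV - {i0})" using lower[of "UNIV - {i0}"] by simp
  show "0 < sum l UNIV" using S S2 k k1 by linarith
  show "\<bar>l i\<bar> \<le> sum l UNIV"
  proof (cases "i = i0")
    case True
    then show ?thesis using S S2 k k1 l(1) by auto
  next
    case False
    have "real (card (UNIV - {i0} - {i})) \<ge> 1" using assms(1) False by (simp add: card_Diff_singleton)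
    then have "1 * k1 \<le> real (card (UNIV - {i0} - {i})) * k1" using k1 by (intro mult_right_mono) auto
    then have "k1 \<le> sum l (UNIV - {i0} - {i})" using lower[of "UNIV - {i0} - {i}"] by auto
    moreover have "sum l (UNIV - {i0}) = l i + sum l (UNIV - {i0} - {i})"
      using False by (simp add: sum.remove[of "UNIV - {i0}" i])
    ultimately show ?thesis using S k k1 l(2)[OF False] by auto
  qed
qed

section \<open>Charts, velocities and the second fundamental form of a hypersurface\<close>

locale hypersurface =
  fixes X :: "'a topology" and \<A> :: "('n::finite, 'a) param set" and x \<nu> :: "'a \<Rightarrow> 'n ambient"
  assumes surf: "two_sided_immersed_hypersurface X \<A> x \<nu>"
begin

lemma Hausdorff: "Hausdorff_space X"
  using surf unfolding two_sided_immersed_hypersurface_def smooth_manifold_def by blast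

lemma
  assumes "(U, \<phi>) \<in> \<A>"
  shows chart_open: "open U" and chart_image_open: "openin X (\<phi> ` U)"
    and chart_homeo: "homeomorphic_map (top_of_set U) (subtopology X (\<phi> ` U)) \<phi>"
    and chart_smooth: "smooth_on U (x \<circ> \<phi>)"
    and chart_inj: "u \<in> U \<Longrightarrow> inj (\<lambda>v. dderivs [v] (x \<circ> \<phi>) u)"
    and chart_normal: "u \<in> U \<Longrightarrow> dderivs [v] (x \<circ> \<phi>) u \<bullet> \<nu> (\<phi> u) = 0"
proof -
  have "local_param X (U, \<phi>)"
    using surf assms unfolding two_sided_immersed_hypersurface_def smooth_manifold_def by blast
  then show "open U" "openin X (\<phi> ` U)" "homeomorphic_map (top_of_set U) (subtopology X (\<phi> ` U)) \<phi>"
    by (auto simp: local_param_def)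
  have imm: "smooth_on U (x \<circ> \<phi>) \<and> (\<forall>u\<in>U. inj (frechet_derivative (x \<circ> \<phi>) (at u)))"
    using surf assms unfolding two_sided_immersed_hypersurface_def smooth_immersion_def by blast
  then show "smooth_on U (x \<circ> \<phi>)" by blast
  show "u \<in> U \<Longrightarrow> inj (\<lambda>v. dderivs [v] (x \<circ> \<phi>) u)" using imm by (simp add: dderivs.simps(2))
  have "\<forall>u\<in>U. \<forall>v. frechet_derivative (x \<circ> \<phi>) (at u) v \<bullet> \<nu> (\<phi> u) = 0"
    using surf assms unfolding two_sided_immersed_hypersurface_def unit_normal_field_def by blast
  then show "u \<in> U \<Longrightarrow> dderivs [v] (x \<circ> \<phi>) u \<bullet> \<nu> (\<phi> u) = 0" by (simp add: dderivs.simps(2))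
qed

lemma chart_at:
  assumes "p \<in> topspace X"
  obtains U \<phi> u where "(U, \<phi>) \<in> \<A>" "u \<in> U" "\<phi> u = p"
proof -
  have "(\<Union>(U, \<phi>)\<in>\<A>. \<phi> ` U) = topspace X"
    using surf unfolding two_sided_immersed_hypersurface_def smooth_manifold_def by blast
  then have "p \<in> (\<Union>(U, \<phi>)\<in>\<A>. \<phi> ` U)" using assms by simp
  then show ?thesis using that by auto
qed

lemma normal_continuous: "continuous_map X euclidean \<nu>"
  and norm_normal: "p \<in> topspace X \<Longrightarrow> norm (\<nu> p) = 1"
  using surf unfolding two_sided_immersed_hypersurface_def unit_normal_field_def by blast+

lemma chart_topspace: "(U, \<phi>) \<in> \<A> \<Longrightarrow> u \<in> U \<Longrightarrow> \<phi> u \<in> topspace X"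
  using chart_image_open openin_subset by blast

lemma chart_inverse:
  assumes "(U, \<phi>) \<in> \<A>"
  obtains \<psi> where "continuous_map (top_of_set U) X \<phi>"
    "continuous_map (subtopology X (\<phi> ` U)) (top_of_set U) \<psi>" "\<And>u. u \<in> U \<Longrightarrow> \<psi> (\<phi> u) = u"
proof -
  obtain \<psi> where "homeomorphic_maps (top_of_set U) (subtopology X (\<phi> ` U)) \<phi> \<psi>"
    using chart_homeo[OF assms] homeomorphic_map_maps by blast
  then show ?thesis
    using that by (auto simp: homeomorphic_maps_def continuous_map_in_subtopology)
qed

lemma curve_in_chart:
  assumes c: "(U, \<phi>) \<in> \<A>" "u \<in> U" and q: "limitin X q (\<phi> u) F"
  obtains \<zeta> where "(\<zeta> \<longlongrightarrow> 0) F" "\<forall>\<^sub>F s in F. u + \<zeta> s \<in> U \<and> q s = \<phi> (u + \<zeta> s)"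
proof -
  obtain \<psi> where \<psi>: "continuous_map (subtopology X (\<phi> ` U)) (top_of_set U) \<psi>" "\<And>u. u \<in> U \<Longrightarrow> \<psi> (\<phi> u) = u"
    using chart_inverse[OF c(1)] by metis
  have ev: "\<forall>\<^sub>F s in F. q s \<in> \<phi> ` U"
    using q chart_image_open[OF c(1)] c(2) by (auto simp: limitin_def)
  then have "limitin (subtopology X (\<phi> ` U)) q (\<phi> u) F"
    using q c(2) by (simp add: limitin_subtopology)
  from continuous_map_limit[OF \<psi>(1) this]
  have "((\<psi> \<circ> q) \<longlongrightarrow> u) F" using \<psi>(2)[OF c(2)] by (simp add: limitin_subtopology)
  from tendsto_diff[OF this tendsto_const[of u]]
  have "((\<lambda>s. \<psi> (q s) - u) \<longlongrightarrow> 0) F" by simp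
  moreover have "\<forall>\<^sub>F s in F. u + (\<psi> (q s) - u) \<in> U \<and> q s = \<phi> (u + (\<psi> (q s) - u))"
    using ev by (rule eventually_mono) (auto simp: \<psi>(2))
  ultimately show ?thesis by (rule that)
qed

text \<open>Convergence is required in \<open>X\<close>, not only of the images: \<open>x\<close>
  may fail to be injective, and the images could jump to another sheet. Beyond the first-order
  quotient no regularity is imposed on \<open>q\<close>.\<close>

definition velocity :: "(real \<Rightarrow> 'a) \<Rightarrow> 'a \<Rightarrow> 'n ambient \<Rightarrow> bool" where
  "velocity q p e \<longleftrightarrow> limitin X q p (at 0) \<and> ((\<lambda>s. (x (q s) - x p) /\<^sub>R s) \<longlongrightarrow> e) (at 0)"

lemma chart_curve_velocity:
  assumes c: "(U, \<phi>) \<in> \<A>" "u \<in> U"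
  shows "velocity (\<lambda>s. \<phi> (u + s *\<^sub>R \<eta>)) (\<phi> u) (dderivs [\<eta>] (x \<circ> \<phi>) u)"
proof -
  have lim: "((\<lambda>s. u + s *\<^sub>R \<eta>) \<longlongrightarrow> u) (at 0)" by (auto intro!: tendsto_eq_intros)
  have "\<forall>\<^sub>F s in at 0. u + s *\<^sub>R \<eta> \<in> U"
    using topological_tendstoD[OF lim chart_open[OF c(1)] c(2)] .
  then have "limitin (top_of_set U) (\<lambda>s. u + s *\<^sub>R \<eta>) u (at 0)"
    using lim c(2) by (simp add: limitin_subtopology)
  moreover have "continuous_map (top_of_set U) X \<phi>" using chart_inverse[OF c(1)] by metis
  ultimately have "limitin X (\<phi> \<circ> (\<lambda>s. u + s *\<^sub>R \<eta>)) (\<phi> u) (at 0)"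
    by (intro continuous_map_limit)
  moreover have "((\<lambda>s. (s *\<^sub>R \<eta>) /\<^sub>R s) \<longlongrightarrow> \<eta>) (at (0::real))"
    by (rule Lim_transform_eventually[OF tendsto_const]) (auto simp: eventually_at_filter)
  from jet2_quotient[OF smooth_jet2[OF chart_smooth[OF c(1)] c(2)] this]
  have "((\<lambda>s. (x (\<phi> (u + s *\<^sub>R \<eta>)) - x (\<phi> u)) /\<^sub>R s) \<longlongrightarrow> dderivs [\<eta>] (x \<circ> \<phi>) u) (at 0)"
    by simp
  ultimately show ?thesis by (simp add: velocity_def o_def)
qed

text \<open>A curve of given velocity is lifted to the chart. Injectivity of the differential
  determines its coordinate velocity, and with it the normal part of its second-order displacement:
  Meusnier's theorem in a weak form.\<close>

lemma curve_second_order: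
  assumes c: "(U, \<phi>) \<in> \<A>" "u \<in> U" and q: "velocity q (\<phi> u) e"
  obtains \<eta> where "dderivs [\<eta>] (x \<circ> \<phi>) u = e"
    "((\<lambda>s. ((x (q s) - x (\<phi> u)) \<bullet> \<nu> (\<phi> u)) / s\<^sup>2) \<longlongrightarrow> (dderivs [\<eta>, \<eta>] (x \<circ> \<phi>) u \<bullet> \<nu> (\<phi> u)) / 2) (at 0)"
proof -
  let ?F = "x \<circ> \<phi>"
  obtain \<zeta> where \<zeta>: "(\<zeta> \<longlongrightarrow> 0) (at 0)" "\<forall>\<^sub>F s in at 0. u + \<zeta> s \<in> U \<and> q s = \<phi> (u + \<zeta> s)"
    using curve_in_chart[OF c] q by (auto simp: velocity_def)
  then have ev: "\<forall>\<^sub>F s in at 0. x (q s) = ?F (u + \<zeta> s)" by (auto elim: eventually_mono)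
  have "((\<lambda>s. (?F (u + \<zeta> s) - ?F u) /\<^sub>R s) \<longlongrightarrow> e) (at 0)"
    by (rule Lim_transform_eventually[of "\<lambda>s. (x (q s) - x (\<phi> u)) /\<^sub>R s"])
      (use q ev in \<open>auto simp: velocity_def elim: eventually_mono\<close>)
  from curve_lift[OF smooth_on_has_derivative[OF chart_smooth[OF c(1)] c(2)] chart_inj[OF c] \<zeta>(1) this]
  obtain \<xi> where \<xi>: "dderivs [\<xi>] ?F u = e" "((\<lambda>s. \<zeta> s /\<^sub>R s) \<longlongrightarrow> \<xi>) (at 0)" by blast
  have "((\<lambda>s. ((?F (u + \<zeta> s) - ?F u) \<bullet> \<nu> (\<phi> u)) / s\<^sup>2) \<longlongrightarrow> (dderivs [\<xi>, \<xi>] ?F u \<bullet> \<nu> (\<phi> u)) / 2) (at 0)"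
    by (rule jet2_normal_part[OF smooth_jet2[OF chart_smooth[OF c(1)] c(2)] \<xi>(2) chart_normal[OF c]])
  then have "((\<lambda>s. ((x (q s) - x (\<phi> u)) \<bullet> \<nu> (\<phi> u)) / s\<^sup>2) \<longlongrightarrow> (dderivs [\<xi>, \<xi>] ?F u \<bullet> \<nu> (\<phi> u)) / 2) (at 0)"
    by (rule Lim_transform_eventually) (use ev in \<open>auto elim: eventually_mono\<close>)
  with \<xi>(1) that show ?thesis by blast
qed

text \<open>The second fundamental form of ambient tangent vectors, read off from curves; this makes it
  independent of the parametrization.\<close>

definition II :: "'a \<Rightarrow> 'n ambient \<Rightarrow> real" where
  "II p e = (THE k. \<exists>q. velocity q p e \<and> ((\<lambda>s. ((x (q s) - x p) \<bullet> \<nu> p) / s\<^sup>2) \<longlongrightarrow> k / 2) (at 0))"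

text \<open>The description in \<open>II\<close> is unambiguous because all curves with the given
  velocity have the same normal displacement to second order, and a coordinate line supplies one
  such curve.\<close>

lemma II_chart:
  assumes c: "(U, \<phi>) \<in> \<A>" "u \<in> U"
  shows "II (\<phi> u) (dderivs [\<eta>] (x \<circ> \<phi>) u) = dderivs [\<eta>, \<eta>] (x \<circ> \<phi>) u \<bullet> \<nu> (\<phi> u)"
  unfolding II_def
proof (rule the_equality)
  have *: "((\<lambda>s. ((x (q s) - x (\<phi> u)) \<bullet> \<nu> (\<phi> u)) / s\<^sup>2) \<longlongrightarrow> (dderivs [\<eta>, \<eta>] (x \<circ> \<phi>) u \<bullet> \<nu> (\<phi> u)) / 2) (at 0)"
    if "velocity q (\<phi> u) (dderivs [\<eta>] (x \<circ> \<phi>) u)" for q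
  proof -
    obtain \<xi> where "dderivs [\<xi>] (x \<circ> \<phi>) u = dderivs [\<eta>] (x \<circ> \<phi>) u"
     "((\<lambda>s. ((x (q s) - x (\<phi> u)) \<bullet> \<nu> (\<phi> u)) / s\<^sup>2) \<longlongrightarrow> (dderivs [\<xi>, \<xi>] (x \<circ> \<phi>) u \<bullet> \<nu> (\<phi> u)) / 2) (at 0)"
      by (rule curve_second_order[OF c \<open>velocity q _ _\<close>]) (rule that)
    then show ?thesis using chart_inj[OF c] by (auto simp: inj_def)
  qed
  then show "\<exists>q. velocity q (\<phi> u) (dderivs [\<eta>] (x \<circ> \<phi>) u) \<and> ((\<lambda>s. ((x (q s) - x (\<phi> u)) \<bullet> \<nu> (\<phi> u)) / s\<^sup>2)
      \<longlongrightarrow> (dderivs [\<eta>, \<eta>] (x \<circ> \<phi>) u \<bullet> \<nu> (\<phi> u)) / 2) (at 0)"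
    using chart_curve_velocity[OF c, of \<eta>] by blast
  fix k assume "\<exists>q. velocity q (\<phi> u) (dderivs [\<eta>] (x \<circ> \<phi>) u) \<and>
     ((\<lambda>s. ((x (q s) - x (\<phi> u)) \<bullet> \<nu> (\<phi> u)) / s\<^sup>2) \<longlongrightarrow> k / 2) (at 0)"
  then obtain q where q: "velocity q (\<phi> u) (dderivs [\<eta>] (x \<circ> \<phi>) u)"
     "((\<lambda>s. ((x (q s) - x (\<phi> u)) \<bullet> \<nu> (\<phi> u)) / s\<^sup>2) \<longlongrightarrow> k / 2) (at 0)" by blast
  have "k / 2 = (dderivs [\<eta>, \<eta>] (x \<circ> \<phi>) u \<bullet> \<nu> (\<phi> u)) / 2"
    by (rule tendsto_unique[OF _ q(2) *[OF q(1)]]) simp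
  then show "k = dderivs [\<eta>, \<eta>] (x \<circ> \<phi>) u \<bullet> \<nu> (\<phi> u)" by simp
qed

lemma II_curve:
  assumes "p \<in> topspace X" "velocity q p e"
  shows "((\<lambda>s. ((x (q s) - x p) \<bullet> \<nu> p) / s\<^sup>2) \<longlongrightarrow> II p e / 2) (at 0)"
proof -
  obtain U \<phi> u where c: "(U, \<phi>) \<in> \<A>" "u \<in> U" "\<phi> u = p" using chart_at[OF assms(1)] by blast
  obtain \<eta> where "dderivs [\<eta>] (x \<circ> \<phi>) u = e"
     "((\<lambda>s. ((x (q s) - x (\<phi> u)) \<bullet> \<nu> (\<phi> u)) / s\<^sup>2) \<longlongrightarrow> (dderivs [\<eta>, \<eta>] (x \<circ> \<phi>) u \<bullet> \<nu> (\<phi> u)) / 2) (at 0)"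
    using curve_second_order[OF c(1,2)] assms(2) c(3) by blast
  then show ?thesis using II_chart[OF c(1,2), of \<eta>] c(3) by simp
qed

lemma tangent_range:
  assumes c: "(U, \<phi>) \<in> \<A>" "u \<in> U"
  shows "range (\<lambda>v. dderivs [v] (x \<circ> \<phi>) u) = {e. e \<bullet> \<nu> (\<phi> u) = 0}"
proof -
  have lin: "linear (\<lambda>v. dderivs [v] (x \<circ> \<phi>) u)" by (rule linear_dderivs1[OF chart_smooth[OF c(1)] c(2)])
  have "norm (\<nu> (\<phi> u)) = 1" using norm_normal chart_topspace[OF c] by blast
  then have nz: "\<nu> (\<phi> u) \<noteq> 0" by auto
  have eq: "{e. e \<bullet> \<nu> (\<phi> u) = 0} = {e. \<nu> (\<phi> u) \<bullet> e = 0}" by (simp add: inner_commute)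
  show ?thesis
  proof (rule subspace_dim_equal)
    show "subspace (range (\<lambda>v. dderivs [v] (x \<circ> \<phi>) u))" by (rule linear_subspace_image[OF lin subspace_UNIV])
    show "subspace {e. e \<bullet> \<nu> (\<phi> u) = 0}" unfolding eq by (rule subspace_hyperplane)
    show "range (\<lambda>v. dderivs [v] (x \<circ> \<phi>) u) \<subseteq> {e. e \<bullet> \<nu> (\<phi> u) = 0}" using chart_normal[OF c] by auto
    have "dim (range (\<lambda>v. dderivs [v] (x \<circ> \<phi>) u)) = dim (UNIV :: (real^'n) set)"
      using dim_image_eq[OF lin, of UNIV] chart_inj[OF c] by simp
    then show "dim {e. e \<bullet> \<nu> (\<phi> u) = 0} \<le> dim (range (\<lambda>v. dderivs [v] (x \<circ> \<phi>) u))"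
      unfolding eq using dim_hyperplane[OF nz] by simp
  qed
qed

lemma chart_frame:
  assumes c: "(U, \<phi>) \<in> \<A>" "u \<in> U" and \<iota>: "normal_frame (\<nu> (\<phi> u)) \<iota>"
  obtains J where "linear J" "\<And>v. dderivs [J v] (x \<circ> \<phi>) u = \<iota> v"
proof -
  have lin: "linear (\<lambda>v. dderivs [v] (x \<circ> \<phi>) u)" by (rule linear_dderivs1[OF chart_smooth[OF c(1)] c(2)])
  obtain K where K: "linear K" "K \<circ> (\<lambda>v. dderivs [v] (x \<circ> \<phi>) u) = id"
    using linear_injective_left_inverse[OF lin chart_inj[OF c]] by blast
  have "dderivs [K (\<iota> v)] (x \<circ> \<phi>) u = \<iota> v" for v
  proof -
    have "\<iota> v \<in> range (\<lambda>v. dderivs [v] (x \<circ> \<phi>) u)"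
      unfolding tangent_range[OF c] using normal_frameD(3)[OF \<iota>] by blast
    then obtain w where w: "\<iota> v = dderivs [w] (x \<circ> \<phi>) u" by blast
    have "K (dderivs [w] (x \<circ> \<phi>) u) = w" using K(2) by (metis comp_apply id_apply)
    then show ?thesis by (simp add: w)
  qed
  moreover have "linear (K \<circ> \<iota>)" using linear_compose[OF normal_frameD(1)[OF \<iota>] K(1)] .
  ultimately show ?thesis using that[of "K \<circ> \<iota>"] by simp
qed

section \<open>Diagonalization and principal curvatures\<close>

lemma bilinear_chart_form:
  assumes c: "(U, \<phi>) \<in> \<A>" "u \<in> U" and J: "linear J"
  shows "bilinear (\<lambda>v w. dderivs [J v, J w] (x \<circ> \<phi>) u \<bullet> N)"
proof -
  note s = chart_smooth[OF c(1)]
  have "linear (\<lambda>y :: 'n ambient. y \<bullet> N)" by (simp add: bounded_linear.linear bounded_linear_inner_left)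
  from linear_compose[OF linear_compose[OF J linear_dderivs1[OF s c(2)]] this]
    linear_compose[OF linear_compose[OF J linear_dderivs2[OF s c(2)]] this]
  show ?thesis by (simp add: bilinear_def o_def)
qed

lemma chart_form_symmetric:
  assumes c: "(U, \<phi>) \<in> \<A>" "u \<in> U"
  shows "dderivs [v, w] (x \<circ> \<phi>) u = dderivs [w, v] (x \<circ> \<phi>) u"
  by (rule dderivs_swap[OF chart_smooth[OF c(1)] c(2)])

lemma II_diagonalization:
  assumes p: "p \<in> topspace X" and \<iota>: "normal_frame (\<nu> p) \<iota>"
  obtains q l where "\<And>i j. q i \<bullet> q j = (if i = j then 1 else 0 :: real)"
    and "\<And>v. II p (\<iota> v) = (\<Sum>i\<in>UNIV. l i * (q (i :: 'n) \<bullet> v)\<^sup>2)"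
proof -
  obtain U \<phi> u where c: "(U, \<phi>) \<in> \<A>" "u \<in> U" and pu: "\<phi> u = p" using chart_at[OF p] by blast
  obtain J where J: "linear J" "\<And>v. dderivs [J v] (x \<circ> \<phi>) u = \<iota> v"
    using chart_frame[OF c] \<iota> pu by blast
  define B where "B v w = dderivs [J v, J w] (x \<circ> \<phi>) u \<bullet> \<nu> p" for v w
  have B: "bilinear B" unfolding B_def by (rule bilinear_chart_form[OF c J(1)])
  define S where "S = (\<chi> i j. B (axis i 1) (axis j 1))"
  have "B v w = B w v" for v w
    unfolding B_def chart_form_symmetric[OF c, of "J v" "J w"] ..
  then have "transpose S = S" by (simp add: S_def transpose_def vec_eq_iff)
  then obtain q l where q: "\<And>i j. q i \<bullet> q j = (if i = j then 1 else 0)" "\<And>i. S *v q i = l i *\<^sub>R q (i::'n)"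
    using symmetric_matrix_diagonalization by blast
  have BS: "B v w = v \<bullet> (S *v w)" for v w
    by (simp add: bilinear_expand_axis[OF B, of v w] S_def inner_vec_def matrix_vector_mult_def sum_distrib_left mult_ac)
  have "II p (\<iota> v) = (\<Sum>i\<in>UNIV. l i * (q i \<bullet> v)\<^sup>2)" for v
  proof -
    have "II p (\<iota> v) = B v v" using II_chart[OF c, of "J v"] by (simp add: J pu B_def)
    also have "\<dots> = v \<bullet> (S *v (\<Sum>i\<in>UNIV. (q i \<bullet> v) *\<^sub>R q i))"
      by (simp add: BS orthonormal_basis_expansion(1)[OF q(1)])
    also have "\<dots> = v \<bullet> (\<Sum>i\<in>UNIV. (q i \<bullet> v) *\<^sub>R l i *\<^sub>R q i)"
      by (simp add: linear_sum[OF matrix_vector_mul_linear] linear_scale[OF matrix_vector_mul_linear] q(2))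
    also have "\<dots> = (\<Sum>i\<in>UNIV. l i * (q i \<bullet> v)\<^sup>2)"
      by (simp add: inner_sum_right power2_eq_square inner_commute mult_ac)
    finally show ?thesis .
  qed
  with q(1) that show ?thesis by blast
qed

text \<open>In the frame of the vectors \<open>J (q j)\<close> the first fundamental form is the
  identity and the second is diagonal. The right-hand side mentions no chart, which is the
  independence of the characteristic polynomial from the parametrization.\<close>

lemma chart_charpoly:
  assumes c: "(U, \<phi>) \<in> \<A>" "u \<in> U" and \<iota>: "normal_frame (\<nu> (\<phi> u)) \<iota>"
    and q: "\<And>i j. q i \<bullet> q j = (if i = j then 1 else 0 :: real)"
    and l: "\<And>v. II (\<phi> u) (\<iota> v) = (\<Sum>i\<in>UNIV. l i * (q (i :: 'n) \<bullet> v)\<^sup>2)"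
  shows "det (t *\<^sub>R mat 1 - shape_operator (x \<circ> \<phi>) (\<nu> (\<phi> u)) u) = (\<Prod>i\<in>UNIV. t - l i)"
proof -
  let ?F = "x \<circ> \<phi>"
  obtain J where J: "linear J" "\<And>v. dderivs [J v] ?F u = \<iota> v"
    using chart_frame[OF c \<iota>] by blast
  define E where "E = (\<chi> i j. J (q j) $ i)"
  have E: "column j E = J (q j)" for j by (simp add: E_def column_def vec_eq_iff)
  have lin: "linear (\<lambda>v. dderivs [v] ?F u)" by (rule linear_dderivs1[OF chart_smooth[OF c(1)] c(2)])
  have gB: "bilinear (\<lambda>v w. dderivs [v] ?F u \<bullet> dderivs [w] ?F u)"
    using linear_add[OF lin] linear_scale[OF lin]
    by (auto simp: bilinear_def intro!: linearI simp: inner_add_left inner_add_right)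
  have hB: "bilinear (\<lambda>v w. dderivs [v, w] ?F u \<bullet> \<nu> (\<phi> u))"
    using bilinear_chart_form[OF c linear_id] by simp
  have JB: "bilinear (\<lambda>v w. dderivs [J v, J w] ?F u \<bullet> \<nu> (\<phi> u))" (is "bilinear ?B")
    by (rule bilinear_chart_form[OF c J(1)])
  have BII: "?B v v = (\<Sum>i\<in>UNIV. l i * (q i \<bullet> v)\<^sup>2)" for v
    using II_chart[OF c, of "J v"] by (simp add: J l)
  \<comment> \<open>\<open>II\<close> is only a quadratic form; the off-diagonal entries are
    recovered by polarization, using the symmetry of second derivatives.\<close>
  have polar: "?B v w = (\<Sum>i\<in>UNIV. l i * ((q i \<bullet> v) * (q i \<bullet> w)))" for v w
  proof -
    have "?B (v + w) (v + w) = ?B v v + 2 * ?B v w + ?B w w"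
      using chart_form_symmetric[OF c, of "J v" "J w"]
      by (simp add: bilinear_ladd[OF JB] bilinear_radd[OF JB])
    then have "2 * ?B v w = ?B (v + w) (v + w) - ?B v v - ?B w w" by simp
    also have "\<dots> = (\<Sum>i\<in>UNIV. l i * (q i \<bullet> (v + w))\<^sup>2 - l i * (q i \<bullet> v)\<^sup>2 - l i * (q i \<bullet> w)\<^sup>2)"
      by (simp add: BII sum_subtractf)
    also have "\<dots> = (\<Sum>i\<in>UNIV. 2 * (l i * ((q i \<bullet> v) * (q i \<bullet> w))))"
      by (rule sum.cong) (simp_all add: inner_add_right power2_eq_square algebra_simps)
    also have "\<dots> = 2 * (\<Sum>i\<in>UNIV. l i * ((q i \<bullet> v) * (q i \<bullet> w)))" by (simp add: sum_distrib_left)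
    finally show ?thesis by simp
  qed
  show ?thesis
    unfolding shape_operator_def
  proof (rule det_shape_frame)
    show "transpose E ** first_fundamental_form ?F u ** E = mat 1"
      unfolding vec_eq_iff first_fundamental_form_def bilinear_matrix_congruence[OF gB]
      by (simp add: E J normal_frameD(5)[OF \<iota>] q mat_def)
    have "?B (q i) (q j) = (if i = j then l i else 0)" for i j
    proof -
      have "?B (q i) (q j) = (\<Sum>k\<in>UNIV. if k = i then (if i = j then l i else 0) else 0)"
        unfolding polar by (rule sum.cong) (auto simp: q)
      then show ?thesis by simp
    qed
    then show "transpose E ** second_fundamental_form ?F (\<nu> (\<phi> u)) u ** E = (\<chi> i j. if i = j then l i else 0)"
      unfolding vec_eq_iff second_fundamental_form_def bilinear_matrix_congruence[OF hB]
      by (simp add: E)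
  qed
qed

lemma principal_curvatures_eq:
  assumes p: "p \<in> topspace X" and \<iota>: "normal_frame (\<nu> p) \<iota>"
    and q: "\<And>i j. q i \<bullet> q j = (if i = j then 1 else 0 :: real)"
    and l: "\<And>v. II p (\<iota> v) = (\<Sum>i\<in>UNIV. l i * (q (i :: 'n) \<bullet> v)\<^sup>2)"
  shows "principal_curvatures \<A> x \<nu> p = sorted_list_of_multiset (image_mset l (mset_set UNIV))"
  unfolding principal_curvatures_def
proof (rule the_equality)
  let ?ks = "sorted_list_of_multiset (image_mset l (mset_set UNIV))"
  have "(\<Prod>k\<leftarrow>?ks. t - k) = prod_mset (image_mset (\<lambda>k. t - k) (mset ?ks))" for t
    by (metis mset_map prod_mset_prod_list)
  then have prod: "(\<Prod>k\<leftarrow>?ks. t - k) = (\<Prod>i\<in>UNIV. t - l i)" for t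
    by (simp add: prod_unfold_prod_mset image_mset.compositionality o_def)
  have det: "det (t *\<^sub>R mat 1 - shape_operator (x \<circ> \<phi>) (\<nu> p) u) = (\<Prod>i\<in>UNIV. t - l i)"
    if "(U, \<phi>) \<in> \<A>" "u \<in> U" "\<phi> u = p" for U \<phi> u t
    using chart_charpoly[OF that(1,2), of \<iota> q l] \<iota> q l that(3) by simp
  have "length ?ks = size (mset ?ks)" by (simp only: size_mset)
  then have "length ?ks = CARD('n)" by (simp del: size_mset)
  then show "sorted ?ks \<and> length ?ks = CARD('n) \<and>
    (\<forall>(U, \<phi>)\<in>\<A>. \<forall>u\<in>U. \<phi> u = p \<longrightarrow> (\<forall>t. det (t *\<^sub>R mat 1 - shape_operator (x \<circ> \<phi>) (\<nu> p) u) = (\<Prod>k\<leftarrow>?ks. t - k)))"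
    using det prod by auto
  fix ks assume ks: "sorted ks \<and> length ks = CARD('n) \<and>
    (\<forall>(U, \<phi>)\<in>\<A>. \<forall>u\<in>U. \<phi> u = p \<longrightarrow> (\<forall>t. det (t *\<^sub>R mat 1 - shape_operator (x \<circ> \<phi>) (\<nu> p) u) = (\<Prod>k\<leftarrow>ks. t - k)))"
  obtain U \<phi> u where c: "(U, \<phi>) \<in> \<A>" "u \<in> U" "\<phi> u = p" using chart_at[OF p] by blast
  show "ks = ?ks"
  proof (rule sorted_roots_unique)
    show "(\<Prod>k\<leftarrow>ks. t - k) = (\<Prod>k\<leftarrow>?ks. t - k)" for t
      using ks c det[OF c, of t] prod[of t] by fastforce
  qed (use ks in auto)
qed

text \<open>Bridge between the sorted list of the definitions and eigenvalues indexed by the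
  coordinate type. Of the order only what the estimates use is kept: an index \<open>i0\<close> of
  the smallest eigenvalue, and the second one as a lower bound for all others.\<close>

lemma curvature_frame:
  assumes p: "p \<in> topspace X" and \<iota>: "normal_frame (\<nu> p) \<iota>" and n: "CARD('n) \<ge> 2"
  obtains q l i0 where "\<And>i j. q i \<bullet> q j = (if i = j then 1 else 0 :: real)"
    and "\<And>v. II p (\<iota> v) = (\<Sum>i\<in>UNIV. l i * (q (i :: 'n) \<bullet> v)\<^sup>2)"
    and "mean_curvature \<A> x \<nu> p = sum l UNIV"
    and "l i0 = kappa \<A> x \<nu> 1 p" "\<And>i. i \<noteq> i0 \<Longrightarrow> kappa \<A> x \<nu> 2 p \<le> l i"
    and "kappa \<A> x \<nu> 1 p \<le> kappa \<A> x \<nu> 2 p"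
proof -
  obtain q l where q: "\<And>i j. q i \<bullet> q j = (if i = j then 1 else 0 :: real)"
    and l: "\<And>v. II p (\<iota> v) = (\<Sum>i\<in>UNIV. l i * (q (i :: 'n) \<bullet> v)\<^sup>2)"
    by (rule II_diagonalization[OF p \<iota>]) (rule that)
  define ks where "ks = sorted_list_of_multiset (image_mset l (mset_set UNIV))"
  have pc: "principal_curvatures \<A> x \<nu> p = ks"
    unfolding ks_def by (rule principal_curvatures_eq[OF p \<iota> q l])
  have m: "mset ks = image_mset l (mset_set UNIV)" and srt: "sorted ks" by (simp_all add: ks_def)
  have "length ks = CARD('n)" using arg_cong[OF m, of size] by simp
  then obtain k0 k1 ks' where ks: "ks = k0 # k1 # ks'"
    using n by (cases ks; cases "tl ks") auto
  have k: "kappa \<A> x \<nu> 1 p = k0" "kappa \<A> x \<nu> 2 p = k1" by (simp_all add: kappa_def pc ks)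
  have "k0 \<in># image_mset l (mset_set UNIV)" using m ks by (metis list.set_intros(1) set_mset_mset)
  then obtain i0 where i0: "l i0 = k0" by auto
  have "mset_set (UNIV :: 'n set) = add_mset i0 (mset_set (UNIV - {i0}))"
    by (metis finite_class.finite_UNIV iso_tuple_UNIV_I mset_set.remove)
  then have "image_mset l (mset_set (UNIV - {i0})) = mset (k1 # ks')"
    using m i0 by (simp add: ks)
  then have "l ` (UNIV - {i0}) = set (k1 # ks')"
    by (metis finite finite_set_mset_mset_set set_image_mset set_mset_mset)
  then have "k1 \<le> l i" if "i \<noteq> i0" for i
    using srt that unfolding ks by fastforce
  moreover have "mean_curvature \<A> x \<nu> p = sum l UNIV"
  proof -
    have "mean_curvature \<A> x \<nu> p = (\<Sum>i = 1..length ks. ks ! (i - 1))"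
      by (simp add: mean_curvature_def kappa_def pc \<open>length ks = CARD('n)\<close>)
    \<comment> \<open>The numbering of the principal curvatures starts at 1, list positions at
      0.\<close>
    also have "\<dots> = (\<Sum>i<length ks. ks ! i)"
      by (rule sum.reindex_bij_witness[of _ Suc "\<lambda>i. i - 1"]) auto
    also have "\<dots> = sum_list ks" by (simp add: sum_list_sum_nth atLeast0LessThan)
    also have "\<dots> = sum_mset (mset ks)" by (simp add: sum_mset_sum_list)
    also have "\<dots> = sum l UNIV" by (simp add: m sum_unfold_sum_mset)
    finally show ?thesis .
  qed
  moreover have "k0 \<le> k1" using srt ks by simp
  ultimately show ?thesis using that[OF q l] i0 k by metis
qed

lemma II_frame_scale:
  assumes "p \<in> topspace X" "e \<bullet> \<nu> p = 0"
  shows "II p (c *\<^sub>R e) = c\<^sup>2 * II p e"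
proof -
  obtain \<iota> where \<iota>: "normal_frame (\<nu> p) \<iota>" using normal_frame_exists norm_normal assms(1) by blast
  obtain v where v: "e = \<iota> v" using normal_frameD(6)[OF \<iota> assms(2)] by blast
  obtain q l where "\<And>i j. q i \<bullet> q j = (if i = j then 1 else 0 :: real)"
    and l: "\<And>v. II p (\<iota> v) = (\<Sum>i\<in>UNIV. l i * (q (i :: 'n) \<bullet> v)\<^sup>2)"
    by (rule II_diagonalization[OF assms(1) \<iota>]) (rule that)
  show ?thesis
    unfolding v linear_scale[OF normal_frameD(1)[OF \<iota>], symmetric]
    by (simp add: l power_mult_distrib sum_distrib_left mult_ac)
qed

section \<open>Extremal properties of the principal curvatures\<close>

lemma kappa1_le_II:
  assumes p: "p \<in> topspace X" and n: "CARD('n) \<ge> 2" and e: "e \<bullet> \<nu> p = 0"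
  shows "kappa \<A> x \<nu> 1 p * (e \<bullet> e) \<le> II p e"
proof -
  obtain \<iota> where \<iota>: "normal_frame (\<nu> p) \<iota>" using normal_frame_exists norm_normal p by blast
  obtain v where v: "e = \<iota> v" using normal_frameD(6)[OF \<iota> e] by blast
  obtain q l i0 where q: "\<And>i j. q i \<bullet> q j = (if i = j then 1 else 0 :: real)"
    and l: "\<And>v. II p (\<iota> v) = (\<Sum>i\<in>UNIV. l i * (q (i :: 'n) \<bullet> v)\<^sup>2)"
    and H: "mean_curvature \<A> x \<nu> p = sum l UNIV"
    and k: "l i0 = kappa \<A> x \<nu> 1 p" "\<And>i. i \<noteq> i0 \<Longrightarrow> kappa \<A> x \<nu> 2 p \<le> l i" "kappa \<A> x \<nu> 1 p \<le> kappa \<A> x \<nu> 2 p"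
    by (rule curvature_frame[OF p \<iota> n]) (rule that)
  have "kappa \<A> x \<nu> 1 p \<le> l i" for i using k by (cases "i = i0") force+
  then have "(\<Sum>i\<in>UNIV. kappa \<A> x \<nu> 1 p * (q i \<bullet> v)\<^sup>2) \<le> II p e"
    unfolding v l by (intro sum_mono mult_right_mono) auto
  moreover have "(\<Sum>i\<in>UNIV. (q i \<bullet> v)\<^sup>2) = e \<bullet> e"
    using orthonormal_basis_expansion(2)[OF q, of v v] by (simp add: v normal_frameD(5)[OF \<iota>] power2_eq_square)
  ultimately show ?thesis by (simp flip: sum_distrib_left)
qed

lemma kappa1_attained:
  assumes p: "p \<in> topspace X" and n: "CARD('n) \<ge> 2"
  obtains e where "norm e = 1" "e \<bullet> \<nu> p = 0" "II p e = kappa \<A> x \<nu> 1 p"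
proof -
  obtain \<iota> where \<iota>: "normal_frame (\<nu> p) \<iota>" using normal_frame_exists norm_normal p by blast
  obtain q l i0 where q: "\<And>i j. q i \<bullet> q j = (if i = j then 1 else 0 :: real)"
    and l: "\<And>v. II p (\<iota> v) = (\<Sum>i\<in>UNIV. l i * (q (i :: 'n) \<bullet> v)\<^sup>2)"
    and H: "mean_curvature \<A> x \<nu> p = sum l UNIV"
    and k: "l i0 = kappa \<A> x \<nu> 1 p" "\<And>i. i \<noteq> i0 \<Longrightarrow> kappa \<A> x \<nu> 2 p \<le> l i" "kappa \<A> x \<nu> 1 p \<le> kappa \<A> x \<nu> 2 p"
    by (rule curvature_frame[OF p \<iota> n]) (rule that)
  have "II p (\<iota> (q i0)) = (\<Sum>i\<in>UNIV. if i = i0 then l i0 else 0)"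
    unfolding l by (rule sum.cong) (auto simp: q)
  then have "II p (\<iota> (q i0)) = kappa \<A> x \<nu> 1 p" using k by simp
  moreover have "norm (\<iota> (q i0)) = 1" using q[of i0 i0] by (simp add: normal_frameD(2)[OF \<iota>] norm_eq_1)
  ultimately show ?thesis using that normal_frameD(3)[OF \<iota>] by blast
qed

text \<open>Ky Fan's inequality for two vectors. The weight \<open>a i\<close> is the squared length
  of the projection of \<open>q i\<close> to the plane of \<open>e\<close> and \<open>e'\<close>.
  The weights add up to 2 and the one at \<open>i0\<close> is at most 1, so replacing every other
  eigenvalue by \<open>k2\<close> and moving the weight at \<open>i0\<close> up to 1 only lowers the
  sum.\<close>

lemma kappa12_le_II:
  assumes p: "p \<in> topspace X" and n: "CARD('n) \<ge> 2"
    and e: "e \<bullet> \<nu> p = 0" "e' \<bullet> \<nu> p = 0" "norm e = 1" "norm e' = 1" "e \<bullet> e' = 0"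
  shows "kappa \<A> x \<nu> 1 p + kappa \<A> x \<nu> 2 p \<le> II p e + II p e'"
proof -
  obtain \<iota> where \<iota>: "normal_frame (\<nu> p) \<iota>" using normal_frame_exists norm_normal p by blast
  obtain v where v: "e = \<iota> v" using normal_frameD(6)[OF \<iota> e(1)] by blast
  obtain w where w: "e' = \<iota> w" using normal_frameD(6)[OF \<iota> e(2)] by blast
  obtain q l i0 where q: "\<And>i j. q i \<bullet> q j = (if i = j then 1 else 0 :: real)"
    and l: "\<And>v. II p (\<iota> v) = (\<Sum>i\<in>UNIV. l i * (q (i :: 'n) \<bullet> v)\<^sup>2)"
    and H: "mean_curvature \<A> x \<nu> p = sum l UNIV"
    and k: "l i0 = kappa \<A> x \<nu> 1 p" "\<And>i. i \<noteq> i0 \<Longrightarrow> kappa \<A> x \<nu> 2 p \<le> l i" "kappa \<A> x \<nu> 1 p \<le> kappa \<A> x \<nu> 2 p"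
    by (rule curvature_frame[OF p \<iota> n]) (rule that)
  define k1 k2 where "k1 = kappa \<A> x \<nu> 1 p" and "k2 = kappa \<A> x \<nu> 2 p"
  have vw: "v \<bullet> v = 1" "w \<bullet> w = 1" "v \<bullet> w = 0"
    using e unfolding v w norm_eq_1 normal_frameD(5)[OF \<iota>] by auto
  define a where "a i = (q i \<bullet> v)\<^sup>2 + (q i \<bullet> w)\<^sup>2" for i
  have a: "sum a UNIV = 2"
    using orthonormal_basis_expansion(2)[OF q, of v v] orthonormal_basis_expansion(2)[OF q, of w w] vw
    by (simp add: a_def sum.distrib power2_eq_square)
  have a1: "a i0 \<le> 1"
  proof -
    \<comment> \<open>\<open>y\<close> is the projection of \<open>q i0\<close> to the plane of
      \<open>v\<close> and \<open>w\<close>, and projections do not increase length.\<close>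
    define y where "y = (q i0 \<bullet> v) *\<^sub>R v + (q i0 \<bullet> w) *\<^sub>R w"
    have "q i0 \<bullet> y = a i0" "y \<bullet> y = a i0"
      using vw by (simp_all add: y_def a_def inner_add_left inner_add_right power2_eq_square inner_commute)
    moreover have "(q i0 \<bullet> y)\<^sup>2 \<le> (q i0 \<bullet> q i0) * (y \<bullet> y)" by (rule Cauchy_Schwarz_ineq)
    ultimately have "a i0 * a i0 \<le> a i0" using q[of i0 i0] by (simp add: power2_eq_square)
    moreover have "a i0 \<ge> 0" by (simp add: a_def)
    ultimately show ?thesis by (cases "a i0 = 0") auto
  qed
  have "II p e + II p e' = (\<Sum>i\<in>UNIV. l i * a i)"
    unfolding v w l a_def by (simp add: sum.distrib distrib_left)
  moreover have "(\<Sum>i\<in>UNIV. (if i = i0 then (k1 - k2) * a i else 0) + k2 * a i) \<le> (\<Sum>i\<in>UNIV. l i * a i)"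
  proof (rule sum_mono)
    fix i :: 'n
    have "a i \<ge> 0" by (simp add: a_def)
    then show "(if i = i0 then (k1 - k2) * a i else 0) + k2 * a i \<le> l i * a i"
      using k(1) k(2)[of i] mult_right_mono[of k2 "l i" "a i"] by (auto simp: k1_def k2_def algebra_simps)
  qed
  moreover have "(\<Sum>i\<in>UNIV. (if i = i0 then (k1 - k2) * a i else 0) + k2 * a i) = (k1 - k2) * a i0 + k2 * 2"
    by (simp add: sum.distrib a flip: sum_distrib_left)
  moreover have "(k1 - k2) * 1 \<le> (k1 - k2) * a i0"
    using a1 k(3) by (intro mult_left_mono_neg) (auto simp: k1_def k2_def)
  ultimately show ?thesis by (simp add: k1_def k2_def)
qed

lemma mean_curvature_trace:
  assumes p: "p \<in> topspace X" and n: "CARD('n) \<ge> 2" and \<iota>: "normal_frame (\<nu> p) \<iota>"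
  shows "mean_curvature \<A> x \<nu> p = (\<Sum>k\<in>UNIV. II p (\<iota> (axis k 1)))"
proof -
  obtain q l i0 where q: "\<And>i j. q i \<bullet> q j = (if i = j then 1 else 0 :: real)"
    and l: "\<And>v. II p (\<iota> v) = (\<Sum>i\<in>UNIV. l i * (q (i :: 'n) \<bullet> v)\<^sup>2)"
    and H: "mean_curvature \<A> x \<nu> p = sum l UNIV"
    and k: "l i0 = kappa \<A> x \<nu> 1 p" "\<And>i. i \<noteq> i0 \<Longrightarrow> kappa \<A> x \<nu> 2 p \<le> l i" "kappa \<A> x \<nu> 1 p \<le> kappa \<A> x \<nu> 2 p"
    by (rule curvature_frame[OF p \<iota> n]) (rule that)
  have "(\<Sum>k\<in>UNIV. II p (\<iota> (axis k 1))) = (\<Sum>i\<in>UNIV. \<Sum>k\<in>UNIV. l i * (q i \<bullet> axis k 1)\<^sup>2)"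
    unfolding l by (rule sum.swap)
  also have "\<dots> = sum l UNIV" by (simp add: sum_axis_inner q flip: sum_distrib_left)
  finally show ?thesis using H by simp
qed

lemma two_convex_II_bound:
  assumes p: "p \<in> topspace X" and n: "CARD('n) \<ge> 3" and kk: "kappa \<A> x \<nu> 1 p + kappa \<A> x \<nu> 2 p > 0"
  shows "0 < mean_curvature \<A> x \<nu> p"
    and "e \<bullet> \<nu> p = 0 \<Longrightarrow> \<bar>II p e\<bar> \<le> mean_curvature \<A> x \<nu> p * (e \<bullet> e)"
proof -
  have n2: "CARD('n) \<ge> 2" using n by simp
  obtain \<iota> where \<iota>: "normal_frame (\<nu> p) \<iota>" using normal_frame_exists norm_normal p by blast
  obtain q l i0 where q: "\<And>i j. q i \<bullet> q j = (if i = j then 1 else 0 :: real)"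
    and l: "\<And>v. II p (\<iota> v) = (\<Sum>i\<in>UNIV. l i * (q (i :: 'n) \<bullet> v)\<^sup>2)"
    and H: "mean_curvature \<A> x \<nu> p = sum l UNIV"
    and k: "l i0 = kappa \<A> x \<nu> 1 p" "\<And>i. i \<noteq> i0 \<Longrightarrow> kappa \<A> x \<nu> 2 p \<le> l i" "kappa \<A> x \<nu> 1 p \<le> kappa \<A> x \<nu> 2 p"
    by (rule curvature_frame[OF p \<iota> n2]) (rule that)
  note b = two_convex_eigenvalue_bound[where l=l and ?i0.0=i0, OF n k kk]
  show "0 < mean_curvature \<A> x \<nu> p" using b(2) H by simp
  assume "e \<bullet> \<nu> p = 0"
  then obtain v where v: "e = \<iota> v" using normal_frameD(6)[OF \<iota>] by blast
  have "\<bar>II p e\<bar> \<le> (\<Sum>i\<in>UNIV. \<bar>l i * (q i \<bullet> v)\<^sup>2\<bar>)" unfolding v l by (rule sum_abs)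
  also have "\<dots> \<le> (\<Sum>i\<in>UNIV. sum l UNIV * (q i \<bullet> v)\<^sup>2)"
    by (intro sum_mono) (simp add: abs_mult mult_right_mono b(1))
  also have "\<dots> = sum l UNIV * (\<Sum>i\<in>UNIV. (q i \<bullet> v)\<^sup>2)" by (simp add: sum_distrib_left)
  also have "(\<Sum>i\<in>UNIV. (q i \<bullet> v)\<^sup>2) = e \<bullet> e"
    using orthonormal_basis_expansion(2)[OF q, of v v] by (simp add: v normal_frameD(5)[OF \<iota>] power2_eq_square)
  finally show "\<bar>II p e\<bar> \<le> mean_curvature \<A> x \<nu> p * (e \<bullet> e)" by (simp add: H)
qed

end

section \<open>Local graphs\<close>

text \<open>\<open>adjoint \<iota>\<close> is the orthogonal projection onto the hyperplane of
  \<open>N\<close>, written in frame coordinates. It serves as the chart in which a hypersurface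
  becomes a graph.\<close>

lemma normal_frame_adjoint:
  assumes \<iota>: "normal_frame N \<iota>" and N: "norm N = 1"
  shows "linear (adjoint \<iota>)" "adjoint \<iota> (\<iota> v) = v" "adjoint \<iota> N = 0"
    "y = \<iota> (adjoint \<iota> y) + (y \<bullet> N) *\<^sub>R N" "adjoint \<iota> y \<bullet> w = y \<bullet> \<iota> w"
    "norm (adjoint \<iota> y) \<le> norm y"
proof -
  have lin: "linear \<iota>" by (rule normal_frameD(1)[OF \<iota>])
  show linP: "linear (adjoint \<iota>)" by (rule adjoint_linear[OF lin])
  have adj: "adjoint \<iota> y \<bullet> w = y \<bullet> \<iota> w" for y w
    using adjoint_works[OF lin, of w y] by (simp add: inner_commute)
  then show "adjoint \<iota> y \<bullet> w = y \<bullet> \<iota> w" .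
  have P: "adjoint \<iota> (\<iota> v) = v" for v
    by (rule vector_eq_rdot[THEN iffD1]) (simp add: adj normal_frameD(5)[OF \<iota>])
  then show "adjoint \<iota> (\<iota> v) = v" .
  have PN: "adjoint \<iota> N = 0"
    by (rule vector_eq_rdot[THEN iffD1]) (simp add: adj normal_frameD(4)[OF \<iota>])
  then show "adjoint \<iota> N = 0" .
  have eq: "y = \<iota> (adjoint \<iota> y) + (y \<bullet> N) *\<^sub>R N" for y
  proof -
    have "(y - (y \<bullet> N) *\<^sub>R N) \<bullet> N = 0" using N by (simp add: inner_diff_left norm_eq_1)
    then obtain v where "y - (y \<bullet> N) *\<^sub>R N = \<iota> v" using normal_frameD(6)[OF \<iota>] by blast
    then have y: "y = \<iota> v + (y \<bullet> N) *\<^sub>R N" by (simp add: algebra_simps)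
    then have "adjoint \<iota> y = adjoint \<iota> (\<iota> v + (y \<bullet> N) *\<^sub>R N)" by simp
    then have "adjoint \<iota> y = v" by (simp add: linear_add[OF linP] linear_scale[OF linP] P PN)
    then show ?thesis using y by simp
  qed
  then show "y = \<iota> (adjoint \<iota> y) + (y \<bullet> N) *\<^sub>R N" .
  have "(norm (adjoint \<iota> y))\<^sup>2 = y \<bullet> \<iota> (adjoint \<iota> y)" by (simp add: power2_norm_eq_inner adj)
  also have "\<dots> \<le> norm y * norm (adjoint \<iota> y)"
    using norm_cauchy_schwarz[of y "\<iota> (adjoint \<iota> y)"] by (simp add: normal_frameD(2)[OF \<iota>])
  finally show "norm (adjoint \<iota> y) \<le> norm y"
    by (cases "adjoint \<iota> y = 0") (simp_all add: power2_eq_square)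
qed

text \<open>Cramer's rule writes each component as a quotient of determinants, whose smoothness is
  already available.\<close>

lemma smooth_on_solve_linear:
  fixes A :: "real ^ 'n::finite \<Rightarrow> real ^ 'n ^ 'n"
  assumes U: "open U" and A: "\<And>i j. smooth_on U (\<lambda>u. A u $ i $ j)"
    and det: "\<And>u. u \<in> U \<Longrightarrow> det (A u) \<noteq> 0" and Z: "\<And>u. u \<in> U \<Longrightarrow> A u *v Z u = w"
  shows "smooth_on U (\<lambda>u. Z u $ k)"
proof (rule smooth_on_cong)
  show "smooth_on U (\<lambda>u. det (\<chi> i j. if j = k then w $ i else A u $ i $ j) * inverse (det (A u)))"
  proof (intro smooth_on_mult smooth_on_inverse smooth_on_det U A det)
    show "smooth_on U (\<lambda>u. (\<chi> i j. if j = k then w $ i else A u $ i $ j) $ i $ j)" for i j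
      by (cases "j = k") (simp_all add: smooth_on_const U A)
  qed
  show "det (\<chi> i j. if j = k then w $ i else A u $ i $ j) * inverse (det (A u)) = Z u $ k"
    if "u \<in> U" for u
    using cramer[OF det[OF that], of "Z u" w] Z[OF that] by (simp add: divide_inverse)
qed

text \<open>Postcomposition with the local inverse \<open>g\<close> preserves smoothness, since \<open>D\<^bsub>w\<^esub> (h \<circ> g)\<close> is again of the form \<open>h' \<circ> g\<close>.\<close>

lemma smooth_inverse_function:
  fixes M :: "real ^ 'n::finite \<Rightarrow> real ^ 'n"
  assumes M: "smooth_on U M" and u0: "u0 \<in> U" and inj: "inj (\<lambda>v. dderivs [v] M u0)"
  obtains U' V g where "open U'" "U' \<subseteq> U" "u0 \<in> U'" "open V" "M u0 \<in> V" "homeomorphism U' V M g"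
    "\<And>h. smooth_on U' h \<Longrightarrow> smooth_on V (\<lambda>y. h (g y) :: real)"
proof -
  have linM: "linear (\<lambda>v. dderivs [v] M u)" if "u \<in> U" for u by (rule linear_dderivs1[OF M that])
  define M' where "M' u = Blinfun (\<lambda>v. dderivs [v] M u)" for u
  have M': "blinfun_apply (M' u) = (\<lambda>v. dderivs [v] M u)" if "u \<in> U" for u
    unfolding M'_def by (rule bounded_linear_Blinfun_apply) (simp add: linM[OF that] flip: linear_conv_bounded_linear)
  obtain K where K: "linear K" "K \<circ> (\<lambda>v. dderivs [v] M u0) = id"
    using linear_injective_left_inverse[OF linM[OF u0] inj] by blast
  have Kb: "blinfun_apply (Blinfun K) = K"
    by (rule bounded_linear_Blinfun_apply) (simp add: K(1) flip: linear_conv_bounded_linear)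
  have inv: "Blinfun K o\<^sub>L M' u0 = id_blinfun"
    by (rule blinfun_eqI) (use K(2) in \<open>simp add: Kb M'[OF u0] fun_eq_iff\<close>)
  have contM: "continuous_on U M'"
  proof (rule continuous_on_blinfun_componentwise)
    fix i :: "real^'n" assume "i \<in> Basis"
    show "continuous_on U (\<lambda>u. blinfun_apply (M' u) i)"
      using continuous_on_dderivs[OF M, of "[i]"] by (rule continuous_on_eq) (simp add: M')
  qed
  have derM: "(M has_derivative blinfun_apply (M' u)) (at u)" if "u \<in> U" for u
    using smooth_on_has_derivative[OF M that] by (simp add: M'[OF that])
  obtain U' V g g' where g: "open U'" "U' \<subseteq> U" "u0 \<in> U'" "open V" "M u0 \<in> V" "homeomorphism U' V M g"
    "\<And>y. y \<in> V \<Longrightarrow> (g has_derivative (g' y)) (at y)"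
    "\<And>y. y \<in> V \<Longrightarrow> g' y = inv (blinfun_apply (M' (g y)))"
    "\<And>y. y \<in> V \<Longrightarrow> bij (blinfun_apply (M' (g y)))"
    using inverse_function_theorem[OF smooth_on_open[OF M] derM contM u0 inv] by blast
  have gU: "g y \<in> U'" if "y \<in> V" for y using g(6) that by (auto simp: homeomorphism_def)
  have Mu: "M u \<in> V" "g (M u) = u" if "u \<in> U'" for u using g(6) that by (auto simp: homeomorphism_def)
  define A where "A u = (\<chi> i j. dderivs [axis j 1] M u $ i)" for u
  have A: "A u *v z = dderivs [z] M u" if "u \<in> U" for u z
  proof -
    have "dderivs [z] M u = (\<Sum>j\<in>UNIV. z $ j *\<^sub>R dderivs [axis j 1] M u)"
      using linear_sum[OF linM[OF that], of "\<lambda>j. z $ j *\<^sub>R axis j 1" UNIV]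
      by (simp add: linear_scale[OF linM[OF that]] basis_expansion[of z, unfolded scalar_mult_eq_scaleR])
    then show ?thesis by (simp add: A_def matrix_vector_mult_def vec_eq_iff mult.commute)
  qed
  have bij: "bij (\<lambda>z. dderivs [z] M u)" if "u \<in> U'" for u
  proof -
    have "u \<in> U" using g(2) that by blast
    then show ?thesis using g(9)[OF Mu(1)[OF that]] by (simp add: Mu(2)[OF that] M')
  qed
  have det: "det (A u) \<noteq> 0" if "u \<in> U'" for u
  proof -
    have "u \<in> U" using g(2) that by blast
    then have "(*v) (A u) = (\<lambda>z. dderivs [z] M u)" by (intro ext A)
    then have "inj ((*v) (A u))" using bij_is_inj[OF bij[OF that]] by simp
    then have "invertible (A u)" using invertible_left_inverse matrix_left_invertible_injective by blast
    then show ?thesis by (rule invertible_det_nz[THEN iffD1])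
  qed
  have smA: "smooth_on U' (\<lambda>u. A u $ i $ j)" for i j
  proof -
    have "smooth_on U' (\<lambda>u. dderivs [axis j 1] M u \<bullet> axis i 1)"
      by (intro smooth_on_inner_left smooth_on_subset[OF smooth_on_dderivs[OF M]] g(1,2))
    then show ?thesis by (simp add: A_def inner_axis)
  qed
  have smooth: "smooth_on V (\<lambda>y. h (g y))" if h: "smooth_on U' h" for h :: "real^'n \<Rightarrow> real"
  proof (rule smooth_on_coinduct[of _ _ "(\<lambda>h y. h (g y)) ` {h. smooth_on U' h}"])
    show "open V" by fact
    show "(\<lambda>y. h (g y)) \<in> (\<lambda>h y. h (g y)) ` {h. smooth_on U' h}" using h by blast
    fix k :: "real^'n \<Rightarrow> real" and w assume "k \<in> (\<lambda>h y. h (g y)) ` {h. smooth_on U' h}"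
    then obtain h where h: "smooth_on U' h" and k: "k = (\<lambda>y. h (g y))" by blast
    \<comment> \<open>Differentiating the composition of \<open>h\<close> with \<open>g\<close> in
      the direction \<open>w\<close> differentiates \<open>h\<close> in the direction that the
      differential of \<open>M\<close> maps to \<open>w\<close>. This direction solves the linear
      system with matrix \<open>A u\<close>, hence depends smoothly on \<open>u\<close>.\<close>
    define Z where "Z u = inv (\<lambda>z. dderivs [z] M u) w" for u
    have AZ: "A u *v Z u = w" if "u \<in> U'" for u
    proof -
      have "A u *v Z u = dderivs [Z u] M u" using A g(2) that by blast
      also have "\<dots> = w" unfolding Z_def by (rule surj_f_inv_f[OF bij_is_surj[OF bij[OF that]]])
      finally show ?thesis .
    qed
    define h' where "h' u = (\<Sum>i\<in>UNIV. Z u $ i * dderivs [axis i 1] h u)" for u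
    have smh': "smooth_on U' h'"
      unfolding h'_def
      by (intro smooth_on_sum smooth_on_mult smooth_on_dderivs h g(1)
          smooth_on_solve_linear[OF g(1) smA det AZ])
    have hd: "(k has_derivative (\<lambda>w. dderivs [g' y w] h (g y))) (at y)" if "y \<in> V" for y
      unfolding k
      using has_derivative_compose[OF g(7)[OF that] smooth_on_has_derivative[OF h gU[OF that]]] .
    have he: "dderivs [g' y w] h (g y) = h' (g y)" if "y \<in> V" for y
    proof -
      have gy: "g y \<in> U'" by (rule gU[OF that])
      note lin = linear_dderivs1[OF h gy, of "[]"]
      have "g y \<in> U" using gy g(2) by blast
      then have "g' y w = Z (g y)" using g(8)[OF that] M' by (simp add: Z_def)
      then have "dderivs [g' y w] h (g y) = (\<Sum>i\<in>UNIV. dderivs [Z (g y) $ i *\<^sub>R axis i 1] h (g y))"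
        using linear_sum[OF lin, of "\<lambda>j. Z (g y) $ j *\<^sub>R axis j 1" UNIV]
        by (simp add: basis_expansion[of "Z (g y)", unfolded scalar_mult_eq_scaleR])
      then show ?thesis using linear_scale[OF lin] by (simp add: h'_def)
    qed
    have "\<forall>y\<in>V. k differentiable at y \<and> frechet_derivative k (at y) w = h' (g y)"
      by (intro ballI frechet_derivative_eqI[OF hd he])
    then show "\<exists>l\<in>(\<lambda>h y. h (g y)) ` {h. smooth_on U' h}.
        \<forall>y\<in>V. k differentiable at y \<and> frechet_derivative k (at y) w = l y"
      using smh' by (intro bexI[of _ "\<lambda>y. h' (g y)"]) auto
  qed
  show ?thesis by (rule that[OF g(1-6) smooth])
qed

definition gradient :: "(real ^ 'n::finite \<Rightarrow> real) \<Rightarrow> real ^ 'n \<Rightarrow> real ^ 'n" where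
  "gradient f v = (\<chi> i. dderivs [axis i 1] f v)"

lemma gradient_inner:
  assumes "smooth_on D f" "v \<in> D"
  shows "gradient f v \<bullet> z = dderivs [z] f v"
proof -
  note lin = linear_dderivs1[OF assms, of "[]"]
  have "dderivs [z] f v = (\<Sum>i\<in>UNIV. dderivs [z $ i *\<^sub>R axis i 1] f v)"
    using linear_sum[OF lin, of "\<lambda>j. z $ j *\<^sub>R axis j 1" UNIV]
    by (simp add: basis_expansion[of z, unfolded scalar_mult_eq_scaleR])
  then show ?thesis using linear_scale[OF lin] by (simp add: gradient_def inner_vec_def mult.commute)
qed

lemma bilinear_hessian:
  assumes "smooth_on D f" "v \<in> D"
  shows "bilinear (\<lambda>z w. dderivs [z, w] f v :: real)"
  using linear_dderivs1[OF assms] linear_dderivs2[OF assms] by (simp add: bilinear_def)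

section \<open>Graph patches and their curvature\<close>

context hypersurface
begin

lemma velocity_tangent:
  assumes "p \<in> topspace X" "velocity q p e"
  shows "e \<bullet> \<nu> p = 0"
proof -
  obtain U \<phi> u where c: "(U, \<phi>) \<in> \<A>" "u \<in> U" "\<phi> u = p" using chart_at[OF assms(1)] by blast
  have "velocity q (\<phi> u) e" using assms(2) c(3) by simp
  then obtain \<eta> where "dderivs [\<eta>] (x \<circ> \<phi>) u = e" using curve_second_order[OF c(1,2)] by blast
  then show ?thesis using chart_normal[OF c(1,2), of \<eta>] c(3) by simp
qed

lemma chart_image_openin:
  assumes c: "(U, \<phi>) \<in> \<A>" and "open T" "T \<subseteq> U"
  shows "openin X (\<phi> ` T)"
proof -
  have "openin (top_of_set U) T" using assms by (simp add: open_subset)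
  then have "openin (subtopology X (\<phi> ` U)) (\<phi> ` T)"
    using homeomorphic_imp_open_map[OF chart_homeo[OF c]] by (auto simp: open_map_def)
  then show ?thesis using chart_image_open[OF c] openin_trans_full by blast
qed

text \<open>Here \<open>s\<close> is a local section of the projection along \<open>N\<close>.
  Openness of \<open>s\<close> lets statements on the parameter domain be read as statements on a
  neighbourhood in \<open>X\<close>, and the sign of \<open>\<nu> (s v) \<bullet> N\<close> selects
  the upward normal of the graph.\<close>

definition graph_patch ::
  "'n ambient \<Rightarrow> (real ^ 'n \<Rightarrow> 'n ambient) \<Rightarrow> (real ^ 'n) set \<Rightarrow> (real ^ 'n \<Rightarrow> 'a) \<Rightarrow> (real ^ 'n \<Rightarrow> real) \<Rightarrow> bool"
where
  "graph_patch N \<iota> D s f \<longleftrightarrow> norm N = 1 \<and> normal_frame N \<iota> \<and> open D \<and>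
     continuous_map (top_of_set D) X s \<and> (\<forall>T\<subseteq>D. open T \<longrightarrow> openin X (s ` T)) \<and>
     (\<forall>v\<in>D. x (s v) = \<iota> v + f v *\<^sub>R N) \<and> smooth_on D f \<and> (\<forall>v\<in>D. \<nu> (s v) \<bullet> N > 0)"

text \<open>A tangent vector annihilated by the projection is a multiple of \<open>N\<close>, and
  \<open>N\<close> is not tangent because \<open>\<nu> q \<bullet> N > 0\<close>. The inverse
  function theorem therefore applies to the projection; the ball is shrunk until the sign persists
  on it.\<close>

lemma local_graph:
  assumes q: "q \<in> topspace X" and N: "norm N = 1" and \<iota>: "normal_frame N \<iota>" and pos: "\<nu> q \<bullet> N > 0"
  obtains r s f where "r > 0" "graph_patch N \<iota> (ball (adjoint \<iota> (x q)) r) s f" "s (adjoint \<iota> (x q)) = q"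
proof -
  obtain U \<phi> u0 where c: "(U, \<phi>) \<in> \<A>" "u0 \<in> U" and qu: "\<phi> u0 = q" using chart_at[OF q] by blast
  note sm = chart_smooth[OF c(1)]
  note P = normal_frame_adjoint[OF \<iota> N]
  define M where "M u = adjoint \<iota> ((x \<circ> \<phi>) u)" for u
  have M: "smooth_on U M" unfolding M_def by (rule smooth_on_linear_comp[OF sm P(1)])
  have DM: "dderivs vs M u = adjoint \<iota> (dderivs vs (x \<circ> \<phi>) u)" if "u \<in> U" for u vs
    unfolding M_def by (rule dderivs_linear_comp[OF sm P(1) that])
  have "inj (\<lambda>v. dderivs [v] M u0)"
  proof (subst linear_inj_iff_eq_0[OF linear_dderivs1[OF M c(2)]], intro allI impI)
    fix v assume "dderivs [v] M u0 = 0"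
    then have "adjoint \<iota> (dderivs [v] (x \<circ> \<phi>) u0) = 0" by (simp add: DM c(2))
    then have e: "dderivs [v] (x \<circ> \<phi>) u0 = (dderivs [v] (x \<circ> \<phi>) u0 \<bullet> N) *\<^sub>R N"
      using P(4)[of "dderivs [v] (x \<circ> \<phi>) u0"] linear_0[OF normal_frameD(1)[OF \<iota>]] by simp
    have "dderivs [v] (x \<circ> \<phi>) u0 \<bullet> \<nu> q = (dderivs [v] (x \<circ> \<phi>) u0 \<bullet> N) * (N \<bullet> \<nu> q)"
      by (subst e) simp
    then have "dderivs [v] (x \<circ> \<phi>) u0 \<bullet> N = 0"
      using chart_normal[OF c, of v] pos by (simp add: qu inner_commute)
    then have "dderivs [v] (x \<circ> \<phi>) u0 = 0" using e by simp
    then show "v = 0"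
      using chart_inj[OF c] linear_inj_iff_eq_0[OF linear_dderivs1[OF sm c(2), of "[]"]] by blast
  qed
  from smooth_inverse_function[OF M c(2) this]
  obtain U' V g where g: "open U'" "U' \<subseteq> U" "u0 \<in> U'" "open V" "M u0 \<in> V" "homeomorphism U' V M g"
    and smg: "\<And>h. smooth_on U' h \<Longrightarrow> smooth_on V (\<lambda>y. h (g y) :: real)" by metis
  define v0 where "v0 = adjoint \<iota> (x q)"
  have v0: "M u0 = v0" by (simp add: M_def v0_def qu)
  define s where "s = \<phi> \<circ> g"
  have gV: "g v \<in> U'" "M (g v) = v" if "v \<in> V" for v using g(6) that by (auto simp: homeomorphism_def)
  have cont\<phi>: "continuous_map (top_of_set U) X \<phi>" using chart_inverse[OF c(1)] by metis
  have contg: "continuous_map (top_of_set V) (top_of_set U) g"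
    using g(2,6) by (auto simp: homeomorphism_def)
  have conts: "continuous_map (top_of_set V) X s"
    unfolding s_def by (rule continuous_map_compose[OF contg cont\<phi>])
  have opens: "openin X (s ` T)" if "T \<subseteq> V" "open T" for T
  proof -
    have "g ` T = U' \<inter> M -` T" using g(6) that(1) by (force simp: homeomorphism_def)
    moreover have "open (U' \<inter> M -` T)"
      using g(6) that(2) by (intro continuous_open_preimage g(1)) (auto simp: homeomorphism_def)
    ultimately have "openin X (\<phi> ` (g ` T))"
      using chart_image_openin[OF c(1), of "g ` T"] g(2) by auto
    moreover have "s ` T = \<phi> ` (g ` T)" by (auto simp: s_def)
    ultimately show ?thesis by simp
  qed
  define f where "f v = x (s v) \<bullet> N" for v
  have smf: "smooth_on V f"
  proof -
    have "smooth_on U' (\<lambda>u. (x \<circ> \<phi>) u \<bullet> N)" by (intro smooth_on_inner_left smooth_on_subset[OF sm] g(1,2))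
    from smg[OF this] show ?thesis by (simp add: f_def[abs_def] s_def)
  qed
  have xs: "x (s v) = \<iota> v + f v *\<^sub>R N" if "v \<in> V" for v
    using P(4)[of "x (s v)"] gV(2)[OF that] by (simp add: f_def s_def M_def)
  have "continuous_map (top_of_set V) euclidean (\<nu> \<circ> s)"
    by (rule continuous_map_compose[OF conts normal_continuous])
  then have contn: "continuous_on V (\<lambda>v. \<nu> (s v) \<bullet> N)"
    by (intro continuous_intros) (simp add: o_def)
  have sv0: "s v0 = q"
    using g(3,6) v0 qu by (auto simp: s_def homeomorphism_def)
  have "open (V \<inter> (\<lambda>v. \<nu> (s v) \<bullet> N) -` {0<..})"
    by (rule continuous_open_preimage[OF contn g(4)]) simp
  moreover have "v0 \<in> V \<inter> (\<lambda>v. \<nu> (s v) \<bullet> N) -` {0<..}"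
    using g(5) v0 pos sv0 by simp
  ultimately obtain r where r: "r > 0" "ball v0 r \<subseteq> V \<inter> (\<lambda>v. \<nu> (s v) \<bullet> N) -` {0<..}"
    using open_contains_ball by metis
  have "graph_patch N \<iota> (ball v0 r) s f"
    unfolding graph_patch_def
  proof (intro conjI ballI allI impI N \<iota> open_ball)
    show "continuous_map (top_of_set (ball v0 r)) X s"
      using continuous_map_from_subtopology_mono[OF conts] r(2) by auto
    show "openin X (s ` T)" if "T \<subseteq> ball v0 r" "open T" for T using opens that r(2) by blast
    show "x (s v) = \<iota> v + f v *\<^sub>R N" if "v \<in> ball v0 r" for v using xs that r(2) by blast
    show "smooth_on (ball v0 r) f" using smooth_on_subset[OF smf] r(2) by auto
    show "\<nu> (s v) \<bullet> N > 0" if "v \<in> ball v0 r" for v using that r(2) by auto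
  qed
  with r(1) sv0 that show ?thesis unfolding v0_def by blast
qed

lemma graph_patchD:
  assumes "graph_patch N \<iota> D s f"
  shows "norm N = 1" "normal_frame N \<iota>" "open D" "continuous_map (top_of_set D) X s"
    "T \<subseteq> D \<Longrightarrow> open T \<Longrightarrow> openin X (s ` T)" "v \<in> D \<Longrightarrow> x (s v) = \<iota> v + f v *\<^sub>R N"
    "smooth_on D f" "v \<in> D \<Longrightarrow> \<nu> (s v) \<bullet> N > 0" "v \<in> D \<Longrightarrow> s v \<in> topspace X"
proof -
  show "norm N = 1" "normal_frame N \<iota>" "open D" and c: "continuous_map (top_of_set D) X s" and
    "T \<subseteq> D \<Longrightarrow> open T \<Longrightarrow> openin X (s ` T)" "v \<in> D \<Longrightarrow> x (s v) = \<iota> v + f v *\<^sub>R N"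
    "smooth_on D f" "v \<in> D \<Longrightarrow> \<nu> (s v) \<bullet> N > 0"
    using assms unfolding graph_patch_def by blast+
  show "v \<in> D \<Longrightarrow> s v \<in> topspace X" using continuous_map_image_subset_topspace[OF c] by auto
qed

lemma graph_velocity:
  assumes G: "graph_patch N \<iota> D s f" and v: "v \<in> D"
  shows "velocity (\<lambda>t. s (v + t *\<^sub>R z)) (s v) (\<iota> z + dderivs [z] f v *\<^sub>R N)"
    and "((\<lambda>t. ((x (s (v + t *\<^sub>R z)) - x (s v)) \<bullet> \<nu> (s v)) / t\<^sup>2) \<longlongrightarrow>
       (dderivs [z, z] f v * (N \<bullet> \<nu> (s v))) / 2) (at 0)"
proof -
  note g = graph_patchD[OF G]
  have lim: "((\<lambda>t. v + t *\<^sub>R z) \<longlongrightarrow> v) (at 0)" by (auto intro!: tendsto_eq_intros)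
  have ev: "\<forall>\<^sub>F t in at 0. v + t *\<^sub>R z \<in> D"
    using topological_tendstoD[OF lim g(3) v] .
  then have "limitin (top_of_set D) (\<lambda>t. v + t *\<^sub>R z) v (at 0)"
    using lim v by (simp add: limitin_subtopology)
  from continuous_map_limit[OF g(4) this]
  have l: "limitin X (\<lambda>t. s (v + t *\<^sub>R z)) (s v) (at 0)" by (simp add: o_def)
  have z: "((\<lambda>t. (t *\<^sub>R z) /\<^sub>R t) \<longlongrightarrow> z) (at (0::real))"
    by (rule Lim_transform_eventually[OF tendsto_const]) (auto simp: eventually_at_filter)
  note jf = smooth_jet2[OF g(7) v]
  have lin: "linear \<iota>" by (rule normal_frameD(1)[OF g(2)])
  have diff: "x (s (v + t *\<^sub>R z)) - x (s v) = t *\<^sub>R \<iota> z + (f (v + t *\<^sub>R z) - f v) *\<^sub>R N"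
    if "v + t *\<^sub>R z \<in> D" for t
    using g(6)[OF v] g(6)[OF that] by (simp add: linear_add[OF lin] linear_scale[OF lin] algebra_simps)
  have "((\<lambda>t. \<iota> z + ((f (v + t *\<^sub>R z) - f v) /\<^sub>R t) *\<^sub>R N) \<longlongrightarrow> \<iota> z + dderivs [z] f v *\<^sub>R N) (at 0)"
    by (intro tendsto_intros jet2_quotient[OF jf z])
  moreover have "\<forall>\<^sub>F t in at 0. \<iota> z + ((f (v + t *\<^sub>R z) - f v) /\<^sub>R t) *\<^sub>R N = (x (s (v + t *\<^sub>R z)) - x (s v)) /\<^sub>R t"
  proof -
    have "\<forall>\<^sub>F t in at (0::real). t \<noteq> 0" by (simp add: eventually_at_filter)
    with ev show ?thesis
      by eventually_elim (simp add: diff scaleR_add_right)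
  qed
  ultimately have "((\<lambda>t. (x (s (v + t *\<^sub>R z)) - x (s v)) /\<^sub>R t) \<longlongrightarrow> \<iota> z + dderivs [z] f v *\<^sub>R N) (at 0)"
    by (rule Lim_transform_eventually)
  with l show vel: "velocity (\<lambda>t. s (v + t *\<^sub>R z)) (s v) (\<iota> z + dderivs [z] f v *\<^sub>R N)"
    by (simp add: velocity_def)
  \<comment> \<open>Tangency of the velocity expresses the horizontal contribution by the slope of
    \<open>f\<close>; after pairing with the normal only the second-order increment of
    \<open>f\<close> is left.\<close>
  have tang: "\<iota> z \<bullet> \<nu> (s v) + dderivs [z] f v * (N \<bullet> \<nu> (s v)) = 0"
    using velocity_tangent[OF g(9)[OF v] vel] by (simp add: inner_add_left)
  have "((\<lambda>t. ((f (v + t *\<^sub>R z) - f v - dderivs [t *\<^sub>R z] f v) /\<^sub>R t\<^sup>2) * (N \<bullet> \<nu> (s v))) \<longlongrightarrow>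
      ((1/2) *\<^sub>R dderivs [z, z] f v) * (N \<bullet> \<nu> (s v))) (at 0)"
    by (intro tendsto_intros jet2D[OF jf z])
  moreover have "\<forall>\<^sub>F t in at 0. ((f (v + t *\<^sub>R z) - f v - dderivs [t *\<^sub>R z] f v) /\<^sub>R t\<^sup>2) * (N \<bullet> \<nu> (s v))
      = ((x (s (v + t *\<^sub>R z)) - x (s v)) \<bullet> \<nu> (s v)) / t\<^sup>2"
    using ev
  proof eventually_elim
    case (elim t)
    have "(x (s (v + t *\<^sub>R z)) - x (s v)) \<bullet> \<nu> (s v)
      = t * (\<iota> z \<bullet> \<nu> (s v)) + (f (v + t *\<^sub>R z) - f v) * (N \<bullet> \<nu> (s v))"
      unfolding diff[OF elim] by (simp add: inner_add_left)
    also have "\<iota> z \<bullet> \<nu> (s v) = - (dderivs [z] f v * (N \<bullet> \<nu> (s v)))" using tang by linarith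
    finally have "(x (s (v + t *\<^sub>R z)) - x (s v)) \<bullet> \<nu> (s v)
      = (f (v + t *\<^sub>R z) - f v - t * dderivs [z] f v) * (N \<bullet> \<nu> (s v))"
      by (simp add: algebra_simps)
    then show ?case
      using linear_scale[OF linear_dderivs1[OF g(7) v, of "[]"], of t z] by (simp add: divide_inverse)
  qed
  ultimately have "((\<lambda>t. ((x (s (v + t *\<^sub>R z)) - x (s v)) \<bullet> \<nu> (s v)) / t\<^sup>2) \<longlongrightarrow>
       ((1/2) *\<^sub>R dderivs [z, z] f v) * (N \<bullet> \<nu> (s v))) (at 0)"
    by (rule Lim_transform_eventually)
  then show "((\<lambda>t. ((x (s (v + t *\<^sub>R z)) - x (s v)) \<bullet> \<nu> (s v)) / t\<^sup>2) \<longlongrightarrow>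
       (dderivs [z, z] f v * (N \<bullet> \<nu> (s v))) / 2) (at 0)" by simp
qed

lemma graph_tangent:
  assumes G: "graph_patch N \<iota> D s f" and v: "v \<in> D"
  shows "(\<iota> z + dderivs [z] f v *\<^sub>R N) \<bullet> \<nu> (s v) = 0"
  by (rule velocity_tangent[OF graph_patchD(9)[OF G v] graph_velocity(1)[OF G v]])

lemma graph_normal:
  assumes G: "graph_patch N \<iota> D s f" and v: "v \<in> D"
  defines "W \<equiv> sqrt (1 + gradient f v \<bullet> gradient f v)"
  shows "\<nu> (s v) = (1 / W) *\<^sub>R (N - \<iota> (gradient f v))" "N \<bullet> \<nu> (s v) = 1 / W"
proof -
  note g = graph_patchD[OF G]
  note P = normal_frame_adjoint[OF g(2,1)]
  define p where "p = gradient f v"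
  define a where "a = N \<bullet> \<nu> (s v)"
  have a: "a > 0" using g(8)[OF v] by (simp add: a_def inner_commute)
  have "adjoint \<iota> (\<nu> (s v)) \<bullet> z = (- a *\<^sub>R p) \<bullet> z" for z
  proof -
    have "adjoint \<iota> (\<nu> (s v)) \<bullet> z = \<nu> (s v) \<bullet> \<iota> z" by (rule P(5))
    also have "\<dots> = \<iota> z \<bullet> \<nu> (s v)" by (rule inner_commute)
    finally have "adjoint \<iota> (\<nu> (s v)) \<bullet> z = \<iota> z \<bullet> \<nu> (s v)" .
    moreover have "\<iota> z \<bullet> \<nu> (s v) + (p \<bullet> z) * a = 0"
      using graph_tangent[OF G v, of z] unfolding a_def p_def gradient_inner[OF g(7) v]
      by (simp add: inner_add_left)
    ultimately have "adjoint \<iota> (\<nu> (s v)) \<bullet> z = - ((p \<bullet> z) * a)" by linarith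
    then show ?thesis by simp
  qed
  then have adj: "adjoint \<iota> (\<nu> (s v)) = - a *\<^sub>R p" by (rule vector_eq_rdot[THEN iffD1, OF allI])
  have "\<nu> (s v) = \<iota> (adjoint \<iota> (\<nu> (s v))) + (\<nu> (s v) \<bullet> N) *\<^sub>R N" by (rule P(4))
  also have "\<dots> = - a *\<^sub>R \<iota> p + a *\<^sub>R N"
    unfolding adj linear_scale[OF normal_frameD(1)[OF g(2)]] by (simp add: a_def inner_commute)
  finally have nu: "\<nu> (s v) = a *\<^sub>R (N - \<iota> p)" by (simp add: scaleR_diff_right)
  have pp: "1 + p \<bullet> p > 0" by (simp add: add_pos_nonneg)
  have "1 = \<nu> (s v) \<bullet> \<nu> (s v)" using norm_normal[OF g(9)[OF v]] by (simp add: norm_eq_1)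
  also have "\<dots> = a\<^sup>2 * (1 + p \<bullet> p)"
    using g(1) unfolding nu
    by (simp add: inner_diff_left inner_diff_right normal_frameD(3-5)[OF g(2)] norm_eq_1 power2_eq_square algebra_simps)
  finally have "a * W = 1"
    using a pp by (metis W_def p_def real_sqrt_mult real_sqrt_one real_sqrt_abs abs_of_pos)
  moreover have "W > 0" using pp by (simp add: W_def p_def)
  ultimately have aW: "a = 1 / W" by (simp add: field_simps)
  then show "N \<bullet> \<nu> (s v) = 1 / W" by (simp add: a_def)
  show "\<nu> (s v) = (1 / W) *\<^sub>R (N - \<iota> (gradient f v))" using nu aW by (simp add: p_def)
qed

lemma graph_II:
  assumes G: "graph_patch N \<iota> D s f" and v: "v \<in> D"
  shows "II (s v) (\<iota> z + dderivs [z] f v *\<^sub>R N) = dderivs [z, z] f v / sqrt (1 + gradient f v \<bullet> gradient f v)"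
proof -
  have "II (s v) (\<iota> z + dderivs [z] f v *\<^sub>R N) / 2 = dderivs [z, z] f v * (N \<bullet> \<nu> (s v)) / 2"
    by (rule tendsto_unique[OF _ II_curve[OF graph_patchD(9)[OF G v] graph_velocity(1)[OF G v]]
          graph_velocity(2)[OF G v]]) simp
  then show ?thesis using graph_normal(2)[OF G v] by simp
qed

text \<open>The frame of the graph is obtained from the identity by \<open>(1 + p p\<^sup>T)\<^sup>-\<^sup>1\<^sup>/\<^sup>2 = 1 - \<alpha> p p\<^sup>T\<close> with
  \<open>\<alpha> = 1 / (W (W + 1))\<close>.\<close>

lemma graph_mean_curvature:
  assumes n: "CARD('n) \<ge> 2" and G: "graph_patch N \<iota> D s f" and v: "v \<in> D"
  defines "p \<equiv> gradient f v"
  shows "mean_curvature \<A> x \<nu> (s v) * sqrt (1 + p \<bullet> p) =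
    (\<Sum>k\<in>UNIV. dderivs [axis k 1, axis k 1] f v) - dderivs [p, p] f v / (1 + p \<bullet> p)"
proof -
  note g = graph_patchD[OF G]
  define W where "W = sqrt (1 + p \<bullet> p)"
  have pp: "1 + p \<bullet> p > 0" by (simp add: add_pos_nonneg)
  have W: "W > 0" and W2: "W * W = 1 + p \<bullet> p" using pp by (simp_all add: W_def)
  define \<alpha> where "\<alpha> = 1 / (W * (W + 1))"
  have ppW: "p \<bullet> p = (W - 1) * (W + 1)" using W2 by (simp add: algebra_simps)
  have \<alpha>W: "\<alpha> * (W + 1) = 1 / W" using W by (simp add: \<alpha>_def)
  have \<alpha>: "1 - \<alpha> * (p \<bullet> p) = 1 / W"
  proof -
    from \<alpha>W have "1 - \<alpha> * (p \<bullet> p) = 1 - (W - 1) * (1 / W)" by (metis ppW mult.commute mult.left_commute)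
    also have "\<dots> = 1 / W" using W by (simp add: field_simps)
    finally show ?thesis .
  qed
  define T where "T z = z - (\<alpha> * (p \<bullet> z)) *\<^sub>R p" for z
  have linT: "linear T" by (rule linearI) (simp_all add: T_def inner_add_right algebra_simps)
  have pT: "p \<bullet> T z = (p \<bullet> z) / W" for z
  proof -
    have "p \<bullet> T z = (p \<bullet> z) * (1 - \<alpha> * (p \<bullet> p))" by (simp add: T_def inner_diff_right algebra_simps)
    then show ?thesis unfolding \<alpha> by simp
  qed
  define j where "j z = \<iota> (T z) + dderivs [T z] f v *\<^sub>R N" for z
  have Df: "dderivs [z] f v = p \<bullet> z" for z by (simp add: p_def gradient_inner[OF g(7) v])
  have lin\<iota>: "linear \<iota>" by (rule normal_frameD(1)[OF g(2)])
  have "linear j"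
    unfolding j_def Df
    by (rule linearI) (simp_all add: linear_add[OF linT] linear_scale[OF linT] linear_add[OF lin\<iota>]
        linear_scale[OF lin\<iota>] inner_add_right algebra_simps)
  have TT: "T z \<bullet> T z = z \<bullet> z - (p \<bullet> z)\<^sup>2 / W\<^sup>2" for z
  proof -
    have "T z \<bullet> T z = z \<bullet> T z - \<alpha> * (p \<bullet> z) * (p \<bullet> T z)" by (simp add: T_def inner_diff_left)
    also have "z \<bullet> T z = z \<bullet> z - \<alpha> * (p \<bullet> z)\<^sup>2" by (simp add: T_def inner_diff_right inner_commute power2_eq_square)
    finally have "T z \<bullet> T z = z \<bullet> z - (p \<bullet> z)\<^sup>2 * (\<alpha> + \<alpha> / W)" by (simp add: pT algebra_simps power2_eq_square)
    moreover have "\<alpha> + \<alpha> / W = \<alpha> * (W + 1) / W" using W by (simp add: field_simps)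
    then have "\<alpha> + \<alpha> / W = 1 / W\<^sup>2" unfolding \<alpha>W by (simp add: power2_eq_square)
    ultimately show ?thesis by simp
  qed
  have jn: "norm (j z) = norm z" for z
  proof -
    have "j z \<bullet> j z = T z \<bullet> T z + (p \<bullet> T z)\<^sup>2"
      using g(1) by (simp add: j_def Df inner_add_left inner_add_right normal_frameD(3-5)[OF g(2)] norm_eq_1 power2_eq_square)
    also have "\<dots> = z \<bullet> z" by (simp add: TT pT power_divide)
    finally show ?thesis by (simp add: norm_eq_sqrt_inner)
  qed
  have jt: "j z \<bullet> \<nu> (s v) = 0" for z unfolding j_def by (rule graph_tangent[OF G v])
  have nz: "\<nu> (s v) \<noteq> 0" using norm_normal[OF g(9)[OF v]] by auto
  have "range j = {e. e \<bullet> \<nu> (s v) = 0}"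
  proof (rule subspace_dim_equal)
    have eq: "{e. e \<bullet> \<nu> (s v) = 0} = {e. \<nu> (s v) \<bullet> e = 0}" by (simp add: inner_commute)
    show "subspace (range j)" by (rule linear_subspace_image[OF \<open>linear j\<close> subspace_UNIV])
    show "subspace {e. e \<bullet> \<nu> (s v) = 0}" unfolding eq by (rule subspace_hyperplane)
    show "range j \<subseteq> {e. e \<bullet> \<nu> (s v) = 0}" using jt by auto
    have "inj j" using jn by (subst linear_inj_iff_eq_0[OF \<open>linear j\<close>]) (metis norm_eq_zero)
    then have "dim (range j) = dim (UNIV :: (real^'n) set)" using dim_image_eq[OF \<open>linear j\<close>] by simp
    then show "dim {e. e \<bullet> \<nu> (s v) = 0} \<le> dim (range j)" unfolding eq using dim_hyperplane[OF nz] by simp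
  qed
  then have frame: "normal_frame (\<nu> (s v)) j" using \<open>linear j\<close> jn by (simp add: normal_frame_def)
  define B where "B z w = dderivs [z, w] f v" for z w
  have B: "bilinear B" unfolding B_def by (rule bilinear_hessian[OF g(7) v])
  have Bsym: "B z w = B w z" for z w unfolding B_def by (rule dderivs_swap[OF g(7) v])
  have BT: "B (T z) (T z) = B z z - 2 * \<alpha> * (p \<bullet> z) * B z p + \<alpha>\<^sup>2 * (p \<bullet> z)\<^sup>2 * B p p" for z
    unfolding T_def
    by (simp add: bilinear_lsub[OF B] bilinear_rsub[OF B] bilinear_lmul[OF B] bilinear_rmul[OF B] Bsym[of p z]
        power2_eq_square algebra_simps)
  have "mean_curvature \<A> x \<nu> (s v) = (\<Sum>k\<in>UNIV. II (s v) (j (axis k 1)))"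
    by (rule mean_curvature_trace[OF g(9)[OF v] n frame])
  also have "\<dots> = (\<Sum>k\<in>UNIV. B (T (axis k 1)) (T (axis k 1)) / W)"
    unfolding j_def graph_II[OF G v] by (simp add: B_def W_def p_def)
  finally have "mean_curvature \<A> x \<nu> (s v) * W = (\<Sum>k\<in>UNIV. B (T (axis k 1)) (T (axis k 1)))"
    using W by (simp flip: sum_divide_distrib)
  also have "\<dots> = (\<Sum>k\<in>UNIV. B (axis k 1) (axis k 1)) - 2 * \<alpha> * (\<Sum>k\<in>UNIV. p $ k * B (axis k 1) p)
      + \<alpha>\<^sup>2 * B p p * (\<Sum>k\<in>UNIV. (p \<bullet> axis k 1)\<^sup>2)"
    unfolding BT by (simp add: sum.distrib sum_subtractf sum_distrib_left inner_axis mult_ac)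
  also have "(\<Sum>k\<in>UNIV. (p \<bullet> axis k 1)\<^sup>2) = p \<bullet> p" by (rule sum_axis_inner)
  also have "(\<Sum>k\<in>UNIV. p $ k * B (axis k 1) p) = B p p"
  proof -
    have linB: "linear (\<lambda>z. B z p)" using B by (simp add: bilinear_def)
    have "B p p = (\<Sum>k\<in>UNIV. B (p $ k *\<^sub>R axis k 1) p)"
      using linear_sum[OF linB, of "\<lambda>k. p $ k *\<^sub>R axis k 1" UNIV]
      by (simp add: basis_expansion[of p, unfolded scalar_mult_eq_scaleR])
    then show ?thesis by (simp add: bilinear_lmul[OF B])
  qed
  finally have H: "mean_curvature \<A> x \<nu> (s v) * W = (\<Sum>k\<in>UNIV. B (axis k 1) (axis k 1)) - (2 * \<alpha> - \<alpha>\<^sup>2 * (p \<bullet> p)) * B p p"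
    by (simp add: algebra_simps)
  have "\<alpha> * (p \<bullet> p) = 1 - 1 / W" using \<alpha> by simp
  then have "2 * \<alpha> - \<alpha>\<^sup>2 * (p \<bullet> p) = \<alpha> * (1 + 1 / W)" by (simp add: power2_eq_square mult.assoc) (simp add: algebra_simps)
  also have "\<dots> = \<alpha> * (W + 1) / W" using W by (simp add: field_simps)
  also have "\<dots> = 1 / (W * W)" unfolding \<alpha>W by simp
  finally show ?thesis using H unfolding W2 by (simp add: B_def W_def)
qed

end

section \<open>The curvature quotient at a minimum point\<close>

text \<open>The coefficient \<open>m\<close> is half of the second derivative.\<close>

definition jet :: "(real \<Rightarrow> real) \<Rightarrow> real \<Rightarrow> real \<Rightarrow> real \<Rightarrow> bool" where
  "jet F a p m \<longleftrightarrow> ((\<lambda>t. (F t - a - p * t - m * t\<^sup>2) / t\<^sup>2) \<longlongrightarrow> 0) (at 0)"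

section \<open>Second-order jets of functions of one variable\<close>

lemma at_0_nonzero: "\<forall>\<^sub>F t in at (0::real). t \<noteq> 0"
  by (simp add: eventually_at_filter)

lemma jet_eq: "jet F a p m \<Longrightarrow> a = a' \<Longrightarrow> p = p' \<Longrightarrow> m = m' \<Longrightarrow> jet F a' p' m'"
  by simp

lemma jet_cong: "jet F a p m \<Longrightarrow> \<forall>\<^sub>F t in at 0. F t = G t \<Longrightarrow> jet G a p m"
  unfolding jet_def by (rule Lim_transform_eventually) (auto elim: eventually_mono)

lemma jet_const: "jet (\<lambda>t. c) c 0 0"
  by (simp add: jet_def)

lemma jet_linear: "jet (\<lambda>t. c + t * d) c d 0"
  by (simp add: jet_def mult.commute)

lemma jet_add:
  assumes "jet F a p m" "jet G b q k"
  shows "jet (\<lambda>t. F t + G t) (a + b) (p + q) (m + k)"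
proof -
  have "((\<lambda>t. (F t - a - p * t - m * t\<^sup>2) / t\<^sup>2 + (G t - b - q * t - k * t\<^sup>2) / t\<^sup>2) \<longlongrightarrow> 0 + 0) (at 0)"
    by (intro tendsto_add assms[unfolded jet_def])
  then show ?thesis unfolding jet_def by (simp add: algebra_simps flip: add_divide_distrib)
qed

lemma jet_cmult: "jet F a p m \<Longrightarrow> jet (\<lambda>t. c * F t) (c * a) (c * p) (c * m)"
  unfolding jet_def by (drule tendsto_mult_left[where c=c]) (simp add: algebra_simps)

lemma jet_diff: "jet F a p m \<Longrightarrow> jet G b q k \<Longrightarrow> jet (\<lambda>t. F t - G t) (a - b) (p - q) (m - k)"
  using jet_add[of F a p m "\<lambda>t. - 1 * G t" "- 1 * b" "- 1 * q" "- 1 * k"] jet_cmult[of G b q k "- 1"] by simp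

lemma jet_sum:
  "(\<And>i. i \<in> I \<Longrightarrow> jet (F i) (a i) (p i) (m i)) \<Longrightarrow> jet (\<lambda>t. \<Sum>i\<in>I. F i t) (sum a I) (sum p I) (sum m I)"
  by (induction I rule: infinite_finite_induct) (auto intro: jet_add jet_const)

lemma jet_mult:
  assumes "jet F a p m" "jet G b q k"
  shows "jet (\<lambda>t. F t * G t) (a * b) (a * q + b * p) (a * k + b * m + p * q)"
proof -
  define r where "r t = (F t - a - p * t - m * t\<^sup>2) / t\<^sup>2" for t
  define w where "w t = (G t - b - q * t - k * t\<^sup>2) / t\<^sup>2" for t
  have r: "(r \<longlongrightarrow> 0) (at 0)" and w: "(w \<longlongrightarrow> 0) (at 0)"
    using assms by (simp_all add: r_def[abs_def] w_def[abs_def] jet_def)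
  have "((\<lambda>t. a * w t + b * r t + t * (p * (k + w t) + q * (m + r t)) + t\<^sup>2 * ((m + r t) * (k + w t)))
     \<longlongrightarrow> a * 0 + b * 0 + 0 * (p * (k + 0) + q * (m + 0)) + 0\<^sup>2 * ((m + 0) * (k + 0))) (at 0)"
    by (intro tendsto_intros r w)
  then have "((\<lambda>t. a * w t + b * r t + t * (p * (k + w t) + q * (m + r t)) + t\<^sup>2 * ((m + r t) * (k + w t))) \<longlongrightarrow> 0) (at 0)"
    by simp
  then show ?thesis
    unfolding jet_def
  proof (rule Lim_transform_eventually)
    show "\<forall>\<^sub>F t in at 0. a * w t + b * r t + t * (p * (k + w t) + q * (m + r t)) + t\<^sup>2 * ((m + r t) * (k + w t))
      = (F t * G t - a * b - (a * q + b * p) * t - (a * k + b * m + p * q) * t\<^sup>2) / t\<^sup>2"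
      using at_0_nonzero
    proof eventually_elim
      case (elim t)
      have F: "F t = a + p * t + (m + r t) * t\<^sup>2" and G: "G t = b + q * t + (k + w t) * t\<^sup>2"
        using elim by (simp_all add: r_def w_def field_simps)
      have "F t * G t - a * b - (a * q + b * p) * t - (a * k + b * m + p * q) * t\<^sup>2
        = (a * w t + b * r t + t * (p * (k + w t) + q * (m + r t)) + t\<^sup>2 * ((m + r t) * (k + w t))) * t\<^sup>2"
        unfolding F G by algebra
      then show ?case using elim by simp
    qed
  qed
qed

lemma jet_limits:
  assumes "jet F a p m"
  shows "(F \<longlongrightarrow> a) (at 0)" "((\<lambda>t. (F t - a) / t) \<longlongrightarrow> p) (at 0)" "((\<lambda>t. (F t - a - p * t) / t\<^sup>2) \<longlongrightarrow> m) (at 0)"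
proof -
  define r where "r t = (F t - a - p * t - m * t\<^sup>2) / t\<^sup>2" for t
  have r: "(r \<longlongrightarrow> 0) (at 0)" using assms by (simp add: r_def[abs_def] jet_def)
  have F: "\<forall>\<^sub>F t in at 0. F t = a + p * t + (m + r t) * t\<^sup>2"
    using at_0_nonzero by eventually_elim (simp add: r_def field_simps)
  have "((\<lambda>t. a + p * t + (m + r t) * t\<^sup>2) \<longlongrightarrow> a + p * 0 + (m + 0) * 0\<^sup>2) (at 0)" by (intro tendsto_intros r)
  then have "((\<lambda>t. a + p * t + (m + r t) * t\<^sup>2) \<longlongrightarrow> a) (at 0)" by simp
  then show "(F \<longlongrightarrow> a) (at 0)"
    by (rule Lim_transform_eventually) (use F in \<open>auto elim: eventually_mono\<close>)
  have "((\<lambda>t. p + (m + r t) * t) \<longlongrightarrow> p + (m + 0) * 0) (at 0)" by (intro tendsto_intros r)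
  then have "((\<lambda>t. p + (m + r t) * t) \<longlongrightarrow> p) (at 0)" by simp
  then show "((\<lambda>t. (F t - a) / t) \<longlongrightarrow> p) (at 0)"
  proof (rule Lim_transform_eventually)
    show "\<forall>\<^sub>F t in at 0. p + (m + r t) * t = (F t - a) / t"
      using F at_0_nonzero by eventually_elim (simp add: field_simps power2_eq_square)
  qed
  have "((\<lambda>t. m + r t) \<longlongrightarrow> m + 0) (at 0)" by (intro tendsto_intros r)
  then have "((\<lambda>t. m + r t) \<longlongrightarrow> m) (at 0)" by simp
  then show "((\<lambda>t. (F t - a - p * t) / t\<^sup>2) \<longlongrightarrow> m) (at 0)"
  proof (rule Lim_transform_eventually)
    show "\<forall>\<^sub>F t in at 0. m + r t = (F t - a - p * t) / t\<^sup>2"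
      using F at_0_nonzero by eventually_elim (simp add: field_simps)
  qed
qed

lemma jet_unique:
  assumes "jet F a p m" "jet F b q k"
  shows "a = b" "p = q" "m = k"
proof -
  show ab: "a = b" using tendsto_unique[OF _ jet_limits(1)[OF assms(1)] jet_limits(1)[OF assms(2)]] by simp
  show pq: "p = q"
    using tendsto_unique[OF _ jet_limits(2)[OF assms(1)] jet_limits(2)[OF assms(2)[folded ab]]] by simp
  show "m = k"
    using tendsto_unique[OF _ jet_limits(3)[OF assms(1)] jet_limits(3)[OF assms(2)[folded ab pq]]] by simp
qed

lemma jet_minimum:
  assumes F: "jet F 0 p m" and nonneg: "\<forall>\<^sub>F t in at 0. F t \<ge> 0"
  shows "p = 0" "m \<ge> 0"
proof -
  have lim: "((\<lambda>t. F t / t) \<longlongrightarrow> p) (at 0)" using jet_limits(2)[OF F] by simp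
  have r: "\<forall>\<^sub>F t in at_right 0. F t / t \<ge> 0"
    using nonneg[unfolded eventually_at_split] eventually_at_right_less[of "0::real"]
    by (auto elim: eventually_elim2)
  have l: "\<forall>\<^sub>F t in at_left 0. F t / t \<le> 0"
    using nonneg[unfolded eventually_at_split] eventually_at_left[of "-1" "0::real", simplified]
    by (auto simp: eventually_at_filter divide_nonneg_nonpos elim!: eventually_mono)
  have "0 \<le> p"
    by (rule tendsto_lowerbound[OF tendsto_mono[OF at_le lim] r]) auto
  moreover have "p \<le> 0"
    by (rule tendsto_upperbound[OF tendsto_mono[OF at_le lim] l]) auto
  ultimately show p: "p = 0" by simp
  have "((\<lambda>t. F t / t\<^sup>2) \<longlongrightarrow> m) (at 0)" using jet_limits(3)[OF F] by (simp add: p)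
  moreover have "\<forall>\<^sub>F t in at 0. F t / t\<^sup>2 \<ge> 0" using nonneg by eventually_elim simp
  ultimately show "m \<ge> 0" by (rule tendsto_lowerbound) simp
qed

lemma jet_exp:
  assumes "jet F a p m"
  shows "jet (\<lambda>t. exp (F t)) (exp a) (exp a * p) (exp a * (m + p\<^sup>2 / 2))"
proof -
  \<comment> \<open>The second-order remainder quotient of the exponential, completed at 0 by its
    limit 1/2. The default value 0 of a division by zero would destroy continuity where
    \<open>G t = 0\<close>.\<close>
  define E where "E y = (if y = 0 then 1/2 else (exp y - 1 - y) / y\<^sup>2)" for y :: real
  have "((\<lambda>y. (exp y - 1 - y) / y\<^sup>2) \<longlongrightarrow> 1/2) (at (0::real))" by real_asymp
  then have "isCont E 0"
    unfolding isCont_def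
    by (rule Lim_transform_eventually[THEN tendsto_eq_rhs]) (auto simp: E_def eventually_at_filter)
  have E: "exp y = 1 + y + E y * y\<^sup>2" for y by (simp add: E_def)
  define G where "G t = F t - a" for t
  have G: "jet G 0 p m" unfolding G_def using jet_diff[OF assms jet_const[of a]] by simp
  have "((\<lambda>t. E (G t)) \<longlongrightarrow> E 0) (at 0)"
    using isCont_tendsto_compose[OF \<open>isCont E 0\<close> jet_limits(1)[OF G]] .
  then have EG: "((\<lambda>t. E (G t)) \<longlongrightarrow> 1/2) (at 0)" by (simp add: E_def)
  have "((\<lambda>t. (G t / t)\<^sup>2) \<longlongrightarrow> p\<^sup>2) (at 0)" using jet_limits(2)[OF G] by (intro tendsto_intros) simp
  from tendsto_mult[OF EG this]
  have lim: "((\<lambda>t. E (G t) * (G t / t)\<^sup>2 - 1/2 * p\<^sup>2) \<longlongrightarrow> 1/2 * p\<^sup>2 - 1/2 * p\<^sup>2) (at 0)"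
    by (intro tendsto_diff tendsto_const)
  have "((\<lambda>t. (G t - 0 - p * t - m * t\<^sup>2) / t\<^sup>2 + (E (G t) * (G t / t)\<^sup>2 - 1/2 * p\<^sup>2)) \<longlongrightarrow> 0 + (1/2 * p\<^sup>2 - 1/2 * p\<^sup>2)) (at 0)"
    by (intro tendsto_add lim G[unfolded jet_def])
  then have "((\<lambda>t. (G t - 0 - p * t - m * t\<^sup>2) / t\<^sup>2 + (E (G t) * (G t / t)\<^sup>2 - 1/2 * p\<^sup>2)) \<longlongrightarrow> 0) (at 0)" by simp
  then have "jet (\<lambda>t. exp (G t)) 1 p (m + p\<^sup>2 / 2)"
    unfolding jet_def
  proof (rule Lim_transform_eventually)
    show "\<forall>\<^sub>F t in at 0. (G t - 0 - p * t - m * t\<^sup>2) / t\<^sup>2 + (E (G t) * (G t / t)\<^sup>2 - 1/2 * p\<^sup>2)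
        = (exp (G t) - 1 - p * t - (m + p\<^sup>2 / 2) * t\<^sup>2) / t\<^sup>2"
      using at_0_nonzero
    proof eventually_elim
      case (elim t)
      then show ?case by (subst E) (simp add: field_simps)
    qed
  qed
  from jet_cmult[OF this, of "exp a"] show ?thesis by (simp add: G_def flip: exp_add)
qed

lemma smooth_jet:
  assumes f: "smooth_on D f" and v: "v \<in> D"
  shows "jet (\<lambda>t. dderivs vs f (v + t *\<^sub>R z)) (dderivs vs f v) (dderivs (z # vs) f v) (dderivs (z # z # vs) f v / 2)"
proof -
  have z: "((\<lambda>t. (t *\<^sub>R z) /\<^sub>R t) \<longlongrightarrow> z) (at (0::real))"
    by (rule Lim_transform_eventually[OF tendsto_const]) (auto simp: eventually_at_filter)
  define g where "g = dderivs vs f"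
  have g: "smooth_on D g" unfolding g_def by (rule smooth_on_dderivs[OF f])
  have gd: "dderivs ws g v = dderivs (ws @ vs) f v" for ws by (simp add: g_def dderivs_append)
  have "((\<lambda>t. (g (v + t *\<^sub>R z) - g v - dderivs [t *\<^sub>R z] g v) /\<^sub>R t\<^sup>2 - (1/2) *\<^sub>R dderivs [z, z] g v)
      \<longlongrightarrow> (1/2) *\<^sub>R dderivs [z, z] g v - (1/2) *\<^sub>R dderivs [z, z] g v) (at 0)"
    by (intro tendsto_diff jet2D[OF smooth_jet2[OF g v] z] tendsto_const)
  then have "((\<lambda>t. (g (v + t *\<^sub>R z) - g v - dderivs [t *\<^sub>R z] g v) /\<^sub>R t\<^sup>2 - (1/2) *\<^sub>R dderivs [z, z] g v) \<longlongrightarrow> 0) (at 0)" by simp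
  then have "jet (\<lambda>t. g (v + t *\<^sub>R z)) (g v) (dderivs [z] g v) (dderivs [z, z] g v / 2)"
    unfolding jet_def
  proof (rule Lim_transform_eventually)
    show "\<forall>\<^sub>F t in at 0. (g (v + t *\<^sub>R z) - g v - dderivs [t *\<^sub>R z] g v) /\<^sub>R t\<^sup>2 - (1/2) *\<^sub>R dderivs [z, z] g v
      = (g (v + t *\<^sub>R z) - g v - dderivs [z] g v * t - dderivs [z, z] g v / 2 * t\<^sup>2) / t\<^sup>2"
      using at_0_nonzero
      by eventually_elim (use linear_scale[OF linear_dderivs1[OF g v, of "[]"]] in \<open>simp add: field_simps\<close>)
  qed
  then show ?thesis by (simp add: gd) (simp add: g_def)
qed

text \<open>Where \<open>\<Psi>\<close> touches u = kappa_1 / H from below, this is the inequality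
  Laplacian u + <x^T, grad u> + (2 / H) <grad H, grad u> <= 0 with \<open>\<Psi>\<close> in place of
  u; \<open>b\<close> is the tangential part of the position vector and \<open>c\<close> is H. The
  graph is taken over the tangent plane, so \<open>crit\<close> removes the corrections due to the
  metric. Since \<open>f v - v \<bullet> gradient f v\<close> is H times the area element,
  \<open>min\<close> compares \<open>\<Psi>\<close> H with the second fundamental form on the lift
  of \<open>e\<close>, both multiplied by the area element. The difference of its two sides has
  minimum zero at \<open>b\<close>, and the trace of its Hessian there is evaluated with the graph
  equation.\<close>

lemma graph_expander_inequality:
  fixes f :: "real ^ 'n::finite \<Rightarrow> real" and b :: "real ^ 'n"
  assumes f: "smooth_on D f" and b: "b \<in> D"
    and E: "\<And>v. v \<in> D \<Longrightarrow> (\<Sum>i\<in>UNIV. dderivs [axis i 1, axis i 1] f v) -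
        dderivs [gradient f v, gradient f v] f v / (1 + gradient f v \<bullet> gradient f v) = f v - v \<bullet> gradient f v"
    and crit: "\<And>z. dderivs [z] f b = 0"
    and eig: "\<And>z. dderivs [z, e] f b = \<kappa> * (z \<bullet> e)" and e: "e \<bullet> e = 1"
    and c: "f b = c" "c > 0"
    and \<Psi>: "\<And>k. jet (\<lambda>t. \<Psi> (b + t *\<^sub>R axis k 1)) (\<kappa> / c) (g k) (m k)"
    and min: "\<And>v. v \<in> D \<Longrightarrow> \<Psi> v * (f v - v \<bullet> gradient f v) * (1 + (dderivs [e] f v)\<^sup>2) \<le> dderivs [e, e] f v"
  shows "(\<Sum>i\<in>UNIV. dderivs [axis i 1, axis i 1] f b) = c"
    and "(\<Sum>k\<in>UNIV. 2 * m k + b $ k * g k) - 2 / c * (\<Sum>k\<in>UNIV. g k * dderivs [axis k 1, b] f b) \<le> 0"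
proof -
  define h where "h z w = dderivs [z, w] f b" for z w
  define T where "T z w y = dderivs [z, w, y] f b" for z w y
  have lin1: "linear (\<lambda>z. dderivs (z # vs) f b)" for vs by (rule linear_dderivs1[OF f b])
  have h: "bilinear h" unfolding h_def[abs_def] by (rule bilinear_hessian[OF f b])
  have hsym: "h z w = h w z" for z w unfolding h_def by (rule dderivs_swap[OF f b])
  have comp: "L y = (\<Sum>i\<in>UNIV. y $ i * L (axis i 1))" if "linear L" for L :: "real^'n \<Rightarrow> real" and y
  proof -
    have "L y = L (\<Sum>i\<in>UNIV. y $ i *\<^sub>R axis i 1)" by (simp add: basis_expansion[of y, unfolded scalar_mult_eq_scaleR])
    then show ?thesis by (simp add: linear_sum[OF that] linear_scale[OF that])
  qed
  have linh: "linear (\<lambda>w. h z w)" for z using h by (simp add: bilinear_def)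
  have linT: "linear (\<lambda>y. T z w y)" for z w
  proof -
    have "T z w y = T y z w" for y
    proof -
      have "dderivs [z, w, y] f b = dderivs [z, y, w] f b"
      proof -
        have "frechet_derivative (dderivs [w, y] f) (at b) z = frechet_derivative (dderivs [y, w] f) (at b) z"
          using dderivs_cong[OF smooth_on_open[OF f], of "dderivs [w, y] f" "dderivs [y, w] f" b "[z]"]
            dderivs_swap[OF f, of _ w y "[]"] b by (simp add: dderivs.simps(2))
        then show ?thesis by (simp add: dderivs.simps(2))
      qed
      also have "\<dots> = dderivs [y, z, w] f b" by (rule dderivs_swap[OF f b])
      finally show ?thesis by (simp add: T_def)
    qed
    then show ?thesis using lin1[of "[z, w]"] by (simp add: T_def)
  qed
  have inD: "\<forall>\<^sub>F t in at 0. b + t *\<^sub>R z \<in> D" for z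
  proof -
    have "((\<lambda>t. b + t *\<^sub>R z) \<longlongrightarrow> b) (at 0)" by (auto intro!: tendsto_eq_intros)
    from topological_tendstoD[OF this smooth_on_open[OF f] b] show ?thesis .
  qed
  have jp: "jet (\<lambda>t. dderivs [y] f (b + t *\<^sub>R z)) 0 (h z y) (T z z y / 2)" for y z
    using smooth_jet[OF f b, of "[y]" z] crit by (simp add: h_def T_def)
  have jg: "jet (\<lambda>t. gradient f (b + t *\<^sub>R z) $ i) 0 (h z (axis i 1)) (T z z (axis i 1) / 2)" for i z
    using jp[of "axis i 1" z] by (simp add: gradient_def)
  define K where "K v = f v - v \<bullet> gradient f v" for v
  have jK: "jet (\<lambda>t. K (b + t *\<^sub>R z)) c (- h z b) (- (h z z + T z z b) / 2)" for z
  proof -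
    have "jet (\<lambda>t. (b $ i + t * z $ i) * gradient f (b + t *\<^sub>R z) $ i)
        0 (b $ i * h z (axis i 1)) (b $ i * (T z z (axis i 1) / 2) + z $ i * h z (axis i 1))" for i
      by (rule jet_eq[OF jet_mult[OF jet_linear jg]]) auto
    from jet_sum[OF this, where I=UNIV]
    have "jet (\<lambda>t. \<Sum>i\<in>UNIV. (b $ i + t * z $ i) * gradient f (b + t *\<^sub>R z) $ i) 0 (h z b) (T z z b / 2 + h z z)"
      by (rule jet_eq) (simp_all add: comp[OF linh, of z b] comp[OF linh, of z z] comp[OF linT, of z z b]
          sum.distrib sum_divide_distrib)
    then have "jet (\<lambda>t. (b + t *\<^sub>R z) \<bullet> gradient f (b + t *\<^sub>R z)) 0 (h z b) (T z z b / 2 + h z z)"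
      by (simp add: inner_vec_def)
    moreover have "jet (\<lambda>t. f (b + t *\<^sub>R z)) c 0 (h z z / 2)"
      using smooth_jet[OF f b, of "[]" z] crit c by (simp add: h_def)
    ultimately have "jet (\<lambda>t. K (b + t *\<^sub>R z)) (c - 0) (0 - h z b) (h z z / 2 - (T z z b / 2 + h z z))"
      unfolding K_def by (intro jet_diff)
    then show ?thesis by (rule jet_eq) (auto simp: field_simps)
  qed
  have jpp: "jet (\<lambda>t. 1 + gradient f (b + t *\<^sub>R z) \<bullet> gradient f (b + t *\<^sub>R z)) 1 0 (\<Sum>i\<in>UNIV. (h z (axis i 1))\<^sup>2)" for z
  proof -
    have "jet (\<lambda>t. gradient f (b + t *\<^sub>R z) $ i * gradient f (b + t *\<^sub>R z) $ i) 0 0 ((h z (axis i 1))\<^sup>2)" for i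
      by (rule jet_eq[OF jet_mult[OF jg jg]]) (auto simp: power2_eq_square)
    from jet_add[OF jet_const[of 1] jet_sum[OF this, where I=UNIV]] show ?thesis by (simp add: inner_vec_def)
  qed
  have jtr: "jet (\<lambda>t. \<Sum>i\<in>UNIV. dderivs [axis i 1, axis i 1] f (b + t *\<^sub>R z)) (\<Sum>i\<in>UNIV. h (axis i 1) (axis i 1))
      (\<Sum>i\<in>UNIV. T z (axis i 1) (axis i 1)) (\<Sum>i\<in>UNIV. dderivs [z, z, axis i 1, axis i 1] f b / 2)" for z
    by (rule jet_eq[OF jet_sum[OF smooth_jet[OF f b]]]) (auto simp: h_def T_def)
  have jD: "jet (\<lambda>t. dderivs [gradient f (b + t *\<^sub>R z), gradient f (b + t *\<^sub>R z)] f (b + t *\<^sub>R z)) 0 0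
      (\<Sum>i\<in>UNIV. \<Sum>j\<in>UNIV. h z (axis i 1) * h z (axis j 1) * h (axis i 1) (axis j 1))" for z
  proof -
    have "jet (\<lambda>t. gradient f (b + t *\<^sub>R z) $ i * gradient f (b + t *\<^sub>R z) $ j * dderivs [axis i 1, axis j 1] f (b + t *\<^sub>R z))
        0 0 (h z (axis i 1) * h z (axis j 1) * h (axis i 1) (axis j 1))" for i j
      by (rule jet_eq[OF jet_mult[OF jet_mult[OF jg jg] smooth_jet[OF f b]]]) (auto simp: h_def)
    then have inner: "jet (\<lambda>t. \<Sum>j\<in>UNIV. gradient f (b + t *\<^sub>R z) $ i * gradient f (b + t *\<^sub>R z) $ j * dderivs [axis i 1, axis j 1] f (b + t *\<^sub>R z))
        0 0 (\<Sum>j\<in>UNIV. h z (axis i 1) * h z (axis j 1) * h (axis i 1) (axis j 1))" for i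
      by (intro jet_eq[OF jet_sum[where a="\<lambda>_. 0" and p="\<lambda>_. 0"]]) simp_all
    have "jet (\<lambda>t. \<Sum>i\<in>UNIV. \<Sum>j\<in>UNIV. gradient f (b + t *\<^sub>R z) $ i * gradient f (b + t *\<^sub>R z) $ j * dderivs [axis i 1, axis j 1] f (b + t *\<^sub>R z))
        0 0 (\<Sum>i\<in>UNIV. \<Sum>j\<in>UNIV. h z (axis i 1) * h z (axis j 1) * h (axis i 1) (axis j 1))"
      by (rule jet_eq[OF jet_sum[OF inner]]) simp_all
    then show ?thesis
    proof (rule jet_cong)
      show "\<forall>\<^sub>F t in at 0. (\<Sum>i\<in>UNIV. \<Sum>j\<in>UNIV. gradient f (b + t *\<^sub>R z) $ i * gradient f (b + t *\<^sub>R z) $ j * dderivs [axis i 1, axis j 1] f (b + t *\<^sub>R z))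
        = dderivs [gradient f (b + t *\<^sub>R z), gradient f (b + t *\<^sub>R z)] f (b + t *\<^sub>R z)"
        using inD[of z] by eventually_elim (rule bilinear_expand_axis[OF bilinear_hessian[OF f], symmetric])
    qed
  qed
  \<comment> \<open>The graph equation \<open>E\<close>, cleared of its denominator, is compared to
    orders 0, 1 and 2 along a line through \<open>b\<close>. This yields the trace, its first and
    its second derivative.\<close>
  have jets: "(\<Sum>i\<in>UNIV. h (axis i 1) (axis i 1)) = c"
      "(\<Sum>i\<in>UNIV. T z (axis i 1) (axis i 1)) = - h z b"
      "(\<Sum>i\<in>UNIV. dderivs [z, z, axis i 1, axis i 1] f b)
        = 2 * (\<Sum>i\<in>UNIV. \<Sum>j\<in>UNIV. h z (axis i 1) * h z (axis j 1) * h (axis i 1) (axis j 1)) - (h z z + T z z b)" for z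
  proof -
    have ev: "\<forall>\<^sub>F t in at 0. (\<Sum>i\<in>UNIV. dderivs [axis i 1, axis i 1] f (b + t *\<^sub>R z)) * (1 + gradient f (b + t *\<^sub>R z) \<bullet> gradient f (b + t *\<^sub>R z))
       - dderivs [gradient f (b + t *\<^sub>R z), gradient f (b + t *\<^sub>R z)] f (b + t *\<^sub>R z)
       = K (b + t *\<^sub>R z) * (1 + gradient f (b + t *\<^sub>R z) \<bullet> gradient f (b + t *\<^sub>R z))"
      using inD[of z]
    proof eventually_elim
      case (elim t)
      have "1 + gradient f (b + t *\<^sub>R z) \<bullet> gradient f (b + t *\<^sub>R z) \<noteq> 0"
        by (metis add_pos_nonneg inner_ge_zero less_irrefl zero_less_one)
      with E[OF elim] show ?case by (simp add: K_def field_simps)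
    qed
    note j = jet_unique[OF jet_cong[OF jet_diff[OF jet_mult[OF jtr jpp] jD] ev] jet_mult[OF jK jpp]]
    show tr: "(\<Sum>i\<in>UNIV. h (axis i 1) (axis i 1)) = c" using j(1) by simp
    show "(\<Sum>i\<in>UNIV. T z (axis i 1) (axis i 1)) = - h z b" using j(2) by simp
    show "(\<Sum>i\<in>UNIV. dderivs [z, z, axis i 1, axis i 1] f b)
        = 2 * (\<Sum>i\<in>UNIV. \<Sum>j\<in>UNIV. h z (axis i 1) * h z (axis j 1) * h (axis i 1) (axis j 1)) - (h z z + T z z b)"
      using j(3) by (simp add: tr sum_divide_distrib[symmetric] field_simps)
  qed
  show "(\<Sum>i\<in>UNIV. dderivs [axis i 1, axis i 1] f b) = c" using jets(1) by (simp add: h_def)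
  have he: "h z e = \<kappa> * (z \<bullet> e)" for z using eig by (simp add: h_def)
  have cube: "(\<Sum>i\<in>UNIV. \<Sum>j\<in>UNIV. h e (axis i 1) * h e (axis j 1) * h (axis i 1) (axis j 1)) = \<kappa> ^ 3"
  proof -
    have "h e (axis i 1) = \<kappa> * e $ i" for i using he[of "axis i 1"] by (simp add: hsym[of e] inner_axis' )
    then have "(\<Sum>i\<in>UNIV. \<Sum>j\<in>UNIV. h e (axis i 1) * h e (axis j 1) * h (axis i 1) (axis j 1))
        = \<kappa>\<^sup>2 * (\<Sum>i\<in>UNIV. \<Sum>j\<in>UNIV. e $ i * e $ j * h (axis i 1) (axis j 1))"
      by (simp add: sum_distrib_left power2_eq_square mult_ac)
    also have "\<dots> = \<kappa>\<^sup>2 * h e e" by (simp only: bilinear_expand_axis[OF h, symmetric])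
    finally show ?thesis by (simp add: he e power2_eq_square power3_eq_cube)
  qed
  define F where "F k = dderivs [axis k 1, axis k 1, e, e] f b" for k :: 'n
  \<comment> \<open>Commuting fourth derivatives turns the Laplacian of the second derivative in the
    direction \<open>e\<close> into the second derivative of the trace in that direction, which the
    graph equation determines.\<close>
  have swap4: "F k = dderivs [e, e, axis k 1, axis k 1] f b" for k
  proof -
    have in2: "dderivs [a, b', c', d] f b = dderivs [a, c', b', d] f b" for a b' c' d
      using dderivs_cong[OF smooth_on_open[OF f], of "dderivs [b', c', d] f" "dderivs [c', b', d] f" b "[a]"]
        dderivs_swap[OF f, of _ b' c' "[d]"] b by (simp add: dderivs.simps(2))
    have in3: "dderivs [a, b', c', d] f b = dderivs [a, b', d, c'] f b" for a b' c' d
      using dderivs_cong[OF smooth_on_open[OF f], of "dderivs [c', d] f" "dderivs [d, c'] f" b "[a, b']"]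
        dderivs_swap[OF f, of _ c' d "[]"] b by (simp add: dderivs.simps(2))
    have in1: "dderivs [a, b', c', d] f b = dderivs [b', a, c', d] f b" for a b' c' d
      by (rule dderivs_swap[OF f b])
    show ?thesis unfolding F_def by (metis in1 in2 in3)
  qed
  have sumF: "(\<Sum>k\<in>UNIV. F k) = 2 * \<kappa> ^ 3 - (\<kappa> + T e e b)"
    using jets(3)[of e] by (simp add: swap4 cube he e)
  define \<Psi>0 where "\<Psi>0 = \<kappa> / c"
  have \<Psi>0: "\<Psi>0 * c = \<kappa>" using c by (simp add: \<Psi>0_def)
  \<comment> \<open>First- and second-order conditions at \<open>b\<close> for the difference of the
    two sides of \<open>min\<close>, which is nonnegative and vanishes there because
    \<open>\<Psi>\<close> takes the value \<open>\<kappa> / c\<close>.\<close>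
  have DD: "T (axis k 1) e e + \<Psi>0 * h (axis k 1) b - c * g k = 0"
    "F k / 2 + \<Psi>0 * (h (axis k 1) (axis k 1) + T (axis k 1) (axis k 1) b) / 2 - \<kappa> * (h (axis k 1) e)\<^sup>2 - c * m k + g k * h (axis k 1) b \<ge> 0"
    for k
  proof -
    let ?z = "axis k 1 :: real^'n"
    have j1: "jet (\<lambda>t. 1 + (dderivs [e] f (b + t *\<^sub>R ?z))\<^sup>2) 1 0 ((h ?z e)\<^sup>2)"
      using jet_add[OF jet_const[of 1] jet_mult[OF jp[of e ?z] jp[of e ?z]]] by (simp add: power2_eq_square)
    have "jet (\<lambda>t. dderivs [e, e] f (b + t *\<^sub>R ?z) - \<Psi> (b + t *\<^sub>R ?z) * K (b + t *\<^sub>R ?z) * (1 + (dderivs [e] f (b + t *\<^sub>R ?z))\<^sup>2))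
        0 (T ?z e e + \<Psi>0 * h ?z b - c * g k)
        (F k / 2 + \<Psi>0 * (h ?z ?z + T ?z ?z b) / 2 - \<kappa> * (h ?z e)\<^sup>2 - c * m k + g k * h ?z b)"
      by (rule jet_eq[OF jet_diff[OF smooth_jet[OF f b] jet_mult[OF jet_mult[OF \<Psi> jK] j1]]])
        (use \<Psi>0 he[of e] e in \<open>auto simp: h_def[symmetric] T_def[symmetric] F_def \<Psi>0_def[symmetric] algebra_simps add_divide_distrib diff_divide_distrib\<close>)
    moreover have "\<forall>\<^sub>F t in at 0. dderivs [e, e] f (b + t *\<^sub>R ?z) - \<Psi> (b + t *\<^sub>R ?z) * K (b + t *\<^sub>R ?z) * (1 + (dderivs [e] f (b + t *\<^sub>R ?z))\<^sup>2) \<ge> 0"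
      using inD[of ?z] by eventually_elim (use min in \<open>simp add: K_def\<close>)
    ultimately show "T ?z e e + \<Psi>0 * h ?z b - c * g k = 0"
      "F k / 2 + \<Psi>0 * (h ?z ?z + T ?z ?z b) / 2 - \<kappa> * (h ?z e)\<^sup>2 - c * m k + g k * h ?z b \<ge> 0"
      by (rule jet_minimum)+
  qed
  \<comment> \<open>The first-order condition, contracted with \<open>b\<close>, eliminates the
    third derivatives that survive in \<open>sumF\<close>.\<close>
  have Tb: "T e e b = c * (\<Sum>k\<in>UNIV. b $ k * g k) - \<Psi>0 * h b b"
  proof -
    have sym: "T z e e = T e e z" for z
    proof -
      have "dderivs [z, e, e] f b = dderivs [e, z, e] f b" by (rule dderivs_swap[OF f b])
      also have "\<dots> = dderivs [e, e, z] f b"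
        using dderivs_cong[OF smooth_on_open[OF f], of "dderivs [z, e] f" "dderivs [e, z] f" b "[e]"]
          dderivs_swap[OF f, of _ z e "[]"] b by (simp add: dderivs.simps(2))
      finally show ?thesis by (simp add: T_def)
    qed
    have "T e e b = (\<Sum>k\<in>UNIV. b $ k * T e e (axis k 1))" by (rule comp[OF linT])
    also have "\<dots> = (\<Sum>k\<in>UNIV. b $ k * (c * g k - \<Psi>0 * h b (axis k 1)))"
      using DD(1) by (intro sum.cong refl arg_cong2[of _ _ _ _ "(*)"]) (simp_all add: sym hsym[of b] algebra_simps)
    also have "\<dots> = c * (\<Sum>k\<in>UNIV. b $ k * g k) - \<Psi>0 * (\<Sum>k\<in>UNIV. b $ k * h b (axis k 1))"
      by (simp add: right_diff_distrib sum_subtractf sum_distrib_left mult_ac)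
    also have "(\<Sum>k\<in>UNIV. b $ k * h b (axis k 1)) = h b b" by (rule comp[OF linh, symmetric])
    finally show ?thesis .
  qed
  have he2: "(\<Sum>k\<in>UNIV. (h (axis k 1) e)\<^sup>2) = \<kappa>\<^sup>2"
    using sum_axis_inner[of e] by (simp add: he power_mult_distrib inner_commute e flip: sum_distrib_left)
  have Tbb: "(\<Sum>k\<in>UNIV. T (axis k 1) (axis k 1) b) = - h b b"
  proof -
    have sym: "T z z b = T b z z" for z
    proof -
      have "dderivs [z, z, b] f b = dderivs [z, b, z] f b"
        using dderivs_cong[OF smooth_on_open[OF f], of "dderivs [z, b] f" "dderivs [b, z] f" b "[z]"]
          dderivs_swap[OF f, of _ z b "[]"] b by (simp add: dderivs.simps(2))
      also have "\<dots> = dderivs [b, z, z] f b" by (rule dderivs_swap[OF f b])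
      finally show ?thesis by (simp add: T_def)
    qed
    then show ?thesis using jets(2)[of b] by simp
  qed
  have "0 \<le> (\<Sum>k\<in>UNIV. F k / 2 + \<Psi>0 * (h (axis k 1) (axis k 1) + T (axis k 1) (axis k 1) b) / 2 - \<kappa> * (h (axis k 1) e)\<^sup>2 - c * m k + g k * h (axis k 1) b)"
    by (intro sum_nonneg DD(2))
  also have "\<dots> = (\<Sum>k\<in>UNIV. F k) / 2 + \<Psi>0 * ((\<Sum>k\<in>UNIV. h (axis k 1) (axis k 1)) + (\<Sum>k\<in>UNIV. T (axis k 1) (axis k 1) b)) / 2
      - \<kappa> * (\<Sum>k\<in>UNIV. (h (axis k 1) e)\<^sup>2) - c * (\<Sum>k\<in>UNIV. m k) + (\<Sum>k\<in>UNIV. g k * h (axis k 1) b)"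
    by (simp add: sum.distrib sum_subtractf sum_distrib_left sum_divide_distrib distrib_left add_divide_distrib)
  also have "\<dots> = (2 * \<kappa> ^ 3 - (\<kappa> + c * (\<Sum>k\<in>UNIV. b $ k * g k) - \<Psi>0 * h b b)) / 2 + \<Psi>0 * (c - h b b) / 2
      - \<kappa> * \<kappa>\<^sup>2 - c * (\<Sum>k\<in>UNIV. m k) + (\<Sum>k\<in>UNIV. g k * h (axis k 1) b)"
    unfolding sumF jets(1) Tbb he2 Tb by simp
  \<comment> \<open>The cubic terms and the terms with \<open>h b b\<close> cancel, and
    \<open>\<Psi>0 * c = \<kappa>\<close> cancels the zeroth-order ones. Only first and second
    derivatives of \<open>\<Psi>\<close> are left.\<close>
  also have "\<dots> = - (c / 2) * (2 * (\<Sum>k\<in>UNIV. m k) + (\<Sum>k\<in>UNIV. b $ k * g k)) + (\<Sum>k\<in>UNIV. g k * h (axis k 1) b)"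
    using \<Psi>0 by (simp add: power2_eq_square power3_eq_cube field_simps)
  finally have "c / 2 * (2 * (\<Sum>k\<in>UNIV. m k) + (\<Sum>k\<in>UNIV. b $ k * g k)) \<le> (\<Sum>k\<in>UNIV. g k * h (axis k 1) b)" by simp
  then have "2 * (\<Sum>k\<in>UNIV. m k) + (\<Sum>k\<in>UNIV. b $ k * g k) \<le> 2 / c * (\<Sum>k\<in>UNIV. g k * h (axis k 1) b)"
    using c by (simp add: field_simps)
  then show "(\<Sum>k\<in>UNIV. 2 * m k + b $ k * g k) - 2 / c * (\<Sum>k\<in>UNIV. g k * dderivs [axis k 1, b] f b) \<le> 0"
    by (simp add: h_def sum.distrib sum_distrib_left)
qed

text \<open>Polarization on unit vectors and the parallelogram law give the bilinear bound with the
  same constant. Lengths are measured through \<open>j\<close> because the coordinates of a graph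
  are not orthonormal in general.\<close>

lemma bilinear_form_bound:
  fixes h :: "'v::real_vector \<Rightarrow> 'v \<Rightarrow> real" and j :: "'v \<Rightarrow> 'w::real_inner"
  assumes h: "bilinear h" and sym: "\<And>z w. h z w = h w z"
    and j: "linear j" "inj j" and bound: "\<And>z. \<bar>h z z\<bar> \<le> c * (j z \<bullet> j z)"
  shows "\<bar>h z w\<bar> \<le> c * norm (j z) * norm (j w)"
proof (cases "z = 0 \<or> w = 0")
  case True
  then show ?thesis using bilinear_lzero[OF h] bilinear_rzero[OF h] linear_0[OF j(1)] by auto
next
  case False
  then have nz: "j z \<noteq> 0" "j w \<noteq> 0" using linear_injective_0[OF j(1)] j(2) by auto
  define z' w' where "z' = z /\<^sub>R norm (j z)" and "w' = w /\<^sub>R norm (j w)"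
  have n: "j z' \<bullet> j z' = 1" "j w' \<bullet> j w' = 1"
    using nz by (simp_all add: z'_def w'_def linear_scale[OF j(1)] dot_square_norm power2_eq_square)
  have "4 * h z' w' = h (z' + w') (z' + w') - h (z' - w') (z' - w')"
    using sym[of w' z'] by (simp add: bilinear_ladd[OF h] bilinear_radd[OF h] bilinear_lsub[OF h] bilinear_rsub[OF h])
  then have "4 * \<bar>h z' w'\<bar> \<le> c * (j (z' + w') \<bullet> j (z' + w')) + c * (j (z' - w') \<bullet> j (z' - w'))"
    using bound[of "z' + w'"] bound[of "z' - w'"] by linarith
  also have "\<dots> = 4 * c"
    by (simp add: linear_add[OF j(1)] linear_diff[OF j(1)] inner_add_left inner_add_right
        inner_diff_left inner_diff_right n inner_commute algebra_simps)
  finally have "\<bar>h z' w'\<bar> \<le> c" by simp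
  moreover have "h z w = norm (j z) * norm (j w) * h z' w'"
  proof -
    have "h z w = h (norm (j z) *\<^sub>R z') (norm (j w) *\<^sub>R w')" using nz by (simp add: z'_def w'_def)
    then show ?thesis by (simp add: bilinear_lmul[OF h] bilinear_rmul[OF h])
  qed
  ultimately have "\<bar>h z w\<bar> \<le> norm (j z) * norm (j w) * c" by (simp add: abs_mult mult_left_mono)
  then show ?thesis by (simp add: mult_ac)
qed

text \<open>A null vector minimises a nonnegative form, so the first variation vanishes there.
  Applied to the second fundamental form minus kappa_1 times the metric, it turns a minimising
  direction into an eigenvector.\<close>

lemma nonneg_form_null_vector:
  fixes h :: "'v::real_inner \<Rightarrow> 'v \<Rightarrow> real"
  assumes h: "bilinear h" and sym: "\<And>z w. h z w = h w z" and nonneg: "\<And>z. h z z \<ge> 0" and e: "h e e = 0"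
  shows "h z e = 0"
proof (rule ccontr)
  assume ne: "h z e \<noteq> 0"
  \<comment> \<open>The minimiser of the quadratic in \<open>t\<close>, up to the added 1, which
    keeps the denominator positive when \<open>h z z = 0\<close>.\<close>
  define t where "t = - h z e / (h z z + 1)"
  have p: "h z z + 1 > 0" using nonneg[of z] by linarith
  have "0 \<le> h (e + t *\<^sub>R z) (e + t *\<^sub>R z)" by (rule nonneg)
  also have "\<dots> = 2 * t * h z e + t\<^sup>2 * h z z"
    using sym[of e z] e by (simp add: bilinear_ladd[OF h] bilinear_radd[OF h] bilinear_lmul[OF h] bilinear_rmul[OF h] power2_eq_square algebra_simps)
  also have "\<dots> = t * h z e - t\<^sup>2"
  proof -
    have "t * (h z z + 1) = - h z e" using p by (simp add: t_def)
    then have "t * (t * (h z z + 1)) = - (t * h z e)" by simp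
    then show ?thesis by (simp add: power2_eq_square algebra_simps)
  qed
  also have "t * h z e = - ((h z e)\<^sup>2 / (h z z + 1))" by (simp add: t_def power2_eq_square)
  also have "- ((h z e)\<^sup>2 / (h z z + 1)) - t\<^sup>2 < 0"
  proof -
    have "(h z e)\<^sup>2 / (h z z + 1) > 0" using ne p by simp
    then show ?thesis using zero_le_power2[of t] by linarith
  qed
  finally show False by simp
qed

section \<open>The differential inequality at an interior minimum\<close>

context hypersurface
begin

lemma graph_patch_subset:
  "graph_patch N \<iota> D s f \<Longrightarrow> open D' \<Longrightarrow> D' \<subseteq> D \<Longrightarrow> graph_patch N \<iota> D' s f"
  unfolding graph_patch_def
  by (auto intro: continuous_map_from_subtopology_mono smooth_on_subset)

text \<open>On a graph the position vector pairs with the unit normal to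
  \<open>f v - v \<bullet> gradient f v\<close> over the area element, so the self-expander equation
  becomes a quasilinear elliptic equation for \<open>f\<close>.\<close>

lemma graph_mean_curvature_expander:
  assumes n: "CARD('n) \<ge> 2" and G: "graph_patch N \<iota> D s f" and v: "v \<in> D"
    and H: "mean_curvature \<A> x \<nu> (s v) = x (s v) \<bullet> \<nu> (s v)"
  shows "mean_curvature \<A> x \<nu> (s v) = (f v - v \<bullet> gradient f v) / sqrt (1 + gradient f v \<bullet> gradient f v)"
    "(\<Sum>i\<in>UNIV. dderivs [axis i 1, axis i 1] f v) - dderivs [gradient f v, gradient f v] f v / (1 + gradient f v \<bullet> gradient f v)
      = f v - v \<bullet> gradient f v"
proof -
  note g = graph_patchD[OF G]
  define W where "W = sqrt (1 + gradient f v \<bullet> gradient f v)"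
  have W: "W > 0" by (simp add: W_def add_pos_nonneg)
  have "(\<iota> v + f v *\<^sub>R N) \<bullet> (N - \<iota> (gradient f v)) = f v - v \<bullet> gradient f v"
    using g(1) by (simp add: inner_add_left inner_diff_right normal_frameD(3-5)[OF g(2)] norm_eq_1)
  then show *: "mean_curvature \<A> x \<nu> (s v) = (f v - v \<bullet> gradient f v) / sqrt (1 + gradient f v \<bullet> gradient f v)"
    unfolding H g(6)[OF v] graph_normal(1)[OF G v] by simp
  show "(\<Sum>i\<in>UNIV. dderivs [axis i 1, axis i 1] f v) - dderivs [gradient f v, gradient f v] f v / (1 + gradient f v \<bullet> gradient f v)
      = f v - v \<bullet> gradient f v"
    using graph_mean_curvature[OF n G v] * W by (simp add: W_def)
qed

text \<open>In the proof \<open>b\<close> and \<open>c\<close> are the tangential and normal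
  components of \<open>x q\<close>, and \<open>c\<close> is H. The exponential still contributes 2 n
  \<open>\<epsilon>\<close> after paying for the drift. In the penalty, 8 R collects 2 R from the
  normal component, 2 R from the term <x^T, grad> and 4 R from the drift, by the bounds R on
  \<open>x q\<close> and 1 on \<open>x q - a\<close>.\<close>

lemma interior_minimum_bound:
  assumes n: "CARD('n) \<ge> 3"
    and H: "\<And>p. p \<in> topspace X \<Longrightarrow> mean_curvature \<A> x \<nu> p = x p \<bullet> \<nu> p"
    and q: "q \<in> topspace X" and convex: "kappa \<A> x \<nu> 1 q + kappa \<A> x \<nu> 2 q > 0"
    and S: "openin X S" "q \<in> S"
    and min: "\<And>p. p \<in> S \<Longrightarrow>
      (\<mu> + \<epsilon> * exp (x p \<bullet> x p) - \<theta> * ((x p - a) \<bullet> (x p - a))) * mean_curvature \<A> x \<nu> p \<le> kappa \<A> x \<nu> 1 p"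
    and eq: "kappa \<A> x \<nu> 1 q = (\<mu> + \<epsilon> * exp (x q \<bullet> x q) - \<theta> * ((x q - a) \<bullet> (x q - a))) * mean_curvature \<A> x \<nu> q"
    and pos: "\<epsilon> \<ge> 0" "\<theta> \<ge> 0" and R: "norm (x q) \<le> R" "norm (x q - a) \<le> 1"
  shows "2 * real CARD('n) * \<epsilon> \<le> \<theta> * (2 * real CARD('n) + 8 * R)"
proof -
  have n2: "CARD('n) \<ge> 2" using n by simp
  \<comment> \<open>The graph is taken over the tangent plane at \<open>q\<close>, so that its
    gradient vanishes at \<open>b\<close>.\<close>
  define N where "N = \<nu> q"
  have N: "norm N = 1" unfolding N_def by (rule norm_normal[OF q])
  obtain \<iota> where \<iota>: "normal_frame N \<iota>" using normal_frame_exists[OF N] by blast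
  note P = normal_frame_adjoint[OF \<iota> N]
  define b where "b = adjoint \<iota> (x q)"
  have "\<nu> q \<bullet> N > 0" using N by (simp add: N_def norm_eq_1)
  then obtain r s f where r: "r > 0" and G0: "graph_patch N \<iota> (ball b r) s f" and sb: "s b = q"
    using local_graph[OF q N \<iota>] unfolding b_def by blast
  define D where "D = {v \<in> ball b r. s v \<in> S}"
  have "openin (top_of_set (ball b r)) {v \<in> topspace (top_of_set (ball b r)). s v \<in> S}"
    by (rule openin_continuous_map_preimage[OF graph_patchD(4)[OF G0] S(1)])
  then have "open D" unfolding D_def using openin_open_trans by auto
  then have G: "graph_patch N \<iota> D s f"
    by (rule graph_patch_subset[OF G0]) (auto simp: D_def)
  have b: "b \<in> D" using r S(2) sb by (simp add: D_def)
  have SD: "s v \<in> S" "s v \<in> topspace X" if "v \<in> D" for v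
    using that graph_patchD(9)[OF G that] by (auto simp: D_def)
  note g = graph_patchD[OF G]
  note f = g(7)
  define c where "c = f b"
  have xq: "x q = \<iota> b + c *\<^sub>R N" using g(6)[OF b] by (simp add: sb c_def)
  have "N = (1 / sqrt (1 + gradient f b \<bullet> gradient f b)) *\<^sub>R (N - \<iota> (gradient f b))"
    using graph_normal(1)[OF G b] by (simp add: sb N_def)
  from arg_cong[OF this, of "adjoint \<iota>"]
  have "(1 / sqrt (1 + gradient f b \<bullet> gradient f b)) *\<^sub>R gradient f b = 0"
    by (simp add: linear_scale[OF P(1)] linear_diff[OF P(1)] P(2,3))
  moreover have "sqrt (1 + gradient f b \<bullet> gradient f b) > 0" by (simp add: add_pos_nonneg)
  ultimately have grad: "gradient f b = 0" by auto
  have crit: "dderivs [z] f b = 0" for z using gradient_inner[OF f b, of z] by (simp add: grad)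
  have Hq: "mean_curvature \<A> x \<nu> q = c"
    using graph_mean_curvature_expander(1)[OF n2 G b] H[OF q] by (simp add: sb grad c_def)
  have c: "c > 0" using two_convex_II_bound(1)[OF q n convex] by (simp add: Hq)
  define h where "h z w = dderivs [z, w] f b" for z w
  have hbil: "bilinear h" unfolding h_def[abs_def] by (rule bilinear_hessian[OF f b])
  have hsym: "h z w = h w z" for z w unfolding h_def by (rule dderivs_swap[OF f b])
  have IIq: "II q (\<iota> z) = h z z" for z
    using graph_II[OF G b, of z] by (simp add: sb crit grad h_def)
  have tang: "\<iota> z \<bullet> \<nu> q = 0" for z using normal_frameD(3)[OF \<iota>] by (simp add: N_def)
  have hb: "\<bar>h z z\<bar> \<le> c * (z \<bullet> z)" for z
    using two_convex_II_bound(2)[OF q n convex tang[of z]] by (simp add: IIq Hq normal_frameD(5)[OF \<iota>])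
  have hbound: "\<bar>h z w\<bar> \<le> c * norm z * norm w" for z w
    using bilinear_form_bound[OF hbil hsym linear_ident _ hb] by simp
  define \<kappa> where "\<kappa> = kappa \<A> x \<nu> 1 q"
  obtain e0 where e0: "norm e0 = 1" "e0 \<bullet> \<nu> q = 0" "II q e0 = \<kappa>"
    using kappa1_attained[OF q n2] unfolding \<kappa>_def by blast
  obtain e where e: "e0 = \<iota> e" using normal_frameD(6)[OF \<iota>, of e0] e0(2) N_def by blast
  have ee: "e \<bullet> e = 1" using e0(1) normal_frameD(2)[OF \<iota>, of e] by (simp add: e norm_eq_1)
  define h' where "h' z w = h z w - \<kappa> * (z \<bullet> w)" for z w
  have "bilinear h'"
    unfolding h'_def bilinear_def
    by (auto intro!: linearI simp: bilinear_ladd[OF hbil] bilinear_radd[OF hbil] bilinear_lmul[OF hbil]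
        bilinear_rmul[OF hbil] inner_add_left inner_add_right algebra_simps)
  moreover have "h' z z \<ge> 0" for z
    using kappa1_le_II[OF q n2 tang[of z]] by (simp add: h'_def IIq normal_frameD(5)[OF \<iota>] \<kappa>_def)
  moreover have "h' e e = 0" using e0(3) by (simp add: h'_def e IIq ee)
  moreover have "h' z w = h' w z" for z w by (simp only: h'_def hsym[of z w] inner_commute)
  ultimately have "h' z e = 0" for z
    using nonneg_form_null_vector[of h' e z] by blast
  then have eig: "dderivs [z, e] f b = \<kappa> * (z \<bullet> e)" for z by (simp add: h'_def h_def)
  define a' where "a' = adjoint \<iota> a"
  define d where "d = a \<bullet> N"
  \<comment> \<open>The comparison function in graph coordinates: |x|^2 is |v|^2 + f^2, and likewise
    for the distance to \<open>a\<close>.\<close>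
  define \<Psi> where "\<Psi> v = \<mu> + \<epsilon> * exp (v \<bullet> v + (f v)\<^sup>2) - \<theta> * ((v - a') \<bullet> (v - a') + (f v - d)\<^sup>2)" for v
  have nrm: "(\<iota> w + l *\<^sub>R N) \<bullet> (\<iota> w + l *\<^sub>R N) = w \<bullet> w + l\<^sup>2" for w l
    using N by (simp add: inner_add_left inner_add_right normal_frameD(3-5)[OF \<iota>] norm_eq_1 power2_eq_square)
  have a: "a = \<iota> a' + d *\<^sub>R N" unfolding a'_def d_def by (rule P(4))
  have diffa: "\<iota> w + l *\<^sub>R N - a = \<iota> (w - a') + (l - d) *\<^sub>R N" for w l
  proof -
    have "\<iota> w + l *\<^sub>R N - (\<iota> a' + d *\<^sub>R N) = \<iota> (w - a') + (l - d) *\<^sub>R N"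
      by (simp add: linear_diff[OF normal_frameD(1)[OF \<iota>]] scaleR_diff_left)
    then show ?thesis using a by simp
  qed
  have \<Psi>x: "\<Psi> v = \<mu> + \<epsilon> * exp (x (s v) \<bullet> x (s v)) - \<theta> * ((x (s v) - a) \<bullet> (x (s v) - a))" if "v \<in> D" for v
    unfolding \<Psi>_def g(6)[OF that] diffa nrm ..
  have \<Psi>b: "\<Psi> b = \<kappa> / c"
    using eq c unfolding \<Psi>x[OF b] sb by (simp add: Hq \<kappa>_def field_simps)
  define E where "E = exp (b \<bullet> b + c\<^sup>2)"
  define gk where "gk k = \<epsilon> * (E * (2 * b $ k)) - \<theta> * (2 * (b - a') $ k)" for k
  define mk where "mk k = \<epsilon> * (E * (1 + c * h (axis k 1) (axis k 1) + (2 * b $ k)\<^sup>2 / 2))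
      - \<theta> * (1 + (c - d) * h (axis k 1) (axis k 1))" for k
  have jet\<Psi>: "jet (\<lambda>t. \<Psi> (b + t *\<^sub>R axis k 1)) (\<kappa> / c) (gk k) (mk k)" for k
  proof -
    have jf: "jet (\<lambda>t. f (b + t *\<^sub>R axis k 1)) c 0 (h (axis k 1) (axis k 1) / 2)"
      using smooth_jet[OF f b, of "[]" "axis k 1"] crit by (simp add: c_def h_def)
    have jv: "jet (\<lambda>t. (b + t *\<^sub>R axis k 1 - w) \<bullet> (b + t *\<^sub>R axis k 1 - w)) ((b - w) \<bullet> (b - w)) (2 * (b - w) $ k) 1" for w
    proof -
      have "(b + t *\<^sub>R axis k 1 - w) \<bullet> (b + t *\<^sub>R axis k 1 - w) = (b - w) \<bullet> (b - w) + 2 * (b - w) $ k * t + 1 * t\<^sup>2" for t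
      proof -
        have "b + t *\<^sub>R axis k 1 - w = (b - w) + t *\<^sub>R axis k 1" by simp
        then show ?thesis
          by (simp only: inner_add_left inner_add_right) (simp add: inner_axis inner_axis' power2_eq_square)
      qed
      then show ?thesis by (simp add: jet_def)
    qed
    have js: "jet (\<lambda>t. (b + t *\<^sub>R axis k 1) \<bullet> (b + t *\<^sub>R axis k 1) + (f (b + t *\<^sub>R axis k 1))\<^sup>2)
        (b \<bullet> b + c\<^sup>2) (2 * b $ k) (1 + c * h (axis k 1) (axis k 1))"
      using jet_add[OF jv[of 0] jet_mult[OF jf jf]] by (simp add: power2_eq_square)
    have jfd: "jet (\<lambda>t. f (b + t *\<^sub>R axis k 1) - d) (c - d) 0 (h (axis k 1) (axis k 1) / 2)"
      using jet_diff[OF jf jet_const[of d]] by simp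
    have jr: "jet (\<lambda>t. (b + t *\<^sub>R axis k 1 - a') \<bullet> (b + t *\<^sub>R axis k 1 - a') + (f (b + t *\<^sub>R axis k 1) - d)\<^sup>2)
        ((b - a') \<bullet> (b - a') + (c - d)\<^sup>2) (2 * (b - a') $ k) (1 + (c - d) * h (axis k 1) (axis k 1))"
      using jet_add[OF jv[of a'] jet_mult[OF jfd jfd]] by (simp add: power2_eq_square)
    have "jet (\<lambda>t. \<Psi> (b + t *\<^sub>R axis k 1)) (\<Psi> b) (gk k) (mk k)"
      unfolding \<Psi>_def
      by (rule jet_eq[OF jet_diff[OF jet_add[OF jet_const jet_cmult[OF jet_exp[OF js]]] jet_cmult[OF jr]]])
        (simp_all add: c_def gk_def mk_def E_def)
    then show ?thesis by (simp only: \<Psi>b)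
  qed
  have minD: "\<Psi> v * (f v - v \<bullet> gradient f v) * (1 + (dderivs [e] f v)\<^sup>2) \<le> dderivs [e, e] f v" if v: "v \<in> D" for v
  proof -
    define W where "W = sqrt (1 + gradient f v \<bullet> gradient f v)"
    have W: "W > 0" by (simp add: W_def add_pos_nonneg)
    have hv: "mean_curvature \<A> x \<nu> (s v) = (f v - v \<bullet> gradient f v) / W"
      unfolding W_def by (rule graph_mean_curvature_expander(1)[OF n2 G v H[OF SD(2)[OF v]]])
    have "\<Psi> v * mean_curvature \<A> x \<nu> (s v) * (1 + (dderivs [e] f v)\<^sup>2) \<le> kappa \<A> x \<nu> 1 (s v) * (1 + (dderivs [e] f v)\<^sup>2)"
      using min[OF SD(1)[OF v]] unfolding \<Psi>x[OF v] by (intro mult_right_mono) auto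
    also have "\<dots> \<le> II (s v) (\<iota> e + dderivs [e] f v *\<^sub>R N)"
      using kappa1_le_II[OF SD(2)[OF v] n2 graph_tangent[OF G v, of e]] by (simp add: nrm ee)
    also have "\<dots> = dderivs [e, e] f v / W" unfolding W_def by (rule graph_II[OF G v])
    finally have "(\<Psi> v * (f v - v \<bullet> gradient f v) * (1 + (dderivs [e] f v)\<^sup>2)) / W \<le> dderivs [e, e] f v / W"
      unfolding hv by simp
    then show ?thesis using W by (simp only: divide_le_cancel)
  qed
  have E: "(\<Sum>i\<in>UNIV. dderivs [axis i 1, axis i 1] f v) -
        dderivs [gradient f v, gradient f v] f v / (1 + gradient f v \<bullet> gradient f v) = f v - v \<bullet> gradient f v"
    if "v \<in> D" for v
    by (rule graph_mean_curvature_expander(2)[OF n2 G that H[OF SD(2)[OF that]]])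
  note main = graph_expander_inequality[OF f b E crit eig ee c_def[symmetric] c jet\<Psi> minD]
  have tr: "(\<Sum>k\<in>UNIV. h (axis k 1) (axis k 1)) = c" using main(1) by (simp add: h_def)
  have hcomp: "(\<Sum>k\<in>UNIV. w $ k * h (axis k 1) b) = h w b" for w
  proof -
    have lin: "linear (\<lambda>w. h w b)" using hbil by (simp add: bilinear_def)
    have "h w b = h (\<Sum>k\<in>UNIV. w $ k *\<^sub>R axis k 1) b" by (simp add: basis_expansion[of w, unfolded scalar_mult_eq_scaleR])
    then show ?thesis by (simp add: linear_sum[OF lin] linear_scale[OF lin])
  qed
  have s1: "(\<Sum>k\<in>UNIV. gk k * h (axis k 1) b) = 2 * \<epsilon> * E * h b b - 2 * \<theta> * h (b - a') b"
  proof -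
    have "(\<Sum>k\<in>UNIV. gk k * h (axis k 1) b) = (\<Sum>k\<in>UNIV. 2 * \<epsilon> * E * (b $ k * h (axis k 1) b) - 2 * \<theta> * ((b - a') $ k * h (axis k 1) b))"
      by (rule sum.cong) (simp_all add: gk_def algebra_simps)
    also have "\<dots> = 2 * \<epsilon> * E * (\<Sum>k\<in>UNIV. b $ k * h (axis k 1) b) - 2 * \<theta> * (\<Sum>k\<in>UNIV. (b - a') $ k * h (axis k 1) b)"
      by (simp add: sum_subtractf sum_distrib_left)
    finally show ?thesis unfolding hcomp .
  qed
  have s2: "(\<Sum>k\<in>UNIV. 2 * mk k + b $ k * gk k) =
      \<epsilon> * E * (2 * real CARD('n) + 2 * c * c + 6 * (b \<bullet> b))
      - \<theta> * (2 * real CARD('n) + 2 * (c - d) * c + 2 * (b \<bullet> (b - a')))"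
  proof -
    have "(\<Sum>k\<in>UNIV. 2 * mk k + b $ k * gk k) = (\<Sum>k\<in>UNIV. \<epsilon> * E * (2 + 2 * c * h (axis k 1) (axis k 1) + 6 * (b $ k * b $ k))
       - \<theta> * (2 + 2 * (c - d) * h (axis k 1) (axis k 1) + 2 * (b $ k * (b - a') $ k)))"
      by (rule sum.cong) (simp_all add: gk_def mk_def power2_eq_square algebra_simps)
    also have "\<dots> = \<epsilon> * E * (\<Sum>k\<in>UNIV. 2 + 2 * c * h (axis k 1) (axis k 1) + 6 * (b $ k * b $ k))
       - \<theta> * (\<Sum>k\<in>UNIV. 2 + 2 * (c - d) * h (axis k 1) (axis k 1) + 2 * (b $ k * (b - a') $ k))"
      by (simp only: sum_subtractf sum_distrib_left)
    finally show ?thesis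
      by (simp add: sum.distrib tr inner_vec_def mult.commute[of "real CARD('n)" 2] flip: sum_distrib_left)
  qed
  \<comment> \<open>Of the term \<open>6 * (b \<bullet> b)\<close>, four parts come from the squared
    gradient in the second derivative of the exponential and two from the term <x^T, grad>. The
    drift takes at most four.\<close>
  have "c * (b \<bullet> b) \<ge> h b b" using hb[of b] by linarith
  then have hbb: "4 / c * h b b \<le> 4 * (b \<bullet> b)" using c by (simp add: field_simps)
  have main': "\<epsilon> * E * (2 * real CARD('n) + 2 * c * c + 6 * (b \<bullet> b) - 4 / c * h b b)
     \<le> \<theta> * (2 * real CARD('n) + 2 * (c - d) * c + 2 * (b \<bullet> (b - a')) - 4 / c * h (b - a') b)"
    using main(2)[folded h_def] unfolding s1 s2 by (simp add: algebra_simps)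
  have E1: "E \<ge> 1" by (simp add: E_def)
  have nq: "(norm (x q))\<^sup>2 = (norm b)\<^sup>2 + c\<^sup>2" "(norm (x q - a))\<^sup>2 = (norm (b - a'))\<^sup>2 + (c - d)\<^sup>2"
    unfolding power2_norm_eq_inner xq diffa nrm by simp_all
  have R0: "R \<ge> 0" using R(1) norm_ge_zero order_trans by blast
  have "(norm b)\<^sup>2 + c\<^sup>2 \<le> R\<^sup>2" "(norm (b - a'))\<^sup>2 + (c - d)\<^sup>2 \<le> 1\<^sup>2"
    using power_mono[OF R(1), of 2] power_mono[OF R(2), of 2] nq by simp_all
  then have "(norm b)\<^sup>2 \<le> R\<^sup>2" "c\<^sup>2 \<le> R\<^sup>2" "(norm (b - a'))\<^sup>2 \<le> 1\<^sup>2" "(c - d)\<^sup>2 \<le> 1\<^sup>2"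
    using zero_le_power2[of c] zero_le_power2[of "norm b"] zero_le_power2[of "c - d"] zero_le_power2[of "norm (b - a')"]
    by linarith+
  then have bR: "norm b \<le> R" "c \<le> R" "norm (b - a') \<le> 1" "\<bar>c - d\<bar> \<le> 1"
    using R0 by (auto intro: power2_le_imp_le simp: abs_le_square_iff)
  have "(c - d) * c \<le> 1 * R" using bR c R0 by (intro mult_mono) auto
  moreover have "b \<bullet> (b - a') \<le> R * 1"
    using norm_cauchy_schwarz[of b "b - a'"] mult_mono[OF bR(1,3) R0] by fastforce
  moreover have "- (4 / c * h (b - a') b) \<le> 4 * R"
  proof -
    have "- h (b - a') b \<le> c * (norm (b - a') * norm b)" using hbound[of "b - a'" b] by (simp add: mult.assoc)
    also have "\<dots> \<le> c * (1 * R)" using bR c by (intro mult_left_mono mult_mono) auto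
    finally have "- h (b - a') b \<le> R * c" by (simp add: mult.commute)
    then have "- h (b - a') b / c \<le> R" by (simp only: pos_divide_le_eq[OF c])
    then show ?thesis by simp
  qed
  ultimately have "2 * real CARD('n) + 2 * ((c - d) * c) + 2 * (b \<bullet> (b - a')) - 4 / c * h (b - a') b \<le> 2 * real CARD('n) + 8 * R"
    by linarith
  then have "2 * real CARD('n) + 2 * (c - d) * c + 2 * (b \<bullet> (b - a')) - 4 / c * h (b - a') b \<le> 2 * real CARD('n) + 8 * R"
    by (simp only: mult.assoc)
  then have rhs: "\<theta> * (2 * real CARD('n) + 2 * (c - d) * c + 2 * (b \<bullet> (b - a')) - 4 / c * h (b - a') b) \<le> \<theta> * (2 * real CARD('n) + 8 * R)"
    using pos by (intro mult_left_mono)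
  have "2 * real CARD('n) \<le> 2 * real CARD('n) + 2 * c * c + 6 * (b \<bullet> b) - 4 / c * h b b"
    using hbb inner_ge_zero[of b] zero_le_square[of c] by linarith
  then have "1 * (2 * real CARD('n)) \<le> E * (2 * real CARD('n) + 2 * c * c + 6 * (b \<bullet> b) - 4 / c * h b b)"
    using E1 by (intro mult_mono) auto
  then have "\<epsilon> * (2 * real CARD('n)) \<le> \<epsilon> * (E * (2 * real CARD('n) + 2 * c * c + 6 * (b \<bullet> b) - 4 / c * h b b))"
    using pos by (intro mult_left_mono) auto
  with main' rhs show ?thesis by (simp add: mult_ac)
qed

end

section \<open>Completeness and graphs of uniform size\<close>

lemma continuous_map_local:
  assumes "\<And>v. v \<in> D \<Longrightarrow> \<exists>\<delta>>0. \<exists>t. continuous_map (top_of_set (D \<inter> ball v \<delta>)) Y t \<and> (\<forall>w\<in>D \<inter> ball v \<delta>. s w = t w)"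
  shows "continuous_map (top_of_set D) Y s"
  unfolding continuous_map_def
proof (intro conjI allI impI)
  show "s \<in> topspace (top_of_set D) \<rightarrow> topspace Y"
  proof
    fix v assume "v \<in> topspace (top_of_set D)"
    then have v: "v \<in> D" by simp
    from assms[OF v] obtain \<delta> t where "\<delta> > 0" "continuous_map (top_of_set (D \<inter> ball v \<delta>)) Y t" "\<forall>w\<in>D \<inter> ball v \<delta>. s w = t w"
      by blast
    then have "t v \<in> topspace Y" "s v = t v"
      using continuous_map_image_subset_topspace v by fastforce+
    then show "s v \<in> topspace Y" by simp
  qed
  fix U assume U: "openin Y U"
  show "openin (top_of_set D) {v \<in> topspace (top_of_set D). s v \<in> U}"
  proof (subst openin_subopen, intro ballI)
    fix v assume v: "v \<in> {v \<in> topspace (top_of_set D). s v \<in> U}"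
    then have vD: "v \<in> D" by simp
    from assms[OF vD] obtain \<delta> t where d: "\<delta> > 0" and t: "continuous_map (top_of_set (D \<inter> ball v \<delta>)) Y t"
      "\<forall>w\<in>D \<inter> ball v \<delta>. s w = t w" by blast
    have "openin (top_of_set (D \<inter> ball v \<delta>)) {w \<in> topspace (top_of_set (D \<inter> ball v \<delta>)). t w \<in> U}"
      by (rule openin_continuous_map_preimage[OF t(1) U])
    then have "openin (top_of_set D) {w \<in> D \<inter> ball v \<delta>. t w \<in> U}"
      using openin_trans openin_open_Int[OF open_ball] by fastforce
    moreover have "v \<in> {w \<in> D \<inter> ball v \<delta>. t w \<in> U}" using v d t(2) vD by auto
    moreover have "{w \<in> D \<inter> ball v \<delta>. t w \<in> U} \<subseteq> {v \<in> topspace (top_of_set D). s v \<in> U}" using t(2) by auto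
    ultimately show "\<exists>T. openin (top_of_set D) T \<and> v \<in> T \<and> T \<subseteq> {v \<in> topspace (top_of_set D). s v \<in> U}" by blast
  qed
qed

text \<open>The source of lower bounds for the induced distance. If the length is finite, the speed
  is integrable and the fundamental theorem of calculus applies across the finitely many exceptional
  points.\<close>

lemma chord_le_curve_length:
  fixes c :: "real \<Rightarrow> 'v::euclidean_space"
  assumes c: "c piecewise_C1_differentiable_on {0..1}" and a: "0 \<le> a" "a \<le> 1"
  shows "ennreal (norm (c 1 - c a)) \<le> curve_length c"
proof (cases "curve_length c = \<infinity>")
  case False
  let ?c' = "\<lambda>t. vector_derivative c (at t)"
  from c obtain S where S: "finite S" and C1: "c C1_differentiable_on ({0..1} - S)" and cont: "continuous_on {0..1} c"
    by (auto simp: piecewise_C1_differentiable_on_def)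
  have der: "(c has_vector_derivative ?c' t) (at t)" if "t \<in> {0..1} - S" for t
    using C1 that by (auto simp: C1_differentiable_on_eq vector_derivative_works)
  have cont': "continuous_on ({0..1} - S) ?c'" using C1 by (auto simp: C1_differentiable_on_eq)
  \<comment> \<open>The speed, set to 0 off the interval and at the exceptional points, where
    \<open>vector_derivative\<close> carries no information. This makes it measurable and does not
    change the integral.\<close>
  define g where "g t = indicator ({0..1} - S) t *\<^sub>R norm (?c' t)" for t
  have meas: "g \<in> borel_measurable borel"
    unfolding g_def
    by (intro borel_measurable_continuous_on_indicator continuous_intros cont' sets.Diff borel_closed
        closed_atLeastAtMost finite_imp_closed S)
  have AE: "AE t in lborel. ennreal (norm (?c' t)) * indicator {0..1} t = ennreal (g t)"
  proof (rule AE_I'[of S])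
    show "S \<in> null_sets lborel" using S by (rule finite_imp_null_set_lborel)
    show "{t \<in> space lborel. ennreal (norm (?c' t)) * indicator {0..1} t \<noteq> ennreal (g t)} \<subseteq> S"
      by (auto simp: g_def indicator_def split: if_splits)
  qed
  have len: "curve_length c = (\<integral>\<^sup>+ t. ennreal (g t) \<partial>lborel)"
    unfolding curve_length_def by (rule nn_integral_cong_AE[OF AE])
  have g0: "g t \<ge> 0" for t by (simp add: g_def)
  have int: "integrable lborel g"
    using False len meas g0 by (intro integrableI_nonneg) (auto simp: less_top)
  have "ennreal (integral\<^sup>L lborel g) = curve_length c"
    using nn_integral_eq_integral[OF int] g0 len by simp
  moreover have "norm (c 1 - c a) \<le> integral\<^sup>L lborel g"
  proof -
    have gi: "(g has_integral integral\<^sup>L lborel g) UNIV" by (rule has_integral_integral_lborel[OF int])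
    have ga: "g integrable_on {a..1}"
      using integrable_on_subinterval[OF has_integral_integrable[OF gi], of a 1] by simp
    define d where "d t = (if t \<in> S then 0 else ?c' t)" for t
    have "(?c' has_integral (c 1 - c a)) {a..1}"
      by (rule fundamental_theorem_of_calculus_interior_strong[OF S a(2)])
        (use a in \<open>auto intro: der continuous_on_subset[OF cont]\<close>)
    then have d: "(d has_integral (c 1 - c a)) {a..1}"
      by (rule has_integral_spike_finite[OF S, rotated]) (simp add: d_def)
    have "norm (integral {a..1} d) \<le> integral {a..1} g"
      by (rule integral_norm_bound_integral[OF has_integral_integrable[OF d] ga])
        (use a in \<open>auto simp: d_def g_def indicator_def\<close>)
    also have "\<dots> \<le> integral UNIV g"
      by (rule integral_subset_le) (use ga gi g0 in \<open>auto simp: has_integral_integrable\<close>)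
    also have "\<dots> = integral\<^sup>L lborel g" by (rule integral_unique[OF gi])
    finally show ?thesis by (simp add: integral_unique[OF d])
  qed
  ultimately show ?thesis by (metis ennreal_leI)
qed simp

text \<open>The differential at \<open>u\<close> expands by \<open>B\<close>; on a small ball
  \<open>F\<close> differs from it by a map with Lipschitz constant \<open>B / 2\<close>, which
  leaves the expansion constant \<open>B / 2\<close>.\<close>

lemma smooth_immersion_expanding:
  assumes F: "smooth_on U F" and u: "u \<in> U" and inj: "inj (\<lambda>v. dderivs [v] F u)"
  obtains r c C where "r > 0" "c > 0" "cball u r \<subseteq> U"
    "\<And>a b. a \<in> cball u r \<Longrightarrow> b \<in> cball u r \<Longrightarrow> c * norm (a - b) \<le> norm (F a - F b)"
    "\<And>a v. a \<in> cball u r \<Longrightarrow> c * norm v \<le> norm (dderivs [v] F a)"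
    "\<And>a v. a \<in> cball u r \<Longrightarrow> norm (dderivs [v] F a) \<le> C * norm v"
proof -
  define L where "L = (\<lambda>v. dderivs [v] F u)"
  have L: "linear L" unfolding L_def by (rule linear_dderivs1[OF F u])
  obtain B where B: "B > 0" "\<And>v. B * norm v \<le> norm (L v)"
    using linear_inj_bounded_below_pos[OF L] inj unfolding L_def by blast
  obtain r0 where r0: "r0 > 0" "cball u r0 \<subseteq> U" using smooth_on_open[OF F] u open_contains_cball by blast
  define n where "n = real (card (Basis :: 'a set))"
  have n: "n > 0" by (simp add: n_def DIM_positive)
  have "\<exists>d>0. \<forall>y. dist y u < d \<longrightarrow> norm (dderivs [b] F y - dderivs [b] F u) \<le> B / (2 * n)" for b
  proof -
    have "isCont (dderivs [b] F) u"
      using continuous_on_dderivs[OF F] smooth_on_open[OF F] u continuous_on_eq_continuous_at by blast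
    moreover have "B / (2 * n) > 0" using B n by simp
    ultimately show ?thesis unfolding continuous_at_eps_delta dist_norm by (meson less_imp_le)
  qed
  then obtain d where d: "\<And>b. d b > 0" "\<And>b y. dist y u < d b \<Longrightarrow> norm (dderivs [b] F y - dderivs [b] F u) \<le> B / (2 * n)"
    by metis
  \<comment> \<open>Half of the minimum, because the estimates of the basis derivatives hold on open
    balls and are needed on a closed one.\<close>
  define r where "r = min r0 (Min (d ` Basis) / 2)"
  have r: "r > 0" using r0 d(1) by (simp add: r_def)
  have sub: "cball u r \<subseteq> U" using r0 by (auto simp: r_def)
  have der: "((\<lambda>y. F y - L y) has_derivative (\<lambda>v. dderivs [v] F y - L v)) (at y within cball u r)" if "y \<in> cball u r" for y
    using sub that
    by (intro has_derivative_diff has_derivative_at_withinI[OF smooth_on_has_derivative[OF F]]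
        linear_imp_has_derivative L) auto
  have dif: "norm (dderivs [v] F y - L v) \<le> B / 2 * norm v" if y: "y \<in> cball u r" for y v
  proof -
    have yU: "y \<in> U" using sub y by blast
    define R where "R v = dderivs [v] F y - L v" for v
    have "linear R" unfolding R_def by (intro linear_compose_sub linear_dderivs1[OF F yU] L)
    then have "norm (R v) = norm (\<Sum>b\<in>Basis. (v \<bullet> b) *\<^sub>R R b)" by (metis linear_Basis_expansion)
    also have "\<dots> \<le> (\<Sum>b\<in>Basis. \<bar>v \<bullet> b\<bar> * norm (R b))" by (rule order_trans[OF norm_sum]) simp
    also have "\<dots> \<le> (\<Sum>b\<in>(Basis::'a set). norm v * (B / (2 * n)))"
    proof (rule sum_mono, rule mult_mono)
      fix b :: 'a assume b: "b \<in> Basis"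
      show "\<bar>v \<bullet> b\<bar> \<le> norm v" using b by (simp add: Basis_le_norm)
      have "Min (d ` Basis) \<le> d b" using b by simp
      moreover have "dist y u \<le> r" using y by (simp add: dist_commute)
      ultimately have "dist y u < d b" using d(1)[of b] r unfolding r_def by linarith
      then show "norm (R b) \<le> B / (2 * n)" using d(2) by (simp add: R_def L_def)
    qed auto
    also have "\<dots> = B / 2 * norm v" using n by (simp add: n_def)
    finally show "norm (dderivs [v] F y - L v) \<le> B / 2 * norm v" by (simp add: R_def)
  qed
  have on: "onorm (\<lambda>v. dderivs [v] F y - L v) \<le> B / 2" if "y \<in> cball u r" for y
    using dif[OF that] B by (intro onorm_bound) auto
  obtain BL where BL: "\<And>v. norm (L v) \<le> BL * norm v" using linear_bounded[OF L] by blast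
  show ?thesis
  proof (rule that[OF r _ sub, of "B / 2" "BL + B / 2"])
    show "B / 2 > 0" using B by simp
    fix a v assume a: "a \<in> cball u r"
    show "B / 2 * norm v \<le> norm (dderivs [v] F a)"
      using dif[OF a, of v] B(2)[of v] norm_triangle_ineq2[of "L v" "dderivs [v] F a"]
      by (simp add: norm_minus_commute)
    show "norm (dderivs [v] F a) \<le> (BL + B / 2) * norm v"
      using dif[OF a, of v] BL[of v] norm_triangle_sub[of "dderivs [v] F a" "L v"]
      by (simp add: algebra_simps)
  next
    fix a b assume ab: "a \<in> cball u r" "b \<in> cball u r"
    have "norm ((F a - L a) - (F b - L b)) \<le> B / 2 * norm (a - b)"
      by (rule differentiable_bound[OF convex_cball der on ab])
    moreover have "(F a - L a) - (F b - L b) = (F a - F b) - L (a - b)" by (simp add: linear_diff[OF L])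
    moreover have "norm (L (a - b)) \<le> norm (F a - F b) + norm ((F a - F b) - L (a - b))"
      using norm_triangle_ineq4[of "F a - F b" "(F a - F b) - L (a - b)"] by simp
    ultimately show "B / 2 * norm (a - b) \<le> norm (F a - F b)" using B(2)[of "a - b"] by simp
  qed
qed

section \<open>Convergence in the induced distance\<close>

context hypersurface
begin

lemma x_tendsto:
  assumes "limitin X q p F"
  shows "((\<lambda>s. x (q s)) \<longlongrightarrow> x p) F"
proof -
  have "p \<in> topspace X" using assms by (simp add: limitin_def)
  then obtain U \<phi> u where c: "(U, \<phi>) \<in> \<A>" "u \<in> U" "\<phi> u = p" using chart_at by blast
  have "limitin X q (\<phi> u) F" using assms c(3) by simp
  then obtain \<zeta> where \<zeta>: "(\<zeta> \<longlongrightarrow> 0) F" "\<forall>\<^sub>F s in F. u + \<zeta> s \<in> U \<and> q s = \<phi> (u + \<zeta> s)"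
    using curve_in_chart[OF c(1,2)] by blast
  have "((\<lambda>s. u + \<zeta> s) \<longlongrightarrow> u + 0) F" by (intro tendsto_intros \<zeta>)
  then have "((\<lambda>s. dderivs [] (x \<circ> \<phi>) (u + \<zeta> s)) \<longlongrightarrow> dderivs [] (x \<circ> \<phi>) u) F"
    by (intro tendsto_dderivs_gen[OF chart_smooth[OF c(1)] c(2)]) simp
  then have "((\<lambda>s. x (\<phi> (u + \<zeta> s))) \<longlongrightarrow> x p) F" by (simp add: c(3))
  then show ?thesis by (rule Lim_transform_eventually) (use \<zeta>(2) in \<open>auto elim: eventually_mono\<close>)
qed

lemma x_continuous: "continuous_map X euclidean x"
proof -
  have "limitin X id p (atin X p)" if "p \<in> topspace X" for p
    using continuous_map_id[of X] that unfolding continuous_map_atin by auto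
  then show ?thesis unfolding continuous_map_atin using x_tendsto[of id] by simp
qed

text \<open>A curve that ends at \<open>p\<close> and starts outside the image of a small coordinate
  ball has to pass the image of its boundary sphere. As the parametrization is expanding, this costs
  length at least \<open>c0 * \<rho>\<close>, so short curves to \<open>p\<close> start
  inside.\<close>

lemma induced_dist_limitin:
  assumes \<sigma>: "\<And>i::nat. \<sigma> i \<in> topspace X" and p: "p \<in> topspace X"
    and lim: "(\<lambda>i. induced_dist X x (\<sigma> i) p) \<longlonglongrightarrow> 0"
  shows "limitin X \<sigma> p sequentially"
  unfolding limitin_def
proof (intro conjI p allI impI)
  fix O' assume O': "openin X O' \<and> p \<in> O'"
  obtain U \<phi> u where c: "(U, \<phi>) \<in> \<A>" "u \<in> U" and pu: "\<phi> u = p" using chart_at[OF p] by blast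
  obtain r c0 where r: "r > 0" "c0 > 0" "cball u r \<subseteq> U"
    and exp: "\<And>a b. a \<in> cball u r \<Longrightarrow> b \<in> cball u r \<Longrightarrow> c0 * norm (a - b) \<le> norm ((x \<circ> \<phi>) a - (x \<circ> \<phi>) b)"
    by (rule smooth_immersion_expanding[OF chart_smooth[OF c(1)] c(2) chart_inj[OF c]]) (rule that)
  obtain \<psi> where cont: "continuous_map (top_of_set U) X \<phi>" and \<psi>: "\<And>u. u \<in> U \<Longrightarrow> \<psi> (\<phi> u) = u"
    using chart_inverse[OF c(1)] by metis
  have "openin (top_of_set U) {a \<in> topspace (top_of_set U). \<phi> a \<in> O'}"
    using openin_continuous_map_preimage[OF cont] O' by blast
  then have "open {a \<in> U. \<phi> a \<in> O'}" using openin_open_trans chart_open[OF c(1)] by auto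
  then obtain r' where r': "r' > 0" "ball u r' \<subseteq> {a \<in> U. \<phi> a \<in> O'}"
    using open_contains_ball O' c(2) pu by (metis (mono_tags, lifting) mem_Collect_eq)
  define \<rho> where "\<rho> = min r r'"
  have \<rho>: "\<rho> > 0" "cball u \<rho> \<subseteq> cball u r" "ball u \<rho> \<subseteq> ball u r'" using r r' by (auto simp: \<rho>_def)
  have bO: "\<phi> ` ball u \<rho> \<subseteq> O'" using r'(2) \<rho>(3) by blast
  have op: "openin X (\<phi> ` ball u \<rho>)"
    using chart_image_openin[OF c(1) open_ball] \<rho>(2) r(3) ball_subset_cball by blast
  have "compactin (top_of_set U) (cball u \<rho>)" using \<rho>(2) r(3) by (auto simp: compactin_subtopology)
  from image_compactin[OF this cont] have "compactin X (\<phi> ` cball u \<rho>)" .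
  then have cl: "closedin X (\<phi> ` cball u \<rho>)" using compactin_imp_closedin Hausdorff by blast
  have "\<forall>\<^sub>F i in sequentially. induced_dist X x (\<sigma> i) p < ennreal (c0 * \<rho>)"
    using order_tendstoD(2)[OF lim] r \<rho> by simp
  then show "\<forall>\<^sub>F i in sequentially. \<sigma> i \<in> O'"
  proof eventually_elim
    case (elim i)
    then obtain \<gamma> where \<gamma>: "admissible_curve X x (\<sigma> i) p \<gamma>" "curve_length (x \<circ> \<gamma>) < ennreal (c0 * \<rho>)"
      unfolding induced_dist_def by (auto simp: INF_less_iff)
    have path: "continuous_map (top_of_set {0..1}) X \<gamma>" and C1: "(x \<circ> \<gamma>) piecewise_C1_differentiable_on {0..1}"
      and \<gamma>0: "\<gamma> 0 = \<sigma> i" and \<gamma>1: "\<gamma> 1 = p"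
      using \<gamma>(1) by (auto simp: admissible_curve_def pathin_def)
    have "\<sigma> i \<in> \<phi> ` ball u \<rho>"
    proof (rule ccontr)
      assume notin: "\<sigma> i \<notin> \<phi> ` ball u \<rho>"
      \<comment> \<open>The maximum \<open>t1\<close> of \<open>T\<close> is the last time outside
        the image of the open ball. The image of the closed ball is compact, hence closed in the
        Hausdorff space \<open>X\<close>, which puts \<open>\<gamma> t1\<close> on the image of the
        bounding sphere.\<close>
      define T where "T = {t \<in> {0..1}. \<gamma> t \<notin> \<phi> ` ball u \<rho>}"
      have "openin (top_of_set {0..1}) {t \<in> topspace (top_of_set {0..1}). \<gamma> t \<in> \<phi> ` ball u \<rho>}"
        by (rule openin_continuous_map_preimage[OF path op])
      then have "closedin (top_of_set {0..1}) T"
        unfolding closedin_def T_def by (auto elim!: back_subst[of "openin _"])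
      then have "compact T" using closedin_compact by (metis compact_Icc)
      moreover have "0 \<in> T" using notin by (simp add: T_def \<gamma>0)
      ultimately obtain t1 where t1: "t1 \<in> T" "\<And>t. t \<in> T \<Longrightarrow> t \<le> t1"
        using compact_attains_sup[of T] by auto
      have t01: "0 \<le> t1" "t1 \<le> 1" "\<gamma> t1 \<notin> \<phi> ` ball u \<rho>" using t1(1) by (auto simp: T_def)
      have "\<phi> u \<in> \<phi> ` ball u \<rho>" using \<rho>(1) by (intro imageI) simp
      then have "\<gamma> 1 \<in> \<phi> ` ball u \<rho>" by (simp add: \<gamma>1 pu)
      then have "t1 \<noteq> 1" using t01 by auto
      then have t1lt: "t1 < 1" using t01 by simp
      have inb: "\<gamma> t \<in> \<phi> ` ball u \<rho>" if "t1 < t" "t \<le> 1" for t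
        using t1(2)[of t] that t01(1) by (force simp: T_def)
      have "closedin (top_of_set {0..1}) {t \<in> topspace (top_of_set {0..1}). \<gamma> t \<in> \<phi> ` cball u \<rho>}"
        by (rule closedin_continuous_map_preimage[OF path cl])
      then have "closed {t \<in> {0..1}. \<gamma> t \<in> \<phi> ` cball u \<rho>}" using closedin_closed_trans by auto
      moreover have "{t1<..1} \<subseteq> {t \<in> {0..1}. \<gamma> t \<in> \<phi> ` cball u \<rho>}"
      proof
        fix t assume t: "t \<in> {t1<..1}"
        then have "\<gamma> t \<in> \<phi> ` ball u \<rho>" using inb by auto
        then show "t \<in> {t \<in> {0..1}. \<gamma> t \<in> \<phi> ` cball u \<rho>}" using t t01(1) by auto
      qed
      ultimately have "closure {t1<..1} \<subseteq> {t \<in> {0..1}. \<gamma> t \<in> \<phi> ` cball u \<rho>}" by (rule closure_minimal[rotated])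
      moreover have "t1 \<in> closure {t1<..1}" using t1lt by simp
      ultimately have "\<gamma> t1 \<in> \<phi> ` cball u \<rho>" by blast
      then obtain a where a: "a \<in> cball u \<rho>" "\<gamma> t1 = \<phi> a" by auto
      then have "a \<notin> ball u \<rho>" using t01(3) by auto
      then have "norm (u - a) = \<rho>" using a(1) by (auto simp: dist_norm)
      moreover have "c0 * norm (u - a) \<le> norm ((x \<circ> \<phi>) u - (x \<circ> \<phi>) a)"
        by (rule exp) (use a(1) \<rho> r in auto)
      ultimately have "c0 * \<rho> \<le> norm ((x \<circ> \<gamma>) 1 - (x \<circ> \<gamma>) t1)" using a(2) \<gamma>1 pu by simp
      then have "ennreal (c0 * \<rho>) \<le> ennreal (norm ((x \<circ> \<gamma>) 1 - (x \<circ> \<gamma>) t1))" by (rule ennreal_leI)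
      also have "\<dots> \<le> curve_length (x \<circ> \<gamma>)" by (rule chord_le_curve_length[OF C1 t01(1,2)])
      finally show False using \<gamma>(2) by simp
    qed
    then show ?case using bO by blast
  qed
qed

text \<open>In contrast to a \<open>graph_patch\<close>, a section may live on a closed ball and
  carries a quantitative slope bound. Its smoothness is recovered by comparison with patches, with
  which it coincides locally.\<close>

definition graph_section ::
  "'n ambient \<Rightarrow> (real ^ 'n \<Rightarrow> 'n ambient) \<Rightarrow> (real ^ 'n) set \<Rightarrow> (real ^ 'n \<Rightarrow> 'a) \<Rightarrow> bool" where
  "graph_section N \<iota> D s \<longleftrightarrow> continuous_map (top_of_set D) X s \<and>
     (\<forall>v\<in>D. adjoint \<iota> (x (s v)) = v \<and> \<nu> (s v) \<bullet> N \<ge> 1 / 2)"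

lemma graph_sectionD:
  assumes "graph_section N \<iota> D s"
  shows "continuous_map (top_of_set D) X s" "v \<in> D \<Longrightarrow> adjoint \<iota> (x (s v)) = v"
    "v \<in> D \<Longrightarrow> \<nu> (s v) \<bullet> N \<ge> 1 / 2" "v \<in> D \<Longrightarrow> s v \<in> topspace X"
  using assms continuous_map_image_subset_topspace[of "top_of_set D" X s]
  by (auto simp: graph_section_def)

lemma graph_section_subset: "graph_section N \<iota> D s \<Longrightarrow> D' \<subseteq> D \<Longrightarrow> graph_section N \<iota> D' s"
  by (auto simp: graph_section_def intro: continuous_map_from_subtopology_mono)

lemma graph_patch_adjoint:
  "graph_patch N \<iota> D t f \<Longrightarrow> w \<in> D \<Longrightarrow> adjoint \<iota> (x (t w)) = w"
  using normal_frame_adjoint[of N \<iota>] graph_patchD[of N \<iota> D t f]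
  by (simp add: linear_add linear_scale)

text \<open>The image of the patch \<open>t\<close> is open and the projection is injective on it,
  so a section through \<open>q\<close> stays in this image near \<open>v\<close> and has to agree
  with \<open>t\<close> there.\<close>

lemma graph_section_local:
  assumes N: "norm N = 1" and \<iota>: "normal_frame N \<iota>"
    and q: "q \<in> topspace X" "\<nu> q \<bullet> N > 0" "adjoint \<iota> (x q) = v"
  obtains \<delta> t f where "\<delta> > 0" "graph_patch N \<iota> (ball v \<delta>) t f" "t v = q"
    "\<And>D s. graph_section N \<iota> D s \<Longrightarrow> v \<in> D \<Longrightarrow> s v = q \<Longrightarrow> \<exists>\<delta>'>0. \<delta>' \<le> \<delta> \<and> (\<forall>w\<in>D \<inter> ball v \<delta>'. s w = t w)"
proof -
  obtain \<delta> t f where G: "\<delta> > 0" "graph_patch N \<iota> (ball v \<delta>) t f" "t v = q"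
    using local_graph[OF q(1) N \<iota> q(2)] unfolding q(3) by blast
  have op: "openin X (t ` ball v \<delta>)" using graph_patchD(5)[OF G(2)] by simp
  have "\<exists>\<delta>'>0. \<delta>' \<le> \<delta> \<and> (\<forall>w\<in>D \<inter> ball v \<delta>'. s w = t w)"
    if s: "graph_section N \<iota> D s" "v \<in> D" "s v = q" for D s
  proof -
    have "openin (top_of_set D) {w \<in> topspace (top_of_set D). s w \<in> t ` ball v \<delta>}"
      by (rule openin_continuous_map_preimage[OF graph_sectionD(1)[OF s(1)] op])
    then obtain T where T: "open T" "{w \<in> D. s w \<in> t ` ball v \<delta>} = D \<inter> T"
      by (auto simp: openin_open)
    have "t v \<in> t ` ball v \<delta>" using G(1) by (intro imageI) simp
    then have "v \<in> {w \<in> D. s w \<in> t ` ball v \<delta>}" using s(2,3) G(3) by simp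
    then have "v \<in> T" using T(2) by blast
    then obtain \<rho> where \<rho>: "\<rho> > 0" "ball v \<rho> \<subseteq> T" using T(1) open_contains_ball by blast
    have "s w = t w" if w: "w \<in> D \<inter> ball v (min \<rho> \<delta>)" for w
    proof -
      have "w \<in> D \<inter> T" using w \<rho>(2) by auto
      then obtain w' where w': "w' \<in> ball v \<delta>" "s w = t w'" using T(2) by blast
      then have "w = w'" using graph_sectionD(2)[OF s(1), of w] graph_patch_adjoint[OF G(2) w'(1)] w by simp
      then show ?thesis using w' by simp
    qed
    then show ?thesis using \<rho>(1) G(1) by (intro exI[of _ "min \<rho> \<delta>"]) auto
  qed
  then show ?thesis using that[OF G] by blast
qed

text \<open>The set of agreement is closed because \<open>X\<close> is Hausdorff, and open because
  both sections agree with the same patch near each of its points.\<close>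

lemma graph_section_unique:
  assumes N: "norm N = 1" and \<iota>: "normal_frame N \<iota>"
    and s: "graph_section N \<iota> D s" and t: "graph_section N \<iota> D t"
    and D: "connected D" and v0: "v0 \<in> D" "s v0 = t v0" and v: "v \<in> D"
  shows "s v = t v"
proof -
  define E where "E = {v \<in> D. s v = t v}"
  have "closedin (top_of_set D) {v \<in> topspace (top_of_set D). s v = t v}"
    by (rule closedin_continuous_maps_eq[OF Hausdorff graph_sectionD(1)[OF s] graph_sectionD(1)[OF t]])
  then have cl: "closedin (top_of_set D) E" by (simp add: E_def)
  have op: "openin (top_of_set D) E"
  proof (subst openin_subopen, intro ballI)
    fix w assume w: "w \<in> E"
    then have wD: "w \<in> D" "t w = s w" by (auto simp: E_def)
    have "\<nu> (s w) \<bullet> N > 0" using graph_sectionD(3)[OF s wD(1)] by linarith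
    then obtain \<delta> T where loc: "\<And>D s'. graph_section N \<iota> D s' \<Longrightarrow> w \<in> D \<Longrightarrow> s' w = s w \<Longrightarrow>
        \<exists>\<delta>'>0. \<delta>' \<le> \<delta> \<and> (\<forall>u\<in>D \<inter> ball w \<delta>'. s' u = T u)"
      using graph_section_local[OF N \<iota> graph_sectionD(4)[OF s wD(1)] _ graph_sectionD(2)[OF s wD(1)]] by metis
    obtain d1 where d1: "d1 > 0" "\<forall>u\<in>D \<inter> ball w d1. s u = T u" using loc[OF s wD(1) refl] by blast
    obtain d2 where d2: "d2 > 0" "\<forall>u\<in>D \<inter> ball w d2. t u = T u" using loc[OF t wD] by blast
    have "D \<inter> ball w (min d1 d2) \<subseteq> E" using d1(2) d2(2) by (auto simp: E_def)
    moreover have "openin (top_of_set D) (D \<inter> ball w (min d1 d2))" by (simp add: openin_open_Int)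
    moreover have "w \<in> D \<inter> ball w (min d1 d2)" using wD d1 d2 by simp
    ultimately show "\<exists>T. openin (top_of_set D) T \<and> w \<in> T \<and> T \<subseteq> E" by blast
  qed
  have "E = {} \<or> E = D" using D op cl unfolding connected_clopen by blast
  then have "E = D" using v0 by (auto simp: E_def)
  then show ?thesis using v by (auto simp: E_def)
qed

text \<open>\<open>j z\<close> is the tangent vector above \<open>z\<close>. Its vertical part is at
  most twice \<open>norm z\<close> because \<open>\<nu> (s v) \<bullet> N \<ge> 1 / 2\<close>, hence
  the factor 3. The differential of the normal is tangential and represents minus the second
  fundamental form, so a bound \<open>K\<close> for the latter gives
  \<open>K * norm (j z)\<close>.\<close>

lemma graph_section_derivative:
  assumes N: "norm N = 1" and \<iota>: "normal_frame N \<iota>"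
    and D: "open D" and s: "graph_section N \<iota> D s" and v: "v \<in> D"
  defines "j \<equiv> \<lambda>z. \<iota> z - ((\<iota> z \<bullet> \<nu> (s v)) / (N \<bullet> \<nu> (s v))) *\<^sub>R N"
  shows "((\<lambda>w. x (s w)) has_derivative j) (at v)" "norm (j z) \<le> 3 * norm z"
    "\<exists>d. ((\<lambda>w. \<nu> (s w)) has_derivative d) (at v) \<and> (\<forall>K z. K \<ge> 0 \<longrightarrow>
      (\<forall>e. e \<bullet> \<nu> (s v) = 0 \<longrightarrow> \<bar>II (s v) e\<bar> \<le> K * (e \<bullet> e)) \<longrightarrow> norm (d z) \<le> 3 * K * norm z)"
proof -
  note sD = graph_sectionD[OF s]
  have pos: "\<nu> (s v) \<bullet> N > 0" using sD(3)[OF v] by linarith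
  obtain \<delta>0 t f where G0: "\<delta>0 > 0" "graph_patch N \<iota> (ball v \<delta>0) t f" "t v = s v"
    and loc: "\<And>D s'. graph_section N \<iota> D s' \<Longrightarrow> v \<in> D \<Longrightarrow> s' v = s v \<Longrightarrow> \<exists>\<delta>'>0. \<delta>' \<le> \<delta>0 \<and> (\<forall>w\<in>D \<inter> ball v \<delta>'. s' w = t w)"
    using graph_section_local[OF N \<iota> sD(4)[OF v] pos sD(2)[OF v]] by metis
  obtain \<delta> where \<delta>: "\<delta> > 0" "\<delta> \<le> \<delta>0" "\<forall>w\<in>D \<inter> ball v \<delta>. s w = t w" using loc[OF s v refl] by blast
  define D' where "D' = D \<inter> ball v \<delta>"
  have D': "open D'" "v \<in> D'" using D v \<delta> by (auto simp: D'_def)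
  have st: "t w = s w" if "w \<in> D'" for w using \<delta>(3) that by (simp add: D'_def)
  have G: "graph_patch N \<iota> D' t f"
    by (rule graph_patch_subset[OF G0(2) D'(1)]) (use \<delta>(2) in \<open>auto simp: D'_def\<close>)
  note g = graph_patchD[OF G]
  note f = g(7)
  have tv: "t v = s v" using st[OF D'(2)] .
  have lin\<iota>: "linear \<iota>" by (rule normal_frameD(1)[OF \<iota>])
  have Nn: "N \<bullet> \<nu> (s v) \<ge> 1 / 2" using sD(3)[OF v] by (simp add: inner_commute)
  have j: "j z = \<iota> z + dderivs [z] f v *\<^sub>R N" for z
  proof -
    have "\<iota> z \<bullet> \<nu> (s v) + dderivs [z] f v * (N \<bullet> \<nu> (s v)) = 0"
      using graph_tangent[OF G D'(2), of z] by (simp add: tv inner_add_left)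
    then have "dderivs [z] f v = - ((\<iota> z \<bullet> \<nu> (s v)) / (N \<bullet> \<nu> (s v)))"
      using Nn by (simp add: field_simps)
    then show ?thesis by (simp add: j_def)
  qed
  have "((\<lambda>w. \<iota> w + f w *\<^sub>R N) has_derivative (\<lambda>z. \<iota> z + dderivs [z] f v *\<^sub>R N)) (at v)"
    by (intro has_derivative_add linear_imp_has_derivative lin\<iota> has_derivative_scaleR_left
        smooth_on_has_derivative[OF f D'(2)])
  then have "((\<lambda>w. x (s w)) has_derivative (\<lambda>z. \<iota> z + dderivs [z] f v *\<^sub>R N)) (at v)"
    by (rule has_derivative_transform_within_open[OF _ D']) (use g(6) st in auto)
  then have derx: "((\<lambda>w. x (s w)) has_derivative j) (at v)"
    using ext[of j "\<lambda>z. \<iota> z + dderivs [z] f v *\<^sub>R N", OF j] by simp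
  have linj: "linear j" using derx by (rule has_derivative_linear)
  have jn: "norm (j z) \<le> 3 * norm z" for z
  proof -
    have "\<bar>\<iota> z \<bullet> \<nu> (s v)\<bar> \<le> norm z"
      using Cauchy_Schwarz_ineq2[of "\<iota> z" "\<nu> (s v)"] normal_frameD(2)[OF \<iota>, of z] norm_normal[OF sD(4)[OF v]] by simp
    then have "\<bar>\<iota> z \<bullet> \<nu> (s v)\<bar> / (N \<bullet> \<nu> (s v)) \<le> norm z / (1 / 2)"
      using Nn by (intro frac_le) auto
    then have "norm (((\<iota> z \<bullet> \<nu> (s v)) / (N \<bullet> \<nu> (s v))) *\<^sub>R N) \<le> 2 * norm z"
      using Nn N by (simp add: abs_div)
    then show ?thesis
      using norm_triangle_ineq4[of "\<iota> z" "((\<iota> z \<bullet> \<nu> (s v)) / (N \<bullet> \<nu> (s v))) *\<^sub>R N"] normal_frameD(2)[OF \<iota>, of z]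
      by (simp add: j_def)
  qed
  have P: "adjoint \<iota> (j z) = z" for z
    using normal_frame_adjoint(1-3)[OF \<iota> N] by (simp add: j linear_add linear_scale)
  have injj: "inj j" using P by (metis injI)
  have jtang: "j z \<bullet> \<nu> (s v) = 0" for z using graph_tangent[OF G D'(2), of z] by (simp add: tv j)
  define W where "W = sqrt (1 + gradient f v \<bullet> gradient f v)"
  have W: "W > 0" by (simp add: W_def add_pos_nonneg)
  \<comment> \<open>The unit normal is only assumed continuous; its differentiability is obtained
    from the explicit formula for the upward normal of a graph.\<close>
  define y where "y w = 1 + (\<Sum>i\<in>UNIV. dderivs [axis i 1] f w * dderivs [axis i 1] f w)" for w
  have yg: "y w = 1 + gradient f w \<bullet> gradient f w" for w by (simp add: y_def inner_vec_def gradient_def)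
  have ypos: "y v > 0" by (simp add: yg add_pos_nonneg)
  have "smooth_on D' y"
    unfolding y_def by (intro smooth_on_add smooth_on_const smooth_on_sum smooth_on_mult smooth_on_dderivs f D'(1))
  then obtain y' where y': "(y has_derivative y') (at v)" using smooth_on_has_derivative D'(2) by blast
  have "((\<lambda>u. 1 / sqrt u) has_real_derivative (- (inverse (sqrt (y v)) / 2) / (sqrt (y v) * sqrt (y v)))) (at (y v))"
    using ypos by (auto intro!: derivative_eq_intros simp: field_simps)
  then have "((\<lambda>u. 1 / sqrt u) has_derivative (*) (- (inverse (sqrt (y v)) / 2) / (sqrt (y v) * sqrt (y v)))) (at (y v))"
    by (simp add: has_field_derivative_def)
  from has_derivative_compose[OF y' this]
  obtain \<omega> where \<omega>: "((\<lambda>w. 1 / sqrt (y w)) has_derivative \<omega>) (at v)" by blast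
  define n where "n w = N - (\<Sum>i\<in>UNIV. dderivs [axis i 1] f w *\<^sub>R \<iota> (axis i 1))" for w
  have n\<iota>: "n w = N - \<iota> (gradient f w)" for w
  proof -
    have "\<iota> (gradient f w) = \<iota> (\<Sum>i\<in>UNIV. gradient f w $ i *\<^sub>R axis i 1)"
      by (simp add: basis_expansion[of "gradient f w", unfolded scalar_mult_eq_scaleR])
    also have "\<dots> = (\<Sum>i\<in>UNIV. dderivs [axis i 1] f w *\<^sub>R \<iota> (axis i 1))"
      by (simp add: linear_sum[OF lin\<iota>] linear_scale[OF lin\<iota>] gradient_def)
    finally show ?thesis by (simp add: n_def)
  qed
  define n' where "n' z = - (\<Sum>i\<in>UNIV. dderivs [z, axis i 1] f v *\<^sub>R \<iota> (axis i 1))" for z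
  have "(n has_derivative (\<lambda>z. 0 - (\<Sum>i\<in>UNIV. dderivs [z, axis i 1] f v *\<^sub>R \<iota> (axis i 1)))) (at v)"
    unfolding n_def
    by (intro has_derivative_diff has_derivative_const has_derivative_sum has_derivative_scaleR_left
        dderivs_has_derivative[OF f D'(2)])
  then have n': "(n has_derivative n') (at v)" by (simp add: n'_def[abs_def])
  define d where "d z = (1 / sqrt (y v)) *\<^sub>R n' z + \<omega> z *\<^sub>R n v" for z
  have "((\<lambda>w. (1 / sqrt (y w)) *\<^sub>R n w) has_derivative d) (at v)"
    unfolding d_def by (rule has_derivative_scaleR[OF \<omega> n'])
  then have dern: "((\<lambda>w. \<nu> (s w)) has_derivative d) (at v)"
    by (rule has_derivative_transform_within_open[OF _ D'])
      (use graph_normal(1)[OF G] st in \<open>simp add: yg n\<iota>\<close>)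
  define h where "h z w = dderivs [z, w] f v / W" for z w
  note bl = bilinear_hessian[OF f D'(2)]
  have hb: "bilinear h"
    unfolding h_def bilinear_def
    by (auto intro!: linearI simp: bilinear_ladd[OF bl] bilinear_radd[OF bl] bilinear_lmul[OF bl] bilinear_rmul[OF bl]
        add_divide_distrib)
  have nW: "n v = W *\<^sub>R \<nu> (s v)" using graph_normal(1)[OF G D'(2)] W by (simp add: n\<iota> W_def tv)
  have dj: "d z \<bullet> j w = - h z w" for z w
  proof -
    have ij: "\<iota> a \<bullet> j w = a \<bullet> w" for a by (simp add: j inner_add_right normal_frameD(3,5)[OF \<iota>])
    have "n' z \<bullet> j w = - (\<Sum>i\<in>UNIV. dderivs [z, axis i 1] f v * w $ i)"
      by (simp add: n'_def inner_sum_left ij inner_axis')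
    also have "(\<Sum>i\<in>UNIV. dderivs [z, axis i 1] f v * w $ i) = dderivs [z, w] f v"
    proof -
      note lin = linear_dderivs2[OF f D'(2), of z "[]"]
      have "dderivs [z, w] f v = (\<Sum>i\<in>UNIV. dderivs [z, w $ i *\<^sub>R axis i 1] f v)"
        using linear_sum[OF lin, of "\<lambda>i. w $ i *\<^sub>R axis i 1" UNIV]
        by (simp add: basis_expansion[of w, unfolded scalar_mult_eq_scaleR])
      then show ?thesis using linear_scale[OF lin] by (simp add: mult.commute)
    qed
    finally have "n' z \<bullet> j w = - dderivs [z, w] f v" .
    moreover have "n v \<bullet> j w = 0" using jtang[of w] by (simp add: nW inner_commute)
    ultimately show ?thesis by (simp add: d_def inner_add_left h_def W_def yg)
  qed
  have d\<nu>: "d z \<bullet> \<nu> (s v) = 0" for z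
  proof -
    have "((\<lambda>w. \<nu> (s w) \<bullet> \<nu> (s w)) has_derivative (\<lambda>z. \<nu> (s v) \<bullet> d z + d z \<bullet> \<nu> (s v))) (at v)"
      by (rule has_derivative_inner[OF dern dern])
    moreover have "((\<lambda>w. \<nu> (s w) \<bullet> \<nu> (s w)) has_derivative (\<lambda>z. 0)) (at v)"
      by (rule has_derivative_transform_within_open[OF has_derivative_const[of 1] D v])
        (use norm_normal sD(4) in \<open>simp add: norm_eq_1\<close>)
    ultimately have "(\<lambda>z. \<nu> (s v) \<bullet> d z + d z \<bullet> \<nu> (s v)) = (\<lambda>z. 0)" by (rule has_derivative_unique)
    from fun_cong[OF this, of z] show ?thesis by (simp add: inner_commute)
  qed
  have dn: "norm (d z) \<le> 3 * K * norm z"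
    if K: "K \<ge> 0" and II: "\<And>e. e \<bullet> \<nu> (s v) = 0 \<Longrightarrow> \<bar>II (s v) e\<bar> \<le> K * (e \<bullet> e)" for K z
  proof -
    \<comment> \<open>A tangent vector is \<open>j\<close> of its projection. With this
      \<open>w\<close> the identity \<open>dj\<close> computes the squared norm of
      \<open>d z\<close>.\<close>
    define w where "w = adjoint \<iota> (d z)"
    have dz: "d z = \<iota> w + (d z \<bullet> N) *\<^sub>R N" unfolding w_def by (rule normal_frame_adjoint(4)[OF \<iota> N])
    have "\<iota> w \<bullet> \<nu> (s v) + (d z \<bullet> N) * (N \<bullet> \<nu> (s v)) = 0"
      using d\<nu>[of z] by (subst (asm) dz) (simp add: inner_add_left)
    then have "d z \<bullet> N = - ((\<iota> w \<bullet> \<nu> (s v)) / (N \<bullet> \<nu> (s v)))" using Nn by (simp add: field_simps)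
    then have dw: "d z = j w" using dz by (simp add: j_def)
    have "\<bar>h z z\<bar> \<le> K * (j z \<bullet> j z)" for z
      using II[OF jtang[of z]] graph_II[OF G D'(2), of z] by (simp add: tv j h_def W_def)
    then have "\<bar>h z w\<bar> \<le> K * norm (j z) * norm (j w)"
      by (intro bilinear_form_bound[OF hb _ linj injj]) (simp_all add: h_def dderivs_swap[OF f D'(2)])
    moreover have "norm (d z) * norm (d z) = - h z w"
      using dj[of z w] by (simp add: dw flip: power2_norm_eq_inner power2_eq_square)
    ultimately have "norm (d z) * norm (d z) \<le> K * norm (j z) * norm (d z)" by (simp add: dw)
    then have "norm (d z) \<le> K * norm (j z)" using K by (cases "d z = 0") auto
    also have "\<dots> \<le> K * (3 * norm z)" using jn K by (intro mult_left_mono)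
    finally show ?thesis by (simp add: mult_ac)
  qed
  show "((\<lambda>w. x (s w)) has_derivative j) (at v)" "norm (j z) \<le> 3 * norm z" by (fact derx jn)+
  show "\<exists>d. ((\<lambda>w. \<nu> (s w)) has_derivative d) (at v) \<and> (\<forall>K z. K \<ge> 0 \<longrightarrow>
      (\<forall>e. e \<bullet> \<nu> (s v) = 0 \<longrightarrow> \<bar>II (s v) e\<bar> \<le> K * (e \<bullet> e)) \<longrightarrow> norm (d z) \<le> 3 * K * norm z)"
    using dern dn by blast
qed

text \<open>The slope bound improves from 1/2 to 7/8, which is the room needed for continuation. By
  \<open>6 * K * r \<le> 1\<close> the normal moves by at most 1/2 away from \<open>N\<close>, and
  the inner product of unit vectors is 1 minus half their squared distance. The condition
  \<open>3 * r \<le> 1\<close> keeps the section in the region where \<open>K\<close> is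
  available.\<close>

lemma graph_section_bounds:
  assumes N: "norm N = 1" and \<iota>: "normal_frame N \<iota>" and s: "graph_section N \<iota> (ball b r) s"
    and sb: "s b = p" "\<nu> p = N" and r: "3 * r \<le> 1" "6 * K * r \<le> 1" "K \<ge> 0"
    and II: "\<And>q e. q \<in> topspace X \<Longrightarrow> norm (x q - x p) \<le> 1 \<Longrightarrow> e \<bullet> \<nu> q = 0 \<Longrightarrow> \<bar>II q e\<bar> \<le> K * (e \<bullet> e)"
  shows "v \<in> ball b r \<Longrightarrow> norm (x (s v) - x p) \<le> 3 * r"
    and "v \<in> ball b r \<Longrightarrow> \<nu> (s v) \<bullet> N \<ge> 7 / 8"
proof -
  note der = graph_section_derivative[OF N \<iota> open_ball s]
  have x_lip: "norm (x (s v) - x p) \<le> 3 * norm (v - b)" if v: "v \<in> ball b r" for v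
  proof -
    have "b \<in> ball b r" using v by (metis centre_in_ball ball_eq_empty not_less empty_iff)
    moreover have "\<exists>j. ((\<lambda>w. x (s w)) has_derivative j) (at w) \<and> onorm j \<le> 3" if "w \<in> ball b r" for w
      by (rule exI, rule conjI[OF der(1)[OF that]], rule onorm_bound[OF _ der(2)[OF that]]) simp
    then obtain j where j: "\<And>w. w \<in> ball b r \<Longrightarrow> ((\<lambda>w. x (s w)) has_derivative j w) (at w)"
       "\<And>w. w \<in> ball b r \<Longrightarrow> onorm (j w) \<le> 3" by metis
    ultimately show ?thesis
      using differentiable_bound[OF convex_ball has_derivative_at_withinI[OF j(1)] j(2) v, of b] sb by simp
  qed
  have vb: "norm (v - b) \<le> r" if "v \<in> ball b r" for v using that by (simp add: dist_norm norm_minus_commute)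
  show "norm (x (s v) - x p) \<le> 3 * r" if "v \<in> ball b r" for v using x_lip[OF that] vb[OF that] by simp
  assume v: "v \<in> ball b r"
  have "b \<in> ball b r" using v by (metis centre_in_ball ball_eq_empty not_less empty_iff)
  moreover have "\<exists>d. ((\<lambda>w. \<nu> (s w)) has_derivative d) (at w) \<and> onorm d \<le> 3 * K" if w: "w \<in> ball b r" for w
  proof -
    have "norm (x (s w) - x p) \<le> 1" using x_lip[OF w] vb[OF w] r(1) by linarith
    then have "\<forall>e. e \<bullet> \<nu> (s w) = 0 \<longrightarrow> \<bar>II (s w) e\<bar> \<le> K * (e \<bullet> e)"
      using II[OF graph_sectionD(4)[OF s w]] by blast
    then obtain d where d: "((\<lambda>w. \<nu> (s w)) has_derivative d) (at w)" "\<And>z. norm (d z) \<le> 3 * K * norm z"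
      using der(3)[OF w] r(3) by blast
    then have "onorm d \<le> 3 * K" using r(3) by (intro onorm_bound) auto
    then show ?thesis using d(1) by blast
  qed
  then obtain d where d: "\<And>w. w \<in> ball b r \<Longrightarrow> ((\<lambda>w. \<nu> (s w)) has_derivative d w) (at w)"
       "\<And>w. w \<in> ball b r \<Longrightarrow> onorm (d w) \<le> 3 * K" by metis
  ultimately have "norm (\<nu> (s v) - N) \<le> 3 * K * norm (v - b)"
    using differentiable_bound[OF convex_ball has_derivative_at_withinI[OF d(1)] d(2) v, of b] sb by simp
  also have "\<dots> \<le> 3 * K * r" using vb[OF v] r(3) by (intro mult_left_mono) auto
  also have "\<dots> \<le> 1 / 2" using r(2) by simp
  finally have "(norm (\<nu> (s v) - N))\<^sup>2 \<le> (1 / 2)\<^sup>2" by (intro power_mono) auto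
  moreover have "(norm (\<nu> (s v) - N))\<^sup>2 = 2 - 2 * (\<nu> (s v) \<bullet> N)"
    using N norm_normal[OF graph_sectionD(4)[OF s v]]
    by (simp add: power2_norm_eq_inner inner_diff_left inner_diff_right norm_eq_1 inner_commute)
  ultimately show "\<nu> (s v) \<bullet> N \<ge> 7 / 8" by (simp add: power2_eq_square)
qed

text \<open>The segment from \<open>v\<close> to \<open>w\<close> lifts to an admissible curve, with
  speed at most three times that of the segment.\<close>

lemma graph_section_dist:
  assumes N: "norm N = 1" and \<iota>: "normal_frame N \<iota>" and s: "graph_section N \<iota> (ball b r) s"
    and v: "v \<in> ball b r" and w: "w \<in> ball b r"
  shows "induced_dist X x (s v) (s w) \<le> ennreal (3 * norm (w - v))"
proof -
  define z where "z = w - v"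
  define l where "l t = v + t *\<^sub>R z" for t
  define \<gamma> where "\<gamma> t = s (l t)" for t
  have lb: "l t \<in> ball b r" if "t \<in> {0..1}" for t
  proof -
    have "l t = (1 - t) *\<^sub>R v + t *\<^sub>R w" by (simp add: l_def z_def algebra_simps)
    then show ?thesis using convex_ball[of b r] v w that unfolding convex_alt by auto
  qed
  have contl: "continuous_on A l" for A unfolding l_def by (intro continuous_intros)
  have "continuous_map (top_of_set {0..1}) (top_of_set (ball b r)) l"
    using contl lb by auto
  from continuous_map_compose[OF this graph_sectionD(1)[OF s]]
  have path: "continuous_map (top_of_set {0..1}) X \<gamma>" by (simp add: \<gamma>_def[abs_def] o_def)
  define D where "D t = \<iota> z - ((\<iota> z \<bullet> \<nu> (\<gamma> t)) / (N \<bullet> \<nu> (\<gamma> t))) *\<^sub>R N" for t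
  have D: "((x \<circ> \<gamma>) has_vector_derivative D t) (at t)" "norm (D t) \<le> 3 * norm z" if t: "t \<in> {0..1}" for t
  proof -
    define j where "j z = \<iota> z - ((\<iota> z \<bullet> \<nu> (s (l t))) / (N \<bullet> \<nu> (s (l t)))) *\<^sub>R N" for z
    have j: "((\<lambda>w. x (s w)) has_derivative j) (at (l t))" "\<And>z. norm (j z) \<le> 3 * norm z"
      using graph_section_derivative[OF N \<iota> open_ball s lb[OF t]] unfolding j_def by blast+
    have "(l has_derivative (\<lambda>h. h *\<^sub>R z)) (at t)" unfolding l_def by (auto intro!: derivative_eq_intros)
    from has_derivative_compose[OF this j(1)]
    have "((x \<circ> \<gamma>) has_derivative (\<lambda>h. j (h *\<^sub>R z))) (at t)" by (simp add: \<gamma>_def o_def)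
    moreover have "j (h *\<^sub>R z) = h *\<^sub>R D t" for h
      using linear_scale[OF has_derivative_linear[OF j(1)], of h z] by (simp add: j_def D_def \<gamma>_def)
    ultimately show "((x \<circ> \<gamma>) has_vector_derivative D t) (at t)" by (simp add: has_vector_derivative_def)
    show "norm (D t) \<le> 3 * norm z" using j(2)[of z] by (simp add: j_def D_def \<gamma>_def)
  qed
  have "continuous_map (top_of_set {0..1}) euclidean (\<nu> \<circ> \<gamma>)"
    by (rule continuous_map_compose[OF path normal_continuous])
  then have cont\<nu>: "continuous_on {0..1} (\<lambda>t. \<nu> (\<gamma> t))" by (simp add: o_def)
  have "N \<bullet> \<nu> (\<gamma> t) \<noteq> 0" if "t \<in> {0..1}" for t
    using graph_sectionD(3)[OF s lb[OF that]] by (simp add: \<gamma>_def inner_commute)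
  then have "continuous_on {0..1} D" unfolding D_def by (intro continuous_intros cont\<nu>) auto
  then have "(x \<circ> \<gamma>) C1_differentiable_on {0..1}" using D(1) unfolding C1_differentiable_on_def by blast
  then have "admissible_curve X x (s v) (s w) \<gamma>"
    using path by (auto simp: admissible_curve_def pathin_def C1_differentiable_imp_piecewise \<gamma>_def l_def z_def)
  then have "induced_dist X x (s v) (s w) \<le> curve_length (x \<circ> \<gamma>)"
    unfolding induced_dist_def by (intro INF_lower) auto
  also have "\<dots> \<le> (\<integral>\<^sup>+ t. ennreal (3 * norm z) * indicator {0..1::real} t \<partial>lborel)"
    unfolding curve_length_def
  proof (intro nn_integral_mono)
    fix t :: real
    show "ennreal (norm (vector_derivative (x \<circ> \<gamma>) (at t))) * indicator {0..1} t \<le> ennreal (3 * norm z) * indicator {0..1} t"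
      using D[of t] by (auto simp: indicator_def vector_derivative_at intro!: ennreal_leI)
  qed
  also have "\<dots> = ennreal (3 * norm z)" by (simp add: nn_integral_cmult_indicator)
  finally show ?thesis by (simp add: z_def)
qed

section \<open>Continuation of graph sections\<close>

lemma graph_patch_section:
  assumes G: "graph_patch N \<iota> (ball v \<delta>) t f" and \<delta>: "\<delta> > 0" and pos: "\<nu> (t v) \<bullet> N > 1 / 2"
  obtains \<delta>' where "\<delta>' > 0" "\<delta>' \<le> \<delta>" "graph_section N \<iota> (ball v \<delta>') t"
proof -
  note g = graph_patchD[OF G]
  have "continuous_map (top_of_set (ball v \<delta>)) euclidean (\<nu> \<circ> t)"
    by (rule continuous_map_compose[OF g(4) normal_continuous])
  then have "continuous_on (ball v \<delta>) (\<lambda>w. \<nu> (t w) \<bullet> N)"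
    by (intro continuous_intros) (simp add: o_def)
  then have "open (ball v \<delta> \<inter> (\<lambda>w. \<nu> (t w) \<bullet> N) -` {1/2<..})"
    by (rule continuous_open_preimage) auto
  moreover have "v \<in> ball v \<delta> \<inter> (\<lambda>w. \<nu> (t w) \<bullet> N) -` {1/2<..}" using \<delta> pos by simp
  ultimately obtain \<rho> where \<rho>: "\<rho> > 0" "ball v \<rho> \<subseteq> ball v \<delta> \<inter> (\<lambda>w. \<nu> (t w) \<bullet> N) -` {1/2<..}"
    using open_contains_ball by metis
  have "graph_section N \<iota> (ball v (min \<rho> \<delta>)) t"
    unfolding graph_section_def
  proof (intro conjI ballI)
    show "continuous_map (top_of_set (ball v (min \<rho> \<delta>))) X t"
      by (rule continuous_map_from_subtopology_mono[OF g(4)]) auto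
    fix w assume "w \<in> ball v (min \<rho> \<delta>)"
    then have w: "w \<in> ball v \<rho>" "w \<in> ball v \<delta>" by auto
    show "adjoint \<iota> (x (t w)) = w" by (rule graph_patch_adjoint[OF G w(2)])
    show "\<nu> (t w) \<bullet> N \<ge> 1 / 2" using \<rho>(2) w(1) by auto
  qed
  then show ?thesis using that[of "min \<rho> \<delta>"] \<rho>(1) \<delta> by simp
qed

text \<open>Radial sequences towards the boundary lift to Cauchy sequences by
  \<open>graph_section_dist\<close>, and completeness supplies boundary values. A patch through a
  boundary value meets the lifted sequence and hence agrees with \<open>s\<close> on the overlap,
  which gives continuity up to the boundary.\<close>

lemma graph_section_extend:
  assumes N: "norm N = 1" and \<iota>: "normal_frame N \<iota>" and s: "graph_section N \<iota> (ball b r) s" and r: "r > 0"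
    and complete: "complete_hypersurface X x" and pos: "\<And>v. v \<in> ball b r \<Longrightarrow> \<nu> (s v) \<bullet> N \<ge> 7 / 8"
  obtains s' where "graph_section N \<iota> (cball b r) s'" "s' b = s b" "\<And>v. v \<in> cball b r \<Longrightarrow> \<nu> (s' v) \<bullet> N \<ge> 7 / 8"
    "\<And>v. v \<in> ball b r \<Longrightarrow> s' v = s v"
proof -
  \<comment> \<open>The factor lies in the interval [1/2, 1) for every \<open>k\<close>, so the
    whole sequence stays in the open ball.\<close>
  define a where "a v k = b + (1 - inverse (real k + 2)) *\<^sub>R (v - b)" for v :: "real^'n" and k
  have ab: "a v k \<in> ball b r" if "v \<in> cball b r" for v k
  proof -
    have p: "0 < inverse (real k + 2)" "inverse (real k + 2) < 1" by (auto simp: field_simps)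
    have "norm (a v k - b) = (1 - inverse (real k + 2)) * norm (v - b)" using p by (simp add: a_def)
    also have "\<dots> < r"
    proof (cases "v = b")
      case False
      then have "(1 - inverse (real k + 2)) * norm (v - b) < 1 * norm (v - b)" using p by (intro mult_strict_right_mono) auto
      then show ?thesis using that by (simp add: dist_norm norm_minus_commute)
    qed (use r in simp)
    finally show ?thesis by (simp add: dist_norm norm_minus_commute)
  qed
  have alim: "a v \<longlonglongrightarrow> v" for v
  proof -
    have "(\<lambda>k. inverse (real k + 2)) \<longlonglongrightarrow> 0" by real_asymp
    then have "(\<lambda>k. b + (1 - inverse (real k + 2)) *\<^sub>R (v - b)) \<longlonglongrightarrow> b + (1 - 0) *\<^sub>R (v - b)" by (intro tendsto_intros)
    then show ?thesis by (simp add: a_def[abs_def])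
  qed
  have "\<exists>q. q \<in> topspace X \<and> limitin X (\<lambda>k. s (a v k)) q sequentially" if v: "v \<in> cball b r" for v
  proof -
    have "\<exists>M. \<forall>i\<ge>M. \<forall>j\<ge>M. induced_dist X x (s (a v i)) (s (a v j)) < e" if e: "e > 0" for e
    proof -
      obtain e0 where e0: "e0 > 0" "ennreal e0 \<le> e"
      proof (cases e)
        case (real y)
        then show ?thesis using that[of y] e by simp
      next
        case top
        then show ?thesis using that[of 1] by simp
      qed
      have "Cauchy (a v)" using alim[of v] by (rule LIMSEQ_imp_Cauchy)
      then obtain M where M: "\<And>i j. i \<ge> M \<Longrightarrow> j \<ge> M \<Longrightarrow> norm (a v i - a v j) < e0 / 3"
        using CauchyD[of "a v" "e0 / 3"] e0(1) by auto
      show ?thesis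
      proof (intro exI[of _ M] allI impI)
        fix i j assume ij: "M \<le> i" "M \<le> j"
        have "induced_dist X x (s (a v i)) (s (a v j)) \<le> ennreal (3 * norm (a v j - a v i))"
          by (rule graph_section_dist[OF N \<iota> s ab[OF v] ab[OF v]])
        also have "\<dots> < ennreal e0" using M[OF ij(2,1)] e0(1) by (simp add: ennreal_lessI)
        also have "\<dots> \<le> e" by (rule e0(2))
        finally show "induced_dist X x (s (a v i)) (s (a v j)) < e" .
      qed
    qed
    then obtain q where q: "q \<in> topspace X" "(\<lambda>i. induced_dist X x (s (a v i)) q) \<longlonglongrightarrow> 0"
      using complete[unfolded complete_hypersurface_def, rule_format, of "\<lambda>k. s (a v k)"] graph_sectionD(4)[OF s ab[OF v]]
      by blast
    then show ?thesis using induced_dist_limitin[of "\<lambda>k. s (a v k)" q] graph_sectionD(4)[OF s ab[OF v]] by blast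
  qed
  then obtain Q where Q: "\<And>v. v \<in> cball b r \<Longrightarrow> Q v \<in> topspace X"
     "\<And>v. v \<in> cball b r \<Longrightarrow> limitin X (\<lambda>k. s (a v k)) (Q v) sequentially" by metis
  have linP: "linear (adjoint \<iota>)" by (rule normal_frame_adjoint(1)[OF \<iota> N])
  have QP: "adjoint \<iota> (x (Q v)) = v" if v: "v \<in> cball b r" for v
  proof -
    have "(\<lambda>k. adjoint \<iota> (x (s (a v k)))) \<longlonglongrightarrow> adjoint \<iota> (x (Q v))"
      using x_tendsto[OF Q(2)[OF v]] by (rule bounded_linear.tendsto[OF linear_conv_bounded_linear[THEN iffD1, OF linP]])
    then have "a v \<longlonglongrightarrow> adjoint \<iota> (x (Q v))" using graph_sectionD(2)[OF s ab[OF v]] by simp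
    then show ?thesis using alim LIMSEQ_unique by blast
  qed
  have Qpos: "\<nu> (Q v) \<bullet> N \<ge> 7 / 8" if v: "v \<in> cball b r" for v
  proof -
    have "limitin euclidean (\<nu> \<circ> (\<lambda>k. s (a v k))) (\<nu> (Q v)) sequentially"
      by (rule continuous_map_limit[OF normal_continuous Q(2)[OF v]])
    then have "(\<lambda>k. \<nu> (s (a v k))) \<longlonglongrightarrow> \<nu> (Q v)" by (simp add: o_def)
    then have "(\<lambda>k. \<nu> (s (a v k)) \<bullet> N) \<longlonglongrightarrow> \<nu> (Q v) \<bullet> N" by (intro tendsto_intros)
    then show ?thesis by (rule LIMSEQ_le_const) (use pos ab[OF v] in blast)
  qed
  have loc: "\<exists>\<delta>>0. \<exists>t. graph_section N \<iota> (ball v \<delta>) t \<and> (\<forall>w\<in>cball b r \<inter> ball v \<delta>. Q w = t w)" if v: "v \<in> cball b r" for v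
  proof -
    have Qv: "\<nu> (Q v) \<bullet> N > 0" "\<nu> (Q v) \<bullet> N > 1 / 2" using Qpos[OF v] by auto
    obtain \<delta>0 t f where t: "\<delta>0 > 0" "graph_patch N \<iota> (ball v \<delta>0) t f" "t v = Q v"
      using graph_section_local[OF N \<iota> Q(1)[OF v] Qv(1) QP[OF v]] by metis
    obtain \<delta> where \<delta>: "\<delta> > 0" "\<delta> \<le> \<delta>0" "graph_section N \<iota> (ball v \<delta>) t"
      using graph_patch_section[OF t(2,1)] Qv(2) t(3) by metis
    have "openin X (t ` ball v \<delta>)" by (rule graph_patchD(5)[OF t(2)]) (use \<delta>(2) in auto)
    moreover have "t v \<in> t ` ball v \<delta>" using \<delta>(1) by (intro imageI) simp
    ultimately have "\<forall>\<^sub>F k in sequentially. s (a v k) \<in> t ` ball v \<delta>"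
      using Q(2)[OF v] t(3) by (auto simp: limitin_def)
    then obtain k where "s (a v k) \<in> t ` ball v \<delta>" using eventually_happens by (metis trivial_limit_sequentially)
    then obtain w where w: "w \<in> ball v \<delta>" "s (a v k) = t w" by auto
    have "w = a v k" using graph_sectionD(2)[OF \<delta>(3) w(1)] graph_sectionD(2)[OF s ab[OF v], of k] w(2) by simp
    then have ak: "a v k \<in> ball b r \<inter> ball v \<delta>" "s (a v k) = t (a v k)" using w ab[OF v] by auto
    have s1: "graph_section N \<iota> (ball b r \<inter> ball v \<delta>) s" and s2: "graph_section N \<iota> (ball b r \<inter> ball v \<delta>) t"
      using graph_section_subset[OF s] graph_section_subset[OF \<delta>(3)] by auto
    \<comment> \<open>Both balls are convex, so agreement at the single point \<open>a v k\<close>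
      spreads over their whole intersection.\<close>
    have conn: "connected (ball b r \<inter> ball v \<delta>)" by (intro convex_connected convex_Int convex_ball)
    have st: "s u = t u" if "u \<in> ball b r \<inter> ball v \<delta>" for u
      by (rule graph_section_unique[where s=s and t=t, OF N \<iota> s1 s2 conn ak that])
    have "Q w = t w" if w: "w \<in> cball b r \<inter> ball v \<delta>" for w
    proof -
      have "\<forall>\<^sub>F k in sequentially. a w k \<in> ball v \<delta>"
        using topological_tendstoD[OF alim[of w] open_ball] w by blast
      then have ev: "\<forall>\<^sub>F k in sequentially. t (a w k) = s (a w k)"
        by (rule eventually_mono) (use st ab[of w] w in auto)
      have "limitin (top_of_set (ball v \<delta>)) (a w) w sequentially"
        using \<open>\<forall>\<^sub>F k in sequentially. a w k \<in> ball v \<delta>\<close> alim[of w] w by (simp add: limitin_subtopology)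
      from continuous_map_limit[OF graph_sectionD(1)[OF \<delta>(3)] this]
      have "limitin X (\<lambda>k. t (a w k)) (t w) sequentially" by (simp add: o_def)
      then have "limitin X (\<lambda>k. s (a w k)) (t w) sequentially"
        by (rule limitin_transform_eventually[OF ev])
      then show ?thesis using limitin_Hausdorff_unique[OF Q(2)] w Hausdorff by (metis IntD1 trivial_limit_sequentially)
    qed
    then show ?thesis using \<delta>(1,3) by blast
  qed
  have "continuous_map (top_of_set (cball b r)) X Q"
  proof (rule continuous_map_local)
    fix v assume "v \<in> cball b r"
    from loc[OF this] obtain \<delta> t where "\<delta> > 0" "graph_section N \<iota> (ball v \<delta>) t" "\<forall>w\<in>cball b r \<inter> ball v \<delta>. Q w = t w"
      by blast
    then show "\<exists>\<delta>>0. \<exists>t. continuous_map (top_of_set (cball b r \<inter> ball v \<delta>)) X t \<and> (\<forall>w\<in>cball b r \<inter> ball v \<delta>. Q w = t w)"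
      using continuous_map_from_subtopology_mono[OF graph_sectionD(1), of N \<iota> "ball v \<delta>" t "cball b r \<inter> ball v \<delta>"]
      by blast
  qed
  moreover have "\<nu> (Q v) \<bullet> N \<ge> 1 / 2" if "v \<in> cball b r" for v using Qpos[OF that] by simp
  ultimately have sec: "graph_section N \<iota> (cball b r) Q" using QP by (simp add: graph_section_def)
  have Qb: "Q v = s v" if v: "v \<in> ball b r" for v
  proof -
    have vc: "v \<in> cball b r" using v by simp
    have "limitin (top_of_set (ball b r)) (a v) v sequentially"
      using alim[of v] v ab[OF vc] by (simp add: limitin_subtopology)
    from continuous_map_limit[OF graph_sectionD(1)[OF s] this]
    have "limitin X (\<lambda>k. s (a v k)) (s v) sequentially" by (simp add: o_def)
    then show ?thesis using limitin_Hausdorff_unique[OF Q(2)[OF vc]] Hausdorff by (metis trivial_limit_sequentially)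
  qed
  show ?thesis by (rule that[OF sec _ Qpos Qb]) (use Qb r in auto)
qed


lemma graph_section_patch:
  assumes N: "norm N = 1" and \<iota>: "normal_frame N \<iota>"
    and y: "y \<in> topspace X" "\<nu> y \<bullet> N > 0" and S: "openin X S" "y \<in> S"
  obtains \<delta> t f where "\<delta> > 0" "graph_patch N \<iota> (ball (adjoint \<iota> (x y)) \<delta>) t f" "t (adjoint \<iota> (x y)) = y"
    "t ` ball (adjoint \<iota> (x y)) \<delta> \<subseteq> S"
proof -
  define v where "v = adjoint \<iota> (x y)"
  obtain r t f where r: "r > 0" and G: "graph_patch N \<iota> (ball v r) t f" and tv: "t v = y"
    using local_graph[OF y(1) N \<iota> y(2)] unfolding v_def by blast
  have "openin (top_of_set (ball v r)) {w \<in> topspace (top_of_set (ball v r)). t w \<in> S}"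
    by (rule openin_continuous_map_preimage[OF graph_patchD(4)[OF G] S(1)])
  then have "open {w \<in> ball v r. t w \<in> S}" using openin_open_trans by auto
  moreover have "v \<in> {w \<in> ball v r. t w \<in> S}" using r tv S(2) by simp
  ultimately obtain \<delta> where \<delta>: "\<delta> > 0" "ball v \<delta> \<subseteq> {w \<in> ball v r. t w \<in> S}"
    using open_contains_ball by metis
  have "graph_patch N \<iota> (ball v \<delta>) t f"
    by (rule graph_patch_subset[OF G open_ball]) (use \<delta>(2) in blast)
  moreover have "t ` ball v \<delta> \<subseteq> S" using \<delta>(2) by blast
  ultimately show ?thesis using that \<delta>(1) tv unfolding v_def by blast
qed

text \<open>The patches around the points of the graph fit together because a local homeomorphism that is
  injective on a compact set is injective on a neighbourhood of it.\<close>

lemma graph_section_beyond: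
  assumes N: "norm N = 1" and \<iota>: "normal_frame N \<iota>" and s: "graph_section N \<iota> (cball b r) s" and r: "r \<ge> 0"
    and pos: "\<And>v. v \<in> cball b r \<Longrightarrow> \<nu> (s v) \<bullet> N > 1 / 2"
  obtains r' s' where "r' > r" "graph_section N \<iota> (ball b r') s'" "s' b = s b"
proof -
  define P where "P y = adjoint \<iota> (x y)" for y
  note sD = graph_sectionD[OF s]
  have Ps: "P (s v) = v" if "v \<in> cball b r" for v using sD(2)[OF that] by (simp add: P_def)
  have contP: "continuous_map X euclidean P"
  proof -
    have "linear (adjoint \<iota>)" by (rule normal_frame_adjoint(1)[OF \<iota> N])
    then have "continuous_map euclidean euclidean (adjoint \<iota>)" by (simp add: linear_continuous_on linear_conv_bounded_linear)
    from continuous_map_compose[OF x_continuous this] show ?thesis by (simp add: P_def[abs_def] o_def)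
  qed
  define Q where "Q = s ` cball b r"
  have "compactin (top_of_set (cball b r)) (cball b r)" by (simp add: compactin_subtopology)
  from image_compactin[OF this sD(1)] have Qc: "compactin X Q" by (simp add: Q_def)
  define A where "A = {y \<in> topspace X. \<nu> y \<bullet> N > 1 / 2}"
  have A: "openin X A"
  proof -
    have "openin X {y \<in> topspace X. \<nu> y \<in> {e. e \<bullet> N > 1 / 2}}"
      by (rule openin_continuous_map_preimage[OF normal_continuous])
        (use open_halfspace_gt[of "1/2" N] in \<open>simp add: inner_commute\<close>)
    then show ?thesis by (simp add: A_def)
  qed
  \<comment> \<open>Pairs of neighbourhoods across which the projection \<open>P\<close> identifies
    no two distinct points. Equal points of \<open>Q\<close> have such neighbourhoods by a local
    patch, distinct ones because their projections differ.\<close>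
  define sep where "sep U V \<longleftrightarrow> openin X U \<and> openin X V \<and> (\<forall>y\<in>U. \<forall>y'\<in>V. P y = P y' \<longrightarrow> y = y')" for U V
  define W where "W = \<Union>{U \<times> V | U V. sep U V}"
  have W: "openin (prod_topology X X) W"
    unfolding W_def by (rule openin_Union) (auto simp: sep_def openin_prod_Times_iff)
  have "(y, y') \<in> W" if y: "y \<in> Q" "y' \<in> Q" for y y'
  proof -
    obtain v v' where v: "v \<in> cball b r" "y = s v" "v' \<in> cball b r" "y' = s v'" using y by (auto simp: Q_def)
    have "\<exists>U V. sep U V \<and> y \<in> U \<and> y' \<in> V"
    proof (cases "v = v'")
      case True
      have "y \<in> topspace X" "\<nu> y \<bullet> N > 0" using sD(4)[OF v(1)] pos[OF v(1)] v(2) by auto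
      from graph_section_patch[OF N \<iota> this openin_topspace]
      obtain \<delta> t f where t: "\<delta> > 0" "graph_patch N \<iota> (ball (P y) \<delta>) t f" "t (P y) = y"
        using \<open>y \<in> topspace X\<close> unfolding P_def by metis
      have op: "openin X (t ` ball (P y) \<delta>)" by (rule graph_patchD(5)[OF t(2)]) auto
      have "t (P y) \<in> t ` ball (P y) \<delta>" using t(1) by (intro imageI) simp
      then have "y \<in> t ` ball (P y) \<delta>" using t(3) by simp
      moreover have "sep (t ` ball (P y) \<delta>) (t ` ball (P y) \<delta>)"
        using op graph_patch_adjoint[OF t(2)] by (auto simp: sep_def P_def)
      moreover have "y' = y" using True v by simp
      ultimately show ?thesis by (intro exI[of _ "t ` ball (P y) \<delta>"]) simp
    next
      case False
      then obtain B B' where B: "open B" "open B'" "v \<in> B" "v' \<in> B'" "B \<inter> B' = {}"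
        using hausdorff[of v v'] by blast
      have "openin X {z \<in> topspace X. P z \<in> B}" "openin X {z \<in> topspace X. P z \<in> B'}"
        using B openin_continuous_map_preimage[OF contP] by auto
      then have "sep {z \<in> topspace X. P z \<in> B} {z \<in> topspace X. P z \<in> B'}" using B(5) by (auto simp: sep_def)
      moreover have "y \<in> {z \<in> topspace X. P z \<in> B}" "y' \<in> {z \<in> topspace X. P z \<in> B'}"
        using v Ps sD(4) B by auto
      ultimately show ?thesis by blast
    qed
    then show ?thesis unfolding W_def by blast
  qed
  then have QW: "Q \<times> Q \<subseteq> W" by auto
  \<comment> \<open>Compactness of \<open>Q\<close> enters through Wallace's theorem: an open set
    containing the square of \<open>Q\<close> contains a product of neighbourhoods of
    \<open>Q\<close>, and on the intersection of these the projection is injective.\<close>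
  obtain O1 O2 where O12: "openin X O1" "openin X O2" "Q \<subseteq> O1" "Q \<subseteq> O2" "O1 \<times> O2 \<subseteq> W"
    using Wallace_theorem_prod_topology[OF Qc Qc W QW] by blast
  define G where "G = O1 \<inter> O2 \<inter> A"
  have G: "openin X G" unfolding G_def using O12 A by (intro openin_Int)
  have GA: "y \<in> topspace X" "\<nu> y \<bullet> N > 1 / 2" if "y \<in> G" for y using that by (auto simp: G_def A_def)
  have QG: "Q \<subseteq> G" using O12(3,4) sD(4) pos by (auto simp: G_def A_def Q_def)
  have inj: "y = y'" if yy: "y \<in> G" "y' \<in> G" "P y = P y'" for y y'
  proof -
    have "(y, y') \<in> W" using O12(5) yy by (auto simp: G_def)
    then show ?thesis using yy(3) by (auto simp: W_def sep_def)
  qed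
  have patch: "\<exists>\<delta>>0. \<exists>t. continuous_map (top_of_set (ball (P y) \<delta>)) X t \<and> (\<forall>w\<in>ball (P y) \<delta>. t w \<in> G \<and> P (t w) = w)"
    if y: "y \<in> G" for y
  proof -
    have "\<nu> y \<bullet> N > 0" using GA(2)[OF y] by simp
    from graph_section_patch[OF N \<iota> GA(1)[OF y] this G y]
    obtain \<delta> t f where t: "\<delta> > 0" "graph_patch N \<iota> (ball (P y) \<delta>) t f" "t ` ball (P y) \<delta> \<subseteq> G"
      unfolding P_def by metis
    then show ?thesis using graph_patchD(4)[OF t(2)] graph_patch_adjoint[OF t(2)] unfolding P_def by blast
  qed
  have opP: "open (P ` G)"
    unfolding open_contains_ball
  proof (intro ballI)
    fix v assume "v \<in> P ` G"
    then obtain y where y: "y \<in> G" "v = P y" by blast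
    from patch[OF y(1)] obtain \<delta> t where "\<delta> > 0" "\<forall>w\<in>ball v \<delta>. t w \<in> G \<and> P (t w) = w" unfolding y(2) by blast
    then show "\<exists>e>0. ball v e \<subseteq> P ` G" by (intro exI[of _ \<delta>]) (auto intro!: rev_image_eqI)
  qed
  have "cball b r \<subseteq> P ` G" using QG Ps by (force simp: Q_def)
  then obtain e where e: "e > 0" "(\<Union>u\<in>cball b r. ball u e) \<subseteq> P ` G"
    using compact_subset_open_imp_ball_epsilon_subset[OF compact_cball opP] by blast
  have sub: "ball b (r + e) \<subseteq> P ` G"
  proof
    fix w assume w: "w \<in> ball b (r + e)"
    have "\<exists>u\<in>cball b r. w \<in> ball u e"
    proof (cases "w \<in> cball b r")
      case False
      then have n: "norm (w - b) > r" by (simp add: dist_norm norm_minus_commute)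
      then have n0: "norm (w - b) > 0" using r by linarith
      define u where "u = b + (r / norm (w - b)) *\<^sub>R (w - b)"
      have nu: "norm (u - b) = r" using n0 r by (simp add: u_def)
      have "w - u = (1 - r / norm (w - b)) *\<^sub>R (w - b)" by (simp add: u_def algebra_simps)
      then have "norm (w - u) = \<bar>1 - r / norm (w - b)\<bar> * norm (w - b)" by simp
      moreover have "\<bar>1 - r / norm (w - b)\<bar> = 1 - r / norm (w - b)" using n n0 by simp
      ultimately have "norm (w - u) = norm (w - b) - r" using n0 by (simp add: left_diff_distrib)
      then show ?thesis using w nu by (intro bexI[of _ u]) (auto simp: dist_norm norm_minus_commute)
    qed (use e(1) in \<open>auto intro!: bexI[of _ w]\<close>)
    then show "w \<in> P ` G" using e(2) by blast
  qed
  define s' where "s' = inv_into G P"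
  have s': "s' w \<in> G" "P (s' w) = w" if "w \<in> P ` G" for w
    using that by (auto simp: s'_def inv_into_into f_inv_into_f)
  have "continuous_map (top_of_set (P ` G)) X s'"
  proof (rule continuous_map_local)
    fix w assume w: "w \<in> P ` G"
    from patch[OF s'(1)[OF w]] obtain \<delta> t where t: "\<delta> > 0" "continuous_map (top_of_set (ball w \<delta>)) X t"
      "\<forall>u\<in>ball w \<delta>. t u \<in> G \<and> P (t u) = u" unfolding s'(2)[OF w] by blast
    have "s' u = t u" if "u \<in> P ` G \<inter> ball w \<delta>" for u
      using inj[OF s'(1), of u "t u"] s'(2)[of u] t(3) that by auto
    then show "\<exists>\<delta>>0. \<exists>t. continuous_map (top_of_set (P ` G \<inter> ball w \<delta>)) X t \<and> (\<forall>u\<in>P ` G \<inter> ball w \<delta>. s' u = t u)"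
      using t(1) continuous_map_from_subtopology_mono[OF t(2), of "P ` G \<inter> ball w \<delta>"] by blast
  qed
  then have "graph_section N \<iota> (P ` G) s'"
    using s' GA(2) unfolding graph_section_def P_def by (meson less_imp_le)
  then have "graph_section N \<iota> (ball b (r + e)) s'" using sub by (rule graph_section_subset)
  moreover have "s' b = s b"
  proof -
    have bc: "b \<in> cball b r" using r by simp
    have "s b \<in> G" using QG bc by (auto simp: Q_def)
    moreover have "b \<in> P ` G" using \<open>cball b r \<subseteq> P ` G\<close> bc by blast
    ultimately show ?thesis using inj[OF s'(1), of b "s b"] s'(2)[of b] Ps[OF bc] by simp
  qed
  ultimately show ?thesis using that[of "r + e" s'] e(1) by simp
qed

text \<open>Continuity method in the radius: \<open>graph_section_extend\<close> reaches the
  boundary of a ball, \<open>graph_section_beyond\<close> crosses it, and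
  \<open>graph_section_bounds\<close> keeps the slope from degenerating up to radius
  \<open>r\<close>. As the conditions on \<open>r\<close> involve only \<open>K\<close>, the size is
  uniform wherever the curvature is bounded.\<close>

lemma uniform_graph_section:
  assumes complete: "complete_hypersurface X x" and p: "p \<in> topspace X" and \<iota>: "normal_frame (\<nu> p) \<iota>"
    and r: "0 < r" "3 * r \<le> 1" "6 * K * r \<le> 1" "K \<ge> 0"
    and II: "\<And>q e. q \<in> topspace X \<Longrightarrow> norm (x q - x p) \<le> 1 \<Longrightarrow> e \<bullet> \<nu> q = 0 \<Longrightarrow> \<bar>II q e\<bar> \<le> K * (e \<bullet> e)"
  obtains s where "graph_section (\<nu> p) \<iota> (cball (adjoint \<iota> (x p)) r) s" "s (adjoint \<iota> (x p)) = p"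
    "\<And>v. v \<in> cball (adjoint \<iota> (x p)) r \<Longrightarrow> norm (x (s v) - x p) \<le> 1"
    "\<And>T. open T \<Longrightarrow> T \<subseteq> ball (adjoint \<iota> (x p)) r \<Longrightarrow> openin X (s ` T)"
proof -
  define N where "N = \<nu> p"
  have N: "norm N = 1" unfolding N_def by (rule norm_normal[OF p])
  note \<iota> = \<iota>[folded N_def]
  define b where "b = adjoint \<iota> (x p)"
  have bounds: "norm (x (s v) - x p) \<le> 3 * \<rho>" "\<nu> (s v) \<bullet> N \<ge> 7 / 8"
    if "graph_section N \<iota> (ball b \<rho>) s" "s b = p" "\<rho> \<le> r" "v \<in> ball b \<rho>" for s \<rho> v
  proof -
    have "6 * K * \<rho> \<le> 6 * K * r" using that(3) r(4) by (intro mult_left_mono) auto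
    then have "3 * \<rho> \<le> 1" "6 * K * \<rho> \<le> 1" using that(3) r by linarith+
    from graph_section_bounds[OF N \<iota> that(1,2) N_def[symmetric] this r(4) II that(4)]
    show "norm (x (s v) - x p) \<le> 3 * \<rho>" "\<nu> (s v) \<bullet> N \<ge> 7 / 8" by blast+
  qed
  define R where "R = {\<rho>. 0 < \<rho> \<and> \<rho> \<le> r \<and> (\<exists>s. graph_section N \<iota> (ball b \<rho>) s \<and> s b = p)}"
  have grow: "\<exists>\<rho>'\<in>R. \<rho>' > \<rho>"
    if g: "graph_section N \<iota> (cball b \<rho>) s" "0 \<le> \<rho>" "\<rho> < r" "s b = p" "\<And>v. v \<in> cball b \<rho> \<Longrightarrow> \<nu> (s v) \<bullet> N > 1 / 2" for \<rho> s
  proof -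
    obtain r' s' where r': "r' > \<rho>" "graph_section N \<iota> (ball b r') s'" "s' b = s b"
      using graph_section_beyond[OF N \<iota> g(1,2,5)] by metis
    have "graph_section N \<iota> (ball b (min r' r)) s'" by (rule graph_section_subset[OF r'(2)]) auto
    then have "min r' r \<in> R" using r' g by (auto simp: R_def)
    moreover have "min r' r > \<rho>" using r'(1) g(3) by simp
    ultimately show ?thesis by blast
  qed
  \<comment> \<open>The continuation starts from the section over the closed ball of radius 0, a
    single point.\<close>
  have "R \<noteq> {}"
  proof -
    have "continuous_map (top_of_set {b}) X (\<lambda>_. p)" using p by simp
    then have "graph_section N \<iota> (cball b 0) (\<lambda>_. p)"
      using N by (auto simp: graph_section_def b_def N_def norm_eq_1)
    from grow[OF this] r(1) N show ?thesis by (auto simp: N_def norm_eq_1)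
  qed
  have bdd: "bdd_above R" by (rule bdd_aboveI[of _ r]) (auto simp: R_def)
  define R' where "R' = Sup R"
  have R'r: "R' \<le> r" unfolding R'_def using \<open>R \<noteq> {}\<close> by (rule cSup_least) (auto simp: R_def)
  have R'up: "\<rho> \<le> R'" if "\<rho> \<in> R" for \<rho> unfolding R'_def using that bdd by (rule cSup_upper)
  obtain \<rho>1 where "\<rho>1 \<in> R" using \<open>R \<noteq> {}\<close> by blast
  then have R'0: "R' > 0" using R'up[of \<rho>1] by (auto simp: R_def)
  have "\<forall>\<rho>\<in>R. \<exists>s. graph_section N \<iota> (ball b \<rho>) s \<and> s b = p" by (auto simp: R_def)
  from bchoice[OF this] obtain \<sigma> where
    \<sigma>: "\<And>\<rho>. \<rho> \<in> R \<Longrightarrow> graph_section N \<iota> (ball b \<rho>) (\<sigma> \<rho>)" "\<And>\<rho>. \<rho> \<in> R \<Longrightarrow> \<sigma> \<rho> b = p" by blast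
  have "\<exists>\<rho>\<in>R. norm (v - b) < \<rho>" if "v \<in> ball b R'" for v
  proof -
    have "norm (v - b) < R'" using that by (simp add: dist_norm norm_minus_commute)
    then show ?thesis using \<open>R \<noteq> {}\<close> bdd unfolding R'_def by (simp add: less_cSup_iff)
  qed
  then obtain \<rho> where \<rho>: "\<And>v. v \<in> ball b R' \<Longrightarrow> \<rho> v \<in> R" "\<And>v. v \<in> ball b R' \<Longrightarrow> norm (v - b) < \<rho> v" by metis
  \<comment> \<open>The sections over balls with radii in \<open>R\<close> agree on overlaps because
    they share the value at the centre; \<open>s\<close> is their union.\<close>
  define s where "s v = \<sigma> (\<rho> v) v" for v
  have agree: "s w = \<sigma> \<rho>' w" if \<rho>': "\<rho>' \<in> R" and w: "w \<in> ball b R'" "norm (w - b) < \<rho>'" for \<rho>' w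
    unfolding s_def
  proof (rule graph_section_unique[where s="\<sigma> (\<rho> w)" and t="\<sigma> \<rho>'" and D="ball b (min (\<rho> w) \<rho>')" and ?v0.0=b, OF N \<iota>])
    show "graph_section N \<iota> (ball b (min (\<rho> w) \<rho>')) (\<sigma> (\<rho> w))"
      by (rule graph_section_subset[OF \<sigma>(1)[OF \<rho>(1)[OF w(1)]]]) auto
    show "graph_section N \<iota> (ball b (min (\<rho> w) \<rho>')) (\<sigma> \<rho>')"
      by (rule graph_section_subset[OF \<sigma>(1)[OF \<rho>']]) auto
    show "\<sigma> (\<rho> w) b = \<sigma> \<rho>' b" using \<sigma>(2) \<rho>(1)[OF w(1)] \<rho>' by simp
    show "w \<in> ball b (min (\<rho> w) \<rho>')" using w(2) \<rho>(2)[OF w(1)] by (simp add: dist_norm norm_minus_commute)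
    show "b \<in> ball b (min (\<rho> w) \<rho>')" using \<rho>(1)[OF w(1)] \<rho>' by (auto simp: R_def)
  qed (intro convex_connected convex_ball)
  have "continuous_map (top_of_set (ball b R')) X s"
  proof (rule continuous_map_local)
    fix v assume v: "v \<in> ball b R'"
    define \<delta> where "\<delta> = \<rho> v - norm (v - b)"
    have "w \<in> ball b (\<rho> v)" if "w \<in> ball v \<delta>" for w
      using that dist_triangle[of b w v] by (simp add: \<delta>_def dist_norm norm_minus_commute)
    then have sub: "ball b R' \<inter> ball v \<delta> \<subseteq> ball b (\<rho> v)" by blast
    have "continuous_map (top_of_set (ball b R' \<inter> ball v \<delta>)) X (\<sigma> (\<rho> v))"
      by (rule continuous_map_from_subtopology_mono[OF graph_sectionD(1)[OF \<sigma>(1)[OF \<rho>(1)[OF v]]] sub])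
    moreover have "s w = \<sigma> (\<rho> v) w" if "w \<in> ball b R' \<inter> ball v \<delta>" for w
    proof (rule agree[OF \<rho>(1)[OF v]])
      show "w \<in> ball b R'" using that by blast
      have "w \<in> ball b (\<rho> v)" using sub that by blast
      then show "norm (w - b) < \<rho> v" by (simp add: dist_norm norm_minus_commute)
    qed
    moreover have "\<delta> > 0" using \<rho>(2)[OF v] by (simp add: \<delta>_def)
    ultimately show "\<exists>\<delta>>0. \<exists>t. continuous_map (top_of_set (ball b R' \<inter> ball v \<delta>)) X t \<and> (\<forall>w\<in>ball b R' \<inter> ball v \<delta>. s w = t w)"
      by blast
  qed
  moreover have "adjoint \<iota> (x (s v)) = v" "\<nu> (s v) \<bullet> N \<ge> 1 / 2" if v: "v \<in> ball b R'" for v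
  proof -
    have "v \<in> ball b (\<rho> v)" using \<rho>(2)[OF v] by (simp add: dist_norm norm_minus_commute)
    then show "adjoint \<iota> (x (s v)) = v" "\<nu> (s v) \<bullet> N \<ge> 1 / 2"
      using graph_sectionD(2,3)[OF \<sigma>(1)[OF \<rho>(1)[OF v]]] by (auto simp: s_def)
  qed
  ultimately have sec: "graph_section N \<iota> (ball b R') s" by (simp add: graph_section_def)
  have sb: "s b = p" using \<sigma>(2)[OF \<rho>(1), of b] R'0 by (simp add: s_def)
  obtain t where t: "graph_section N \<iota> (cball b R') t" "t b = s b" "\<And>v. v \<in> cball b R' \<Longrightarrow> \<nu> (t v) \<bullet> N \<ge> 7 / 8"
    using graph_section_extend[OF N \<iota> sec R'0 complete bounds(2)[OF sec sb R'r]] by metis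
  have tb: "t b = p" using t(2) sb by simp
  \<comment> \<open>Otherwise the extension to the closed ball could be continued beyond
    \<open>R'\<close>, against its choice as supremum.\<close>
  have "R' = r"
  proof (rule ccontr)
    assume "R' \<noteq> r"
    then have lt: "R' < r" using R'r by simp
    have "\<nu> (t v) \<bullet> N > 1 / 2" if "v \<in> cball b R'" for v using t(3)[OF that] by simp
    from grow[OF t(1) less_imp_le[OF R'0] lt tb this] show False using R'up by fastforce
  qed
  note t = t(1)[unfolded this]
  have tball: "graph_section N \<iota> (ball b r) t" using t by (rule graph_section_subset) auto
  have near: "norm (x (t v) - x p) \<le> 1" if v: "v \<in> cball b r" for v
  proof -
    have "continuous_map (top_of_set (cball b r)) euclidean (x \<circ> t)"
      by (rule continuous_map_compose[OF graph_sectionD(1)[OF t] x_continuous])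
    then have "continuous_on (cball b r) (\<lambda>v. norm (x (t v) - x p))"
      by (intro continuous_intros) (simp add: o_def)
    then have "closed (cball b r \<inter> (\<lambda>v. norm (x (t v) - x p)) -` {..1})"
      by (rule continuous_closed_preimage) auto
    moreover have "ball b r \<subseteq> cball b r \<inter> (\<lambda>v. norm (x (t v) - x p)) -` {..1}"
    proof
      fix w assume w: "w \<in> ball b r"
      then show "w \<in> cball b r \<inter> (\<lambda>v. norm (x (t v) - x p)) -` {..1}"
        using bounds(1)[OF tball tb order_refl w] r(2) by auto
    qed
    ultimately have "closure (ball b r) \<subseteq> cball b r \<inter> (\<lambda>v. norm (x (t v) - x p)) -` {..1}" by (rule closure_minimal[rotated])
    then show ?thesis using v r(1) by auto
  qed
  have "openin X (t ` T)" if T: "open T" "T \<subseteq> ball b r" for T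
  proof (subst openin_subopen, intro ballI)
    fix y assume "y \<in> t ` T"
    then obtain v where v: "v \<in> T" "y = t v" by blast
    have vb: "v \<in> ball b r" using v T by blast
    have "\<nu> (t v) \<bullet> N > 0" using graph_sectionD(3)[OF tball vb] by linarith
    then obtain \<delta> t' f where G: "graph_patch N \<iota> (ball v \<delta>) t' f"
      and loc: "\<And>D s. graph_section N \<iota> D s \<Longrightarrow> v \<in> D \<Longrightarrow> s v = t v \<Longrightarrow> \<exists>\<delta>'>0. \<delta>' \<le> \<delta> \<and> (\<forall>w\<in>D \<inter> ball v \<delta>'. s w = t' w)"
      using graph_section_local[OF N \<iota> graph_sectionD(4)[OF tball vb] _ graph_sectionD(2)[OF tball vb]] by metis
    obtain \<delta>' where \<delta>': "\<delta>' > 0" "\<delta>' \<le> \<delta>" "\<forall>w\<in>ball b r \<inter> ball v \<delta>'. t w = t' w" using loc[OF tball vb refl] by blast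
    have "openin X (t' ` (T \<inter> ball v \<delta>'))" by (rule graph_patchD(5)[OF G]) (use \<delta>'(2) T in auto)
    moreover have "t' ` (T \<inter> ball v \<delta>') = t ` (T \<inter> ball v \<delta>')" using \<delta>'(3) T(2) by (intro image_cong) auto
    ultimately show "\<exists>S. openin X S \<and> y \<in> S \<and> S \<subseteq> t ` T"
      using v \<delta>'(1) by (intro exI[of _ "t ` (T \<inter> ball v \<delta>')"]) auto
  qed
  then show ?thesis using that[of t] t tb near unfolding N_def b_def by blast
qed

end

section \<open>The minimum principle for the curvature quotient\<close>

context hypersurface
begin

text \<open>kappa_1 is a minimum over unit tangent vectors. If it stayed at most \<open>c\<close>
  along a subsequence, minimising directions would be bounded in chart coordinates, since the
  immersion is expanding there, and would converge to a unit vector on which the limit form is at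
  most \<open>c\<close>.\<close>

lemma kappa1_lower_semicontinuous:
  assumes n: "CARD('n) \<ge> 2" and q: "limitin X q p sequentially" "\<And>k::nat. q k \<in> topspace X"
    and c: "c < kappa \<A> x \<nu> 1 p"
  shows "\<forall>\<^sub>F k in sequentially. c < kappa \<A> x \<nu> 1 (q k)"
proof (rule ccontr)
  assume "\<not> ?thesis"
  then have "\<exists>\<^sub>F k in sequentially. kappa \<A> x \<nu> 1 (q k) \<le> c" by (simp add: not_eventually not_less)
  then have "infinite {k. kappa \<A> x \<nu> 1 (q k) \<le> c}" by (simp add: frequently_cofinite flip: cofinite_eq_sequentially)
  then obtain r :: "nat \<Rightarrow> nat" where r: "strict_mono r" "\<And>k. kappa \<A> x \<nu> 1 (q (r k)) \<le> c"
    using infinite_enumerate by blast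
  have p: "p \<in> topspace X" using q by (simp add: limitin_def)
  obtain U \<phi> u where ch: "(U, \<phi>) \<in> \<A>" "u \<in> U" and pu: "\<phi> u = p" using chart_at[OF p] by blast
  note sm = chart_smooth[OF ch(1)]
  obtain \<zeta> where \<zeta>: "\<zeta> \<longlonglongrightarrow> 0" "\<forall>\<^sub>F k in sequentially. u + \<zeta> k \<in> U \<and> q k = \<phi> (u + \<zeta> k)"
    using curve_in_chart[OF ch] q(1) pu by blast
  obtain \<rho> c0 where \<rho>: "\<rho> > 0" "c0 > 0"
    and low: "\<And>a v. a \<in> cball u \<rho> \<Longrightarrow> c0 * norm v \<le> norm (dderivs [v] (x \<circ> \<phi>) a)"
    by (rule smooth_immersion_expanding[OF sm ch(2) chart_inj[OF ch]]) (rule that)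
  have "\<forall>\<^sub>F k in sequentially. norm (\<zeta> k) < \<rho>"
    using order_tendstoD(2)[OF tendsto_norm[OF \<zeta>(1)]] \<rho>(1) by simp
  with \<zeta>(2) have "\<forall>\<^sub>F k in sequentially. u + \<zeta> k \<in> U \<and> q k = \<phi> (u + \<zeta> k) \<and> u + \<zeta> k \<in> cball u \<rho>"
    by eventually_elim (simp add: dist_norm)
  then obtain M where M: "\<And>k. k \<ge> M \<Longrightarrow> u + \<zeta> k \<in> U \<and> q k = \<phi> (u + \<zeta> k) \<and> u + \<zeta> k \<in> cball u \<rho>"
    unfolding eventually_sequentially by blast
  define t where "t k = r (k + M)" for k
  have t: "strict_mono t" unfolding t_def using r(1) by (auto simp: strict_mono_def)
  have tM: "t k \<ge> M" for k using seq_suble[OF r(1), of "k + M"] by (simp add: t_def)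
  define a where "a k = u + \<zeta> (t k)" for k
  have a: "a k \<in> U" "q (t k) = \<phi> (a k)" "a k \<in> cball u \<rho>" for k using M[OF tM[of k]] by (auto simp: a_def)
  have "\<exists>\<eta>. norm (dderivs [\<eta>] (x \<circ> \<phi>) (a k)) = 1 \<and> dderivs [\<eta>, \<eta>] (x \<circ> \<phi>) (a k) \<bullet> \<nu> (q (t k)) \<le> c" for k
  proof -
    obtain e where e: "norm e = 1" "e \<bullet> \<nu> (q (t k)) = 0" "II (q (t k)) e = kappa \<A> x \<nu> 1 (q (t k))"
      using kappa1_attained[OF q(2) n] by blast
    have "e \<in> range (\<lambda>v. dderivs [v] (x \<circ> \<phi>) (a k))" unfolding tangent_range[OF ch(1) a(1)] using e(2) a(2) by simp
    then obtain \<eta> where \<eta>: "e = dderivs [\<eta>] (x \<circ> \<phi>) (a k)" by blast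
    have "dderivs [\<eta>, \<eta>] (x \<circ> \<phi>) (a k) \<bullet> \<nu> (q (t k)) = kappa \<A> x \<nu> 1 (q (t k))"
      using II_chart[OF ch(1) a(1)[of k], of \<eta>] e(3) by (simp add: \<eta> a(2))
    then show ?thesis using e(1) r(2)[of "k + M"] \<eta> by (auto simp: t_def)
  qed
  then obtain \<eta> where \<eta>: "\<And>k. norm (dderivs [\<eta> k] (x \<circ> \<phi>) (a k)) = 1"
    "\<And>k. dderivs [\<eta> k, \<eta> k] (x \<circ> \<phi>) (a k) \<bullet> \<nu> (q (t k)) \<le> c" by metis
  have "norm (\<eta> k) \<le> 1 / c0" for k
    using low[OF a(3), of "\<eta> k" k] \<eta>(1)[of k] \<rho>(2) by (simp add: field_simps)
  then have "\<forall>k. \<eta> k \<in> cball 0 (1 / c0)" by simp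
  then obtain \<eta>0 l where l: "strict_mono l" "(\<eta> \<circ> l) \<longlonglongrightarrow> \<eta>0"
    using compact_cball unfolding compact_def by metis
  define m where "m = t \<circ> l"
  have m: "strict_mono m" unfolding m_def using strict_mono_o[OF t l(1)] .
  have \<zeta>m: "(\<lambda>k. u + \<zeta> (m k)) \<longlonglongrightarrow> u"
    using tendsto_add[OF tendsto_const LIMSEQ_subseq_LIMSEQ[OF \<zeta>(1) m], of u] by (simp add: o_def)
  have al: "(\<lambda>k. a (l k)) \<longlonglongrightarrow> u" using \<zeta>m by (simp add: a_def m_def)
  have \<eta>l: "(\<lambda>k. \<eta> (l k)) \<longlonglongrightarrow> \<eta>0" using l(2) by (simp add: o_def)
  have "limitin euclidean (\<nu> \<circ> q) (\<nu> p) sequentially" by (rule continuous_map_limit[OF normal_continuous q(1)])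
  then have "(\<lambda>k. \<nu> (q k)) \<longlonglongrightarrow> \<nu> p" by (simp add: o_def)
  from LIMSEQ_subseq_LIMSEQ[OF this m] have \<nu>l: "(\<lambda>k. \<nu> (q (t (l k)))) \<longlonglongrightarrow> \<nu> p" by (simp add: o_def m_def)
  have "(\<lambda>k. norm (dderivs [\<eta> (l k)] (x \<circ> \<phi>) (a (l k)))) \<longlonglongrightarrow> norm (dderivs [\<eta>0] (x \<circ> \<phi>) u)"
    by (intro tendsto_intros tendsto_dderivs1[OF sm ch(2)] al \<eta>l)
  then have one: "norm (dderivs [\<eta>0] (x \<circ> \<phi>) u) = 1" using \<eta>(1) by (simp add: LIMSEQ_const_iff)
  have "(\<lambda>k. dderivs [\<eta> (l k), \<eta> (l k)] (x \<circ> \<phi>) (a (l k)) \<bullet> \<nu> (q (t (l k)))) \<longlonglongrightarrow> dderivs [\<eta>0, \<eta>0] (x \<circ> \<phi>) u \<bullet> \<nu> p"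
    by (intro tendsto_intros tendsto_dderivs2[OF sm ch(2)] al \<eta>l \<nu>l)
  then have "dderivs [\<eta>0, \<eta>0] (x \<circ> \<phi>) u \<bullet> \<nu> p \<le> c"
    by (rule LIMSEQ_le_const2) (use \<eta>(2) in blast)
  moreover have "kappa \<A> x \<nu> 1 p * 1 \<le> dderivs [\<eta>0, \<eta>0] (x \<circ> \<phi>) u \<bullet> \<nu> p"
    using kappa1_le_II[OF p n, of "dderivs [\<eta>0] (x \<circ> \<phi>) u"] chart_normal[OF ch, of \<eta>0] II_chart[OF ch, of \<eta>0] one
    by (simp add: pu norm_eq_1)
  ultimately show False using c by simp
qed

lemma nonneg_at_infinity_imp_convex:
  assumes n: "CARD('n) \<ge> 3" and complete: "complete_hypersurface X x"
    and H: "\<And>p. p \<in> topspace X \<Longrightarrow> mean_curvature \<A> x \<nu> p = x p \<bullet> \<nu> p"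
    and two_convex: "\<And>p. p \<in> topspace X \<Longrightarrow> kappa \<A> x \<nu> 1 p + kappa \<A> x \<nu> 2 p > 0"
    and infinity: "\<And>\<delta>. \<delta> > 0 \<Longrightarrow> \<exists>R. \<forall>p\<in>topspace X. R \<le> norm (x p) \<longrightarrow> - \<delta> * mean_curvature \<A> x \<nu> p \<le> kappa \<A> x \<nu> 1 p"
    and p0: "p0 \<in> topspace X"
  shows "kappa \<A> x \<nu> 1 p0 \<ge> 0"
proof (rule ccontr)
  assume neg: "\<not> kappa \<A> x \<nu> 1 p0 \<ge> 0"
  define h where "h p = mean_curvature \<A> x \<nu> p" for p
  define k where "k p = kappa \<A> x \<nu> 1 p" for p
  have n2: "CARD('n) \<ge> 2" using n by simp
  have hpos: "h p > 0" if "p \<in> topspace X" for p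
    unfolding h_def by (rule two_convex_II_bound(1)[OF that n two_convex[OF that]])
  have IIh: "\<bar>II p e\<bar> \<le> h p * (e \<bullet> e)" if "p \<in> topspace X" "e \<bullet> \<nu> p = 0" for p e
    unfolding h_def by (rule two_convex_II_bound(2)[OF that(1) n two_convex[OF that(1)] that(2)])
  have hx: "h p \<le> norm (x p)" if "p \<in> topspace X" for p
    using norm_cauchy_schwarz[of "x p" "\<nu> p"] norm_normal[OF that] by (simp add: h_def H[OF that])
  have kh: "- h p \<le> k p" if pt: "p \<in> topspace X" for p
  proof -
    obtain e where e: "norm e = 1" "e \<bullet> \<nu> p = 0" "II p e = k p"
      using kappa1_attained[OF pt n2] unfolding k_def by blast
    then show ?thesis using IIh[OF pt e(2)] by (simp add: norm_eq_1)
  qed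
  \<comment> \<open>Minus the quotient at the point where convexity is supposed to fail. Far out the
    quotient is then at least \<open>- (c / 2)\<close>.\<close>
  define c where "c = - k p0 / h p0"
  have c: "c > 0" using neg hpos[OF p0] by (simp add: c_def k_def divide_neg_pos)
  obtain R where R: "\<And>p. p \<in> topspace X \<Longrightarrow> R \<le> norm (x p) \<Longrightarrow> - (c / 2) * h p \<le> k p"
    using infinity[of "c / 2"] c unfolding h_def k_def by auto
  define R0 where "R0 = max R (norm (x p0) + 1)"
  have R0: "R \<le> R0" "norm (x p0) \<le> R0" "1 \<le> R0" using norm_ge_zero[of "x p0"] unfolding R0_def by linarith+
  \<comment> \<open>Points whose images are within distance 1 of the image of a point of
    \<open>Y\<close> have position vectors bounded by \<open>R1\<close>.\<close>
  define R1 where "R1 = R0 + 1"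
  have R1: "R1 \<ge> 2" using R0 by (simp add: R1_def)
  \<comment> \<open>The barrier is at most \<open>c / 4\<close> up to radius \<open>R1\<close>.
    Between \<open>R0\<close> and \<open>R1\<close> this leaves \<open>w\<close> at least
    \<open>- 3 * c / 4\<close>, above the level \<open>- c\<close> that the infimum does not exceed;
    hence the infimum over \<open>Y\<close> bounds \<open>w\<close> up to radius
    \<open>R1\<close>.\<close>
  define \<epsilon> where "\<epsilon> = c / 4 * exp (- (R1\<^sup>2))"
  have \<epsilon>: "\<epsilon> > 0" using c by (simp add: \<epsilon>_def)
  have \<epsilon>e: "\<epsilon> * exp (x p \<bullet> x p) \<le> c / 4" if "norm (x p) \<le> R1" for p
  proof -
    have "x p \<bullet> x p \<le> R1\<^sup>2" using power_mono[OF that norm_ge_zero, of 2] by (simp add: power2_norm_eq_inner)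
    then have "\<epsilon> * exp (x p \<bullet> x p) \<le> \<epsilon> * exp (R1\<^sup>2)" using \<epsilon> by (intro mult_left_mono) auto
    also have "\<dots> = c / 4" by (simp add: \<epsilon>_def exp_minus)
    finally show ?thesis .
  qed
  define w where "w p = k p / h p - \<epsilon> * exp (x p \<bullet> x p)" for p
  define Y where "Y = {p \<in> topspace X. norm (x p) \<le> R0}"
  have p0Y: "p0 \<in> Y" using p0 R0 by (simp add: Y_def)
  have wlow: "- 1 - c / 4 \<le> w p" if "p \<in> Y" for p
  proof -
    have p: "p \<in> topspace X" "norm (x p) \<le> R1" using that by (auto simp: Y_def R1_def)
    have "- 1 \<le> k p / h p" using kh[OF p(1)] hpos[OF p(1)] by (simp add: field_simps)
    then show ?thesis using \<epsilon>e[OF p(2)] by (simp add: w_def)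
  qed
  have bdd: "bdd_below (w ` Y)" using wlow by (intro bdd_belowI2)
  define m where "m = Inf (w ` Y)"
  have mY: "m \<le> w p" if "p \<in> Y" for p unfolding m_def using that bdd by (simp add: cInf_lower)
  have mc: "m \<le> - c"
  proof -
    have "w p0 \<le> - c" using \<epsilon> by (simp add: w_def c_def)
    then show ?thesis using mY[OF p0Y] by simp
  qed
  have m1: "m \<le> w q" if q: "q \<in> topspace X" "norm (x q) \<le> R1" for q
  proof (cases "norm (x q) \<le> R0")
    case True
    then show ?thesis using q mY by (simp add: Y_def)
  next
    case False
    then have "- (c / 2) * h q \<le> k q" using R[OF q(1)] R0 by simp
    then have "- (c / 2) \<le> k q / h q" using hpos[OF q(1)] by (simp add: field_simps)
    then show ?thesis using \<epsilon>e[OF q(2)] mc c by (simp add: w_def)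
  qed
  \<comment> \<open>|A| <= H <= |x| gives the curvature bound \<open>R1\<close> near the chosen
    point, and this radius meets the conditions of \<open>uniform_graph_section\<close> with
    \<open>R1\<close> for \<open>K\<close>.\<close>
  define r where "r = 1 / (6 * R1)"
  have r: "0 < r" "3 * r \<le> 1" "6 * R1 * r \<le> 1" using R1 by (auto simp: r_def field_simps)
  define nn where "nn = real CARD('n)"
  have nn: "nn > 0" by (simp add: nn_def)
  \<comment> \<open>Half of the value for which \<open>interior_minimum_bound\<close> would be an
    equality: with it the bound reads 2 n \<open>\<epsilon>\<close> <= n
    \<open>\<epsilon>\<close>.\<close>
  define \<theta> where "\<theta> = nn * \<epsilon> / (2 * nn + 8 * R1)"
  have den: "2 * nn + 8 * R1 > 0" using nn R1 by simp
  have \<theta>: "\<theta> > 0" unfolding \<theta>_def using nn \<epsilon> den by simp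
  \<comment> \<open>Over the boundary of the ball the penalty is at least
    \<open>\<theta> * r\<^sup>2\<close>; a defect of less than half of this at the centre forces the
    minimum into the interior.\<close>
  have "m < m + \<theta> * r\<^sup>2 / 2" using \<theta> r by simp
  then obtain p where p: "p \<in> Y" "w p < m + \<theta> * r\<^sup>2 / 2"
    using cInf_lessD[of "w ` Y" "m + \<theta> * r\<^sup>2 / 2"] p0Y unfolding m_def by auto
  have pX: "p \<in> topspace X" "norm (x p) \<le> R0" using p(1) by (auto simp: Y_def)
  define N where "N = \<nu> p"
  have N: "norm N = 1" unfolding N_def by (rule norm_normal[OF pX(1)])
  obtain \<iota> where \<iota>: "normal_frame N \<iota>" using normal_frame_exists[OF N] by blast
  have near: "norm (x q) \<le> R1" if "norm (x q - x p) \<le> 1" for q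
    using norm_triangle_sub[of "x q" "x p"] that pX(2) by (simp add: R1_def)
  have bound: "\<bar>II q e\<bar> \<le> R1 * (e \<bullet> e)" if q: "q \<in> topspace X" "norm (x q - x p) \<le> 1" "e \<bullet> \<nu> q = 0" for q e
  proof -
    have "h q \<le> R1" using hx[OF q(1)] near[OF q(2)] by simp
    then have "h q * (e \<bullet> e) \<le> R1 * (e \<bullet> e)" by (intro mult_right_mono) auto
    then show ?thesis using IIh[OF q(1,3)] by simp
  qed
  define b where "b = adjoint \<iota> (x p)"
  have R10: "0 \<le> R1" using R1 by simp
  obtain s where s: "graph_section N \<iota> (cball b r) s" "s b = p"
    and sx: "\<And>v. v \<in> cball b r \<Longrightarrow> norm (x (s v) - x p) \<le> 1"
    and sop: "\<And>T. open T \<Longrightarrow> T \<subseteq> ball b r \<Longrightarrow> openin X (s ` T)"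
    using uniform_graph_section[OF complete pX(1) \<iota>[unfolded N_def] r R10 bound] unfolding N_def b_def by blast
  note sD = graph_sectionD[OF s(1)]
  define g where "g y = w y + \<theta> * ((x y - x p) \<bullet> (x y - x p))" for y
  define \<Phi> where "\<Phi> v = g (s v)" for v
  have \<Phi>low: "m \<le> \<Phi> v" if "v \<in> cball b r" for v
    using m1[OF sD(4)[OF that] near[OF sx[OF that]]] \<theta> by (simp add: \<Phi>_def g_def add_increasing2)
  have bc: "b \<in> cball b r" using r by simp
  define I where "I = Inf (\<Phi> ` cball b r)"
  have bddI: "bdd_below (\<Phi> ` cball b r)" using \<Phi>low by (intro bdd_belowI2)
  have I: "I \<le> \<Phi> v" if "v \<in> cball b r" for v unfolding I_def using that bddI by (simp add: cInf_lower)
  have "\<exists>v\<in>cball b r. \<Phi> v < I + inverse (real (Suc j))" for j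
    using cInf_lessD[of "\<Phi> ` cball b r" "I + inverse (real (Suc j))"] bc unfolding I_def by force
  then obtain v where v: "\<And>j. v j \<in> cball b r" "\<And>j. \<Phi> (v j) < I + inverse (real (Suc j))" by metis
  obtain v1 l where v1: "v1 \<in> cball b r" "strict_mono l" "(v \<circ> l) \<longlonglongrightarrow> v1"
    using compact_cball[of b r] v(1) unfolding compact_def by metis
  have vl: "(\<lambda>j. v (l j)) \<longlonglongrightarrow> v1" using v1(3) by (simp add: o_def)
  have \<Phi>l: "(\<lambda>j. \<Phi> (v (l j))) \<longlonglongrightarrow> I"
  proof (rule tendsto_sandwich[of "\<lambda>_. I" _ _ "\<lambda>j. I + inverse (real (Suc (l j)))"])
    show "(\<lambda>j. I + inverse (real (Suc (l j)))) \<longlonglongrightarrow> I"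
      using LIMSEQ_subseq_LIMSEQ[OF LIMSEQ_inverse_real_of_nat_add v1(2), of I] by (simp add: o_def)
    show "\<forall>\<^sub>F j in sequentially. \<Phi> (v (l j)) \<le> I + inverse (real (Suc (l j)))"
      using v(2) less_imp_le by (intro always_eventually allI) blast
  qed (use I v(1) in auto)
  have lims: "limitin X (\<lambda>j. s (v (l j))) (s v1) sequentially"
  proof -
    have "limitin (top_of_set (cball b r)) (\<lambda>j. v (l j)) v1 sequentially"
      using vl v1(1) v(1) by (simp add: limitin_subtopology)
    from continuous_map_limit[OF sD(1) this] show ?thesis by (simp add: o_def)
  qed
  have xl: "(\<lambda>j. x (s (v (l j)))) \<longlonglongrightarrow> x (s v1)" by (rule x_tendsto[OF lims])
  have "limitin euclidean (\<nu> \<circ> (\<lambda>j. s (v (l j)))) (\<nu> (s v1)) sequentially"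
    by (rule continuous_map_limit[OF normal_continuous lims])
  then have nl: "(\<lambda>j. \<nu> (s (v (l j)))) \<longlonglongrightarrow> \<nu> (s v1)" by (simp add: o_def)
  have hl: "(\<lambda>j. h (s (v (l j)))) \<longlonglongrightarrow> h (s v1)"
    using tendsto_inner[OF xl nl] H sD(4) v(1) v1(1) by (simp add: h_def)
  \<comment> \<open>The value that kappa_1 has at \<open>y\<close> when \<open>g y = j\<close>.
    Multiplying by H avoids limits of quotients.\<close>
  define z where "z j y = (j + \<epsilon> * exp (x y \<bullet> x y) - \<theta> * ((x y - x p) \<bullet> (x y - x p))) * h y" for j y
  have kz: "k y = z (g y) y" if "y \<in> topspace X" for y
    using hpos[OF that] by (simp add: z_def g_def w_def)
  have "(\<lambda>j. z (\<Phi> (v (l j))) (s (v (l j)))) \<longlonglongrightarrow> z I (s v1)"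
    unfolding z_def by (intro tendsto_intros \<Phi>l xl hl)
  then have kl: "(\<lambda>j. k (s (v (l j)))) \<longlonglongrightarrow> z I (s v1)"
    using kz[OF sD(4)[OF v(1)]] by (simp add: \<Phi>_def)
  \<comment> \<open>Lower semicontinuity of kappa_1 is what makes the limit of the minimising
    sequence a minimum; H and the remaining terms are continuous.\<close>
  have "k (s v1) \<le> z I (s v1)"
  proof (rule ccontr)
    assume "\<not> ?thesis"
    then obtain d where d: "z I (s v1) < d" "d < k (s v1)" using dense not_le by blast
    have "\<forall>\<^sub>F j in sequentially. d < k (s (v (l j)))"
      unfolding k_def by (rule kappa1_lower_semicontinuous[OF n2 lims sD(4)[OF v(1)] d(2)[unfolded k_def]])
    moreover have "\<forall>\<^sub>F j in sequentially. k (s (v (l j))) < d" using order_tendstoD(2)[OF kl d(1)] .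
    ultimately have "\<forall>\<^sub>F j in sequentially. False" by eventually_elim simp
    then show False by simp
  qed
  then have "z (\<Phi> v1) (s v1) \<le> z I (s v1)" using kz[OF sD(4)[OF v1(1)]] by (simp add: \<Phi>_def)
  then have "\<Phi> v1 \<le> I" using hpos[OF sD(4)[OF v1(1)]] by (simp add: z_def)
  then have \<Phi>I: "\<Phi> v1 = I" using I[OF v1(1)] by simp
  have "\<Phi> v1 \<le> \<Phi> b" using I[OF bc] \<Phi>I by simp
  also have "\<Phi> b = w p" by (simp add: \<Phi>_def g_def s(2))
  finally have small: "\<Phi> v1 < m + \<theta> * r\<^sup>2 / 2" using p(2) by simp
  have "norm (v1 - b) < r"
  proof (rule ccontr)
    assume "\<not> ?thesis"
    then have "r \<le> norm (v1 - b)" by simp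
    also have "v1 - b = adjoint \<iota> (x (s v1) - x p)"
      using sD(2)[OF v1(1)] linear_diff[OF normal_frame_adjoint(1)[OF \<iota> N]] by (simp add: b_def)
    also have "norm \<dots> \<le> norm (x (s v1) - x p)" by (rule normal_frame_adjoint(6)[OF \<iota> N])
    finally have "r\<^sup>2 \<le> (norm (x (s v1) - x p))\<^sup>2" using r by (intro power_mono) auto
    then have "\<theta> * r\<^sup>2 \<le> \<theta> * ((x (s v1) - x p) \<bullet> (x (s v1) - x p))"
      using \<theta> by (intro mult_left_mono) (auto simp: power2_norm_eq_inner)
    moreover have "m \<le> w (s v1)" by (rule m1[OF sD(4)[OF v1(1)] near[OF sx[OF v1(1)]]])
    ultimately have "m + \<theta> * r\<^sup>2 \<le> \<Phi> v1" by (simp add: \<Phi>_def g_def)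
    moreover have "\<theta> * r\<^sup>2 > 0" using \<theta> r by simp
    ultimately show False using small by linarith
  qed
  then have v1b: "v1 \<in> ball b r" by (simp add: dist_norm norm_minus_commute)
  have "2 * real CARD('n) * \<epsilon> \<le> \<theta> * (2 * real CARD('n) + 8 * R1)"
  proof (rule interior_minimum_bound[OF n H sD(4)[OF v1(1)] two_convex[OF sD(4)[OF v1(1)]]])
    show "openin X (s ` ball b r)" by (rule sop) auto
    show "s v1 \<in> s ` ball b r" using v1b by blast
    show "(I + \<epsilon> * exp (x y \<bullet> x y) - \<theta> * ((x y - x p) \<bullet> (x y - x p))) * mean_curvature \<A> x \<nu> y \<le> kappa \<A> x \<nu> 1 y"
      if ys: "y \<in> s ` ball b r" for y
    proof -
      obtain u where u: "u \<in> ball b r" "y = s u" using ys by blast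
      then have uc: "u \<in> cball b r" by simp
      have y: "y \<in> topspace X" using sD(4)[OF uc] u by simp
      have "I \<le> g y" using I[OF uc] by (simp add: \<Phi>_def u)
      then have "z I y \<le> z (g y) y" unfolding z_def using hpos[OF y] by (intro mult_right_mono) auto
      then show ?thesis using kz[OF y] by (simp add: z_def h_def k_def)
    qed
    show "kappa \<A> x \<nu> 1 (s v1) = (I + \<epsilon> * exp (x (s v1) \<bullet> x (s v1)) - \<theta> * ((x (s v1) - x p) \<bullet> (x (s v1) - x p))) * mean_curvature \<A> x \<nu> (s v1)"
      using kz[OF sD(4)[OF v1(1)]] \<Phi>I by (simp add: \<Phi>_def z_def h_def k_def)
    show "norm (x (s v1)) \<le> R1" by (rule near[OF sx[OF v1(1)]])
    show "norm (x (s v1) - x p) \<le> 1" by (rule sx[OF v1(1)])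
  qed (use \<epsilon> \<theta> in auto)
  also have "\<dots> = nn * \<epsilon>" using den by (simp add: \<theta>_def nn_def)
  finally show False using nn \<epsilon> by (simp add: nn_def)
qed

end

section \<open>Blow-downs and the asymptotic cone\<close>

lemma jet2_add:
  assumes F: "jet2 F a L B" and G: "jet2 G a L' B'"
  shows "jet2 (\<lambda>z. F z + G z) a (\<lambda>v. L v + L' v) (\<lambda>v. B v + B' v)"
  unfolding jet2_def
proof (intro conjI allI impI)
  show "linear (\<lambda>v. L v + L' v)" using F G by (intro linear_compose_add) (auto simp: jet2_def)
  fix \<zeta> :: "real \<Rightarrow> 'a" and \<xi> assume \<zeta>: "((\<lambda>s. \<zeta> s /\<^sub>R s) \<longlongrightarrow> \<xi>) (at 0)"
  have "((\<lambda>s. (F (a + \<zeta> s) - F a - L (\<zeta> s)) /\<^sub>R s\<^sup>2 + (G (a + \<zeta> s) - G a - L' (\<zeta> s)) /\<^sub>R s\<^sup>2)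
      \<longlongrightarrow> (1/2) *\<^sub>R B \<xi> + (1/2) *\<^sub>R B' \<xi>) (at 0)"
    by (intro tendsto_add jet2D[OF F \<zeta>] jet2D[OF G \<zeta>])
  moreover have "u /\<^sub>R c + v /\<^sub>R c = z /\<^sub>R c" if "u + v = z" for u v z :: 'b and c :: real
    using that by (simp flip: scaleR_add_right)
  then have "(F (a + \<zeta> s) - F a - L (\<zeta> s)) /\<^sub>R s\<^sup>2 + (G (a + \<zeta> s) - G a - L' (\<zeta> s)) /\<^sub>R s\<^sup>2 =
      (F (a + \<zeta> s) + G (a + \<zeta> s) - (F a + G a) - (L (\<zeta> s) + L' (\<zeta> s))) /\<^sub>R s\<^sup>2" for s by simp
  ultimately show "((\<lambda>s. (F (a + \<zeta> s) + G (a + \<zeta> s) - (F a + G a) - (L (\<zeta> s) + L' (\<zeta> s))) /\<^sub>R s\<^sup>2)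
      \<longlongrightarrow> (1/2) *\<^sub>R (B \<xi> + B' \<xi>)) (at 0)"
    by (simp only: scaleR_add_right)
qed

lemma linear_norm_le_Basis:
  fixes L :: "'v::euclidean_space \<Rightarrow> 'w::real_normed_vector"
  assumes L: "linear L" and K: "\<And>b. b \<in> Basis \<Longrightarrow> norm (L b) \<le> K"
  shows "norm (L v) \<le> real DIM('v) * K * norm v"
proof -
  have "norm (L v) = norm (\<Sum>b\<in>Basis. (v \<bullet> b) *\<^sub>R L b)"
    by (metis (mono_tags, lifting) L euclidean_representation linear_scale linear_sum sum.cong)
  also have "\<dots> \<le> (\<Sum>b\<in>Basis. norm ((v \<bullet> b) *\<^sub>R L b))" by (rule norm_sum)
  also have "\<dots> \<le> (\<Sum>b\<in>(Basis :: 'v set). norm v * K)"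
  proof (rule sum_mono)
    fix b :: 'v assume b: "b \<in> Basis"
    have "\<bar>v \<bullet> b\<bar> \<le> norm v" using Basis_le_norm[OF b] by simp
    then show "norm ((v \<bullet> b) *\<^sub>R L b) \<le> norm v * K" using K[OF b] by (simp add: mult_mono)
  qed
  finally show ?thesis by (simp add: mult_ac)
qed

text \<open>\<open>Ck_convergent_in_annulus\<close> controls derivatives along basis vectors only;
  linearity in each slot extends the bounds to arbitrary directions.\<close>

lemma dderivs_norm_le_Basis:
  fixes w :: "'v::euclidean_space \<Rightarrow> 'w::euclidean_space"
  assumes w: "smooth_on W w" "y \<in> W"
    and K: "\<And>vs. length vs \<le> 2 \<Longrightarrow> set vs \<subseteq> Basis \<Longrightarrow> norm (dderivs vs w y) \<le> K"
  shows "norm (dderivs [v] w y) \<le> real DIM('v) * K * norm v"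
    and "norm (dderivs [v, u] w y) \<le> (real DIM('v))\<^sup>2 * K * norm v * norm u"
proof -
  have one: "norm (dderivs (v # vs) w y) \<le> real DIM('v) * K * norm v" if vs: "length vs \<le> 1" "set vs \<subseteq> Basis" for v vs
    by (rule linear_norm_le_Basis[OF linear_dderivs1[OF w]]) (rule K; use vs in simp)
  show "norm (dderivs [v] w y) \<le> real DIM('v) * K * norm v" by (rule one) auto
  have "norm (dderivs [v, u] w y) \<le> real DIM('v) * (real DIM('v) * K * norm v) * norm u"
    by (rule linear_norm_le_Basis[OF linear_dderivs2[OF w]]) (rule one; simp)
  then show "norm (dderivs [v, u] w y) \<le> (real DIM('v))\<^sup>2 * K * norm v * norm u"
    by (simp add: power2_eq_square mult_ac)
qed

text \<open>\<open>G\<close> parametrizes the perturbed hypersurface. Bounds on \<open>w\<close> are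
  available only along \<open>\<psi>\<close>, so the composition of \<open>w\<close> with
  \<open>\<psi>\<close> is estimated as a whole, and convexity of \<open>A\<close> turns the
  derivative bound into a Lipschitz bound. The condition \<open>K * C \<le> c / 2\<close> sacrifices
  half of the expansion of \<open>\<psi>\<close>.\<close>

lemma perturbed_parametrization:
  fixes \<psi> :: "'a::euclidean_space \<Rightarrow> 'v::euclidean_space" and w :: "'v \<Rightarrow> 'v"
  assumes \<psi>: "smooth_on V \<psi>" and A: "convex A" "A \<subseteq> V" and w: "smooth_on W w" and sub: "\<psi> ` A \<subseteq> W"
    and low: "\<And>a b. a \<in> A \<Longrightarrow> b \<in> A \<Longrightarrow> c * norm (a - b) \<le> norm (\<psi> a - \<psi> b)"
    and dlow: "\<And>a v. a \<in> A \<Longrightarrow> c * norm v \<le> norm (dderivs [v] \<psi> a)"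
    and dup: "\<And>a v. a \<in> A \<Longrightarrow> norm (dderivs [v] \<psi> a) \<le> C * norm v"
    and dw: "\<And>a v. a \<in> A \<Longrightarrow> norm (dderivs [v] w (\<psi> a)) \<le> K * norm v" and K: "K \<ge> 0" "K * C \<le> c / 2"
    and a: "a \<in> A"
  defines "G \<equiv> \<lambda>z. \<psi> z + w (\<psi> z)"
    and "L \<equiv> \<lambda>\<xi>. dderivs [\<xi>] \<psi> a + dderivs [dderivs [\<xi>] \<psi> a] w (\<psi> a)"
    and "B \<equiv> \<lambda>\<xi>. dderivs [\<xi>, \<xi>] \<psi> a + (dderivs [dderivs [\<xi>, \<xi>] \<psi> a] w (\<psi> a) +
        dderivs [dderivs [\<xi>] \<psi> a, dderivs [\<xi>] \<psi> a] w (\<psi> a))"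
  shows "jet2 G a L B" "(G has_derivative L) (at a)" "c / 2 * norm \<xi> \<le> norm (L \<xi>)"
    "b \<in> A \<Longrightarrow> c / 2 * norm (b - a) \<le> norm (G b - G a)"
proof -
  have der: "(w \<circ> \<psi> has_derivative (\<lambda>v. dderivs [dderivs [v] \<psi> z] w (\<psi> z))) (at z)" if "z \<in> A" for z
    using diff_chain_at[OF smooth_on_has_derivative[OF \<psi>] smooth_on_has_derivative[OF w], of z] that A(2) sub
    by (auto simp: o_def)
  have bound: "norm (dderivs [dderivs [v] \<psi> z] w (\<psi> z)) \<le> c / 2 * norm v" if z: "z \<in> A" for z v
  proof -
    have "norm (dderivs [dderivs [v] \<psi> z] w (\<psi> z)) \<le> K * (C * norm v)"
      using dw[OF z] dup[OF z] K(1) by (meson mult_left_mono order_trans)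
    also have "\<dots> \<le> c / 2 * norm v" using mult_right_mono[OF K(2) norm_ge_zero[of v]] by (simp add: mult.assoc)
    finally show ?thesis .
  qed
  have aV: "a \<in> V" "\<psi> a \<in> W" using a A sub by auto
  show "jet2 G a L B"
    unfolding G_def L_def B_def
    by (intro jet2_add smooth_jet2[OF \<psi> aV(1)] jet2_compose[OF smooth_jet2[OF \<psi> aV(1)] smooth_jet2[OF w aV(2)]])
  show "(G has_derivative L) (at a)"
    using has_derivative_add[OF smooth_on_has_derivative[OF \<psi> aV(1)] der[OF a]] by (simp add: G_def L_def o_def)
  have tri: "norm x - norm y \<le> norm (x + y)" for x y :: 'v using norm_diff_ineq by blast
  show "c / 2 * norm \<xi> \<le> norm (L \<xi>)"
    using tri[of "dderivs [\<xi>] \<psi> a" "dderivs [dderivs [\<xi>] \<psi> a] w (\<psi> a)"] bound[OF a, of \<xi>] dlow[OF a, of \<xi>]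
    by (simp add: L_def)
  show "c / 2 * norm (b - a) \<le> norm (G b - G a)" if b: "b \<in> A"
  proof -
    have "norm ((w \<circ> \<psi>) b - (w \<circ> \<psi>) a) \<le> c / 2 * norm (b - a)"
    proof (rule differentiable_bound[OF A(1)])
      show "(w \<circ> \<psi> has_derivative (\<lambda>v. dderivs [dderivs [v] \<psi> z] w (\<psi> z))) (at z within A)" if "z \<in> A" for z
        by (rule has_derivative_at_withinI[OF der[OF that]])
      show "onorm (\<lambda>v. dderivs [dderivs [v] \<psi> z] w (\<psi> z)) \<le> c / 2" if "z \<in> A" for z
        by (rule onorm_le[OF bound[OF that]])
    qed (use a b in auto)
    moreover have "G b - G a = (\<psi> b - \<psi> a) + ((w \<circ> \<psi>) b - (w \<circ> \<psi>) a)" by (simp add: G_def)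
    ultimately show ?thesis
      using tri[of "\<psi> b - \<psi> a" "(w \<circ> \<psi>) b - (w \<circ> \<psi>) a"] low[OF b a] by simp
  qed
qed

text \<open>The sign is left open because a limit of unit normals of the hypersurface may be either
  normal of the cone.\<close>

lemma orthonormal_unit_eq:
  fixes N N' :: "'n::finite ambient"
  assumes \<iota>: "normal_frame N \<iota>" and N: "norm N = 1" and N': "norm N' = 1" and perp: "\<And>v. \<iota> v \<bullet> N' = 0"
  obtains \<sigma> :: real where "\<sigma>\<^sup>2 = 1" "N' = \<sigma> *\<^sub>R N"
proof -
  have "adjoint \<iota> N' = 0"
    using normal_frame_adjoint(5)[OF \<iota> N, of N' "adjoint \<iota> N'"] perp by (simp add: inner_commute)
  then have e: "N' = (N' \<bullet> N) *\<^sub>R N"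
    using normal_frame_adjoint(4)[OF \<iota> N, of N'] linear_0[OF normal_frameD(1)[OF \<iota>]] by simp
  then have "norm N' = \<bar>N' \<bullet> N\<bar> * norm N" by (metis norm_scaleR)
  then have "(N' \<bullet> N)\<^sup>2 = 1" using N N' by (metis mult.right_neutral one_power2 power2_abs)
  with e that show ?thesis by blast
qed

lemma isometry_normal_frame:
  fixes \<iota> :: "real ^ 'n::finite \<Rightarrow> 'n ambient"
  assumes \<iota>: "linear \<iota>" "\<And>v. norm (\<iota> v) = norm v" and N: "norm N = 1" and perp: "\<And>v. \<iota> v \<bullet> N = 0"
  shows "normal_frame N \<iota>"
proof -
  obtain \<iota>0 where \<iota>0: "normal_frame N \<iota>0" using normal_frame_exists[OF N] by blast
  have inj: "inj j" if "linear j" "\<And>v. norm (j v) = norm v" for j :: "real ^ 'n \<Rightarrow> 'n ambient"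
    using that by (metis linear_injective_0 norm_eq_zero)
  have "range \<iota> \<subseteq> range \<iota>0" using perp \<iota>0 by (auto simp: normal_frame_def)
  moreover have "dim (range \<iota>0) \<le> dim (range \<iota>)"
    using dim_image_eq[OF \<iota>(1), of UNIV] dim_image_eq[OF normal_frameD(1)[OF \<iota>0], of UNIV]
      inj[OF \<iota>] inj[OF normal_frameD(1,2)[OF \<iota>0]] by (simp add: span_UNIV)
  ultimately have "range \<iota> = range \<iota>0"
    by (intro subspace_dim_equal linear_subspace_image \<iota>(1) normal_frameD(1)[OF \<iota>0] subspace_UNIV)
  then show ?thesis using \<iota> \<iota>0 by (simp add: normal_frame_def)
qed

section \<open>Cones under dilation, and contact of rescaled hypersurfaces\<close>

context hypersurface
begin

text \<open>A cone is invariant under its dilations, so the radial direction is tangent and in the kernel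
  of the second fundamental form.\<close>

lemma dilation_null_direction:
  assumes d: "\<And>q p \<tau>. limitin X q p (at 0) \<Longrightarrow> (\<tau> \<longlongrightarrow> (1::real)) (at (0::real)) \<Longrightarrow> limitin X (\<lambda>s. d (\<tau> s) (q s)) p (at 0)"
    and x: "\<And>t p. x (d t p) = t *\<^sub>R x p" and p: "p \<in> topspace X"
  shows "x p \<bullet> \<nu> p = 0" "e \<bullet> \<nu> p = 0 \<Longrightarrow> II p (e + \<alpha> *\<^sub>R x p) = II p e"
proof -
  \<comment> \<open>Dilating the point at time \<open>s\<close> by \<open>1 + \<alpha> * s\<close>
    adds \<open>\<alpha>\<close> times the position vector to the velocity.\<close>
  have vel: "velocity (\<lambda>s. d (1 + \<alpha> * s) (q s)) p (e + \<alpha> *\<^sub>R x p)" if q: "velocity q p e" for q e \<alpha>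
    unfolding velocity_def
  proof
    have l: "limitin X q p (at 0)" and v: "((\<lambda>s. (x (q s) - x p) /\<^sub>R s) \<longlongrightarrow> e) (at 0)" using q by (auto simp: velocity_def)
    have "((\<lambda>s. 1 + \<alpha> * s) \<longlongrightarrow> 1 + \<alpha> * 0) (at (0::real))" by (intro tendsto_intros)
    then show "limitin X (\<lambda>s. d (1 + \<alpha> * s) (q s)) p (at 0)" by (intro d[OF l]) simp
    have "((\<lambda>s. (x (q s) - x p) /\<^sub>R s + \<alpha> *\<^sub>R x (q s)) \<longlongrightarrow> e + \<alpha> *\<^sub>R x p) (at 0)"
      by (intro tendsto_intros v x_tendsto[OF l])
    moreover have "\<forall>\<^sub>F s in at (0::real). (x (q s) - x p) /\<^sub>R s + \<alpha> *\<^sub>R x (q s) = (x (d (1 + \<alpha> * s) (q s)) - x p) /\<^sub>R s"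
      unfolding eventually_at_filter
      by (rule always_eventually) (simp add: x scaleR_add_left scaleR_diff_right scaleR_add_right)
    ultimately show "((\<lambda>s. (x (d (1 + \<alpha> * s) (q s)) - x p) /\<^sub>R s) \<longlongrightarrow> e + \<alpha> *\<^sub>R x p) (at 0)"
      by (rule Lim_transform_eventually)
  qed
  obtain U \<phi> u where ch: "(U, \<phi>) \<in> \<A>" "u \<in> U" and pu: "\<phi> u = p" using chart_at[OF p] by blast
  have curve: "\<exists>q. velocity q p e" if "e \<bullet> \<nu> p = 0" for e
  proof -
    have "e \<in> range (\<lambda>v. dderivs [v] (x \<circ> \<phi>) u)" unfolding tangent_range[OF ch] using that pu by simp
    then show ?thesis using chart_curve_velocity[OF ch] pu by blast
  qed
  obtain q0 where "velocity q0 p 0" using curve[of 0] by auto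
  from velocity_tangent[OF p vel[OF this, of 1]] show xp: "x p \<bullet> \<nu> p = 0" by simp
  assume "e \<bullet> \<nu> p = 0"
  then obtain q where q: "velocity q p e" using curve by blast
  \<comment> \<open>The position vector is tangent, so the dilation multiplies the normal
    displacement by \<open>1 + \<alpha> * s\<close>, which tends to 1 and does not change the
    limit.\<close>
  have "((\<lambda>s. (1 + \<alpha> * s) * (((x (q s) - x p) \<bullet> \<nu> p) / s\<^sup>2)) \<longlongrightarrow> (1 + \<alpha> * 0) * (II p e / 2)) (at 0)"
    by (intro tendsto_intros II_curve[OF p q])
  moreover have "(1 + \<alpha> * s) * (((x (q s) - x p) \<bullet> \<nu> p) / s\<^sup>2) = ((x (d (1 + \<alpha> * s) (q s)) - x p) \<bullet> \<nu> p) / s\<^sup>2" for s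
    by (simp add: x inner_diff_left xp)
  ultimately have "((\<lambda>s. ((x (d (1 + \<alpha> * s) (q s)) - x p) \<bullet> \<nu> p) / s\<^sup>2) \<longlongrightarrow> II p e / 2) (at 0)"
    by (simp only: mult_zero_right add_0_right mult_1)
  then show "II p (e + \<alpha> *\<^sub>R x p) = II p e"
    using tendsto_unique[OF _ II_curve[OF p vel[OF q, of \<alpha>]]] by fastforce
qed

text \<open>Curves in \<open>X\<close> through \<open>p\<close>, rescaled by \<open>l\<close>, are
  lifted to the parameter domain of \<open>G\<close>: preimages are merely chosen, and
  \<open>low\<close> makes them converge to \<open>a\<close>. Every tangent vector is attained in
  this way, so the tangent spaces agree by dimension. Normal displacements scale by \<open>l\<close>
  and squared velocities by its square, which gives the factor \<open>1 / l\<close>.\<close>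

lemma rescaled_contact:
  fixes G :: "real ^ 'n \<Rightarrow> 'n ambient"
  assumes p: "p \<in> topspace X" and l: "l > 0" and a: "G a = l *\<^sub>R x p"
    and G: "jet2 G a L B" "(G has_derivative L) (at a)" and m: "m > 0" "\<And>\<xi>. m * norm \<xi> \<le> norm (L \<xi>)"
    and low: "\<And>b. b \<in> A \<Longrightarrow> m * norm (b - a) \<le> norm (G b - G a)"
    and cover: "\<And>q. limitin X q p (at (0::real)) \<Longrightarrow> \<forall>\<^sub>F s in at 0. \<exists>b\<in>A. l *\<^sub>R x (q s) = G b"
  shows "L \<xi> \<bullet> \<nu> p = 0" "e \<bullet> \<nu> p = 0 \<Longrightarrow> \<exists>\<xi>. L \<xi> = e" "B \<xi> \<bullet> \<nu> p = II p (L \<xi>) / l"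
proof -
  have L: "linear L" using G(1) by (simp add: jet2_def)
  have inj: "inj L"
    using m by (metis L linear_injective_0 mult_le_0_iff norm_le_zero_iff norm_zero not_less)
  obtain U \<phi> u where ch: "(U, \<phi>) \<in> \<A>" "u \<in> U" and pu: "\<phi> u = p" using chart_at[OF p] by blast
  have lift: "\<exists>\<xi> \<zeta> q. L \<xi> = e \<and> ((\<lambda>s. \<zeta> s /\<^sub>R s) \<longlongrightarrow> \<xi>) (at (0::real)) \<and> velocity q p (e /\<^sub>R l) \<and>
      (\<forall>\<^sub>F s in at 0. G (a + \<zeta> s) = l *\<^sub>R x (q s))" if e: "e \<bullet> \<nu> p = 0" for e
  proof -
    have "e /\<^sub>R l \<in> range (\<lambda>v. dderivs [v] (x \<circ> \<phi>) u)" unfolding tangent_range[OF ch] using e pu by simp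
    then obtain \<eta> where \<eta>: "e /\<^sub>R l = dderivs [\<eta>] (x \<circ> \<phi>) u" by blast
    define q where "q s = \<phi> (u + s *\<^sub>R \<eta>)" for s
    have q: "velocity q p (e /\<^sub>R l)" using chart_curve_velocity[OF ch, of \<eta>] unfolding q_def pu \<eta> .
    then have ql: "limitin X q p (at 0)" and qv: "((\<lambda>s. (x (q s) - x p) /\<^sub>R s) \<longlongrightarrow> e /\<^sub>R l) (at 0)"
      by (auto simp: velocity_def)
    define \<zeta> where "\<zeta> s = (SOME b. b \<in> A \<and> l *\<^sub>R x (q s) = G b) - a" for s
    have \<zeta>: "\<forall>\<^sub>F s in at 0. a + \<zeta> s \<in> A \<and> l *\<^sub>R x (q s) = G (a + \<zeta> s)"
      using cover[OF ql]
    proof eventually_elim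
      case (elim s)
      then have "\<exists>b. b \<in> A \<and> l *\<^sub>R x (q s) = G b" by blast
      from someI_ex[OF this] show ?case by (simp add: \<zeta>_def)
    qed
    have "((\<lambda>s. l / m * norm (x (q s) - x p)) \<longlongrightarrow> l / m * norm (x p - x p)) (at 0)"
      by (intro tendsto_intros x_tendsto[OF ql])
    then have "((\<lambda>s. l / m * norm (x (q s) - x p)) \<longlongrightarrow> 0) (at 0)" by simp
    then have \<zeta>0: "(\<zeta> \<longlongrightarrow> 0) (at 0)"
    proof (rule Lim_null_comparison[rotated])
      show "\<forall>\<^sub>F s in at 0. norm (\<zeta> s) \<le> l / m * norm (x (q s) - x p)"
        using \<zeta>
      proof eventually_elim
        case (elim s)
        have "m * norm (\<zeta> s) \<le> norm (l *\<^sub>R x (q s) - l *\<^sub>R x p)" using low[of "a + \<zeta> s"] elim a by simp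
        also have "\<dots> = l * norm (x (q s) - x p)" using l by (simp flip: scaleR_diff_right)
        finally show ?case using m(1) by (simp add: pos_le_divide_eq mult.commute)
      qed
    qed
    have "((\<lambda>s. l *\<^sub>R ((x (q s) - x p) /\<^sub>R s)) \<longlongrightarrow> l *\<^sub>R (e /\<^sub>R l)) (at 0)" by (intro tendsto_intros qv)
    then have "((\<lambda>s. l *\<^sub>R ((x (q s) - x p) /\<^sub>R s)) \<longlongrightarrow> e) (at 0)" using l by simp
    moreover have "\<forall>\<^sub>F s in at 0. l *\<^sub>R ((x (q s) - x p) /\<^sub>R s) = (G (a + \<zeta> s) - G a) /\<^sub>R s"
      using \<zeta>
    proof eventually_elim
      case (elim s)
      have "l *\<^sub>R ((x (q s) - x p) /\<^sub>R s) = (l *\<^sub>R x (q s) - l *\<^sub>R x p) /\<^sub>R s"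
        by (simp add: scaleR_diff_right mult.commute)
      then show ?case using elim a by simp
    qed
    ultimately have "((\<lambda>s. (G (a + \<zeta> s) - G a) /\<^sub>R s) \<longlongrightarrow> e) (at 0)" by (rule Lim_transform_eventually)
    from curve_lift[OF G(2) inj \<zeta>0 this] obtain \<xi> where "L \<xi> = e" "((\<lambda>s. \<zeta> s /\<^sub>R s) \<longlongrightarrow> \<xi>) (at 0)" by blast
    moreover have "\<forall>\<^sub>F s in at 0. G (a + \<zeta> s) = l *\<^sub>R x (q s)" using \<zeta> by eventually_elim simp
    ultimately show ?thesis using q by blast
  qed
  then show surj: "\<exists>\<xi>. L \<xi> = e" if "e \<bullet> \<nu> p = 0" for e using that by blast
  obtain \<iota> where \<iota>: "normal_frame (\<nu> p) \<iota>" using normal_frame_exists[OF norm_normal[OF p]] by blast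
  have "inj \<iota>" using normal_frameD(1,2)[OF \<iota>] by (metis linear_injective_0 norm_eq_zero)
  then have "dim (range L) \<le> dim (range \<iota>)"
    using dim_image_eq[OF L, of UNIV] dim_image_eq[OF normal_frameD(1)[OF \<iota>], of UNIV] inj by (simp add: span_UNIV)
  moreover have "range \<iota> \<subseteq> range L" using surj normal_frameD(3)[OF \<iota>] by (metis image_subsetI rangeI)
  ultimately have "range \<iota> = range L"
    by (intro subspace_dim_equal linear_subspace_image L normal_frameD(1)[OF \<iota>] subspace_UNIV)
  then have perp: "L \<xi> \<bullet> \<nu> p = 0" for \<xi> using normal_frameD(3)[OF \<iota>] by (metis rangeE rangeI)
  then show "L \<xi> \<bullet> \<nu> p = 0" .
  obtain \<xi>' \<zeta> q where h: "L \<xi>' = L \<xi>" "((\<lambda>s. \<zeta> s /\<^sub>R s) \<longlongrightarrow> \<xi>') (at 0)" "velocity q p (L \<xi> /\<^sub>R l)"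
      "\<forall>\<^sub>F s in at 0. G (a + \<zeta> s) = l *\<^sub>R x (q s)"
    using lift[OF perp[of \<xi>]] by blast
  have "\<xi>' = \<xi>" using h(1) inj by (simp add: inj_eq)
  then have lim: "((\<lambda>s. ((G (a + \<zeta> s) - G a) \<bullet> \<nu> p) / s\<^sup>2) \<longlongrightarrow> (B \<xi> \<bullet> \<nu> p) / 2) (at 0)"
    using jet2_normal_part[OF G(1) h(2) perp] by simp
  have "\<forall>\<^sub>F s in at 0. ((G (a + \<zeta> s) - G a) \<bullet> \<nu> p) / s\<^sup>2 = l * (((x (q s) - x p) \<bullet> \<nu> p) / s\<^sup>2)"
    using h(4) by eventually_elim (simp add: a flip: scaleR_diff_right)
  from Lim_transform_eventually[OF lim this]
  have "((\<lambda>s. l * (((x (q s) - x p) \<bullet> \<nu> p) / s\<^sup>2)) \<longlongrightarrow> (B \<xi> \<bullet> \<nu> p) / 2) (at 0)" .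
  moreover have "((\<lambda>s. l * (((x (q s) - x p) \<bullet> \<nu> p) / s\<^sup>2)) \<longlongrightarrow> l * (II p (L \<xi> /\<^sub>R l) / 2)) (at 0)"
    by (intro tendsto_intros II_curve[OF p h(3)])
  ultimately have "(B \<xi> \<bullet> \<nu> p) / 2 = l * (II p (L \<xi> /\<^sub>R l) / 2)" by (intro tendsto_unique[OF at_neq_bot])
  moreover have "II p (L \<xi> /\<^sub>R l) = (inverse l)\<^sup>2 * II p (L \<xi>)" by (rule II_frame_scale[OF p perp])
  ultimately show "B \<xi> \<bullet> \<nu> p = II p (L \<xi>) / l" using l by (simp add: power2_eq_square field_simps)
qed

end

lemma regular_cone_scale:
  assumes "regular_cone C" "y \<in> C" "t \<ge> 0"
  shows "t *\<^sub>R y \<in> C"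
proof -
  obtain \<Gamma> where C: "C = {\<rho> *\<^sub>R y | \<rho> y. 0 \<le> \<rho> \<and> y \<in> \<Gamma>}" using assms(1) unfolding regular_cone_def by blast
  obtain \<rho> z where "y = \<rho> *\<^sub>R z" "0 \<le> \<rho>" "z \<in> \<Gamma>" using assms(2) C by blast
  then have "t *\<^sub>R y = (t * \<rho>) *\<^sub>R z" "0 \<le> t * \<rho>" using assms(3) by auto
  then show ?thesis using \<open>z \<in> \<Gamma>\<close> C by blast
qed

context hypersurface
begin

text \<open>Points with property \<open>Q\<close> that run off to infinity are rescaled to the unit
  sphere. Along a subsequence they approach a point of the cone and their normals converge, so a
  single chart \<open>\<psi>\<close> of the cone serves all \<open>j\<close>; \<open>L j\<close> and
  \<open>B j\<close> are the first and second derivatives of \<open>\<psi>\<close> plus the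
  \<open>j\<close>-th perturbation. The last two conclusions allow varying arguments and further
  subsequences, so that converging frames can be inserted.\<close>

lemma blow_down_parametrization:
  assumes asym: "asymptotically_conical (x ` topspace X) C"
    and K: "two_sided_immersed_hypersurface (top_of_set (C - {0})) (maximal_atlas (C - {0})) (\<lambda>y. y) N"
    and Q: "\<And>R. \<exists>p\<in>topspace X. Q p \<and> R \<le> norm (x p)"
  obtains V \<psi> a p L B n m where "(V, \<psi>) \<in> maximal_atlas (C - {0})" "a \<in> V"
    "\<And>j::nat. p j \<in> topspace X" "\<And>j. Q (p j)" "\<And>j. norm (x (p j)) > 0" "(\<lambda>j. \<nu> (p j)) \<longlonglongrightarrow> n"
    "m > 0" "\<And>j. linear (L j)" "\<And>j \<xi>. m * norm \<xi> \<le> norm (L j \<xi>)"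
    "\<And>j e. e \<bullet> \<nu> (p j) = 0 \<Longrightarrow> \<exists>\<xi>. L j \<xi> = e"
    "\<And>j \<xi>. B j \<xi> \<bullet> \<nu> (p j) = norm (x (p j)) * II (p j) (L j \<xi>)"
    "\<And>s \<xi> \<xi>0. strict_mono s \<Longrightarrow> \<xi> \<longlonglongrightarrow> \<xi>0 \<Longrightarrow> (\<lambda>j. L (s j) (\<xi> j)) \<longlonglongrightarrow> dderivs [\<xi>0] \<psi> a"
    "\<And>s \<xi> \<xi>0. strict_mono s \<Longrightarrow> \<xi> \<longlonglongrightarrow> \<xi>0 \<Longrightarrow> (\<lambda>j. B (s j) (\<xi> j)) \<longlonglongrightarrow> dderivs [\<xi>0, \<xi>0] \<psi> a"
proof -
  interpret K: hypersurface "top_of_set (C - {0})" "maximal_atlas (C - {0})" "\<lambda>y. y" N by unfold_locales (rule K)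
  have "regular_cone C" using asym by (simp add: asymptotically_conical_def)
  then obtain \<Gamma> where \<Gamma>: "\<Gamma> \<subseteq> sphere 0 1" "compact \<Gamma>" and C: "C = {\<rho> *\<^sub>R y | \<rho> y. 0 \<le> \<rho> \<and> y \<in> \<Gamma>}"
    unfolding regular_cone_def by blast
  \<comment> \<open>Two derivatives determine curvature, and radius 2 puts the unit sphere into the
    interior of the annulus.\<close>
  have conv: "Ck_convergent_in_annulus 2 2 (\<lambda>t. (\<lambda>y. sqrt t *\<^sub>R y) ` (x ` topspace X)) C"
    using asym by (simp add: asymptotically_conical_def)
  define \<epsilon> :: "nat \<Rightarrow> real" where "\<epsilon> j = inverse (real (Suc j))" for j
  have \<epsilon>: "\<epsilon> j > 0" for j by (simp add: \<epsilon>_def)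
  have \<epsilon>0: "\<epsilon> \<longlonglongrightarrow> 0" unfolding \<epsilon>_def by (rule LIMSEQ_inverse_real_of_nat)
  define D where "D j p W w \<longleftrightarrow> p \<in> topspace X \<and> Q p \<and> 1 \<le> norm (x p) \<and> C \<inter> annulus 2 \<subseteq> W \<and> smooth_on W w \<and>
      (\<forall>y\<in>C \<inter> W. \<forall>vs. length vs \<le> 2 \<and> set vs \<subseteq> Basis \<longrightarrow> norm (dderivs vs w y) < \<epsilon> j) \<and>
      (\<forall>q\<in>topspace X. (1 / norm (x p)) *\<^sub>R x q \<in> annulus 2 \<longrightarrow> (\<exists>y\<in>C \<inter> W. (1 / norm (x p)) *\<^sub>R x q = y + w y))"
    for j p and W :: "'n ambient set" and w
  have "\<exists>p W w. D j p W w" for j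
  proof -
    define P where "P = (\<lambda>t. \<exists>W w. C \<inter> annulus 2 \<subseteq> W \<and> smooth_on W w \<and>
          (\<forall>y\<in>C \<inter> W. \<forall>vs. length vs \<le> 2 \<and> set vs \<subseteq> Basis \<longrightarrow> norm (dderivs vs w y) < \<epsilon> j) \<and>
          (\<lambda>y. sqrt t *\<^sub>R y) ` (x ` topspace X) \<inter> annulus 2 = (\<lambda>y. y + w y) ` (C \<inter> W) \<inter> annulus 2)"
    have "eventually P (at_right 0)"
      unfolding P_def by (rule conv[unfolded Ck_convergent_in_annulus_def, THEN spec, THEN mp, OF \<epsilon>])
    then obtain b where b: "b > 0" and bP: "\<And>t. 0 < t \<Longrightarrow> t < b \<Longrightarrow> P t"
      unfolding eventually_at_right_field by blast
    obtain p where p: "p \<in> topspace X" "Q p" and large: "max 1 (2 / b) \<le> norm (x p)" using Q by blast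
    \<comment> \<open>The factor that brings \<open>x p\<close> to the unit sphere. It belongs to
      the parameter \<open>l\<^sup>2\<close>, which is below \<open>b\<close> once
      \<open>norm (x p)\<close> is at least 1 and at least \<open>2 / b\<close>.\<close>
    define l where "l = 1 / norm (x p)"
    have n1: "1 \<le> norm (x p)" and n2: "2 / b \<le> norm (x p)" using large by auto
    have nz: "x p \<noteq> 0" using n1 by auto
    have "2 \<le> norm (x p) * b" using n2 b by (simp add: pos_divide_le_eq)
    then have "l \<le> b / 2" using nz by (simp add: l_def divide_le_eq mult.commute)
    moreover have l: "0 < l" "l \<le> 1" using n1 nz unfolding l_def by (simp_all add: divide_le_eq)
    moreover have "l\<^sup>2 \<le> l" using l by (simp add: power2_eq_square mult_left_le)
    ultimately have "0 < l\<^sup>2" "l\<^sup>2 < b" using b by auto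
    from bP[OF this, unfolded P_def] obtain W w where W: "C \<inter> annulus 2 \<subseteq> W" "smooth_on W w"
        "\<forall>y\<in>C \<inter> W. \<forall>vs. length vs \<le> 2 \<and> set vs \<subseteq> Basis \<longrightarrow> norm (dderivs vs w y) < \<epsilon> j"
        "(\<lambda>y. sqrt (l\<^sup>2) *\<^sub>R y) ` (x ` topspace X) \<inter> annulus 2 = (\<lambda>y. y + w y) ` (C \<inter> W) \<inter> annulus 2" by blast
    have "sqrt (l\<^sup>2) = l" using l by simp
    have "\<exists>y\<in>C \<inter> W. l *\<^sub>R x q = y + w y" if q: "q \<in> topspace X" "l *\<^sub>R x q \<in> annulus 2" for q
    proof -
      have "l *\<^sub>R x q \<in> (\<lambda>y. sqrt (l\<^sup>2) *\<^sub>R y) ` (x ` topspace X) \<inter> annulus 2"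
        unfolding \<open>sqrt (l\<^sup>2) = l\<close> using q by blast
      then show ?thesis unfolding W(4) by blast
    qed
    then show ?thesis using p n1 W(1-3) unfolding D_def l_def by blast
  qed
  then obtain p0 W0 w0 where D: "\<And>j. D j (p0 j) (W0 j) (w0 j)" by metis
  have p0: "p0 j \<in> topspace X" and Qp: "Q (p0 j)" and xp: "1 \<le> norm (x (p0 j))" and WC: "C \<inter> annulus 2 \<subseteq> W0 j"
    and w0: "smooth_on (W0 j) (w0 j)" for j
    using D[of j] unfolding D_def by blast+
  have w\<epsilon>: "norm (dderivs vs (w0 j) y) \<le> \<epsilon> j" if "y \<in> C" "y \<in> W0 j" "length vs \<le> 2" "set vs \<subseteq> Basis" for j y vs
    using D[of j] that unfolding D_def by (meson IntI less_imp_le)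
  have near: "\<exists>y. y \<in> C \<and> y \<in> W0 j \<and> (1 / norm (x (p0 j))) *\<^sub>R x q = y + w0 j y"
    if "q \<in> topspace X" "(1 / norm (x (p0 j))) *\<^sub>R x q \<in> annulus 2" for j q
    using D[of j] that unfolding D_def by (meson IntE)
  have w0\<epsilon>: "norm (w0 j y) \<le> \<epsilon> j" if "y \<in> C" "y \<in> W0 j" for j y using w\<epsilon>[OF that, of "[]"] by simp
  have unit: "norm ((1 / norm (x (p0 j))) *\<^sub>R x (p0 j)) = 1" for j using xp[of j] by (cases "x (p0 j) = 0") auto
  have "\<exists>y \<gamma>. y \<in> C \<and> y \<in> W0 j \<and> (1 / norm (x (p0 j))) *\<^sub>R x (p0 j) = y + w0 j y \<and> \<gamma> \<in> \<Gamma> \<and> y = norm y *\<^sub>R \<gamma>" for j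
  proof -
    have "(1 / norm (x (p0 j))) *\<^sub>R x (p0 j) \<in> annulus 2" using unit[of j] by (auto simp: annulus_def)
    from near[OF p0 this] obtain y where y: "y \<in> C" "y \<in> W0 j" "(1 / norm (x (p0 j))) *\<^sub>R x (p0 j) = y + w0 j y" by blast
    obtain \<rho> \<gamma> where "y = \<rho> *\<^sub>R \<gamma>" "0 \<le> \<rho>" "\<gamma> \<in> \<Gamma>" using y(1) C by blast
    moreover have "norm \<gamma> = 1" using \<Gamma>(1) \<open>\<gamma> \<in> \<Gamma>\<close> by auto
    ultimately have "\<gamma> \<in> \<Gamma>" "y = norm y *\<^sub>R \<gamma>" by simp_all
    with y show ?thesis by blast
  qed
  then obtain y0 \<gamma>0 where y0: "\<And>j. y0 j \<in> C" "\<And>j. y0 j \<in> W0 j"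
      and y0x: "\<And>j. (1 / norm (x (p0 j))) *\<^sub>R x (p0 j) = y0 j + w0 j (y0 j)"
      and \<gamma>0: "\<And>j. \<gamma>0 j \<in> \<Gamma>" "\<And>j. y0 j = norm (y0 j) *\<^sub>R \<gamma>0 j" by metis
  have compact: "compact (\<Gamma> \<times> sphere (0::'n ambient) 1)" using \<Gamma>(2) by (intro compact_Times) auto
  have "\<forall>j. (\<gamma>0 j, \<nu> (p0 j)) \<in> \<Gamma> \<times> sphere 0 1" using \<gamma>0(1) norm_normal[OF p0] by simp
  from compact[unfolded compact_def, THEN spec, THEN mp, OF this]
  have "\<exists>z\<in>\<Gamma> \<times> sphere 0 1. \<exists>r. strict_mono (r :: nat \<Rightarrow> nat) \<and> ((\<lambda>j. (\<gamma>0 j, \<nu> (p0 j))) \<circ> r) \<longlonglongrightarrow> z" .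
  then obtain z r where z: "z \<in> \<Gamma> \<times> sphere (0::'n ambient) 1" and r: "strict_mono (r :: nat \<Rightarrow> nat)"
      and rz: "((\<lambda>j. (\<gamma>0 j, \<nu> (p0 j))) \<circ> r) \<longlonglongrightarrow> z" by blast
  define g where "g = fst z"
  have g: "g \<in> \<Gamma>" "norm g = 1" using z \<Gamma>(1) by (auto simp: g_def)
  have \<gamma>r: "(\<lambda>j. \<gamma>0 (r j)) \<longlonglongrightarrow> g" using tendsto_fst[OF rz] by (simp add: g_def o_def)
  have \<nu>r: "(\<lambda>j. \<nu> (p0 (r j))) \<longlonglongrightarrow> snd z" using tendsto_snd[OF rz] by (simp add: o_def)
  have \<epsilon>r: "(\<lambda>j. \<epsilon> (r j)) \<longlonglongrightarrow> 0" using LIMSEQ_subseq_LIMSEQ[OF \<epsilon>0 r] by (simp add: o_def)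
  have "norm (norm (y0 j) - 1) \<le> \<epsilon> j" for j
  proof -
    have "norm (y0 j + w0 j (y0 j)) = 1" using unit[of j] y0x[of j] by simp
    then show ?thesis
      using w0\<epsilon>[OF y0, of j] norm_triangle_ineq[of "y0 j" "w0 j (y0 j)"] norm_diff_ineq[of "y0 j" "w0 j (y0 j)"]
      by simp
  qed
  then have "(\<lambda>j. norm (y0 (r j)) - 1) \<longlonglongrightarrow> 0" by (intro Lim_null_comparison[OF _ \<epsilon>r] always_eventually) auto
  from tendsto_add[OF this tendsto_const[of 1]] have "(\<lambda>j. norm (y0 (r j))) \<longlonglongrightarrow> 1" by simp
  from tendsto_scaleR[OF this \<gamma>r] have yr: "(\<lambda>j. y0 (r j)) \<longlonglongrightarrow> g" using \<gamma>0(2) by simp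
  have gM: "g \<in> C - {0}"
  proof -
    have "g = 1 *\<^sub>R g" by simp
    then have "g \<in> C" unfolding C using g(1) zero_le_one by blast
    then show ?thesis using g(2) by auto
  qed
  have "g \<in> topspace (top_of_set (C - {0}))" using gM by simp
  then obtain V \<psi> a where ch: "(V, \<psi>) \<in> maximal_atlas (C - {0})" "a \<in> V" and ag: "\<psi> a = g" using K.chart_at by metis
  have id\<psi>: "(\<lambda>y. y) \<circ> \<psi> = \<psi>" by (simp add: o_def)
  have \<psi>: "smooth_on V \<psi>" using K.chart_smooth[OF ch(1)] by (simp only: id\<psi>)
  have inj: "inj (\<lambda>v. dderivs [v] \<psi> a)" using K.chart_inj[OF ch] by (simp only: id\<psi>)
  obtain r0 c C1 where r0: "r0 > 0" "c > 0" "cball a r0 \<subseteq> V"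
    and low: "\<And>b b'. b \<in> cball a r0 \<Longrightarrow> b' \<in> cball a r0 \<Longrightarrow> c * norm (b - b') \<le> norm (\<psi> b - \<psi> b')"
    and dlow: "\<And>b v. b \<in> cball a r0 \<Longrightarrow> c * norm v \<le> norm (dderivs [v] \<psi> b)"
    and dup: "\<And>b v. b \<in> cball a r0 \<Longrightarrow> norm (dderivs [v] \<psi> b) \<le> C1 * norm v"
    by (rule smooth_immersion_expanding[OF \<psi> ch(2) inj]) (rule that)
  have "isCont \<psi> a" using smooth_on_has_derivative[OF \<psi> ch(2)] by (rule has_derivative_continuous)
  \<comment> \<open>Distance 1/4 from the unit vector \<open>g\<close> keeps the image of the chart
    in the annulus, where the perturbation is defined.\<close>
  then obtain r1 where r1: "r1 > 0" "\<And>b. dist b a < r1 \<Longrightarrow> dist (\<psi> b) (\<psi> a) < 1 / 4"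
    unfolding continuous_at_eps_delta by (metis zero_less_divide_iff zero_less_numeral zero_less_one)
  define A where "A = ball a (min r0 r1)"
  have A: "A \<subseteq> cball a r0" "a \<in> A" "convex A" "open A" using r0 r1 by (auto simp: A_def)
  have AV: "A \<subseteq> V" using A(1) r0(3) by blast
  have \<psi>A: "\<psi> b \<in> C" "\<psi> b \<in> annulus 2" if "b \<in> A" for b
  proof -
    show "\<psi> b \<in> C" using K.chart_topspace[OF ch(1)] that AV by auto
    have "norm (\<psi> b - g) < 1 / 4" using r1(2)[of b] that ag by (simp add: A_def dist_norm norm_minus_commute)
    then show "\<psi> b \<in> annulus 2"
      using norm_triangle_ineq2[of "\<psi> b" g] norm_triangle_ineq2[of g "\<psi> b"] g(2)
      by (simp add: annulus_def norm_minus_commute)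
  qed
  have AW: "\<psi> ` A \<subseteq> W0 j" for j using \<psi>A WC by blast
  \<comment> \<open>Charts of the cone are open for the subspace topology, so the image of
    \<open>A\<close> contains all points of the punctured cone near \<open>g\<close>.\<close>
  have "openin (top_of_set (C - {0})) (\<psi> ` A)" by (rule K.chart_image_openin[OF ch(1) A(4) AV])
  moreover have "g \<in> \<psi> ` A" using A(2) ag by blast
  ultimately obtain \<rho>1 where \<rho>1: "\<rho>1 > 0" "ball g \<rho>1 \<inter> (C - {0}) \<subseteq> \<psi> ` A"
    unfolding openin_contains_ball by blast
  define \<rho> where "\<rho> = min \<rho>1 (1 / 2)"
  have \<rho>: "\<rho> > 0" using \<rho>1 by (simp add: \<rho>_def)
  have inA: "\<exists>b\<in>A. y = \<psi> b" if "y \<in> C" "norm (y - g) < \<rho>" for y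
  proof -
    have "y \<noteq> 0" using that(2) g(2) by (auto simp: \<rho>_def)
    then show ?thesis using \<rho>1(2) that by (auto simp: \<rho>_def dist_norm norm_minus_commute)
  qed
  define DD where "DD = real DIM('n ambient)"
  have "(\<lambda>j. DD * \<epsilon> (r j) * C1) \<longlonglongrightarrow> DD * 0 * C1" by (intro tendsto_intros \<epsilon>r)
  then have DDlim: "(\<lambda>j. DD * \<epsilon> (r j) * C1) \<longlonglongrightarrow> 0" by simp
  have ch2: "0 < c / 2" "0 < \<rho> / 4" using r0(2) \<rho> by auto
  note e1 = order_tendstoD(2)[OF DDlim ch2(1)] and e2 = order_tendstoD(2)[OF \<epsilon>r ch2(2)] and e3 = tendstoD[OF yr ch2(2)]
  have "\<forall>\<^sub>F j in sequentially. DD * \<epsilon> (r j) * C1 \<le> c / 2 \<and> \<epsilon> (r j) < \<rho> / 4 \<and> norm (y0 (r j) - g) < \<rho> / 4"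
    using e1 e2 e3 by eventually_elim (simp add: dist_norm)
  \<comment> \<open>The first bound is the smallness required by
    \<open>perturbed_parametrization\<close>. The quarters of \<open>\<rho>\<close> add up in
    \<open>cover\<close>: the distance of the base point to \<open>g\<close>, two perturbations and
    one displacement.\<close>
  then obtain J where J: "\<And>j. j \<ge> J \<Longrightarrow> DD * \<epsilon> (r j) * C1 \<le> c / 2 \<and> \<epsilon> (r j) < \<rho> / 4 \<and> norm (y0 (r j) - g) < \<rho> / 4"
    unfolding eventually_sequentially by blast
  define k where "k j = r (j + J)" for j
  have k\<epsilon>: "DD * \<epsilon> (k j) * C1 \<le> c / 2" "\<epsilon> (k j) < \<rho> / 4" "norm (y0 (k j) - g) < \<rho> / 4" for j
    using J[of "j + J"] by (auto simp: k_def)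
  have \<nu>k: "(\<lambda>j. \<nu> (p0 (k j))) \<longlonglongrightarrow> snd z" unfolding k_def by (rule LIMSEQ_ignore_initial_segment[OF \<nu>r])
  have \<epsilon>k: "(\<lambda>j. \<epsilon> (k j)) \<longlonglongrightarrow> 0" unfolding k_def by (rule LIMSEQ_ignore_initial_segment[OF \<epsilon>r])
  have yk: "(\<lambda>j. y0 (k j)) \<longlonglongrightarrow> g" unfolding k_def by (rule LIMSEQ_ignore_initial_segment[OF yr])
  have "\<exists>b. b \<in> A \<and> y0 (k j) = \<psi> b" for j using inA[OF y0(1), of "k j"] k\<epsilon>(3)[of j] \<rho> by auto
  then obtain b where b: "\<And>j. b j \<in> A" "\<And>j. y0 (k j) = \<psi> (b j)" by metis
  have ba: "b \<longlonglongrightarrow> a"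
  proof -
    have "(\<lambda>j. norm (y0 (k j) - g) / c) \<longlonglongrightarrow> norm (g - g) / c" using r0(2) by (intro tendsto_intros yk) simp
    then have "(\<lambda>j. norm (y0 (k j) - g) / c) \<longlonglongrightarrow> 0" by simp
    moreover have "norm (b j - a) \<le> norm (y0 (k j) - g) / c" for j
    proof -
      have "c * norm (b j - a) \<le> norm (y0 (k j) - g)"
        using low[OF subsetD[OF A(1) b(1)] subsetD[OF A(1,2)], of j] b(2) ag by simp
      then show ?thesis using r0(2) by (simp add: pos_le_divide_eq mult.commute)
    qed
    then have "\<forall>\<^sub>F j in sequentially. norm (b j - a) \<le> norm (y0 (k j) - g) / c" by (rule always_eventually[OF allI])
    ultimately have "(\<lambda>j. b j - a) \<longlonglongrightarrow> 0" by (rule Lim_null_comparison[rotated])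
    then show ?thesis by (simp add: LIM_zero_iff)
  qed
  define G where "G j = (\<lambda>z. \<psi> z + w0 (k j) (\<psi> z))" for j
  define L where "L j = (\<lambda>\<xi>. dderivs [\<xi>] \<psi> (b j) + dderivs [dderivs [\<xi>] \<psi> (b j)] (w0 (k j)) (\<psi> (b j)))" for j
  define B where "B j = (\<lambda>\<xi>. dderivs [\<xi>, \<xi>] \<psi> (b j) + (dderivs [dderivs [\<xi>, \<xi>] \<psi> (b j)] (w0 (k j)) (\<psi> (b j)) +
        dderivs [dderivs [\<xi>] \<psi> (b j), dderivs [\<xi>] \<psi> (b j)] (w0 (k j)) (\<psi> (b j))))" for j
  have dw1: "norm (dderivs [v] (w0 (k j)) (\<psi> b')) \<le> DD * \<epsilon> (k j) * norm v"
    and dw2: "norm (dderivs [v, u] (w0 (k j)) (\<psi> b')) \<le> DD\<^sup>2 * \<epsilon> (k j) * norm v * norm u" if "b' \<in> A" for v u j b'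
  proof -
    have W: "\<psi> b' \<in> W0 (k j)" using AW that by blast
    show "norm (dderivs [v] (w0 (k j)) (\<psi> b')) \<le> DD * \<epsilon> (k j) * norm v"
      unfolding DD_def by (rule dderivs_norm_le_Basis(1)[OF w0 W]) (rule w\<epsilon>[OF \<psi>A(1)[OF that] W])
    show "norm (dderivs [v, u] (w0 (k j)) (\<psi> b')) \<le> DD\<^sup>2 * \<epsilon> (k j) * norm v * norm u"
      unfolding DD_def by (rule dderivs_norm_le_Basis(2)[OF w0 W]) (rule w\<epsilon>[OF \<psi>A(1)[OF that] W])
  qed
  have lowA: "c * norm (b' - b'') \<le> norm (\<psi> b' - \<psi> b'')" if "b' \<in> A" "b'' \<in> A" for b' b''
    using low that A(1) by blast
  have dlowA: "c * norm v \<le> norm (dderivs [v] \<psi> b')" if "b' \<in> A" for v b' using dlow that A(1) by blast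
  have dupA: "norm (dderivs [v] \<psi> b') \<le> C1 * norm v" if "b' \<in> A" for v b' using dup that A(1) by blast
  have DD\<epsilon>: "0 \<le> DD * \<epsilon> (k j)" for j using \<epsilon>[of "k j"] by (simp add: DD_def)
  note pert = perturbed_parametrization[where \<psi> = \<psi> and V = V and A = A and W = "W0 (k j)" and w = "w0 (k j)" and c = c
      and C = C1 and K = "DD * \<epsilon> (k j)" and a = "b j" for j,
      OF \<psi> A(3) AV w0 AW lowA dlowA dupA dw1 DD\<epsilon> k\<epsilon>(1) b(1), folded L_def B_def G_def]
  have jet: "jet2 (G j) (b j) (L j) (B j)" for j by (rule pert(1); assumption)
  have der: "(G j has_derivative L j) (at (b j))" for j by (rule pert(2); assumption)
  have Llow: "c / 2 * norm \<xi> \<le> norm (L j \<xi>)" for j \<xi> unfolding L_def by (rule pert(3); assumption)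
  have Glow: "c / 2 * norm (b' - b j) \<le> norm (G j b' - G j (b j))" if b': "b' \<in> A" for j b'
    using b' unfolding G_def by - (rule pert(4); assumption)
  define l where "l j = 1 / norm (x (p0 (k j)))" for j
  have l: "l j > 0" for j using xp[of "k j"] by (cases "x (p0 (k j)) = 0") (auto simp: l_def)
  have Gb: "G j (b j) = l j *\<^sub>R x (p0 (k j))" for j using y0x[of "k j"] b(2)[of j] by (simp add: G_def l_def)
  \<comment> \<open>Points of the hypersurface near the base point are rescaled into the annulus,
    hence are perturbed cone points; the cone point is near \<open>g\<close> and therefore in the
    image of \<open>A\<close>.\<close>
  have cover: "\<forall>\<^sub>F s in at 0. \<exists>b'\<in>A. l j *\<^sub>R x (q s) = G j b'" if q: "limitin X q (p0 (k j)) (at (0::real))" for q j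
  proof -
    have lim: "((\<lambda>s. l j *\<^sub>R x (q s)) \<longlongrightarrow> l j *\<^sub>R x (p0 (k j))) (at 0)" by (intro tendsto_intros x_tendsto[OF q])
    define \<eta> where "\<eta> = min (\<rho> / 4) (1 / 2)"
    have "\<eta> > 0" using \<rho> by (simp add: \<eta>_def)
    from tendstoD[OF lim this] have "\<forall>\<^sub>F s in at 0. norm (l j *\<^sub>R x (q s) - l j *\<^sub>R x (p0 (k j))) < \<eta>" by (simp add: dist_norm)
    moreover have "\<forall>\<^sub>F s in at 0. q s \<in> topspace X" using q p0 by (simp add: limitin_def)
    ultimately show ?thesis
    proof eventually_elim
      case (elim s)
      define d where "d = l j *\<^sub>R x (q s) - l j *\<^sub>R x (p0 (k j))"
      have un: "norm (l j *\<^sub>R x (p0 (k j))) = 1" using unit[of "k j"] by (simp add: l_def)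
      have d: "norm d < 1 / 2" "norm d < \<rho> / 4" using elim(1) by (auto simp: d_def \<eta>_def)
      have e: "l j *\<^sub>R x (q s) = l j *\<^sub>R x (p0 (k j)) + d" by (simp add: d_def)
      have "l j *\<^sub>R x (q s) \<in> annulus 2"
        using norm_triangle_ineq[of "l j *\<^sub>R x (p0 (k j))" d] norm_diff_ineq[of "l j *\<^sub>R x (p0 (k j))" d] un d
        unfolding e annulus_def by simp
      from near[OF elim(2), of "k j"] this obtain y where y: "y \<in> C" "y \<in> W0 (k j)" "l j *\<^sub>R x (q s) = y + w0 (k j) y"
        unfolding l_def by blast
      have "y + w0 (k j) y = (y0 (k j) + w0 (k j) (y0 (k j))) + d"
        using y(3) y0x[of "k j"] unfolding e by (simp add: l_def)
      then have y': "y = y0 (k j) + w0 (k j) (y0 (k j)) + d - w0 (k j) y" by (metis add_diff_cancel_right')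
      have "y - g = y0 (k j) + w0 (k j) (y0 (k j)) + d - w0 (k j) y - g" by (rule arg_cong[OF y', of "\<lambda>z. z - g"])
      also have "\<dots> = (y0 (k j) - g) + w0 (k j) (y0 (k j)) + d - w0 (k j) y" by (simp add: algebra_simps)
      finally have "norm (y - g) = norm ((y0 (k j) - g) + w0 (k j) (y0 (k j)) + d - w0 (k j) y)" by (rule arg_cong)
      also have "\<dots> \<le> norm (y0 (k j) - g) + norm (w0 (k j) (y0 (k j))) + norm d + norm (w0 (k j) y)"
        by (intro order_trans[OF norm_triangle_ineq4] add_mono norm_triangle_ineq[THEN order_trans] order_refl)
      also have "\<dots> < \<rho>" using k\<epsilon>(2,3)[of j] w0\<epsilon>[OF y0, of "k j"] w0\<epsilon>[OF y(1,2)] d(2) by linarith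
      finally obtain b' where "b' \<in> A" "y = \<psi> b'" using inA[OF y(1)] by blast
      then show ?case using y(3) by (auto simp: G_def)
    qed
  qed
  have c2: "c / 2 > 0" using r0(2) by simp
  note contact = rescaled_contact[OF p0 l Gb jet der c2 Llow Glow cover]
  have Lsurj: "\<exists>\<xi>. L j \<xi> = e" if "e \<bullet> \<nu> (p0 (k j)) = 0" for j e using contact(2)[of j e] that by blast
  have BII: "B j \<xi> \<bullet> \<nu> (p0 (k j)) = norm (x (p0 (k j))) * II (p0 (k j)) (L j \<xi>)" for j \<xi>
    using contact(3)[of j \<xi>] by (simp add: l_def)
  have DL: "linear (L j)" for j using jet[of j] by (simp add: jet2_def)
  have limL: "(\<lambda>j. L (s j) (\<xi> j)) \<longlonglongrightarrow> dderivs [\<xi>0] \<psi> a"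
    and limB: "(\<lambda>j. B (s j) (\<xi> j)) \<longlonglongrightarrow> dderivs [\<xi>0, \<xi>0] \<psi> a" if s: "strict_mono s" and \<xi>: "\<xi> \<longlonglongrightarrow> \<xi>0" for s \<xi> \<xi>0
  proof -
    have bs: "(\<lambda>j. b (s j)) \<longlonglongrightarrow> a" using LIMSEQ_subseq_LIMSEQ[OF ba s] by (simp add: o_def)
    have \<epsilon>s: "(\<lambda>j. \<epsilon> (k (s j))) \<longlonglongrightarrow> 0" using LIMSEQ_subseq_LIMSEQ[OF \<epsilon>k s] by (simp add: o_def)
    have l1: "(\<lambda>j. dderivs [\<xi> j] \<psi> (b (s j))) \<longlonglongrightarrow> dderivs [\<xi>0] \<psi> a" by (rule tendsto_dderivs1[OF \<psi> ch(2) bs \<xi>])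
    have l2: "(\<lambda>j. dderivs [\<xi> j, \<xi> j] \<psi> (b (s j))) \<longlonglongrightarrow> dderivs [\<xi>0, \<xi>0] \<psi> a" by (rule tendsto_dderivs2[OF \<psi> ch(2) bs \<xi> \<xi>])
    have small: "(\<lambda>j. dderivs [v j] (w0 (k (s j))) (\<psi> (b (s j)))) \<longlonglongrightarrow> 0" if v: "v \<longlonglongrightarrow> v0" for v v0
    proof (rule Lim_null_comparison)
      show "\<forall>\<^sub>F j in sequentially. norm (dderivs [v j] (w0 (k (s j))) (\<psi> (b (s j)))) \<le> DD * \<epsilon> (k (s j)) * norm (v j)"
        using dw1[OF b(1)] by (intro always_eventually allI)
      have "(\<lambda>j. DD * \<epsilon> (k (s j)) * norm (v j)) \<longlonglongrightarrow> DD * 0 * norm v0" by (intro tendsto_intros \<epsilon>s v)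
      then show "(\<lambda>j. DD * \<epsilon> (k (s j)) * norm (v j)) \<longlonglongrightarrow> 0" by simp
    qed
    have small2: "(\<lambda>j. dderivs [v j, v j] (w0 (k (s j))) (\<psi> (b (s j)))) \<longlonglongrightarrow> 0" if v: "v \<longlonglongrightarrow> v0" for v v0
    proof (rule Lim_null_comparison)
      show "\<forall>\<^sub>F j in sequentially. norm (dderivs [v j, v j] (w0 (k (s j))) (\<psi> (b (s j)))) \<le> DD\<^sup>2 * \<epsilon> (k (s j)) * norm (v j) * norm (v j)"
        using dw2[OF b(1)] by (intro always_eventually allI)
      have "(\<lambda>j. DD\<^sup>2 * \<epsilon> (k (s j)) * norm (v j) * norm (v j)) \<longlonglongrightarrow> DD\<^sup>2 * 0 * norm v0 * norm v0" by (intro tendsto_intros \<epsilon>s v)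
      then show "(\<lambda>j. DD\<^sup>2 * \<epsilon> (k (s j)) * norm (v j) * norm (v j)) \<longlonglongrightarrow> 0" by simp
    qed
    show "(\<lambda>j. L (s j) (\<xi> j)) \<longlonglongrightarrow> dderivs [\<xi>0] \<psi> a"
      using tendsto_add[OF l1 small[OF l1]] by (simp add: L_def)
    show "(\<lambda>j. B (s j) (\<xi> j)) \<longlonglongrightarrow> dderivs [\<xi>0, \<xi>0] \<psi> a"
      using tendsto_add[OF l2 tendsto_add[OF small[OF l2] small2[OF l1]]] by (simp add: B_def)
  qed
  have xpos: "norm (x (p0 (k j))) > 0" for j using xp[of "k j"] by linarith
  show thesis
    by (rule that[of V \<psi> a "\<lambda>j. p0 (k j)" "snd z" "c / 2" L B, OF ch p0 Qp xpos \<nu>k c2 DL Llow Lsurj BII limL limB])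
qed

end

section \<open>The quotient kappa_1 / H at infinity\<close>

lemma vec_axis_sum: "(v :: real ^ 'n::finite) = (\<Sum>k\<in>UNIV. v $ k *\<^sub>R axis k 1)"
  by (simp add: vec_eq_iff axis_def if_distrib[of "(*) _"] cong: if_cong)

lemma linear_axis_sum:
  fixes f :: "real ^ 'n::finite \<Rightarrow> 'b::real_vector"
  assumes "linear f"
  shows "f v = (\<Sum>k\<in>UNIV. v $ k *\<^sub>R f (axis k 1))"
proof -
  have "f v = f (\<Sum>k\<in>UNIV. v $ k *\<^sub>R axis k 1)" using vec_axis_sum[of v] by simp
  also have "\<dots> = (\<Sum>k\<in>UNIV. v $ k *\<^sub>R f (axis k 1))"
    by (simp add: linear_sum[OF assms] linear_scale[OF assms])
  finally show ?thesis .
qed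

text \<open>Splitting a vector into its components along and orthogonal to the null direction \<open>w\<close> turns
  the two-convexity inequality into semi-definiteness.\<close>

lemma null_direction_nonneg:
  fixes S :: "'v::euclidean_space \<Rightarrow> real"
  assumes w: "w \<noteq> 0" and null: "\<And>u \<alpha>. S (u + \<alpha> *\<^sub>R w) = S u" and scale: "\<And>c u. S (c *\<^sub>R u) = c\<^sup>2 * S u"
    and pair: "\<And>u u'. norm u = 1 \<Longrightarrow> norm u' = 1 \<Longrightarrow> u \<bullet> u' = 0 \<Longrightarrow> 0 \<le> S u + S u'"
  shows "0 \<le> S v"
proof -
  have S0: "S 0 = 0" using scale[of 0 0] by simp
  define t where "t = v - ((v \<bullet> w) / (w \<bullet> w)) *\<^sub>R w"
  have tw: "t \<bullet> w = 0" using w by (simp add: t_def inner_diff_left)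
  have St: "S t = S v" using null[of v "- ((v \<bullet> w) / (w \<bullet> w))"] by (simp add: t_def)
  show ?thesis
  proof (cases "t = 0")
    case False
    have Sw: "S ((1 / norm w) *\<^sub>R w) = 0" using null[of 0 "1 / norm w"] S0 by simp
    have "0 \<le> S ((1 / norm t) *\<^sub>R t) + S ((1 / norm w) *\<^sub>R w)"
      using False w tw by (intro pair) auto
    then have "0 \<le> (1 / norm t)\<^sup>2 * S v" by (simp only: Sw scale[of "1 / norm t" t] St add_0_right)
    then show ?thesis using False by (simp add: zero_le_mult_iff zero_le_divide_iff)
  qed (use St S0 in simp)
qed

context hypersurface
begin

lemma asymptotically_convex:
  assumes n: "CARD('n) \<ge> 3"
    and two_convex: "\<And>p. p \<in> topspace X \<Longrightarrow> kappa \<A> x \<nu> 1 p + kappa \<A> x \<nu> 2 p > 0"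
    and asym: "asymptotically_conical (x ` topspace X) C" and mean_convex: "mean_convex_cone C" and \<delta>: "\<delta> > 0"
  shows "\<exists>R. \<forall>p\<in>topspace X. R \<le> norm (x p) \<longrightarrow> - \<delta> * mean_curvature \<A> x \<nu> p \<le> kappa \<A> x \<nu> 1 p"
proof (rule ccontr)
  assume "\<not> ?thesis"
  then have bad: "\<exists>p\<in>topspace X. kappa \<A> x \<nu> 1 p < - \<delta> * mean_curvature \<A> x \<nu> p \<and> R \<le> norm (x p)" for R
    by (meson not_le)
  have n2: "CARD('n) \<ge> 2" using n by simp
  obtain N where N: "two_sided_immersed_hypersurface (top_of_set (C - {0})) (maximal_atlas (C - {0})) (\<lambda>y. y) N"
    and HC: "\<And>y. y \<in> C - {0} \<Longrightarrow> mean_curvature (maximal_atlas (C - {0})) (\<lambda>y. y) N y > 0"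
    using mean_convex unfolding mean_convex_cone_def Let_def by blast
  interpret K: hypersurface "top_of_set (C - {0})" "maximal_atlas (C - {0})" "\<lambda>y. y" N by unfold_locales (rule N)
  have cone: "regular_cone C" using asym by (simp add: asymptotically_conical_def)
  obtain V \<psi> a p L B \<nu>0 m where ch: "(V, \<psi>) \<in> maximal_atlas (C - {0})" "a \<in> V"
    and p: "\<And>j::nat. p j \<in> topspace X" and badp: "\<And>j. kappa \<A> x \<nu> 1 (p j) < - \<delta> * mean_curvature \<A> x \<nu> (p j)"
    and xp: "\<And>j. norm (x (p j)) > 0" and \<nu>p: "(\<lambda>j. \<nu> (p j)) \<longlonglongrightarrow> \<nu>0"
    and m: "m > 0" and L: "\<And>j. linear (L j)" "\<And>j \<xi>. m * norm \<xi> \<le> norm (L j \<xi>)"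
    and surj: "\<And>j e. e \<bullet> \<nu> (p j) = 0 \<Longrightarrow> \<exists>\<xi>. L j \<xi> = e"
    and B: "\<And>j \<xi>. B j \<xi> \<bullet> \<nu> (p j) = norm (x (p j)) * II (p j) (L j \<xi>)"
    and limL: "\<And>s \<xi> \<xi>0. strict_mono s \<Longrightarrow> \<xi> \<longlonglongrightarrow> \<xi>0 \<Longrightarrow> (\<lambda>j. L (s j) (\<xi> j)) \<longlonglongrightarrow> dderivs [\<xi>0] \<psi> a"
    and limB: "\<And>s \<xi> \<xi>0. strict_mono s \<Longrightarrow> \<xi> \<longlonglongrightarrow> \<xi>0 \<Longrightarrow> (\<lambda>j. B (s j) (\<xi> j)) \<longlonglongrightarrow> dderivs [\<xi>0, \<xi>0] \<psi> a"
    by (rule blow_down_parametrization[OF asym N bad]) (rule that)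
  define y where "y = \<psi> a"
  have yM: "y \<in> C - {0}" using K.chart_topspace[OF ch] by (simp add: y_def)
  have Ny: "norm (N y) = 1" using K.norm_normal[of y] yM by simp
  have \<nu>0: "norm \<nu>0 = 1"
    using tendsto_norm[OF \<nu>p] norm_normal[OF p] by (simp add: LIMSEQ_const_iff)
  have id\<psi>: "(\<lambda>y. y) \<circ> \<psi> = \<psi>" by (simp add: o_def)
  have \<psi>: "smooth_on V \<psi>" using K.chart_smooth[OF ch(1)] by (simp only: id\<psi>)
  have "\<exists>\<iota>. normal_frame (\<nu> (p j)) \<iota>" for j using normal_frame_exists[OF norm_normal[OF p]] by metis
  then obtain \<iota> where \<iota>: "\<And>j. normal_frame (\<nu> (p j)) (\<iota> j)" by metis
  note \<iota>D = normal_frameD[OF \<iota>]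
  have "\<exists>\<xi>. L j \<xi> = \<iota> j (axis k 1)" for j k by (rule surj[OF \<iota>D(3)])
  then obtain T0 where T0: "\<And>j k. L j (T0 j k) = \<iota> j (axis k 1)" by metis
  \<comment> \<open>The frames \<open>\<iota> j\<close> are arbitrary and need not converge. Their
    preimages under \<open>L j\<close>, collected as the rows of a matrix, are bounded by
    \<open>1 / m\<close>; a convergent subsequence of these matrices yields a limit frame.\<close>
  define T where "T j = (\<chi> k. T0 j k)" for j
  define J where "J T v = (\<Sum>k\<in>UNIV. v $ k *\<^sub>R T $ k)" for T :: "real ^ 'n ^ 'n" and v :: "real ^ 'n"
  have LJ: "L j (J (T j) v) = \<iota> j v" for j v
    by (simp add: J_def T_def linear_sum[OF L(1)] linear_scale[OF L(1)] T0 linear_axis_sum[OF \<iota>D(1), of j v])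
  have Tb: "norm (T j) \<le> real CARD('n) * (1 / m)" for j
  proof -
    have "norm (T j $ k) \<le> 1 / m" for k
      using L(2)[of "T0 j k" j] m by (simp add: T_def T0 \<iota>D(2) pos_le_divide_eq mult.commute)
    then have "(\<Sum>k\<in>UNIV. norm (T j $ k)) \<le> (\<Sum>k\<in>(UNIV :: 'n set). 1 / m)" by (intro sum_mono)
    moreover have "norm (T j) \<le> (\<Sum>k\<in>UNIV. norm (T j $ k))"
      unfolding norm_vec_def by (rule L2_set_le_sum) simp
    ultimately show ?thesis by simp
  qed
  have "\<exists>v. norm v = 1 \<and> II (p j) (\<iota> j v) = kappa \<A> x \<nu> 1 (p j)" for j
  proof -
    obtain e where e: "norm e = 1" "e \<bullet> \<nu> (p j) = 0" "II (p j) e = kappa \<A> x \<nu> 1 (p j)"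
      by (rule kappa1_attained[OF p n2])
    obtain v where "e = \<iota> j v" using \<iota>D(6)[OF e(2)] by blast
    then show ?thesis using e \<iota>D(2)[of j v] by auto
  qed
  then obtain v where v: "\<And>j. norm (v j) = 1" "\<And>j. II (p j) (\<iota> j (v j)) = kappa \<A> x \<nu> 1 (p j)" by metis
  have compact: "compact (cball (0 :: real ^ 'n ^ 'n) (real CARD('n) * (1 / m)) \<times> sphere (0 :: real ^ 'n) 1)"
    by (intro compact_Times compact_cball compact_sphere)
  have "\<forall>j. (T j, v j) \<in> cball 0 (real CARD('n) * (1 / m)) \<times> sphere 0 1" using Tb v(1) by simp
  from compact[unfolded compact_def, THEN spec, THEN mp, OF this]
  have "\<exists>z s. strict_mono (s :: nat \<Rightarrow> nat) \<and> ((\<lambda>j. (T j, v j)) \<circ> s) \<longlonglongrightarrow> z" by (meson bexE)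
  then obtain z s where s: "strict_mono (s :: nat \<Rightarrow> nat)" and z: "((\<lambda>j. (T j, v j)) \<circ> s) \<longlonglongrightarrow> z" by blast
  define Ts vs where "Ts = fst z" and "vs = snd z"
  have Ts: "(\<lambda>j. T (s j)) \<longlonglongrightarrow> Ts" using tendsto_fst[OF z] by (simp add: Ts_def o_def)
  have vs: "(\<lambda>j. v (s j)) \<longlonglongrightarrow> vs" using tendsto_snd[OF z] by (simp add: vs_def o_def)
  have \<nu>s: "(\<lambda>j. \<nu> (p (s j))) \<longlonglongrightarrow> \<nu>0" using LIMSEQ_subseq_LIMSEQ[OF \<nu>p s] by (simp add: o_def)
  have Jlim: "(\<lambda>j. J (T (s j)) (u j)) \<longlonglongrightarrow> J Ts u0" if "u \<longlonglongrightarrow> u0" for u u0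
    unfolding J_def by (intro tendsto_sum tendsto_scaleR tendsto_vec_nth that Ts)
  have Jlin: "linear (J Ts)"
    unfolding J_def by (intro linearI) (simp_all add: scaleR_add_left sum.distrib scaleR_sum_right)
  define I where "I u = dderivs [J Ts u] \<psi> a" for u
  define S where "S u = dderivs [J Ts u, J Ts u] \<psi> a \<bullet> \<nu>0" for u
  \<comment> \<open>The second fundamental form of the hypersurface rescaled to bring the base point
    to the unit sphere, in frame coordinates; \<open>S\<close> is its limit.\<close>
  define S' where "S' j u = norm (x (p (s j))) * II (p (s j)) (\<iota> (s j) u)" for j u
  have Ilim: "(\<lambda>j. \<iota> (s j) (u j)) \<longlonglongrightarrow> I u0" if "u \<longlonglongrightarrow> u0" for u u0
    using limL[OF s Jlim[OF that]] by (simp add: LJ I_def)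
  have Slim: "(\<lambda>j. S' j (u j)) \<longlonglongrightarrow> S u0" if "u \<longlonglongrightarrow> u0" for u u0
    using tendsto_inner[OF limB[OF s Jlim[OF that]] \<nu>s] by (simp add: B LJ S_def S'_def)
  have I: "linear I"
    unfolding I_def using linear_compose[OF Jlin linear_dderivs1[OF \<psi> ch(2), of "[]"]] by (simp add: o_def)
  have Inorm: "norm (I u) = norm u" for u
    using tendsto_norm[OF Ilim[OF tendsto_const, of u]] by (simp add: \<iota>D(2) LIMSEQ_const_iff)
  have Iperp: "I u \<bullet> \<nu>0 = 0" for u
    using tendsto_inner[OF Ilim[OF tendsto_const, of u] \<nu>s] by (simp add: \<iota>D(3) LIMSEQ_const_iff)
  have "I u \<bullet> N y = 0" for u using K.chart_normal[OF ch, of "J Ts u"] by (simp add: id\<psi> I_def y_def)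
  from isometry_normal_frame[OF I Inorm Ny this] have frame: "normal_frame (N y) I" .
  obtain \<sigma> where \<sigma>: "\<nu>0 = \<sigma> *\<^sub>R N y" using orthonormal_unit_eq[OF frame Ny \<nu>0 Iperp] by metis
  have SK: "S u = \<sigma> * K.II y (I u)" for u
    using K.II_chart[OF ch, of "J Ts u"] by (simp add: id\<psi> S_def I_def y_def \<sigma>)
  have trace: "(\<Sum>k\<in>UNIV. S' j (axis k 1)) = norm (x (p (s j))) * mean_curvature \<A> x \<nu> (p (s j))" for j
    by (simp add: S'_def mean_curvature_trace[OF p n2 \<iota>] sum_distrib_left)
  have tracelim: "(\<lambda>j. norm (x (p (s j))) * mean_curvature \<A> x \<nu> (p (s j))) \<longlonglongrightarrow> (\<Sum>k\<in>UNIV. S (axis k 1))"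
    unfolding trace[symmetric] by (intro tendsto_sum Slim tendsto_const)
  have Hpos: "mean_curvature \<A> x \<nu> (p j) > 0" for j by (rule two_convex_II_bound(1)[OF p n two_convex[OF p]])
  have yT: "y \<in> topspace (top_of_set (C - {0}))" using yM by simp
  have "(\<Sum>k\<in>UNIV. S (axis k 1)) = \<sigma> * mean_curvature (maximal_atlas (C - {0})) (\<lambda>y. y) N y"
    unfolding SK K.mean_curvature_trace[OF yT n2 frame] by (simp add: sum_distrib_left)
  moreover have "\<sigma> \<noteq> 0" using \<sigma> \<nu>0 by auto
  \<comment> \<open>Mean convexity of the cone excludes trace zero whatever the sign
    \<open>\<sigma>\<close>; nonnegativity is inherited from H > 0 along the sequence.\<close>
  ultimately have "(\<Sum>k\<in>UNIV. S (axis k 1)) \<noteq> 0" using HC[OF yM] by simp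
  moreover have "0 \<le> (\<Sum>k\<in>UNIV. S (axis k 1))"
  proof (rule LIMSEQ_le_const[OF tracelim])
    have "0 \<le> norm (x (p (s j))) * mean_curvature \<A> x \<nu> (p (s j))" for j
      using Hpos[of "s j"] by (intro mult_nonneg_nonneg) auto
    then show "\<exists>M. \<forall>j\<ge>M. 0 \<le> norm (x (p (s j))) * mean_curvature \<A> x \<nu> (p (s j))" by blast
  qed
  ultimately have Spos: "(\<Sum>k\<in>UNIV. S (axis k 1)) > 0" by simp
  \<comment> \<open>The failing inequality survives in the limit with the fixed factor
    \<open>\<delta>\<close>, which makes \<open>S vs\<close> strictly negative and not merely
    nonpositive.\<close>
  have "S vs \<le> - \<delta> * (\<Sum>k\<in>UNIV. S (axis k 1))"
  proof (rule LIMSEQ_le[OF Slim[OF vs] tendsto_mult[OF tendsto_const tracelim]])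
    have "S' j (v (s j)) \<le> - \<delta> * (norm (x (p (s j))) * mean_curvature \<A> x \<nu> (p (s j)))" for j
      using mult_left_mono[OF less_imp_le[OF badp[of "s j"]] less_imp_le[OF xp[of "s j"]]]
      by (simp add: S'_def v(2) mult_ac)
    then show "\<exists>M. \<forall>j\<ge>M. S' j (v (s j)) \<le> - \<delta> * (norm (x (p (s j))) * mean_curvature \<A> x \<nu> (p (s j)))" by blast
  qed
  moreover have "\<delta> * (\<Sum>k\<in>UNIV. S (axis k 1)) > 0" using \<delta> Spos by simp
  ultimately have neg: "S vs < 0" by simp
  have dil: "limitin (top_of_set (C - {0})) (\<lambda>r. \<tau> r *\<^sub>R q r) z (at 0)"
    if q: "limitin (top_of_set (C - {0})) q z (at 0)" and \<tau>: "(\<tau> \<longlongrightarrow> (1::real)) (at (0::real))" for q z \<tau>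
  proof -
    have q': "z \<in> C - {0}" "\<forall>\<^sub>F r in at 0. q r \<in> C - {0}" "(q \<longlongrightarrow> z) (at 0)"
      using q by (auto simp: limitin_subtopology)
    have "\<forall>\<^sub>F r in at 0. \<tau> r > 0" using order_tendstoD(1)[OF \<tau>, of 0] by simp
    with q'(2) have "\<forall>\<^sub>F r in at 0. \<tau> r *\<^sub>R q r \<in> C - {0}"
    proof eventually_elim
      case (elim r)
      then show ?case using regular_cone_scale[OF cone, of "q r" "\<tau> r"] by simp
    qed
    then show ?thesis using q'(1) tendsto_scaleR[OF \<tau> q'(3)] by (simp add: limitin_subtopology)
  qed
  note radial = K.dilation_null_direction[where d = "\<lambda>t y. t *\<^sub>R y", OF dil refl yT]
  have yN: "y \<bullet> N y = 0" by (rule radial(1); assumption)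
  have radial2: "K.II y (e + \<alpha> *\<^sub>R y) = K.II y e" if "e \<bullet> N y = 0" for e \<alpha> using that by - (rule radial(2); assumption)
  \<comment> \<open>\<open>w\<close> is the radial direction of the cone in frame coordinates, the
    null direction of \<open>S\<close>.\<close>
  obtain w where w: "y = I w" using normal_frameD(6)[OF frame yN] by blast
  have "0 \<le> S vs"
  proof (rule null_direction_nonneg[where S = S and w = w])
    show "w \<noteq> 0" using w yM linear_0[OF I] by auto
    show "S (u + \<alpha> *\<^sub>R w) = S u" for u \<alpha>
      using radial2[OF normal_frameD(3)[OF frame], of u \<alpha>] by (simp add: SK linear_add[OF I] linear_scale[OF I] flip: w)
    show "S (c *\<^sub>R u) = c\<^sup>2 * S u" for c u
      using K.II_frame_scale[OF yT normal_frameD(3)[OF frame], of c u] by (simp add: SK linear_scale[OF I])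
    show "0 \<le> S u + S u'" if u: "norm u = 1" "norm u' = 1" "u \<bullet> u' = 0" for u u'
    proof (rule LIMSEQ_le_const[OF tendsto_add[OF Slim[OF tendsto_const] Slim[OF tendsto_const]]])
      have "0 \<le> S' j u + S' j u'" for j
      proof -
        have "0 < II (p (s j)) (\<iota> (s j) u) + II (p (s j)) (\<iota> (s j) u')"
          using kappa12_le_II[OF p n2 \<iota>D(3) \<iota>D(3), of "s j" u u'] two_convex[OF p, of "s j"] u
          by (simp add: \<iota>D(2,5))
        then have "0 \<le> norm (x (p (s j))) * (II (p (s j)) (\<iota> (s j) u) + II (p (s j)) (\<iota> (s j) u'))"
          by (intro mult_nonneg_nonneg) auto
        then show ?thesis by (simp add: S'_def distrib_left)
      qed
      then show "\<exists>M. \<forall>j\<ge>M. 0 \<le> S' j u + S' j u'" by blast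
    qed
  qed
  with neg show False by simp
qed

end

theorem theorem1p2:
  fixes X :: "'a topology"
    and \<A> :: "('n::finite, 'a) param set"
    and x \<nu> :: "'a \<Rightarrow> 'n ambient"
    and C :: "'n ambient set"
  assumes "CARD('n) \<ge> 3"
    and "two_sided_immersed_hypersurface X \<A> x \<nu>"
    and "complete_hypersurface X x"
    and self_expander: "\<And>p. p \<in> topspace X \<Longrightarrow> mean_curvature \<A> x \<nu> p = x p \<bullet> \<nu> p"
    and two_convex: "\<And>p. p \<in> topspace X \<Longrightarrow> kappa \<A> x \<nu> 1 p + kappa \<A> x \<nu> 2 p > 0"
    and "asymptotically_conical (x ` topspace X) C"
    and "mean_convex_cone C"
  shows "\<forall>p\<in>topspace X. kappa \<A> x \<nu> 1 p \<ge> 0"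
proof
  interpret hypersurface X \<A> x \<nu> by unfold_locales (rule assms(2))
  fix p assume "p \<in> topspace X"
  then show "kappa \<A> x \<nu> 1 p \<ge> 0"
    by (intro nonneg_at_infinity_imp_convex[OF assms(1,3) self_expander two_convex]
        asymptotically_convex[OF assms(1) two_convex assms(6,7)])
qed

end
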